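(* The identity map $\mathrm{id}_\Gamma\colon\Gamma_\bullet\to\Gamma$ has the approximate factorization property. Furthermore, for all odd integers $k_1,k_2\geq1$, \[\kappa_2^{\mathrm{id}_\Gamma}(\mathrm{Ch}^{\mathrm{spin}}_{k_1},\mathrm{Ch}^{\mathrm{spin}}_{k_2})=\mathrm{Ch}^{\mathrm{spin}}_{k_1,k_2}-\mathrm{Ch}^{\mathrm{spin}}_{k_1}\mathrm{Ch}^{\mathrm{spin}}_{k_2}=-\sum_{r\geq1}\frac{2^{r-1}}{r}k_1k_2\sum_{(a_i),(b_i)}\mathrm{Ch}^{\mathrm{spin}}_{(a_1+b_1-1),\dots,(a_r+b_r-1)}+(\text{terms of degree at most }k_1+k_2-2),\] where the inner sum runs over integers $a_1,\dots,a_r,b_1,\dots,b_r\geq1$ with $a_1+\dots+a_r=k_1$, $b_1+\dots+b_r=k_2$, and $a_i+b_i$ even for each $i$.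
   Context: Irreducible spin characters: let $\widetilde{\mathfrak S}_n$ be the spin double cover of $\mathfrak S_n$ (generated by $t_1,\dots,t_{n-1},z$ with $z^2=1$, $zt_i=t_iz$, $t_i^2=z$, $(t_it_{i+1})^3=z$, $t_it_j=zt_jt_i$ for $|i-j|\geq2$). For a strict partition $\xi$ of $n$ (strictly decreasing positive parts) and an odd partition $\pi$ of $n$ (all parts odd), $\phi^\xi(\pi)$ denotes the value of an irreducible spin character (one with $z\mapsto-\mathrm{Id}$) indexed by $\xi$ (Schur's parametrization) at an element of the conjugacy class $C^+_\pi$ lying over cycle type $\pi$ and containing $\prod_i(t_{m_{i-1}+1}\cdots t_{m_i-1})$, $m_i=\pi_1+\dots+\pi_i$. For an odd partition $\pi$ with $|\pi|=k$, the normalized spin character is the function on all strict partitions $\mathrm{Ch}^{\mathrm{spin}}_\pi(\xi)=n^{\downarrow k}2^{\frac{|\pi|-\ell(\pi)}{2}}\phi^\xi(\pi\cup1^{n-k})/\phi^\xi(1^n)$ if $n=|\xi|\geq k$ and $0$ otherwise ($n^{\downarrow k}=n(n-1)\cdots(n-k+1)$); $\mathrm{Ch}^{\mathrm{spin}}_{k}$ means $\mathrm{Ch}^{\mathrm{spin}}_{(k)}$. $\Gamma$ is the linear span of $\{\mathrm{Ch}^{\mathrm{spin}}_\pi:\pi\text{ odd partition}\}$; these are linearly independent and $\Gamma$ is closed under pointwise multiplication (a unital commutative algebra). Filtration: $\mathcal G_k=\mathrm{span}\{\mathrm{Ch}^{\mathrm{spin}}_\pi:|\pi|+\ell(\pi)\leq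 k\}$; degree of $x$ is the minimal $k$ with $x\in\mathcal G_k$. $\Gamma_\bullet$ is the same filtered vector space with the disjoint product $\mathrm{Ch}^{\mathrm{spin}}_{\pi^1}\bullet\mathrm{Ch}^{\mathrm{spin}}_{\pi^2}=\mathrm{Ch}^{\mathrm{spin}}_{\pi^1\pi^2}$ ($\pi^1\pi^2$ the concatenation). For a unital linear map $F\colon\mathcal A\to\mathcal B$ between unital commutative algebras, $\kappa^F_\ell(a_1,\dots,a_\ell)=[t_1\cdots t_\ell]\log F(e^{t_1a_1+\dots+t_\ell a_\ell})$ (exponential in $\mathcal A$, logarithm in $\mathcal B$, formal power series). $F$ between filtered algebras has the approximate factorization property if $\deg\kappa^F_\ell(a_1,\dots,a_\ell)\leq\sum_i\deg a_i-2(\ell-1)$ for all $\ell\geq1$, $a_i\in\mathcal A$. *)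

theory Defs
  imports
    "HOL-Library.Multiset"
    "HOL-Library.Poly_Mapping"
    "HOL-Library.Function_Algebras"
    "HOL-Library.Extended_Real"
    "Jordan_Normal_Form.Matrix"
begin

section \<open>Partitions\<close>

typedef strict_partition = "{xs :: nat list. sorted_wrt (>) xs \<and> 0 \<notin> set xs}"
  morphisms parts Strict_Partition
  by (rule exI[of _ "[]"]) simp

definition sp_size :: "strict_partition \<Rightarrow> nat" where
  "sp_size \<xi> = sum_list (parts \<xi>)"

definition sp_length :: "strict_partition \<Rightarrow> nat" where
  "sp_length \<xi> = length (parts \<xi>)"

text \<open>
  Odd partitions are multisets of odd numbers; the size is \<^const>\<open>sum_mset\<close>, the length is
  \<^const>\<open>size\<close>, and concatenation of partitions is the sum of multisets.
\<close>

definition odd_partition :: "nat multiset \<Rightarrow> bool" where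
  "odd_partition \<pi> \<longleftrightarrow> (\<forall>p \<in># \<pi>. odd p)"

definition z_factor :: "nat multiset \<Rightarrow> nat" where
  "z_factor \<pi> = (\<Prod>i \<in> set_mset \<pi>. i ^ count \<pi> i * fact (count \<pi> i))"


section \<open>The spin double cover of the symmetric group\<close>

datatype spin_gen = T nat | Z

text \<open>
  The congruence on words generated by the defining relations. Since \<open>z\<^sup>2 = 1\<close> and
  \<open>t\<^sub>i\<^sup>2 = z\<close> make every generator invertible, the monoid with this presentation is the group
  with this presentation.
\<close>

inductive spin_rel :: "nat \<Rightarrow> spin_gen list \<Rightarrow> spin_gen list \<Rightarrow> bool" for n where
  z_z: "spin_rel n [Z, Z] []"
| z_t: "i \<in> {1..<n} \<Longrightarrow> spin_rel n [Z, T i] [T i, Z]"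
| t_t: "i \<in> {1..<n} \<Longrightarrow> spin_rel n [T i, T i] [Z]"
| braid: "i \<in> {1..<n} \<Longrightarrow> Suc i \<in> {1..<n} \<Longrightarrow>
    spin_rel n (concat (replicate 3 [T i, T (Suc i)])) [Z]"
| far: "i \<in> {1..<n} \<Longrightarrow> j \<in> {1..<n} \<Longrightarrow> i + 2 \<le> j \<or> j + 2 \<le> i \<Longrightarrow>
    spin_rel n [T i, T j] [Z, T j, T i]"
| refl: "spin_rel n u u"
| sym: "spin_rel n u v \<Longrightarrow> spin_rel n v u"
| trans: "spin_rel n u v \<Longrightarrow> spin_rel n v w \<Longrightarrow> spin_rel n u w"
| cong: "spin_rel n u v \<Longrightarrow> spin_rel n (a @ u @ b) (a @ v @ b)"

definition spin_words :: "nat \<Rightarrow> spin_gen list set" where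
  "spin_words n = lists (insert Z (T ` {1..<n}))"

definition spin_elt :: "nat \<Rightarrow> spin_gen list \<Rightarrow> spin_gen list set" where
  "spin_elt n u = {v. spin_rel n u v}"

definition spin_group :: "nat \<Rightarrow> spin_gen list set monoid" where
  "spin_group n = \<lparr>carrier = spin_elt n ` spin_words n,
     mult = (\<lambda>X Y. \<Union>x \<in> X. \<Union>y \<in> Y. spin_elt n (x @ y)),
     one = spin_elt n []\<rparr>"

lemma spin_elt_eq_iff: "spin_elt n u = spin_elt n v \<longleftrightarrow> spin_rel n u v"
proof
  assume "spin_elt n u = spin_elt n v"
  then have "v \<in> spin_elt n u"
    by (simp add: spin_elt_def spin_rel.refl)
  then show "spin_rel n u v"
    by (simp add: spin_elt_def)
next
  assume uv: "spin_rel n u v"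
  show "spin_elt n u = spin_elt n v"
    unfolding spin_elt_def
    by (intro Collect_cong iffI) (erule spin_rel.trans[OF spin_rel.sym[OF uv]],
        erule spin_rel.trans[OF uv])
qed

lemma spin_rel_append:
  assumes "spin_rel n u u'" "spin_rel n v v'"
  shows "spin_rel n (u @ v) (u' @ v')"
proof (rule spin_rel.trans)
  show "spin_rel n (u @ v) (u' @ v)"
    using spin_rel.cong[OF assms(1), of "[]" v] by simp
  show "spin_rel n (u' @ v) (u' @ v')"
    using spin_rel.cong[OF assms(2), of u' "[]"] by simp
qed

lemma spin_mult: "spin_elt n u \<otimes>\<^bsub>spin_group n\<^esub> spin_elt n v = spin_elt n (u @ v)"
proof -
  have mult: "X \<otimes>\<^bsub>spin_group n\<^esub> Y = (\<Union>x \<in> X. \<Union>y \<in> Y. spin_elt n (x @ y))" for X Y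
    by (simp add: spin_group_def)
  have eq: "spin_elt n (x @ y) = spin_elt n (u @ v)"
    if "x \<in> spin_elt n u" "y \<in> spin_elt n v" for x y
  proof -
    have "spin_rel n u x" "spin_rel n v y"
      using that by (simp_all add: spin_elt_def)
    then have "spin_rel n (u @ v) (x @ y)"
      by (rule spin_rel_append)
    then show ?thesis
      unfolding spin_elt_eq_iff by (rule spin_rel.sym)
  qed
  have mem: "u \<in> spin_elt n u" "v \<in> spin_elt n v"
    by (simp_all add: spin_elt_def spin_rel.refl)
  have "(\<Union>x \<in> spin_elt n u. \<Union>y \<in> spin_elt n v. spin_elt n (x @ y)) =
      (\<Union>x \<in> spin_elt n u. \<Union>y \<in> spin_elt n v. spin_elt n (u @ v))"
    by (intro SUP_cong HOL.refl eq)
  also have "\<dots> = spin_elt n (u @ v)"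
    using mem by blast
  finally show ?thesis
    unfolding mult .
qed

lemma spin_words_append: "u \<in> spin_words n \<Longrightarrow> v \<in> spin_words n \<Longrightarrow> u @ v \<in> spin_words n"
  by (simp add: spin_words_def)

lemma spin_left_inverse:
  assumes "u \<in> spin_words n"
  shows "\<exists>v \<in> spin_words n. spin_rel n (v @ u) []"
  using assms
proof (induction u)
  case Nil
  then show ?case
    by (intro bexI[of _ "[]"]) (auto simp: spin_words_def intro: spin_rel.refl)
next
  case (Cons g u)
  then obtain v where v: "v \<in> spin_words n" "spin_rel n (v @ u) []"
    by (auto simp: spin_words_def)
  have "\<exists>h \<in> spin_words n. spin_rel n (h @ [g]) []"
  proof (cases g)
    case Z
    then show ?thesis
      by (intro bexI[of _ "[Z]"]) (auto simp: spin_words_def intro: spin_rel.z_z)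
  next
    case (T i)
    then have i: "i \<in> {1..<n}"
      using Cons.prems by (auto simp: spin_words_def)
    have "spin_rel n ([Z] @ [T i, T i] @ []) ([Z] @ [Z] @ [])"
      using i by (intro spin_rel.cong spin_rel.t_t)
    then have "spin_rel n [Z, T i, T i] []"
      using spin_rel.trans[OF _ spin_rel.z_z] by simp
    then show ?thesis
      using i T by (intro bexI[of _ "[Z, T i]"]) (auto simp: spin_words_def)
  qed
  then obtain h where h: "h \<in> spin_words n" "spin_rel n (h @ [g]) []"
    by blast
  have "spin_rel n (v @ (h @ [g]) @ u) (v @ [] @ u)"
    using h(2) by (rule spin_rel.cong)
  then have "spin_rel n ((v @ h) @ g # u) []"
    using spin_rel.trans[OF _ v(2)] by simp
  then show ?case
    using v h by (intro bexI[of _ "v @ h"]) (auto simp: spin_words_def)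
qed

lemma group_spin_group: "group (spin_group n)"
proof (rule groupI)
  fix x assume "x \<in> carrier (spin_group n)"
  then obtain u where u: "u \<in> spin_words n" "x = spin_elt n u"
    by (auto simp: spin_group_def)
  obtain v where v: "v \<in> spin_words n" "spin_rel n (v @ u) []"
    using spin_left_inverse[OF u(1)] by blast
  have "spin_elt n v \<otimes>\<^bsub>spin_group n\<^esub> x = \<one>\<^bsub>spin_group n\<^esub>"
    using v(2) by (simp add: u(2) spin_mult) (simp add: spin_group_def spin_elt_eq_iff)
  with v(1) show "\<exists>y \<in> carrier (spin_group n). y \<otimes>\<^bsub>spin_group n\<^esub> x = \<one>\<^bsub>spin_group n\<^esub>"
    by (auto simp: spin_group_def)
next
  have *: "carrier (spin_group n) = spin_elt n ` spin_words n" for n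
    by (simp add: spin_group_def)
  show "x \<otimes>\<^bsub>spin_group n\<^esub> y \<in> carrier (spin_group n)"
    if "x \<in> carrier (spin_group n)" "y \<in> carrier (spin_group n)" for x y
    using that by (auto simp: * spin_mult intro!: imageI spin_words_append)
  show "x \<otimes>\<^bsub>spin_group n\<^esub> y \<otimes>\<^bsub>spin_group n\<^esub> w =
      x \<otimes>\<^bsub>spin_group n\<^esub> (y \<otimes>\<^bsub>spin_group n\<^esub> w)"
    if "x \<in> carrier (spin_group n)" "y \<in> carrier (spin_group n)" "w \<in> carrier (spin_group n)"
    for x y w
    using that by (auto simp: * spin_mult)
  have one: "\<one>\<^bsub>spin_group n\<^esub> = spin_elt n []"
    by (simp add: spin_group_def)
  show "\<one>\<^bsub>spin_group n\<^esub> \<in> carrier (spin_group n)"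
    by (auto simp: one * spin_words_def)
  show "\<one>\<^bsub>spin_group n\<^esub> \<otimes>\<^bsub>spin_group n\<^esub> x = x" if "x \<in> carrier (spin_group n)" for x
    using that by (auto simp: one * spin_mult)
qed

text \<open>
  \<open>block_word m [p\<^sub>1, p\<^sub>2, \<dots>]\<close> is the product of the blocks
  \<open>t\<^bsub>m+1\<^esub> \<dots> t\<^bsub>m+p\<^sub>1-1\<^esub>\<close>, \<open>t\<^bsub>m+p\<^sub>1+1\<^esub> \<dots> t\<^bsub>m+p\<^sub>1+p\<^sub>2-1\<^esub>\<close>, \dots
\<close>

fun block_word :: "nat \<Rightarrow> nat list \<Rightarrow> spin_gen list" where
  "block_word m [] = []"
| "block_word m (p # ps) = map T [m + 1..<m + p] @ block_word (m + p) ps"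

definition cycle_elt :: "nat multiset \<Rightarrow> spin_gen list set" where
  "cycle_elt \<pi> = spin_elt (sum_mset \<pi>) (block_word 0 (rev (sorted_list_of_multiset \<pi>)))"

definition conj_class_plus :: "nat multiset \<Rightarrow> spin_gen list set set" where
  "conj_class_plus \<pi> = (let G = spin_group (sum_mset \<pi>) in
     {g \<otimes>\<^bsub>G\<^esub> cycle_elt \<pi> \<otimes>\<^bsub>G\<^esub> inv\<^bsub>G\<^esub> g | g. g \<in> carrier G})"


section \<open>Irreducible spin characters\<close>

definition matrix_rep :: "('g, 'm) monoid_scheme \<Rightarrow> nat \<Rightarrow> ('g \<Rightarrow> complex mat) \<Rightarrow> bool" where
  "matrix_rep G d \<rho> \<longleftrightarrow>
     (\<forall>g \<in> carrier G. \<rho> g \<in> carrier_mat d d) \<and>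
     \<rho> \<one>\<^bsub>G\<^esub> = 1\<^sub>m d \<and>
     (\<forall>g \<in> carrier G. \<forall>h \<in> carrier G. \<rho> (g \<otimes>\<^bsub>G\<^esub> h) = \<rho> g * \<rho> h)"

definition irreducible_rep :: "('g, 'm) monoid_scheme \<Rightarrow> nat \<Rightarrow> ('g \<Rightarrow> complex mat) \<Rightarrow> bool" where
  "irreducible_rep G d \<rho> \<longleftrightarrow> matrix_rep G d \<rho> \<and> d > 0 \<and>
     (\<forall>W \<subseteq> carrier_vec d.
        0\<^sub>v d \<in> W \<and> (\<forall>v \<in> W. \<forall>w \<in> W. v + w \<in> W) \<and> (\<forall>c. \<forall>v \<in> W. c \<cdot>\<^sub>v v \<in> W) \<and>
        (\<forall>g \<in> carrier G. \<forall>v \<in> W. \<rho> g *\<^sub>v v \<in> W)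
        \<longrightarrow> W = {0\<^sub>v d} \<or> W = carrier_vec d)"

definition irreducible_spin_rep ::
    "nat \<Rightarrow> nat \<Rightarrow> (spin_gen list set \<Rightarrow> complex mat) \<Rightarrow> bool" where
  "irreducible_spin_rep n d \<rho> \<longleftrightarrow>
     irreducible_rep (spin_group n) d \<rho> \<and> \<rho> (spin_elt n [Z]) = - 1\<^sub>m d"

definition mat_trace :: "complex mat \<Rightarrow> complex" where
  "mat_trace A = (\<Sum>i < dim_row A. A $$ (i, i))"


section \<open>Schur's Q-functions and Schur's parametrization\<close>

text \<open>
  Schur's Q-functions live in the polynomial ring in the odd power sums \<open>p\<^sub>1, p\<^sub>3, p\<^sub>5, \<dots>\<close>, here
  the monoid algebra of the multisets: the basis element at \<open>\<pi>\<close> is the monomial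
  \<open>p\<^sub>\<pi> = p\<^bsub>\<pi>\<^sub>1\<^esub> p\<^bsub>\<pi>\<^sub>2\<^esub> \<dots>\<close>. The one-row functions are given by
  \<open>\<Sum>\<^sub>n q\<^sub>n t\<^sup>n = \<Prod>\<^sub>i (1 + x\<^sub>i t) / (1 - x\<^sub>i t) = exp (2 \<Sum>\<^bsub>k odd\<^esub> p\<^sub>k t\<^sup>k / k)\<close>.
\<close>

definition schur_q :: "nat \<Rightarrow> nat multiset \<Rightarrow>\<^sub>0 complex" where
  "schur_q n = (\<Sum>\<pi> \<in> {\<pi>. odd_partition \<pi> \<and> sum_mset \<pi> = n}.
     Poly_Mapping.single \<pi> (2 ^ size \<pi> / of_nat (z_factor \<pi>)))"

text \<open>\<open>schur_q2 r s\<close> is \<open>Q\<^bsub>(r,s)\<^esub>\<close> for \<open>r > s \<ge> 0\<close>.\<close>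

definition schur_q2 :: "nat \<Rightarrow> nat \<Rightarrow> nat multiset \<Rightarrow>\<^sub>0 complex" where
  "schur_q2 r s = schur_q r * schur_q s +
     2 * (\<Sum>i = 1..s. (- 1) ^ i * schur_q (r + i) * schur_q (s - i))"

text \<open>
  The Pfaffian of the antisymmetric matrix with entries \<open>A x y\<close> above the diagonal, by
  expansion along the first row; only lists of even length are relevant.
\<close>

function pfaffian :: "('i \<Rightarrow> 'i \<Rightarrow> 'r :: comm_ring_1) \<Rightarrow> 'i list \<Rightarrow> 'r" where
  "pfaffian A [] = 1"
| "pfaffian A (x # xs) = (\<Sum>j < length xs.
     (- 1) ^ j * A x (xs ! j) * pfaffian A (take j xs @ drop (Suc j) xs))"
  by pat_completeness auto
termination by (relation "measure (\<lambda>(A, xs). length xs)") auto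

definition schur_Q :: "strict_partition \<Rightarrow> nat multiset \<Rightarrow>\<^sub>0 complex" where
  "schur_Q \<xi> = pfaffian schur_q2
     (if even (sp_length \<xi>) then parts \<xi> else parts \<xi> @ [0])"

text \<open>
  \<open>\<phi> \<xi> \<pi>\<close> is the value on \<open>C\<^sup>+\<^sub>\<pi>\<close> of an irreducible spin character indexed by \<open>\<xi>\<close>. Schur's
  indexing is the one for which
  \<open>Q\<^sub>\<xi> = \<Sum>\<^sub>\<pi> 2\<^bsup>(\<ell>(\<xi>) + \<ell>(\<pi>) + \<epsilon>(\<xi>))/2\<^esup> \<phi>\<^sup>\<xi>(\<pi>) p\<^sub>\<pi> / z\<^sub>\<pi>\<close>, the sum being over the odd partitions of
  \<open>|\<xi>|\<close> and \<open>\<epsilon>(\<xi>) \<in> {0, 1}\<close> being the parity of \<open>|\<xi>| - \<ell>(\<xi>)\<close>. If \<open>\<epsilon>(\<xi>) = 1\<close> there are two such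
  (associate) characters; they agree on all the classes considered here.
\<close>

definition schur_spin_characters :: "(strict_partition \<Rightarrow> nat multiset \<Rightarrow> complex) \<Rightarrow> bool" where
  "schur_spin_characters \<phi> \<longleftrightarrow> (\<forall>\<xi>.
     (\<exists>d \<rho>. irreducible_spin_rep (sp_size \<xi>) d \<rho> \<and>
        (\<forall>\<pi>. odd_partition \<pi> \<and> sum_mset \<pi> = sp_size \<xi> \<longrightarrow>
           (\<forall>g \<in> conj_class_plus \<pi>. \<phi> \<xi> \<pi> = mat_trace (\<rho> g)))) \<and>
     (\<forall>\<pi>. odd_partition \<pi> \<and> sum_mset \<pi> = sp_size \<xi> \<longrightarrow>
        Poly_Mapping.lookup (schur_Q \<xi>) \<pi> =
          2 ^ ((sp_length \<xi> + size \<pi> + (sp_size \<xi> - sp_length \<xi>) mod 2) div 2)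
            * \<phi> \<xi> \<pi> / of_nat (z_factor \<pi>)))"


section \<open>Filtered algebras and cumulants\<close>

record 'a filtered_algebra =
  alg_space :: "'a set"
  alg_scale :: "complex \<Rightarrow> 'a \<Rightarrow> 'a"
  alg_product :: "'a \<Rightarrow> 'a \<Rightarrow> 'a"
  alg_unit :: "'a"
  alg_filtration :: "nat \<Rightarrow> 'a set"

text \<open>The degree of \<open>0\<close> is \<open>-\<infinity>\<close>; elements outside the whole filtration get degree \<open>\<infinity>\<close>.\<close>

definition alg_degree :: "'a :: ab_group_add filtered_algebra \<Rightarrow> 'a \<Rightarrow> ereal" where
  "alg_degree A x = (if x = 0 then - \<infinity> else (INF k \<in> {k. x \<in> alg_filtration A k}. ereal (real k)))"

text \<open>
  Formal power series in \<open>t\<^sub>0, t\<^sub>1, \<dots>\<close> with coefficients in an algebra: functions on monomials,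
  a monomial being the multiset of the indices of its variables.
\<close>

definition ps_mult :: "'a :: ab_group_add filtered_algebra \<Rightarrow>
    (nat multiset \<Rightarrow> 'a) \<Rightarrow> (nat multiset \<Rightarrow> 'a) \<Rightarrow> nat multiset \<Rightarrow> 'a" where
  "ps_mult A f g = (\<lambda>m. \<Sum>k \<in> {k. k \<subseteq># m}. alg_product A (f k) (g (m - k)))"

definition ps_one :: "'a :: ab_group_add filtered_algebra \<Rightarrow> nat multiset \<Rightarrow> 'a" where
  "ps_one A = (\<lambda>m. if m = {#} then alg_unit A else 0)"

definition ps_power :: "'a :: ab_group_add filtered_algebra \<Rightarrow>
    (nat multiset \<Rightarrow> 'a) \<Rightarrow> nat \<Rightarrow> nat multiset \<Rightarrow> 'a" where
  "ps_power A f n = (ps_mult A f ^^ n) (ps_one A)"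

text \<open>
  The exponential of a series without constant term and the logarithm of a series with constant
  term \<open>1\<close>. The \<open>n\<close>-th power of a series without constant term only involves monomials of
  degree at least \<open>n\<close>, so each coefficient is a finite sum.
\<close>

definition ps_exp :: "'a :: ab_group_add filtered_algebra \<Rightarrow>
    (nat multiset \<Rightarrow> 'a) \<Rightarrow> nat multiset \<Rightarrow> 'a" where
  "ps_exp A f = (\<lambda>m. \<Sum>n \<le> size m. alg_scale A (1 / fact n) (ps_power A f n m))"

definition ps_log :: "'a :: ab_group_add filtered_algebra \<Rightarrow>
    (nat multiset \<Rightarrow> 'a) \<Rightarrow> nat multiset \<Rightarrow> 'a" where
  "ps_log A f = (\<lambda>m. \<Sum>n = 1..size m.
     alg_scale A ((- 1) ^ (n + 1) / of_nat n) (ps_power A (\<lambda>u. f u - ps_one A u) n m))"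

text \<open>\<open>linear_series [a\<^sub>0, a\<^sub>1, \<dots>] = t\<^sub>0 a\<^sub>0 + t\<^sub>1 a\<^sub>1 + \<dots>\<close>\<close>

definition linear_series :: "'a :: ab_group_add list \<Rightarrow> nat multiset \<Rightarrow> 'a" where
  "linear_series as = (\<lambda>m. \<Sum>i < length as. if m = {#i#} then as ! i else 0)"

definition cumulant :: "'a :: ab_group_add filtered_algebra \<Rightarrow> 'b :: ab_group_add filtered_algebra \<Rightarrow>
    ('a \<Rightarrow> 'b) \<Rightarrow> 'a list \<Rightarrow> 'b" where
  "cumulant A B F as =
     ps_log B (\<lambda>m. F (ps_exp A (linear_series as) m)) (mset [0..<length as])"

definition approximate_factorization ::
    "'a :: ab_group_add filtered_algebra \<Rightarrow> 'b :: ab_group_add filtered_algebra \<Rightarrow> ('a \<Rightarrow> 'b) \<Rightarrow> bool"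
    where
  "approximate_factorization A B F \<longleftrightarrow>
     (\<forall>as. as \<noteq> [] \<and> set as \<subseteq> alg_space A \<longrightarrow>
        alg_degree B (cumulant A B F as) \<le>
          (\<Sum>a \<leftarrow> as. alg_degree A a) - ereal (2 * (real (length as) - 1)))"


section \<open>The algebra of normalized spin characters\<close>

definition fscale :: "complex \<Rightarrow> ('x \<Rightarrow> complex) \<Rightarrow> 'x \<Rightarrow> complex" where
  "fscale c f = (\<lambda>x. c * f x)"

interpretation fun_vs: vector_space fscale
  by unfold_locales (auto simp: fscale_def fun_eq_iff algebra_simps)

definition Ch :: "(strict_partition \<Rightarrow> nat multiset \<Rightarrow> complex) \<Rightarrow>
    nat multiset \<Rightarrow> strict_partition \<Rightarrow> complex" where
  "Ch \<phi> \<pi> \<xi> = (let n = sp_size \<xi>; k = sum_mset \<pi> in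
     if k \<le> n then
       of_nat (\<Prod>i < k. n - i) * 2 ^ ((k - size \<pi>) div 2) *
         \<phi> \<xi> (\<pi> + replicate_mset (n - k) 1) / \<phi> \<xi> (replicate_mset n 1)
     else 0)"

definition Gamma_space :: "(strict_partition \<Rightarrow> nat multiset \<Rightarrow> complex) \<Rightarrow>
    (strict_partition \<Rightarrow> complex) set" where
  "Gamma_space \<phi> = fun_vs.span {Ch \<phi> \<pi> | \<pi>. odd_partition \<pi>}"

definition Gamma_filtration :: "(strict_partition \<Rightarrow> nat multiset \<Rightarrow> complex) \<Rightarrow>
    nat \<Rightarrow> (strict_partition \<Rightarrow> complex) set" where
  "Gamma_filtration \<phi> k =
     fun_vs.span {Ch \<phi> \<pi> | \<pi>. odd_partition \<pi> \<and> sum_mset \<pi> + size \<pi> \<le> k}"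

definition Gamma :: "(strict_partition \<Rightarrow> nat multiset \<Rightarrow> complex) \<Rightarrow>
    (strict_partition \<Rightarrow> complex) filtered_algebra" where
  "Gamma \<phi> = \<lparr>alg_space = Gamma_space \<phi>, alg_scale = fscale, alg_product = (*), alg_unit = 1,
     alg_filtration = Gamma_filtration \<phi>\<rparr>"

definition Ch_combination :: "(strict_partition \<Rightarrow> nat multiset \<Rightarrow> complex) \<Rightarrow>
    (nat multiset \<Rightarrow>\<^sub>0 complex) \<Rightarrow> strict_partition \<Rightarrow> complex" where
  "Ch_combination \<phi> c =
     (\<Sum>\<pi> \<in> Poly_Mapping.keys c. fscale (Poly_Mapping.lookup c \<pi>) (Ch \<phi> \<pi>))"

text \<open>Coordinates in the basis of the \<open>Ch\<^sub>\<pi>\<close>, \<open>\<pi>\<close> an odd partition.\<close>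

definition Ch_coeffs :: "(strict_partition \<Rightarrow> nat multiset \<Rightarrow> complex) \<Rightarrow>
    (strict_partition \<Rightarrow> complex) \<Rightarrow> nat multiset \<Rightarrow>\<^sub>0 complex" where
  "Ch_coeffs \<phi> x =
     (THE c. (\<forall>\<pi> \<in> Poly_Mapping.keys c. odd_partition \<pi>) \<and> Ch_combination \<phi> c = x)"

text \<open>
  The bilinear product with \<open>Ch\<^sub>\<pi> \<bullet> Ch\<^sub>\<sigma> = Ch\<^bsub>\<pi>\<sigma>\<^esub>\<close>: multiplication in the monoid algebra of
  the multisets is the bilinear extension of the sum of multisets.
\<close>

definition disjoint_product :: "(strict_partition \<Rightarrow> nat multiset \<Rightarrow> complex) \<Rightarrow>
    (strict_partition \<Rightarrow> complex) \<Rightarrow> (strict_partition \<Rightarrow> complex) \<Rightarrow> strict_partition \<Rightarrow> complex" where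
  "disjoint_product \<phi> x y = Ch_combination \<phi> (Ch_coeffs \<phi> x * Ch_coeffs \<phi> y)"

definition Gamma_disjoint :: "(strict_partition \<Rightarrow> nat multiset \<Rightarrow> complex) \<Rightarrow>
    (strict_partition \<Rightarrow> complex) filtered_algebra" where
  "Gamma_disjoint \<phi> = \<lparr>alg_space = Gamma_space \<phi>, alg_scale = fscale, alg_product = disjoint_product \<phi>,
     alg_unit = Ch \<phi> {#}, alg_filtration = Gamma_filtration \<phi>\<rparr>"

definition composition_pairs :: "nat \<Rightarrow> nat \<Rightarrow> nat \<Rightarrow> (nat list \<times> nat list) set" where
  "composition_pairs r k1 k2 = {(as, bs).
     length as = r \<and> length bs = r \<and> (\<forall>i < r. as ! i \<ge> 1 \<and> bs ! i \<ge> 1 \<and> even (as ! i + bs ! i)) \<and>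
     sum_list as = k1 \<and> sum_list bs = k2}"

end

theory Submission
  imports Defs "HOL-Combinatorics.Permutations" "Jordan_Normal_Form.Spectral_Radius"
    "HOL-Computational_Algebra.Formal_Power_Series"
begin

text \<open>
  By Schur's lemma the sum of all signed \<open>k\<close>-cycles, \<open>k\<close> odd, acts on an irreducible spin representation as
  a scalar, which is \<open>Ch\<^sub>k\<close> up to a power of 2. Hence \<open>Ch\<^sub>k Ch\<^sub>\<pi>\<close> is obtained by multiplying a fixed signed
  permutation of type \<open>\<pi>\<close> by all \<open>k\<close>-cycles. Building the cycles one transposition at a time, each step
  inserts a fresh point, cuts a cycle or joins two cycles, and products with an even cycle have character 0.
  This expresses \<open>Ch\<^sub>k\<close> times the disjoint product of the \<open>Ch\<close> of the cycles in \<open>I\<close> as the sum over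
  \<open>S \<subseteq> I\<close> of the disjoint products of some \<open>C(S)\<close> with those in \<open>I - S\<close>, where \<open>S\<close> is the set of touched
  cycles. On cumulants it becomes \<open>\<kappa>(Ch\<^sub>k; I) = - \<Sum> \<kappa>(C(S); I - S)\<close>, summed over nonempty \<open>S\<close>. Each
  joining lowers the degree by 2, so the bound on the degree of cumulants follows by induction on the total
  degree; for a single touched cycle the top degree part of \<open>C\<close> is the stated sum.

  Linear independence of the \<open>Ch\<^sub>\<pi>\<close>, needed for the disjoint product to make sense, holds because Schur's
  Q-functions span all polynomials in the odd power sums: \<open>Q\<^sub>\<xi>\<close> is triangular with respect to the products
  \<open>q\<^sub>\<mu>\<close>, ordered by \<open>\<Sum>\<^sub>i \<mu>\<^sub>i\<^sup>2\<close>.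
\<close>

subsection \<open>The monoid algebra of multisets\<close>

text \<open>The walk must not depend on n, although it is run in the spin group on n points. Two
  normalisations achieve this. The falling factorial n (n - 1) ... (n - N + 1), with N the number of
  points in use, absorbs the n - N choices of a fresh point. The generators \<open>yy l\<close>,
  which are p_l divided by a power of 2 for odd l and 0 for even l, have products that evaluate to
  falling factorials times normalised traces; powers of 2 and even cycles then need no separate
  treatment. What is left of a configuration is a list of cycle lengths with marks on the points
  that may still be chosen.

  The loss of 2 per further argument of a cumulant comes from the bound k + 1 + sum (s_i + 1) - 2
  |S| for the degree of C(S): replacing Ch_k and the cycles of S by C(S) removes |S| arguments and
  loses 2 |S| degrees.

  The leading term has three sources: 1/r is an average over the rotations of r blocks, 2^(r-1) is
  what the normalisations of \<open>yy\<close> leave over, and the condition that a_i + b_i is even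
  excludes the even cycles.\<close>

type_synonym mpoly = "nat multiset \<Rightarrow>\<^sub>0 complex"

definition pscale :: "complex \<Rightarrow> mpoly \<Rightarrow> mpoly" where
  "pscale c x = Poly_Mapping.single 0 c * x"

abbreviation mono :: "nat multiset \<Rightarrow> mpoly" where
  "mono \<pi> \<equiv> Poly_Mapping.single \<pi> 1"

lemma lookup_pscale [simp]: "Poly_Mapping.lookup (pscale c x) \<pi> = c * Poly_Mapping.lookup x \<pi>"
  unfolding pscale_def mult_map_scale_conv_mult[symmetric]
  by (simp add: Poly_Mapping.map.rep_eq when_def)

interpretation pvs: vector_space pscale
  by unfold_locales (auto intro!: poly_mapping_eqI simp: lookup_add algebra_simps)

lemma pscale_mult_left: "pscale c x * y = pscale c (x * y)"
  by (simp add: pscale_def mult.assoc)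

lemma pscale_mult_right: "x * pscale c y = pscale c (x * y)"
  by (simp add: pscale_def mult.left_commute)

lemma pscale_single [simp]: "pscale c (Poly_Mapping.single \<pi> d) = Poly_Mapping.single \<pi> (c * d)"
  by (simp add: pscale_def mult_single)

lemma pscale_of_nat: "pscale (of_nat n) x = of_nat n * x"
  by (induction n) (simp_all add: pvs.scale_left_distrib algebra_simps)

lemma mpoly_sum_monomials: "x = (\<Sum>\<pi> \<in> Poly_Mapping.keys x. pscale (Poly_Mapping.lookup x \<pi>) (mono \<pi>))"
  by (rule poly_mapping_eqI)
    (simp add: lookup_sum lookup_single when_def in_keys_iff if_distrib[where f = "(*) _"] cong: if_cong)

lemma pvs_span_mult:
  assumes "x \<in> pvs.span A" "y \<in> pvs.span B" "\<And>a b. a \<in> A \<Longrightarrow> b \<in> B \<Longrightarrow> a * b \<in> pvs.span C"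
  shows "x * y \<in> pvs.span C"
  using assms(1)
proof (induction rule: pvs.span_induct_alt)
  case (step c a z)
  have "a * y \<in> pvs.span C"
    using assms(2)
  proof (induction rule: pvs.span_induct_alt)
    case (step d b w)
    then show ?case
      using assms(3)[OF \<open>a \<in> A\<close>]
      by (auto simp: distrib_left pscale_mult_right intro!: pvs.span_add pvs.span_scale)
  qed (simp add: pvs.span_zero)
  then show ?case
    using step by (auto simp: distrib_right pscale_mult_left intro!: pvs.span_add pvs.span_scale)
qed (simp add: pvs.span_zero)

lemma lookup_mono_mult:
  "Poly_Mapping.lookup (mono {#k#} * x) \<pi> =
     (if k \<in># \<pi> then Poly_Mapping.lookup x (\<pi> - {#k#}) else 0)"
proof -
  have eq: "{#k#} + \<sigma> = \<pi> \<longleftrightarrow> k \<in># \<pi> \<and> \<sigma> = \<pi> - {#k#}" for \<sigma>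
    by auto
  have "mono {#k#} * x = (\<Sum>\<sigma> \<in> Poly_Mapping.keys x. pscale (Poly_Mapping.lookup x \<sigma>) (mono ({#k#} + \<sigma>)))"
    by (subst mpoly_sum_monomials[of x]) (simp add: sum_distrib_left mult_single)
  then have "Poly_Mapping.lookup (mono {#k#} * x) \<pi> =
      (\<Sum>\<sigma> \<in> Poly_Mapping.keys x. if {#k#} + \<sigma> = \<pi> then Poly_Mapping.lookup x \<sigma> else 0)"
    by (simp add: lookup_sum lookup_single when_def)
  also have "\<dots> = (\<Sum>\<sigma> \<in> Poly_Mapping.keys x. if \<sigma> = \<pi> - {#k#} then (if k \<in># \<pi> then Poly_Mapping.lookup x \<sigma> else 0) else 0)"
    unfolding eq by (intro sum.cong) auto
  finally show ?thesis
    by (simp add: in_keys_iff)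
qed


subsection \<open>Schur's Q-functions span the odd power sum polynomials\<close>

lemma member_le_sum_mset: "p \<in># \<pi> \<Longrightarrow> p \<le> sum_mset \<pi>" for p :: nat
  by (induction \<pi>) auto

lemma finite_odd_partitions: "finite {\<pi>. odd_partition \<pi> \<and> sum_mset \<pi> = n}"
proof (rule finite_subset)
  show "finite (mset ` {xs. set xs \<subseteq> {..n} \<and> length xs \<le> n})"
    by (intro finite_imageI finite_lists_length_le) simp
  have le: "size \<pi> \<le> sum_mset \<pi>" if "\<forall>p \<in># \<pi>. odd p" for \<pi> :: "nat multiset"
    using that
  proof (induction \<pi>)
    case (add p \<pi>)
    then have "p > 0" "size \<pi> \<le> sum_mset \<pi>"
      by (simp_all add: odd_pos)
    then show ?case
      by simp
  qed simp
  show "{\<pi>. odd_partition \<pi> \<and> sum_mset \<pi> = n} \<subseteq> mset ` {xs. set xs \<subseteq> {..n} \<and> length xs \<le> n}"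
  proof
    fix \<pi> assume "\<pi> \<in> {\<pi>. odd_partition \<pi> \<and> sum_mset \<pi> = n}"
    then have "set_mset \<pi> \<subseteq> {..n}" "size \<pi> \<le> n"
      using le[of \<pi>] member_le_sum_mset[of _ \<pi>] by (auto simp: odd_partition_def)
    moreover obtain xs where "mset xs = \<pi>"
      using ex_mset by blast
    ultimately show "\<pi> \<in> mset ` {xs. set xs \<subseteq> {..n} \<and> length xs \<le> n}"
      by (intro image_eqI[of _ _ xs]) auto
  qed
qed

lemma lookup_schur_q: "Poly_Mapping.lookup (schur_q n) \<pi> =
    (if odd_partition \<pi> \<and> sum_mset \<pi> = n then 2 ^ size \<pi> / of_nat (z_factor \<pi>) else 0)"
  using finite_odd_partitions[of n] by (simp add: schur_q_def lookup_sum lookup_single when_def)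

lemma z_factor_superset:
  assumes "finite S" "set_mset \<pi> \<subseteq> S"
  shows "z_factor \<pi> = (\<Prod>i \<in> S. i ^ count \<pi> i * fact (count \<pi> i))"
  unfolding z_factor_def
  by (rule prod.mono_neutral_left) (use assms in \<open>auto simp: not_in_iff\<close>)

lemma z_factor_remove:
  assumes "k \<in># \<pi>"
  shows "z_factor \<pi> = k * count \<pi> k * z_factor (\<pi> - {#k#})"
proof -
  obtain c where c: "count \<pi> k = Suc c"
    using assms by (meson count_greater_zero_iff gr0_implies_Suc)
  have "k ^ count \<pi> k * fact (count \<pi> k)
      = k * count \<pi> k * (k ^ (count \<pi> k - 1) * fact (count \<pi> k - 1))"
    by (simp add: c algebra_simps)
  then have "z_factor \<pi> = k * count \<pi> k * ((k ^ (count \<pi> k - 1) * fact (count \<pi> k - 1)) *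
      (\<Prod>i \<in> set_mset \<pi> - {k}. i ^ count \<pi> i * fact (count \<pi> i)))"
    unfolding z_factor_def using assms by (subst prod.remove[of _ k]) (simp_all add: mult.assoc)
  also have "\<dots> = k * count \<pi> k * z_factor (\<pi> - {#k#})"
    by (subst z_factor_superset[of "set_mset \<pi>" "\<pi> - {#k#}"])
      (use assms in \<open>auto simp: prod.remove[of _ k] dest: in_diffD intro!: prod.cong\<close>)
  finally show ?thesis .
qed

lemma z_factor_pos: "odd_partition \<pi> \<Longrightarrow> z_factor \<pi> > 0"
  by (auto simp: z_factor_def odd_partition_def intro!: prod_pos odd_pos)

lemma schur_q_0: "schur_q 0 = 1"
proof -
  have "{\<pi>. odd_partition \<pi> \<and> sum_mset \<pi> = 0} = {{#}}"
    (is "?A = _")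
  proof (intro Set.set_eqI iffI)
    fix \<pi> assume "\<pi> \<in> ?A"
    then have "p \<notin># \<pi>" for p
      using member_le_sum_mset[of p \<pi>] by (auto simp: odd_partition_def)
    then show "\<pi> \<in> {{#}}"
      by (simp add: multiset_eq_iff not_in_iff)
  qed (simp add: odd_partition_def)
  then show ?thesis
    by (simp add: schur_q_def z_factor_def)
qed


lemma sum_mset_eq_sum_count: "sum_mset \<pi> = (\<Sum>k \<in> set_mset \<pi>. count \<pi> k * k)" for \<pi> :: "nat multiset"
proof (induction \<pi>)
  case (add p \<pi>)
  have "(\<Sum>k \<in> set_mset (add_mset p \<pi>). count (add_mset p \<pi>) k * k)
      = (\<Sum>k \<in> insert p (set_mset \<pi>). count \<pi> k * k + (if k = p then p else 0))"
    by (intro sum.cong) auto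
  also have "\<dots> = (\<Sum>k \<in> insert p (set_mset \<pi>). count \<pi> k * k) + p"
    by (simp add: sum.distrib del: sum.insert)
  also have "(\<Sum>k \<in> insert p (set_mset \<pi>). count \<pi> k * k) = (\<Sum>k \<in> set_mset \<pi>. count \<pi> k * k)"
    by (rule sum.mono_neutral_right) (auto simp: not_in_iff)
  finally show ?case
    using add by simp
qed simp

text \<open>Logarithmic derivative of the generating function: t q'(t) = 2 (sum over odd k of p_k
  t^k) q(t). On coefficients, dropping a part k from \<pi> costs the factor k m_k of
  \<open>z_factor\<close>, and over the distinct parts these factors add up to n.\<close>

lemma schur_q_recursion:
  "of_nat n * schur_q n = 2 * (\<Sum>k \<in> {k \<in> {1..n}. odd k}. mono {#k#} * schur_q (n - k))"
proof (rule poly_mapping_eqI)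
  fix \<pi>
  have two: "2 * x = pscale 2 x" for x
    using pscale_of_nat[of 2 x] by simp
  have R: "Poly_Mapping.lookup (2 * (\<Sum>k \<in> {k \<in> {1..n}. odd k}. mono {#k#} * schur_q (n - k))) \<pi>
      = 2 * (\<Sum>k \<in> {k \<in> {1..n}. odd k}. if k \<in># \<pi> then Poly_Mapping.lookup (schur_q (n - k)) (\<pi> - {#k#}) else 0)"
    unfolding two by (simp add: lookup_sum lookup_mono_mult)
  show "Poly_Mapping.lookup (of_nat n * schur_q n) \<pi>
      = Poly_Mapping.lookup (2 * (\<Sum>k \<in> {k \<in> {1..n}. odd k}. mono {#k#} * schur_q (n - k))) \<pi>"
  proof (cases "odd_partition \<pi> \<and> sum_mset \<pi> = n")
    case True
    then have odd: "\<And>k. k \<in># \<pi> \<Longrightarrow> odd k" and n: "sum_mset \<pi> = n"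
      by (auto simp: odd_partition_def)
    have sub: "set_mset \<pi> \<subseteq> {k \<in> {1..n}. odd k}"
      using n odd member_le_sum_mset[of _ \<pi>] odd_pos by (force simp: Suc_le_eq)
    have z: "z_factor \<pi> \<noteq> 0"
      using True z_factor_pos by blast
    have "(\<Sum>k \<in> {k \<in> {1..n}. odd k}. if k \<in># \<pi> then Poly_Mapping.lookup (schur_q (n - k)) (\<pi> - {#k#}) else 0)
        = (\<Sum>k \<in> set_mset \<pi>. Poly_Mapping.lookup (schur_q (n - k)) (\<pi> - {#k#}))"
      by (rule sum.mono_neutral_cong_right) (use sub in auto)
    also have "\<dots> = (\<Sum>k \<in> set_mset \<pi>. of_nat (count \<pi> k * k) * 2 ^ (size \<pi> - 1) / of_nat (z_factor \<pi>))"
    proof (rule sum.cong[OF HOL.refl])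
      fix k assume k: "k \<in># \<pi>"
      have "odd_partition (\<pi> - {#k#})" "sum_mset (\<pi> - {#k#}) = n - k"
        using odd n arg_cong[OF insert_DiffM[OF k], of sum_mset]
        by (auto simp: odd_partition_def dest: in_diffD)
      moreover have "size (\<pi> - {#k#}) = size \<pi> - 1"
        using k by (simp add: size_Diff_singleton)
      ultimately show "Poly_Mapping.lookup (schur_q (n - k)) (\<pi> - {#k#})
          = of_nat (count \<pi> k * k) * 2 ^ (size \<pi> - 1) / of_nat (z_factor \<pi>)"
        using z z_factor_remove[OF k] by (simp add: lookup_schur_q)
    qed
    also have "\<dots> = of_nat n * 2 ^ (size \<pi> - 1) / of_nat (z_factor \<pi>)"
      by (simp add: n[symmetric] sum_mset_eq_sum_count sum_distrib_right sum_divide_distrib)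
    finally have eq: "(\<Sum>k \<in> {k \<in> {1..n}. odd k}. if k \<in># \<pi> then Poly_Mapping.lookup (schur_q (n - k)) (\<pi> - {#k#}) else 0)
        = of_nat n * 2 ^ (size \<pi> - 1) / of_nat (z_factor \<pi>)" .
    \<comment> \<open>For the empty partition the truncated exponent \<open>size \<pi> - 1\<close>
      is wrong, but then both sides carry the factor n = 0.\<close>
    have "n = 0 \<or> size \<pi> = Suc (size \<pi> - 1)"
      using n by (cases \<pi>) auto
    then have "2 * (of_nat n * 2 ^ (size \<pi> - 1) / of_nat (z_factor \<pi>))
        = (of_nat n * (2 ^ size \<pi> / of_nat (z_factor \<pi>)) :: complex)"
      by (metis (no_types, lifting) mult.left_commute mult_eq_0_iff of_nat_0 power_Suc times_divide_eq_right)
    then show ?thesis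
      unfolding R eq pscale_of_nat[symmetric] using True by (auto simp: lookup_schur_q)
  next
    case False
    have "Poly_Mapping.lookup (schur_q (n - k)) (\<pi> - {#k#}) = 0" if k: "k \<in># \<pi>" "odd k" "k \<le> n" for k
    proof -
      obtain \<sigma> where \<sigma>: "\<pi> = add_mset k \<sigma>"
        using k(1) by (meson multi_member_split)
      show ?thesis
        using False k(2,3) by (auto simp: \<sigma> lookup_schur_q odd_partition_def)
    qed
    then show ?thesis
      unfolding R pscale_of_nat[symmetric] using False by (auto simp: lookup_schur_q intro!: sum.neutral)
  qed
qed

text \<open>This is q(-t) q(t) = 1. By the recursion F = q(t) satisfies F' = 2 P F, and since P has
  only even powers, G = q(-t) satisfies G' = -2 P G. Hence (G F)' = 0, and in characteristic 0 the
  coefficients of positive index vanish.\<close>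

lemma schur_q_alternating:
  assumes "m > 0"
  shows "(\<Sum>i = 0..m. (- 1) ^ i * schur_q i * schur_q (m - i)) = 0"
proof -
  define F where "F = Abs_fps schur_q"
  define G where "G = Abs_fps (\<lambda>i. (- 1) ^ i * schur_q i)"
  define P where "P = Abs_fps (\<lambda>j. if even j then mono {#Suc j#} else 0)"
  have rec: "of_nat (Suc n) * schur_q (Suc n) = 2 * (\<Sum>i = 0..n. fps_nth P i * schur_q (n - i))" for n
  proof -
    have "(\<Sum>k \<in> {k \<in> {1..Suc n}. odd k}. mono {#k#} * schur_q (Suc n - k))
        = (\<Sum>k \<in> Suc ` {0..n}. if odd k then mono {#k#} * schur_q (Suc n - k) else 0)"
      by (rule sum.mono_neutral_cong_left) (auto simp: image_iff Suc_le_eq gr0_conv_Suc)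
    also have "\<dots> = (\<Sum>i = 0..n. fps_nth P i * schur_q (n - i))"
      by (subst sum.reindex) (auto simp: P_def intro!: sum.cong)
    finally show ?thesis
      by (simp add: schur_q_recursion del: of_nat_Suc)
  qed
  have F: "fps_deriv F = fps_const 2 * (P * F)"
    by (rule fps_ext) (use rec in \<open>simp add: F_def fps_mult_nth[of P]\<close>)
  have G: "fps_deriv G = - (fps_const 2 * (P * G))"
  proof (rule fps_ext)
    fix n
    have "fps_nth (fps_deriv G) n = (- 1) ^ Suc n * (2 * (\<Sum>i = 0..n. fps_nth P i * schur_q (n - i)))"
      by (simp add: G_def rec[symmetric] algebra_simps del: of_nat_Suc)
    also have "\<dots> = - (2 * (\<Sum>i = 0..n. fps_nth P i * ((- 1) ^ (n - i) * schur_q (n - i))))"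
    proof -
      have "(- 1) ^ n * (fps_nth P i * schur_q (n - i)) = fps_nth P i * ((- 1) ^ (n - i) * schur_q (n - i))"
        if "i \<le> n" for i
        using that by (auto simp: P_def minus_one_power_iff)
      then have "(- 1) ^ n * (\<Sum>i = 0..n. fps_nth P i * schur_q (n - i))
          = (\<Sum>i = 0..n. fps_nth P i * ((- 1) ^ (n - i) * schur_q (n - i)))"
        unfolding sum_distrib_left by (intro sum.cong) auto
      then show ?thesis
        by (simp add: mult.left_commute)
    qed
    finally show "fps_nth (fps_deriv G) n = fps_nth (- (fps_const 2 * (P * G))) n"
      by (simp add: G_def fps_mult_nth[of P])
  qed
  have "fps_deriv (G * F) = 0"
    by (simp add: F G algebra_simps)
  then have "of_nat m * fps_nth (G * F) m = 0"
    using assms by (metis Suc_pred' fps_deriv_nth fps_zero_nth Suc_eq_plus1)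
  then have "pscale (1 / of_nat m) (pscale (of_nat m) (fps_nth (G * F) m)) = 0"
    by (simp add: pscale_of_nat)
  then have "fps_nth (G * F) m = 0"
    using assms by (subst (asm) pvs.scale_scale) simp
  then show ?thesis
    by (simp add: G_def F_def fps_mult_nth)
qed


section \<open>Triangularity of the Q-functions in the products of one-row functions\<close>

definition q_prod :: "nat multiset \<Rightarrow> mpoly" where
  "q_prod \<mu> = prod_mset (image_mset schur_q \<mu>)"

text \<open>The weight of the triangular order: moving two parts r >= s further apart, to r + d and
  s - d with d > 0, raises it strictly.\<close>

definition square_sum :: "nat multiset \<Rightarrow> nat" where
  "square_sum \<mu> = sum_mset (image_mset (\<lambda>i. i ^ 2) \<mu>)"

text \<open>The index \<mu> may contain parts 0. They change neither the product, as q_0 = 1, nor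
  the two statistics, so a pair such as (r + s, 0) needs no special treatment.\<close>

definition q_span :: "nat \<Rightarrow> nat \<Rightarrow> mpoly set" where
  "q_span n N = pvs.span {q_prod \<mu> | \<mu>. sum_mset \<mu> = n \<and> square_sum \<mu> \<ge> N}"

lemma q_prod_simps [simp]:
  "q_prod {#} = 1" "q_prod (add_mset r \<mu>) = schur_q r * q_prod \<mu>" "q_prod (\<mu> + \<nu>) = q_prod \<mu> * q_prod \<nu>"
  by (simp_all add: q_prod_def)

lemma square_sum_simps [simp]:
  "square_sum {#} = 0" "square_sum (add_mset r \<mu>) = r ^ 2 + square_sum \<mu>"
  "square_sum (\<mu> + \<nu>) = square_sum \<mu> + square_sum \<nu>"
  by (simp_all add: square_sum_def)

lemma q_prod_in_q_span: "sum_mset \<mu> = n \<Longrightarrow> square_sum \<mu> \<ge> N \<Longrightarrow> q_prod \<mu> \<in> q_span n N"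
  by (auto simp: q_span_def intro: pvs.span_base)

lemma q_span_add: "x \<in> q_span n N \<Longrightarrow> y \<in> q_span n N \<Longrightarrow> x + y \<in> q_span n N"
  by (simp add: q_span_def pvs.span_add)

lemma q_span_diff: "x \<in> q_span n N \<Longrightarrow> y \<in> q_span n N \<Longrightarrow> x - y \<in> q_span n N"
  by (simp add: q_span_def pvs.span_diff)

lemma q_span_scale: "x \<in> q_span n N \<Longrightarrow> pscale c x \<in> q_span n N"
  by (simp add: q_span_def pvs.span_scale)

lemma q_span_sum: "(\<And>i. i \<in> I \<Longrightarrow> f i \<in> q_span n N) \<Longrightarrow> sum f I \<in> q_span n N"
  by (simp add: q_span_def pvs.span_sum)

lemma q_span_mono: "M \<le> N \<Longrightarrow> q_span n N \<subseteq> q_span n M"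
  unfolding q_span_def by (rule pvs.span_mono) auto

lemma q_span_mult: "x \<in> q_span m M \<Longrightarrow> y \<in> q_span n N \<Longrightarrow> x * y \<in> q_span (m + n) (M + N)"
  unfolding q_span_def
proof (rule pvs_span_mult, assumption+)
  fix a b
  assume "a \<in> {q_prod \<mu> | \<mu>. sum_mset \<mu> = m \<and> square_sum \<mu> \<ge> M}"
    "b \<in> {q_prod \<mu> | \<mu>. sum_mset \<mu> = n \<and> square_sum \<mu> \<ge> N}"
  then obtain \<mu> \<nu> where
    "a = q_prod \<mu>" "sum_mset \<mu> = m" "square_sum \<mu> \<ge> M"
    "b = q_prod \<nu>" "sum_mset \<nu> = n" "square_sum \<nu> \<ge> N"
    by auto
  then show "a * b \<in> pvs.span {q_prod \<mu> | \<mu>. sum_mset \<mu> = m + n \<and> square_sum \<mu> \<ge> M + N}"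
    by (intro pvs.span_base CollectI exI[of _ "\<mu> + \<nu>"]) simp
qed

lemma minus_one_power_scale: "(- 1) ^ i * x = pscale ((- 1) ^ i) x"
  by (cases "even i") simp_all

lemma two_mult_scale: "2 * x = pscale 2 x"
  using pscale_of_nat[of 2 x] by simp

text \<open>In the recursion for k q_k the last summand is 2 p_k, as q_0 = 1. All others contain
  smaller odd power sums, which are covered by induction.\<close>

lemma odd_power_sum_in_q_span:
  assumes "odd k"
  shows "mono {#k#} \<in> q_span k 0"
  using assms
proof (induction k rule: less_induct)
  case (less k)
  have k: "k > 0"
    using less.prems odd_pos by blast
  have eq: "{j \<in> {1..k}. odd j} = insert k {j \<in> {1..<k}. odd j}"
    using less.prems k by auto
  have "of_nat k * schur_q k = 2 * (mono {#k#} * schur_q 0) +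
      2 * (\<Sum>j \<in> {j \<in> {1..<k}. odd j}. mono {#j#} * schur_q (k - j))"
    unfolding schur_q_recursion eq by (subst sum.insert) (auto simp: algebra_simps)
  then have "pscale 2 (mono {#k#}) = pscale (of_nat k) (schur_q k) -
      pscale 2 (\<Sum>j \<in> {j \<in> {1..<k}. odd j}. mono {#j#} * schur_q (k - j))"
    by (simp add: schur_q_0 pscale_of_nat two_mult_scale algebra_simps)
  also have "\<dots> \<in> q_span k 0"
  proof (intro q_span_diff q_span_scale q_span_sum)
    show "schur_q k \<in> q_span k 0"
      using q_prod_in_q_span[of "{#k#}" k 0] by simp
    fix j assume "j \<in> {j \<in> {1..<k}. odd j}"
    then have "mono {#j#} * schur_q (k - j) \<in> q_span (j + (k - j)) (0 + 0)"
      using less.IH q_prod_in_q_span[of "{#k - j#}" "k - j" 0] by (intro q_span_mult) auto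
    then show "mono {#j#} * schur_q (k - j) \<in> q_span k 0"
      using \<open>j \<in> _\<close> by simp
  qed
  finally have "pscale (1/2) (pscale 2 (mono {#k#})) \<in> q_span k 0"
    by (rule q_span_scale)
  then show ?case
    by simp
qed

lemma odd_monomial_in_q_span: "odd_partition \<pi> \<Longrightarrow> mono \<pi> \<in> q_span (sum_mset \<pi>) 0"
proof (induction \<pi>)
  case empty
  then show ?case
    using q_prod_in_q_span[of "{#}" 0 0] by simp
next
  case (add k \<pi>)
  then have "mono {#k#} * mono \<pi> \<in> q_span (k + sum_mset \<pi>) (0 + 0)"
    by (intro q_span_mult odd_power_sum_in_q_span) (auto simp: odd_partition_def)
  then show ?case
    by (simp add: mult_single)
qed

text \<open>In the alternating relation of degree 2 r the middle term is q_r q_r up to sign. All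
  others have indices r + d and r - d with d > 0, whose squares exceed 2 r^2 by 2 d^2 in total. Thus
  a repeated part can be traded for products of larger weight.\<close>

lemma schur_q_square: 
  assumes "r > 0"
  shows "schur_q r * schur_q r \<in> q_span (2 * r) (2 * r ^ 2 + 1)"
proof -
  let ?f = "\<lambda>i. (- 1) ^ i * schur_q i * schur_q (2 * r - i)"
  have mem: "?f i \<in> q_span (2 * r) (2 * r ^ 2 + 1)" if "i \<in> {0..2 * r} - {r}" for i
  proof -
    have "\<exists>d > 0. (i = r + d \<or> i + d = r)"
      using that by (metis DiffE add.commute linorder_neqE_nat less_imp_add_positive singletonI)
    then obtain d where d: "d > 0" "i = r + d \<or> i + d = r" by blast
    have "i ^ 2 + (2 * r - i) ^ 2 = 2 * r ^ 2 + 2 * d ^ 2"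
    proof -
      have "int i ^ 2 + (2 * int r - int i) ^ 2 = 2 * int r ^ 2 + 2 * int d ^ 2"
        using d(2) by (auto simp: power2_eq_square algebra_simps)
      moreover have "int (2 * r - i) = 2 * int r - int i"
        using that by auto
      ultimately have "int (i ^ 2 + (2 * r - i) ^ 2) = int (2 * r ^ 2 + 2 * d ^ 2)"
        by simp
      then show ?thesis
        by presburger
    qed
    then have "q_prod {#i, 2 * r - i#} \<in> q_span (2 * r) (2 * r ^ 2 + 1)"
      using d(1) that by (intro q_prod_in_q_span) (auto simp: Suc_le_eq)
    then show ?thesis
      by (simp add: minus_one_power_scale pscale_mult_left q_span_scale)
  qed
  have "0 = ?f r + sum ?f ({0..2 * r} - {r})"
    using schur_q_alternating[of "2 * r"] assms by (simp add: sum.remove[of _ r])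
  then have "?f r = pscale (- 1) (sum ?f ({0..2 * r} - {r}))"
    by (simp add: eq_neg_iff_add_eq_0)
  also have "\<dots> \<in> q_span (2 * r) (2 * r ^ 2 + 1)"
    by (intro q_span_scale q_span_sum mem)
  finally have "pscale ((- 1) ^ r) (?f r) \<in> q_span (2 * r) (2 * r ^ 2 + 1)"
    by (rule q_span_scale)
  then show ?thesis
    by (simp add: minus_one_power_scale pscale_mult_left flip: power_mult_distrib mult_2)
qed

text \<open>Every correction term moves the parts r > s further apart, to r + i and s - i.\<close>

lemma schur_q2_leading:
  assumes "s < r"
  shows "schur_q2 r s - schur_q r * schur_q s \<in> q_span (r + s) (r ^ 2 + s ^ 2 + 1)"
proof -
  have mem: "(- 1) ^ i * schur_q (r + i) * schur_q (s - i) \<in> q_span (r + s) (r ^ 2 + s ^ 2 + 1)"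
    if i: "i \<in> {1..s}" for i
  proof -
    obtain t where t: "s = i + t"
      using i by (metis atLeastAtMost_iff le_Suc_ex)
    have "r * i \<ge> i + i * s"
      using assms mult_le_mono1[of "Suc s" r i] by (simp add: mult.commute)
    then have "r ^ 2 + s ^ 2 + 1 \<le> (r + i) ^ 2 + (s - i) ^ 2"
      using i by (simp add: t power2_eq_square algebra_simps)
    then have "q_prod {#r + i, s - i#} \<in> q_span (r + s) (r ^ 2 + s ^ 2 + 1)"
      using i by (intro q_prod_in_q_span) auto
    then show ?thesis
      by (simp add: minus_one_power_scale pscale_mult_left q_span_scale)
  qed
  have "pscale 2 (\<Sum>i = 1..s. (- 1) ^ i * schur_q (r + i) * schur_q (s - i))
      \<in> q_span (r + s) (r ^ 2 + s ^ 2 + 1)"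
    by (intro q_span_scale q_span_sum mem)
  then show ?thesis
    by (simp add: schur_q2_def two_mult_scale)
qed

text \<open>With leading products m and n, x y - m n = (x - m)(y - n) + m (y - n) + (x - m) n, and
  each summand has larger weight.\<close>

lemma q_span_leading_mult:
  assumes "x - q_prod \<mu> \<in> q_span (sum_mset \<mu>) (square_sum \<mu> + 1)"
    and "y - q_prod \<nu> \<in> q_span (sum_mset \<nu>) (square_sum \<nu> + 1)"
  shows "x * y - q_prod (\<mu> + \<nu>) \<in> q_span (sum_mset (\<mu> + \<nu>)) (square_sum (\<mu> + \<nu>) + 1)"
proof -
  let ?L = "q_span (sum_mset (\<mu> + \<nu>)) (square_sum (\<mu> + \<nu>) + 1)"
  have "(x - q_prod \<mu>) * (y - q_prod \<nu>) \<in> ?L"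
    using subsetD[OF q_span_mono q_span_mult[OF assms], of "square_sum (\<mu> + \<nu>) + 1"] by simp
  moreover have "q_prod \<mu> * (y - q_prod \<nu>) \<in> ?L"
    using q_span_mult[OF q_prod_in_q_span[OF HOL.refl order.refl] assms(2), of \<mu>] by simp
  moreover have "(x - q_prod \<mu>) * q_prod \<nu> \<in> ?L"
    using q_span_mult[OF assms(1) q_prod_in_q_span[OF HOL.refl order.refl], of \<nu>] by simp
  ultimately have "(x - q_prod \<mu>) * (y - q_prod \<nu>) + q_prod \<mu> * (y - q_prod \<nu>)
      + (x - q_prod \<mu>) * q_prod \<nu> \<in> ?L"
    by (intro q_span_add)
  then show ?thesis
    by (simp add: algebra_simps)
qed

text \<open>Every term of the expansion along the first row has the same leading product, that of
  all entries. The signs alternate and their number is odd, so they add up to 1.\<close>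

lemma pfaffian_schur_q2_leading:
  assumes "sorted_wrt (>) xs" "even (length xs)"
  shows "pfaffian schur_q2 xs - q_prod (mset xs) \<in> q_span (sum_list xs) (square_sum (mset xs) + 1)"
  using assms
proof (induction xs rule: length_induct)
  case (1 xs)
  show ?case
  proof (cases xs)
    case Nil
    then show ?thesis
      by (simp add: q_span_def pvs.span_zero)
  next
    case (Cons x ys)
    let ?L = "q_span (sum_list xs) (square_sum (mset xs) + 1)"
    let ?rest = "\<lambda>j. take j ys @ drop (Suc j) ys"
    have odd: "odd (length ys)" and x: "\<And>y. y \<in> set ys \<Longrightarrow> y < x" and ys: "sorted_wrt (>) ys"
      using 1 Cons by auto
    have mem: "schur_q2 x (ys ! j) * pfaffian schur_q2 (?rest j) - q_prod (mset xs) \<in> ?L"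
      if j: "j < length ys" for j
    proof -
      have split: "ys = take j ys @ ys ! j # drop (Suc j) ys"
        using j by (rule id_take_nth_drop)
      have "mset xs = {#x, ys ! j#} + mset (?rest j)"
        unfolding Cons by (subst split) simp
      moreover have "pfaffian schur_q2 (?rest j) - q_prod (mset (?rest j))
          \<in> q_span (sum_list (?rest j)) (square_sum (mset (?rest j)) + 1)"
      proof (rule 1(1)[rule_format])
        show "length (?rest j) < length xs" "even (length (?rest j))"
          using j odd Cons by auto
        show "sorted_wrt (>) (?rest j)"
          using ys by (subst (asm) split) (auto simp: sorted_wrt_append)
      qed
      moreover have "schur_q2 x (ys ! j) - q_prod {#x, ys ! j#}
          \<in> q_span (sum_mset {#x, ys ! j#}) (square_sum {#x, ys ! j#} + 1)"
        using schur_q2_leading[of "ys ! j" x] x j by simp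
      ultimately show ?thesis
        using q_span_leading_mult[of "schur_q2 x (ys ! j)" "{#x, ys ! j#}"
            "pfaffian schur_q2 (?rest j)" "mset (?rest j)"]
        by (simp only: sum_mset_sum_list[symmetric])
    qed
    have alt: "(\<Sum>j < n. (- 1) ^ j) = (if odd n then 1 else 0 :: complex)" for n
      by (induction n) auto
    have "(\<Sum>j < length ys. pscale ((- 1) ^ j)
        (schur_q2 x (ys ! j) * pfaffian schur_q2 (?rest j) - q_prod (mset xs))) \<in> ?L"
      by (intro q_span_sum q_span_scale mem) simp
    also have "(\<Sum>j < length ys. pscale ((- 1) ^ j)
        (schur_q2 x (ys ! j) * pfaffian schur_q2 (?rest j) - q_prod (mset xs)))
        = pfaffian schur_q2 xs - pscale (\<Sum>j < length ys. (- 1) ^ j) (q_prod (mset xs))"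
      by (simp add: Cons pvs.scale_right_diff_distrib sum_subtractf pvs.scale_sum_left
          minus_one_power_scale pscale_mult_left)
    finally show ?thesis
      using odd by (simp add: alt)
  qed
qed

lemma square_sum_le: "square_sum \<mu> \<le> (sum_mset \<mu>) ^ 2"
  by (induction \<mu>) (auto simp: power2_eq_square algebra_simps intro: add_mono)

text \<open>Downward induction on the square sum, which is at most n^2. A repeated part is removed
  by \<open>schur_q_square\<close>; for distinct parts the product agrees with the Q-function of
  these parts up to terms of larger square sum.\<close>

lemma q_prod_in_span_schur_Q:
  "q_prod \<mu> \<in> pvs.span (schur_Q ` {\<xi>. sp_size \<xi> = sum_mset \<mu>})"
proof (induction "(sum_mset \<mu>) ^ 2 - square_sum \<mu>" arbitrary: \<mu> rule: less_induct)
  case less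
  define n where "n = sum_mset \<mu>"
  define V where "V = pvs.span (schur_Q ` {\<xi>. sp_size \<xi> = n})"
  have sub: "q_span n (square_sum \<mu> + 1) \<subseteq> V"
    unfolding q_span_def V_def
  proof (rule pvs.span_minimal)
    show "{q_prod \<mu>' | \<mu>'. sum_mset \<mu>' = n \<and> square_sum \<mu>' \<ge> square_sum \<mu> + 1}
        \<subseteq> pvs.span (schur_Q ` {\<xi>. sp_size \<xi> = n})"
    proof clarify
      fix \<mu>' assume *: "square_sum \<mu>' \<ge> square_sum \<mu> + 1" "n = sum_mset \<mu>'"
      then show "q_prod \<mu>' \<in> pvs.span (schur_Q ` {\<xi>. sp_size \<xi> = sum_mset \<mu>'})"
        using square_sum_le[of \<mu>'] by (intro less) (simp add: n_def)
    qed
  qed simp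
  define \<nu> where "\<nu> = filter_mset (\<lambda>r. r > 0) \<mu>"
  have strip: "q_prod (filter_mset (\<lambda>r. r > 0) \<mu>) = q_prod \<mu> \<and>
      sum_mset (filter_mset (\<lambda>r. r > 0) \<mu>) = sum_mset \<mu> \<and>
      square_sum (filter_mset (\<lambda>r. r > 0) \<mu>) = square_sum \<mu>" for \<mu>
    by (induction \<mu>) (auto simp: schur_q_0)
  have \<nu>: "q_prod \<nu> = q_prod \<mu>" "sum_mset \<nu> = n" "square_sum \<nu> = square_sum \<mu>" "0 \<notin># \<nu>"
    using strip[of \<mu>] by (auto simp: \<nu>_def n_def)
  have "q_prod \<nu> \<in> V"
  proof (cases "\<exists>r. count \<nu> r \<ge> 2")
    case True
    then obtain r where "{#r, r#} \<subseteq># \<nu>"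
      by (metis One_nat_def Suc_1 count_le_replicate_mset_subset_eq replicate_mset_0 replicate_mset_Suc)
    then obtain \<rho> where \<rho>: "\<nu> = {#r, r#} + \<rho>"
      by (metis subset_mset.le_iff_add)
    have "r > 0"
      using \<nu>(4) by (auto simp: \<rho>)
    have "schur_q r * schur_q r * q_prod \<rho> \<in> q_span (2 * r + sum_mset \<rho>) (2 * r ^ 2 + 1 + square_sum \<rho>)"
      by (intro q_span_mult schur_q_square q_prod_in_q_span \<open>r > 0\<close>) auto
    moreover have "2 * r + sum_mset \<rho> = n" "2 * r ^ 2 + 1 + square_sum \<rho> = square_sum \<mu> + 1"
      using \<nu>(2,3) by (simp_all add: \<rho>)
    ultimately have "q_prod \<nu> \<in> q_span n (square_sum \<mu> + 1)"
      by (simp add: \<rho> mult.assoc)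
    then show ?thesis
      using sub by blast
  next
    case False
    then have c: "count \<nu> r \<le> 1" for r
      by (metis Suc_1 not_less_eq_eq)
    define xs where "xs = rev (sorted_list_of_multiset \<nu>)"
    have mset: "mset xs = \<nu>"
      by (simp add: xs_def)
    have "distinct xs"
      by (metis c count_mset_0_iff distinct_count_atmost_1 le_Suc_eq le_zero_eq mset One_nat_def)
    then have sorted: "sorted_wrt (>) xs"
      by (simp add: xs_def sorted_wrt_rev strict_sorted_iff del: distinct_rev) (simp add: strict_sorted_iff[symmetric])
    have "0 \<notin> set xs"
      using \<nu>(4) mset by (metis set_mset_mset)
    with sorted have parts: "parts (Strict_Partition xs) = xs"
      by (intro Strict_Partition_inverse) simp
    let ?\<xi> = "Strict_Partition xs"
    \<comment> \<open>The 0 that \<open>schur_Q\<close> appends to lists of odd length is harmless,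
      as q_0 = 1.\<close>
    let ?ys = "if even (length xs) then xs else xs @ [0]"
    have "sorted_wrt (>) ?ys" "even (length ?ys)"
      using sorted \<open>0 \<notin> set xs\<close> by (auto simp: sorted_wrt_append intro!: Nat.gr0I)
    from pfaffian_schur_q2_leading[OF this]
    have "schur_Q ?\<xi> - q_prod (mset ?ys) \<in> q_span (sum_list ?ys) (square_sum (mset ?ys) + 1)"
      by (simp only: schur_Q_def sp_length_def parts)
    moreover have "q_prod (mset ?ys) = q_prod \<nu>" "sum_list ?ys = n" "square_sum (mset ?ys) = square_sum \<mu>"
      using \<nu> by (auto simp: mset schur_q_0 sum_mset_sum_list[symmetric])
    ultimately have "schur_Q ?\<xi> - q_prod \<nu> \<in> V"
      using sub by auto
    moreover have "schur_Q ?\<xi> \<in> V"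
      unfolding V_def using \<nu>(2) by (intro pvs.span_base imageI) (simp add: sp_size_def parts mset[symmetric] sum_mset_sum_list)
    ultimately have "schur_Q ?\<xi> - (schur_Q ?\<xi> - q_prod \<nu>) \<in> V"
      unfolding V_def by (rule pvs.span_diff[rotated])
    then show ?thesis
      by simp
  qed
  then show ?case
    by (simp add: \<nu> V_def n_def)
qed

lemma odd_monomial_in_span_schur_Q:
  assumes "odd_partition \<pi>"
  shows "mono \<pi> \<in> pvs.span (schur_Q ` {\<xi>. sp_size \<xi> = sum_mset \<pi>})"
proof -
  have "q_span (sum_mset \<pi>) 0 \<subseteq> pvs.span (schur_Q ` {\<xi>. sp_size \<xi> = sum_mset \<pi>})"
    unfolding q_span_def
    by (rule pvs.span_minimal) (use q_prod_in_span_schur_Q in auto, metis)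
  then show ?thesis
    using odd_monomial_in_q_span[OF assms] by blast
qed


subsection \<open>Linear independence of the normalized characters\<close>

lemma Ch_combination_superset:
  assumes "finite S" "Poly_Mapping.keys c \<subseteq> S"
  shows "Ch_combination \<phi> c = (\<Sum>\<pi> \<in> S. fscale (Poly_Mapping.lookup c \<pi>) (Ch \<phi> \<pi>))"
  unfolding Ch_combination_def
  by (rule sum.mono_neutral_left) (use assms in \<open>auto simp: in_keys_iff fscale_def fun_eq_iff\<close>)

lemma Ch_combination_add: "Ch_combination \<phi> (x + y) = Ch_combination \<phi> x + Ch_combination \<phi> y"
proof -
  let ?S = "Poly_Mapping.keys x \<union> Poly_Mapping.keys y"
  have "Ch_combination \<phi> (x + y) = (\<Sum>\<pi> \<in> ?S. fscale (Poly_Mapping.lookup (x + y) \<pi>) (Ch \<phi> \<pi>))"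
    by (rule Ch_combination_superset) (use keys_add[of x y] in auto)
  also have "\<dots> = Ch_combination \<phi> x + Ch_combination \<phi> y"
    by (subst (1 2) Ch_combination_superset[of ?S])
      (auto simp: lookup_add fun_vs.scale_left_distrib sum.distrib)
  finally show ?thesis .
qed

lemma Ch_combination_pscale: "Ch_combination \<phi> (pscale c x) = fscale c (Ch_combination \<phi> x)"
proof -
  have "Poly_Mapping.keys (pscale c x) \<subseteq> Poly_Mapping.keys x"
    by (auto simp: in_keys_iff)
  then show ?thesis
    by (subst Ch_combination_superset[of "Poly_Mapping.keys x"])
      (simp_all add: Ch_combination_def fun_vs.scale_sum_right)
qed

lemma Ch_combination_zero [simp]: "Ch_combination \<phi> 0 = 0"
  by (simp add: Ch_combination_def)

lemma Ch_combination_sum: "Ch_combination \<phi> (sum f I) = (\<Sum>i \<in> I. Ch_combination \<phi> (f i))"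
  by (induction I rule: infinite_finite_induct) (simp_all add: Ch_combination_add)

lemma Ch_combination_diff: "Ch_combination \<phi> (x - y) = Ch_combination \<phi> x - Ch_combination \<phi> y"
  using Ch_combination_add[of \<phi> "x - y" y] by simp

lemma Ch_combination_single: "Ch_combination \<phi> (Poly_Mapping.single \<pi> c) = fscale c (Ch \<phi> \<pi>)"
  by (cases "c = 0") (simp_all add: Ch_combination_def)

lemma Ch_combination_apply:
  "Ch_combination \<phi> x \<xi> = (\<Sum>\<pi> \<in> Poly_Mapping.keys x. Poly_Mapping.lookup x \<pi> * Ch \<phi> \<pi> \<xi>)"
  unfolding Ch_combination_def by (induction rule: infinite_finite_induct) (simp_all add: fscale_def)

definition odd_poly :: "mpoly \<Rightarrow> bool" where
  "odd_poly x \<longleftrightarrow> (\<forall>\<pi> \<in> Poly_Mapping.keys x. odd_partition \<pi>)"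

lemma odd_size_parity: "odd_partition \<pi> \<Longrightarrow> even (sum_mset \<pi> + size \<pi>)"
  by (induction \<pi>) (auto simp: odd_partition_def)

text \<open>The numbers \<open>l\<close> define a linear functional on the polynomials of degree n.
  It is zero on the Q-functions, and every odd monomial of that degree lies in their span.\<close>

lemma odd_functional_eq_0:
  assumes zero: "\<And>\<xi>. sp_size \<xi> = n \<Longrightarrow>
      (\<Sum>\<pi> \<in> {\<pi>. odd_partition \<pi> \<and> sum_mset \<pi> = n}. Poly_Mapping.lookup (schur_Q \<xi>) \<pi> * l \<pi>) = 0"
    and "odd_partition \<pi>" "sum_mset \<pi> = n"
  shows "l \<pi> = 0"
proof -
  let ?S = "{\<pi>. odd_partition \<pi> \<and> sum_mset \<pi> = n}"
  have "(\<Sum>\<sigma> \<in> ?S. Poly_Mapping.lookup x \<sigma> * l \<sigma>) = 0"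
    if "x \<in> pvs.span (schur_Q ` {\<xi>. sp_size \<xi> = n})" for x
    using that
  proof (induction rule: pvs.span_induct_alt)
    case (step c x y)
    then obtain \<xi> where "x = schur_Q \<xi>" "sp_size \<xi> = n"
      by auto
    with step zero[of \<xi>] show ?case
      by (simp add: lookup_add distrib_right sum.distrib mult.assoc sum_distrib_left[symmetric])
  qed simp
  from this[of "mono \<pi>"] have "(\<Sum>\<sigma> \<in> ?S. Poly_Mapping.lookup (mono \<pi>) \<sigma> * l \<sigma>) = 0"
    using odd_monomial_in_span_schur_Q assms(2,3) by blast
  also have "(\<Sum>\<sigma> \<in> ?S. Poly_Mapping.lookup (mono \<pi>) \<sigma> * l \<sigma>) = l \<pi>"
    using assms(2,3) finite_odd_partitions[of n]
    by (simp add: lookup_single when_def if_distrib[where f = "\<lambda>x. x * _"] cong: if_cong)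
  finally show ?thesis .
qed

lemma cycle_elt_ones: "cycle_elt (replicate_mset n 1) = \<one>\<^bsub>spin_group n\<^esub>"
proof -
  have "block_word m (replicate k 1) = []" for m k
    by (induction k arbitrary: m) simp_all
  moreover have "sorted_list_of_multiset (replicate_mset n (1 :: nat)) = replicate n 1"
    by (induction n) (simp_all add: insort_is_Cons)
  ultimately show ?thesis
    by (simp add: cycle_elt_def spin_group_def)
qed

lemma cycle_elt_in_conj_class_plus:
  assumes "cycle_elt \<pi> \<in> carrier (spin_group (sum_mset \<pi>))"
  shows "cycle_elt \<pi> \<in> conj_class_plus \<pi>"
proof -
  interpret group "spin_group (sum_mset \<pi>)"
    by (rule group_spin_group)
  show ?thesis
    unfolding conj_class_plus_def Let_def
    using assms by (intro CollectI exI[of _ "\<one>\<^bsub>spin_group (sum_mset \<pi>)\<^esub>"]) simp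
qed

lemma obtain_spin_representation:
  assumes "schur_spin_characters \<phi>"
  obtains d \<rho> where "irreducible_spin_rep (sp_size \<xi>) d \<rho>"
    "\<And>\<pi> g. odd_partition \<pi> \<Longrightarrow> sum_mset \<pi> = sp_size \<xi> \<Longrightarrow> g \<in> conj_class_plus \<pi> \<Longrightarrow> \<phi> \<xi> \<pi> = mat_trace (\<rho> g)"
proof -
  have "\<exists>d \<rho>. irreducible_spin_rep (sp_size \<xi>) d \<rho> \<and>
      (\<forall>\<pi>. odd_partition \<pi> \<and> sum_mset \<pi> = sp_size \<xi> \<longrightarrow> (\<forall>g \<in> conj_class_plus \<pi>. \<phi> \<xi> \<pi> = mat_trace (\<rho> g)))"
    by (rule conjunct1[OF spec[OF iffD1[OF schur_spin_characters_def assms]]])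
  then show thesis
    using that by blast
qed

lemma lookup_schur_Q:
  assumes "schur_spin_characters \<phi>" "odd_partition \<pi>" "sum_mset \<pi> = sp_size \<xi>"
  shows "Poly_Mapping.lookup (schur_Q \<xi>) \<pi> =
    2 ^ ((sp_length \<xi> + size \<pi> + (sp_size \<xi> - sp_length \<xi>) mod 2) div 2) * \<phi> \<xi> \<pi> / of_nat (z_factor \<pi>)"
proof -
  have "\<forall>\<pi>. odd_partition \<pi> \<and> sum_mset \<pi> = sp_size \<xi> \<longrightarrow> Poly_Mapping.lookup (schur_Q \<xi>) \<pi> =
      2 ^ ((sp_length \<xi> + size \<pi> + (sp_size \<xi> - sp_length \<xi>) mod 2) div 2) * \<phi> \<xi> \<pi> / of_nat (z_factor \<pi>)"
    by (rule conjunct2[OF spec[OF iffD1[OF schur_spin_characters_def assms(1)]]])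
  then show ?thesis
    using assms(2,3) by (elim allE[of _ \<pi>]) (rule mp, assumption, rule conjI)
qed

text \<open>The value at the identity is the dimension of the representation, so the quotient in
  \<open>Ch\<close> never has denominator 0.\<close>

lemma spin_character_ones_nonzero:
  assumes "schur_spin_characters \<phi>"
  shows "\<phi> \<xi> (replicate_mset (sp_size \<xi>) 1) \<noteq> 0"
proof -
  let ?n = "sp_size \<xi>"
  obtain d \<rho> where \<rho>: "irreducible_spin_rep ?n d \<rho>"
    and tr: "\<And>\<pi> g. odd_partition \<pi> \<Longrightarrow> sum_mset \<pi> = ?n \<Longrightarrow> g \<in> conj_class_plus \<pi> \<Longrightarrow> \<phi> \<xi> \<pi> = mat_trace (\<rho> g)"
    by (rule obtain_spin_representation[OF assms, of \<xi>]) blast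
  interpret group "spin_group ?n"
    by (rule group_spin_group)
  have "\<one>\<^bsub>spin_group ?n\<^esub> \<in> conj_class_plus (replicate_mset ?n 1)"
    using cycle_elt_in_conj_class_plus[of "replicate_mset ?n 1"] by (simp add: cycle_elt_ones del: One_nat_def)
  then have "\<phi> \<xi> (replicate_mset ?n 1) = mat_trace (\<rho> \<one>\<^bsub>spin_group ?n\<^esub>)"
    by (intro tr) (auto simp: odd_partition_def)
  also have "\<dots> = of_nat d"
    using \<rho> by (simp add: irreducible_spin_rep_def irreducible_rep_def matrix_rep_def mat_trace_def)
  finally show ?thesis
    using \<rho> by (simp add: irreducible_spin_rep_def irreducible_rep_def)
qed

text \<open>For the least size n of a partition occurring in x, evaluation at strict partitions of n
  annihilates all larger \<open>Ch\<close>. Up to factors that depend on \<xi> alone or on the odd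
  partition alone, the rest is a linear functional of the coefficients of the Q-function of
  \<xi>.\<close>

lemma Ch_combination_inj_aux:
  assumes \<phi>: "schur_spin_characters \<phi>" and x: "odd_poly x" and zero: "Ch_combination \<phi> x = 0"
  shows "x = 0"
proof (rule ccontr)
  assume "x \<noteq> 0"
  then have "Poly_Mapping.keys x \<noteq> {}"
    by (metis keys_eq_empty)
  define n where "n = (LEAST n. \<exists>\<pi> \<in> Poly_Mapping.keys x. sum_mset \<pi> = n)"
  have "\<exists>\<pi> \<in> Poly_Mapping.keys x. sum_mset \<pi> = n"
    unfolding n_def by (rule LeastI_ex) (use \<open>Poly_Mapping.keys x \<noteq> {}\<close> in blast)
  then obtain \<pi> where \<pi>: "\<pi> \<in> Poly_Mapping.keys x" "sum_mset \<pi> = n"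
    by blast
  have least: "sum_mset \<sigma> \<ge> n" if "\<sigma> \<in> Poly_Mapping.keys x" for \<sigma>
    unfolding n_def by (rule Least_le) (use that in blast)
  let ?S = "{\<pi>. odd_partition \<pi> \<and> sum_mset \<pi> = n}"
  \<comment> \<open>Besides the coefficient of x, \<open>l\<close> collects those factors between
    \<open>Ch\<close> and a coefficient of Q that depend on \<sigma>; \<open>c\<close> below
    collects those that depend on \<xi>.\<close>
  define l where "l = (\<lambda>\<sigma>. Poly_Mapping.lookup x \<sigma> * 2 ^ ((n - size \<sigma>) div 2) *
      of_nat (z_factor \<sigma>) / 2 ^ (size \<sigma> div 2))"
  have "(\<Sum>\<sigma> \<in> ?S. Poly_Mapping.lookup (schur_Q \<xi>) \<sigma> * l \<sigma>) = 0" if \<xi>: "sp_size \<xi> = n" for \<xi>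
  proof -
    define a where "a = sp_length \<xi> + (n - sp_length \<xi>) mod 2"
    define c :: complex where "c = 2 ^ (a div 2 + n mod 2) * \<phi> \<xi> (replicate_mset n 1) / of_nat (\<Prod>i < n. n - i)"
    have len: "sp_length \<xi> \<le> n"
    proof -
      have *: "length xs \<le> sum_list xs" if "0 \<notin> set xs" for xs :: "nat list"
        using that by (induction xs) auto
      show ?thesis
        using *[of "parts \<xi>"] parts[of \<xi>] \<xi> unfolding sp_length_def sp_size_def by blast
    qed
    obtain r where r: "n = sp_length \<xi> + r"
      using len le_Suc_ex by blast
    have a: "even (a + n)"
      unfolding a_def by (simp add: r)
    have Q: "Poly_Mapping.lookup (schur_Q \<xi>) \<sigma> * l \<sigma> = c * (Poly_Mapping.lookup x \<sigma> * Ch \<phi> \<sigma> \<xi>)"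
      if \<sigma>: "odd_partition \<sigma>" "sum_mset \<sigma> = n" for \<sigma>
    proof -
      have "sp_length \<xi> + size \<sigma> + (n - sp_length \<xi>) mod 2 = a + size \<sigma>"
        by (simp add: a_def)
      \<comment> \<open>Both a and the length of \<sigma> have the parity of n. If n is odd, halving
        them separately loses 1, which n mod 2 restores.\<close>
      also have "(a + size \<sigma>) div 2 = a div 2 + n mod 2 + size \<sigma> div 2"
      proof -
        have "even (size \<sigma>) = even n"
          using odd_size_parity[OF \<sigma>(1)] \<sigma>(2) by simp
        then show ?thesis
          using a by (cases "even n") (auto elim!: evenE oddE)
      qed
      finally have "(sp_length \<xi> + size \<sigma> + (n - sp_length \<xi>) mod 2) div 2 = a div 2 + n mod 2 + size \<sigma> div 2" .
      then have q1: "Poly_Mapping.lookup (schur_Q \<xi>) \<sigma> =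
          2 ^ (a div 2 + n mod 2 + size \<sigma> div 2) * \<phi> \<xi> \<sigma> / of_nat (z_factor \<sigma>)"
        using lookup_schur_Q[OF \<phi> \<sigma>(1), of \<xi>] \<sigma>(2) \<xi> by simp
      have c1: "Ch \<phi> \<sigma> \<xi> = of_nat (\<Prod>i < n. n - i) * 2 ^ ((n - size \<sigma>) div 2) *
          \<phi> \<xi> \<sigma> / \<phi> \<xi> (replicate_mset n 1)"
        using \<sigma> \<xi> by (simp add: Ch_def Let_def)
      have "of_nat (\<Prod>i < n. n - i) \<noteq> (0 :: complex)"
        by simp
      moreover have "of_nat (z_factor \<sigma>) \<noteq> (0 :: complex)"
        using z_factor_pos[OF \<sigma>(1)] by simp
      moreover have "\<phi> \<xi> (replicate_mset n 1) \<noteq> 0"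
        using spin_character_ones_nonzero[OF \<phi>, of \<xi>] \<xi> by simp
      ultimately show ?thesis
        unfolding l_def c_def q1 c1 by (simp add: power_add field_simps del: of_nat_prod prod_zero_iff of_nat_eq_0_iff)
    qed
    have "(\<Sum>\<sigma> \<in> ?S. Poly_Mapping.lookup (schur_Q \<xi>) \<sigma> * l \<sigma>)
        = c * (\<Sum>\<sigma> \<in> ?S. Poly_Mapping.lookup x \<sigma> * Ch \<phi> \<sigma> \<xi>)"
      by (simp add: Q sum_distrib_left)
    also have "(\<Sum>\<sigma> \<in> ?S. Poly_Mapping.lookup x \<sigma> * Ch \<phi> \<sigma> \<xi>) = Ch_combination \<phi> x \<xi>"
    proof -
      have "(\<Sum>\<sigma> \<in> ?S. Poly_Mapping.lookup x \<sigma> * Ch \<phi> \<sigma> \<xi>)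
          = (\<Sum>\<sigma> \<in> Poly_Mapping.keys x \<inter> ?S. Poly_Mapping.lookup x \<sigma> * Ch \<phi> \<sigma> \<xi>)"
        by (rule sum.mono_neutral_right) (auto simp: finite_odd_partitions in_keys_iff)
      also have "\<dots> = Ch_combination \<phi> x \<xi>"
        unfolding Ch_combination_apply
      proof (rule sum.mono_neutral_left)
        show "\<forall>\<sigma> \<in> Poly_Mapping.keys x - Poly_Mapping.keys x \<inter> ?S. Poly_Mapping.lookup x \<sigma> * Ch \<phi> \<sigma> \<xi> = 0"
          using x least \<xi> by (auto simp: odd_poly_def Ch_def Let_def dest: le_antisym)
      qed auto
      finally show ?thesis .
    qed
    finally show ?thesis
      by (simp add: zero)
  qed
  then have "l \<pi> = 0"
    by (rule odd_functional_eq_0) (use \<pi> x in \<open>auto simp: odd_poly_def\<close>)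
  then show False
    using \<pi> x z_factor_pos[of \<pi>] by (auto simp: l_def odd_poly_def in_keys_iff)
qed

lemma odd_poly_add: "odd_poly x \<Longrightarrow> odd_poly y \<Longrightarrow> odd_poly (x + y)"
  using keys_add[of x y] by (auto simp: odd_poly_def)

lemma odd_poly_minus: "odd_poly x \<Longrightarrow> odd_poly (- x)"
  by (simp add: odd_poly_def in_keys_iff)

lemma odd_poly_mult: "odd_poly x \<Longrightarrow> odd_poly y \<Longrightarrow> odd_poly (x * y)"
  using keys_mult[of x y] by (fastforce simp: odd_poly_def odd_partition_def)

lemma Ch_combination_inj:
  assumes "schur_spin_characters \<phi>" "odd_poly x" "odd_poly y" "Ch_combination \<phi> x = Ch_combination \<phi> y"
  shows "x = y"
  using Ch_combination_inj_aux[OF assms(1), of "x + - y"] assms(2-)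
  by (simp add: odd_poly_add odd_poly_minus Ch_combination_diff del: add_uminus_conv_diff)
    (simp add: Ch_combination_diff)

lemma Ch_coeffs_Ch_combination:
  assumes "schur_spin_characters \<phi>" "odd_poly x"
  shows "Ch_coeffs \<phi> (Ch_combination \<phi> x) = x"
  unfolding Ch_coeffs_def
  by (rule the_equality) (use assms Ch_combination_inj[OF assms(1)] in \<open>auto simp: odd_poly_def\<close>)

lemma disjoint_product_Ch_combination:
  assumes "schur_spin_characters \<phi>" "odd_poly x" "odd_poly y"
  shows "disjoint_product \<phi> (Ch_combination \<phi> x) (Ch_combination \<phi> y) = Ch_combination \<phi> (x * y)"
  by (simp add: disjoint_product_def Ch_coeffs_Ch_combination assms)

subsection \<open>Signed transpositions and cycles\<close>

lemma transpose_neq_iff: "transpose a b x = transpose a b y \<longleftrightarrow> x = y"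
  by (metis transpose_involutory)

text \<open>Axioms for signed transpositions on a set of labels. The lifts are oriented,
  \<open>T b a = z * T a b\<close>; this lets conjugation by \<open>T a b\<close> relabel the points
  at the cost of exactly one z in every case. All signs of cycles below follow from these
  rules.\<close>

locale spin_system =
  fixes V :: "'l set" and T :: "'l \<Rightarrow> 'l \<Rightarrow> 'g :: monoid_mult" and z :: 'g
  assumes zz: "z * z = 1"
    and T_z: "a \<in> V \<Longrightarrow> b \<in> V \<Longrightarrow> a \<noteq> b \<Longrightarrow> T a b * z = z * T a b"
    and TT: "a \<in> V \<Longrightarrow> b \<in> V \<Longrightarrow> a \<noteq> b \<Longrightarrow> T a b * T a b = z"
    and T_swap: "a \<in> V \<Longrightarrow> b \<in> V \<Longrightarrow> a \<noteq> b \<Longrightarrow> T b a = z * T a b"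
    and T_conj: "a \<in> V \<Longrightarrow> b \<in> V \<Longrightarrow> a \<noteq> b \<Longrightarrow> c \<in> V \<Longrightarrow> d \<in> V \<Longrightarrow> c \<noteq> d \<Longrightarrow>
      T a b * T c d = z * T (transpose a b c) (transpose a b d) * T a b"
begin

lemma z_power_even: "even k \<Longrightarrow> z ^ k = 1"
  by (auto elim!: evenE simp: power_mult power2_eq_square zz)

lemma z_power_cong: "even i = even j \<Longrightarrow> z ^ i = z ^ j"
  by (cases "even i") (auto elim!: oddE simp: z_power_even)

lemma z_power_mult_assoc: "z ^ i * (z ^ j * x) = z ^ (i + j) * x"
  by (simp add: power_add mult.assoc)

lemma T_z_power: "a \<in> V \<Longrightarrow> b \<in> V \<Longrightarrow> a \<noteq> b \<Longrightarrow> T a b * z ^ k = z ^ k * T a b"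
  by (rule power_commuting_commutes[symmetric]) (simp add: T_z)

lemma T_z_power_assoc: "a \<in> V \<Longrightarrow> b \<in> V \<Longrightarrow> a \<noteq> b \<Longrightarrow> T a b * (z ^ k * x) = z ^ k * (T a b * x)"
  using arg_cong[OF T_z_power[of a b k], of "\<lambda>w. w * x"] by (simp add: mult.assoc)

text \<open>On consecutive points this becomes a block t_a t_(a+1) ... as in the classes C^+. Empty
  lists and single points give 1, so fixed points may be listed or left out.\<close>

fun cyc :: "'l list \<Rightarrow> 'g" where
  "cyc (x # y # p) = T x y * cyc (y # p)"
| "cyc _ = 1"

lemma cyc_z_power: "set c \<subseteq> V \<Longrightarrow> distinct c \<Longrightarrow> cyc c * z ^ k = z ^ k * cyc c"
proof (induction c rule: cyc.induct)
  case (1 x y p)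
  then show ?case
    by (simp add: T_z_power_assoc mult.assoc)
qed simp_all

lemma cyc_append: "cyc (xs @ y # ys) = cyc (xs @ [y]) * cyc (y # ys)"
proof (induction xs)
  case (Cons x xs)
  then show ?case
    by (cases xs) (simp_all add: mult.assoc)
qed simp

lemma T_conj_cyc:
  assumes "a \<in> V" "b \<in> V" "a \<noteq> b" "set c \<subseteq> V" "distinct c"
  shows "T a b * cyc c = z ^ (length c - 1) * cyc (map (transpose a b) c) * T a b"
  using assms(4,5)
proof (induction c rule: cyc.induct)
  case (1 x y p)
  have "T a b * cyc (x # y # p) = (T a b * T x y) * cyc (y # p)"
    by (simp add: mult.assoc)
  also have "\<dots> = z * T (transpose a b x) (transpose a b y) * (T a b * cyc (y # p))"
    using 1 assms by (simp add: T_conj mult.assoc)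
  also have "\<dots> = z * (T (transpose a b x) (transpose a b y) * z ^ length p) *
      cyc (map (transpose a b) (y # p)) * T a b"
    using 1 by (simp add: mult.assoc)
  also have "T (transpose a b x) (transpose a b y) * z ^ length p =
      z ^ length p * T (transpose a b x) (transpose a b y)"
  proof (rule T_z_power)
    show "transpose a b x \<in> V" "transpose a b y \<in> V"
      using 1 assms by (auto simp: transpose_def)
    show "transpose a b x \<noteq> transpose a b y"
      using 1 by (auto simp: transpose_neq_iff)
  qed
  finally show ?case
    by (simp add: mult.assoc)
qed simp_all

lemma T_cyc_disjoint:
  assumes "a \<in> V" "b \<in> V" "a \<noteq> b" "set c \<subseteq> V" "distinct c" "a \<notin> set c" "b \<notin> set c"
  shows "T a b * cyc c = z ^ (length c - 1) * cyc c * T a b"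
proof -
  have "map (transpose a b) c = c"
    using assms(6,7) by (intro map_idI) (auto simp: transpose_def)
  then show ?thesis
    using T_conj_cyc[OF assms(1-5)] by simp
qed

text \<open>The lifts of two disjoint transpositions anticommute, and a cycle of length l is a
  product of l - 1 of them. Odd cycles therefore commute with all disjoint cycles.\<close>

lemma cyc_cyc_disjoint:
  assumes "set c \<subseteq> V" "distinct c" "set d \<subseteq> V" "distinct d" "set c \<inter> set d = {}"
  shows "cyc c * cyc d = z ^ ((length c - 1) * (length d - 1)) * cyc d * cyc c"
  using assms(1,2,5)
proof (induction c rule: cyc.induct)
  case (1 x y p)
  define e where "e = length d - 1"
  have "cyc (x # y # p) * cyc d = T x y * (cyc (y # p) * cyc d)"
    by (simp add: mult.assoc)
  also have "\<dots> = T x y * z ^ (length p * e) * cyc d * cyc (y # p)"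
    using 1 by (simp add: mult.assoc e_def)
  also have "\<dots> = z ^ (length p * e) * (T x y * cyc d) * cyc (y # p)"
    using 1 by (simp add: T_z_power_assoc mult.assoc)
  also have "\<dots> = z ^ (length p * e) * (z ^ e * (cyc d * cyc (x # y # p)))"
    using 1 assms T_cyc_disjoint[of x y d] by (simp add: mult.assoc e_def)
  also have "\<dots> = z ^ (Suc (length p) * e) * (cyc d * cyc (x # y # p))"
    by (simp add: z_power_mult_assoc add.commute)
  finally show ?case
    by (simp add: mult.assoc e_def)
qed simp_all

text \<open>The last transposition travels to the left through the cycle. Each passage replaces its
  first point by the preceding one and costs one z.\<close>

lemma cyc_T_last:
  assumes "x \<in> V" "x \<notin> set c" "set c \<subseteq> V" "distinct c" "c \<noteq> []"
  shows "cyc c * T (last c) x = z ^ (length c - 1) * T (hd c) x * cyc c"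
  using assms
proof (induction c rule: cyc.induct)
  case (1 a b p)
  have "cyc (a # b # p) * T (last (a # b # p)) x = T a b * (cyc (b # p) * T (last (b # p)) x)"
    by (simp add: mult.assoc)
  also have "\<dots> = T a b * z ^ length p * T b x * cyc (b # p)"
    using 1 by (simp add: mult.assoc)
  also have "\<dots> = z ^ length p * (T a b * T b x) * cyc (b # p)"
    using 1 by (simp add: T_z_power_assoc mult.assoc)
  also have "T a b * T b x = z * T a x * T a b"
    using 1 T_conj[of a b b x] by (auto simp: transpose_def)
  finally show ?case
    using z_power_mult_assoc[of "length p" 1] by (simp add: mult.assoc)
qed simp_all

text \<open>One z is due to the orientation of the transposition that closes the cycle, the others
  to moving it to the front. For a cycle of odd length they cancel.\<close>

lemma cyc_rotate1:
  assumes "set (x # xs) \<subseteq> V" "distinct (x # xs)"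
  shows "cyc (xs @ [x]) = z ^ length xs * cyc (x # xs)"
proof (cases xs)
  case (Cons y ys)
  have xs: "xs = butlast xs @ [last xs]"
    using Cons by simp
  have "cyc (xs @ [x]) = cyc (butlast xs @ last xs # [x])"
    by (subst xs) simp
  also have "\<dots> = cyc xs * T (last xs) x"
    unfolding cyc_append[of "butlast xs" "last xs" "[x]"] by (simp flip: xs)
  also have "\<dots> = z ^ length ys * T y x * cyc xs"
    using cyc_T_last[of x xs] assms Cons by simp
  also have "T y x = z * T x y"
    using assms Cons by (intro T_swap) auto
  finally show ?thesis
    using z_power_mult_assoc[of "length ys" 1] by (simp add: Cons mult.assoc)
qed simp

lemma cyc_rotate:
  assumes "set (a @ b) \<subseteq> V" "distinct (a @ b)"
  shows "cyc (b @ a) = z ^ (length a * (length (a @ b) - 1)) * cyc (a @ b)"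
  using assms
proof (induction a arbitrary: b)
  case (Cons x a)
  have "cyc (b @ x # a) = z ^ (length a * (length (a @ b @ [x]) - 1)) * cyc (a @ b @ [x])"
    using Cons.IH[of "b @ [x]"] Cons.prems by auto
  also have "cyc (a @ b @ [x]) = z ^ length (a @ b) * cyc (x # a @ b)"
    using cyc_rotate1[of x "a @ b"] Cons.prems by auto
  finally show ?case
    by (simp add: z_power_mult_assoc algebra_simps)
qed simp

text \<open>In the symmetric group (x y)(y A x B) = (x B)(y A). The sign arises from rotating x to
  the front of y A x, from the square of \<open>T x y\<close>, and from exchanging the two
  cycles.\<close>

lemma T_cyc_cut:
  assumes "set (y # A @ x # B) \<subseteq> V" "distinct (y # A @ x # B)"
  shows "T x y * cyc (y # A @ x # B) = z ^ (length A * (1 + length B)) * cyc (x # B) * cyc (y # A)"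
proof -
  have xy: "x \<in> V" "y \<in> V" "x \<noteq> y"
    using assms by auto
  have "T x y * cyc (y # A @ x # B) = T x y * cyc ((y # A) @ [x]) * cyc (x # B)"
    using cyc_append[of "y # A" x B] by (simp add: mult.assoc)
  also have "cyc ((y # A) @ [x]) = z ^ (length A + 1) * (T x y * cyc (y # A))"
    using assms by (subst cyc_rotate1) auto
  also have "T x y * (z ^ (length A + 1) * (T x y * cyc (y # A))) * cyc (x # B)
      = z ^ (length A + 1) * (T x y * T x y) * (cyc (y # A) * cyc (x # B))"
    by (simp only: mult.assoc[symmetric] T_z_power[OF xy])
  also have "\<dots> = z ^ (length A + 2) * (cyc (y # A) * cyc (x # B))"
    using z_power_mult_assoc[of "length A + 1" 1] by (simp add: TT[OF xy] mult.assoc)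
  also have "cyc (y # A) * cyc (x # B) = z ^ (length A * length B) * cyc (x # B) * cyc (y # A)"
    using assms by (subst cyc_cyc_disjoint) auto
  also have "z ^ (length A + 2) * (z ^ (length A * length B) * cyc (x # B) * cyc (y # A)) =
      z ^ (length A + 2 + length A * length B) * cyc (x # B) * cyc (y # A)"
    by (simp add: power_add mult.assoc)
  also have "z ^ (length A + 2 + length A * length B) = z ^ (length A * (1 + length B))"
    by (rule z_power_cong) simp
  finally show ?thesis .
qed

text \<open>The converse of cutting: (x y)(y A)(x B) = (x B y A). The sign collects two rotations,
  and its exponent is reduced modulo 2 at the end.\<close>

lemma T_cyc_join:
  assumes "set (y # A @ x # B) \<subseteq> V" "distinct (y # A @ x # B)"
  shows "T x y * (cyc (y # A) * cyc (x # B)) = z ^ ((length A + 1) * length B) * cyc (x # B @ y # A)"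
proof -
  have "cyc ((y # A) @ [x]) = z ^ (length A + 1) * (T x y * cyc (y # A))"
    using assms by (subst cyc_rotate1) auto
  then have "z ^ (length A + 1) * cyc ((y # A) @ [x]) = z ^ ((length A + 1) + (length A + 1)) * (T x y * cyc (y # A))"
    by (simp only: z_power_mult_assoc)
  also have "z ^ ((length A + 1) + (length A + 1)) = 1"
    by (rule z_power_even) simp
  finally have "T x y * cyc (y # A) = z ^ (length A + 1) * cyc ((y # A) @ [x])"
    by simp
  then have "T x y * (cyc (y # A) * cyc (x # B)) = z ^ (length A + 1) * (cyc ((y # A) @ [x]) * cyc (x # B))"
    by (simp add: mult.assoc[symmetric])
  also have "cyc ((y # A) @ [x]) * cyc (x # B) = cyc ((y # A) @ (x # B))"
    using cyc_append[of "y # A" x B] by simp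
  also have "\<dots> = z ^ ((length B + 1) * (length B + length A + 1)) * cyc (x # B @ y # A)"
    using assms by (subst cyc_rotate) (auto simp: add.assoc)
  also have "z ^ (length A + 1) * (z ^ ((length B + 1) * (length B + length A + 1)) * cyc (x # B @ y # A))
     = z ^ (length A + 1 + (length B + 1) * (length B + length A + 1)) * cyc (x # B @ y # A)"
    by (rule z_power_mult_assoc)
  also have "z ^ (length A + 1 + (length B + 1) * (length B + length A + 1)) = z ^ ((length A + 1) * length B)"
    by (rule z_power_cong) auto
  finally show ?thesis .
qed

definition lift :: "'l list list \<Rightarrow> 'g" where
  "lift \<gamma> = prod_list (map cyc \<gamma>)"

lemma lift_simps [simp]:
  "lift [] = 1" "lift (c # \<gamma>) = cyc c * lift \<gamma>" "lift (\<gamma> @ \<delta>) = lift \<gamma> * lift \<delta>"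
  by (simp_all add: lift_def)

lemma lift_z_power: "set (concat \<gamma>) \<subseteq> V \<Longrightarrow> distinct (concat \<gamma>) \<Longrightarrow> lift \<gamma> * z ^ k = z ^ k * lift \<gamma>"
proof (induction \<gamma>)
  case (Cons c \<gamma>)
  then show ?case
    using arg_cong[OF cyc_z_power[of c k], of "\<lambda>w. w * lift \<gamma>"] by (simp add: mult.assoc)
qed simp

lemma lift_cyc_commute:
  assumes "set (concat \<gamma>) \<subseteq> V" "distinct (concat \<gamma>)" "set c \<subseteq> V" "distinct c"
    "set c \<inter> set (concat \<gamma>) = {}"
  shows "lift \<gamma> * cyc c = z ^ ((length c - 1) * (\<Sum>d \<leftarrow> \<gamma>. length d - 1)) * cyc c * lift \<gamma>"
  using assms(1,2,5)
proof (induction \<gamma>)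
  case (Cons d \<gamma>)
  let ?s = "\<Sum>d \<leftarrow> \<gamma>. length d - 1"
  have "lift (d # \<gamma>) * cyc c = cyc d * (lift \<gamma> * cyc c)"
    by (simp add: mult.assoc)
  also have "lift \<gamma> * cyc c = z ^ ((length c - 1) * ?s) * cyc c * lift \<gamma>"
    using Cons by auto
  also have "cyc d * (z ^ ((length c - 1) * ?s) * cyc c * lift \<gamma>)
      = (cyc d * z ^ ((length c - 1) * ?s)) * cyc c * lift \<gamma>"
    by (simp add: mult.assoc)
  also have "cyc d * z ^ ((length c - 1) * ?s) = z ^ ((length c - 1) * ?s) * cyc d"
    using Cons.prems by (intro cyc_z_power) auto
  also have "\<dots> * cyc c * lift \<gamma> = z ^ ((length c - 1) * ?s) * (cyc d * cyc c) * lift \<gamma>"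
    by (simp add: mult.assoc)
  also have "cyc d * cyc c = z ^ ((length d - 1) * (length c - 1)) * cyc c * cyc d"
    using Cons.prems assms by (intro cyc_cyc_disjoint) auto
  finally show ?case
    by (simp add: mult.assoc z_power_mult_assoc algebra_simps)
qed simp

lemma lift_move_front:
  assumes "set (concat (\<gamma> @ c # \<delta>)) \<subseteq> V" "distinct (concat (\<gamma> @ c # \<delta>))"
  shows "lift (\<gamma> @ c # \<delta>) = z ^ ((length c - 1) * (\<Sum>d \<leftarrow> \<gamma>. length d - 1)) * lift (c # \<gamma> @ \<delta>)"
proof -
  have "lift (\<gamma> @ c # \<delta>) = (lift \<gamma> * cyc c) * lift \<delta>"
    by (simp add: mult.assoc)
  also have "lift \<gamma> * cyc c = z ^ ((length c - 1) * (\<Sum>d \<leftarrow> \<gamma>. length d - 1)) * cyc c * lift \<gamma>"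
    by (rule lift_cyc_commute) (use assms in auto)
  finally show ?thesis
    by (simp add: mult.assoc)
qed

lemma T_lift_conj:
  assumes "a \<in> V" "b \<in> V" "a \<noteq> b" "set (concat \<gamma>) \<subseteq> V" "distinct (concat \<gamma>)"
  shows "T a b * lift \<gamma> = z ^ (\<Sum>d \<leftarrow> \<gamma>. length d - 1) * lift (map (map (transpose a b)) \<gamma>) * T a b"
  using assms(4,5)
proof (induction \<gamma>)
  case (Cons d \<gamma>)
  let ?s = "\<Sum>d \<leftarrow> \<gamma>. length d - 1"
  let ?m = "map (transpose a b)"
  have "T a b * lift (d # \<gamma>) = (T a b * cyc d) * lift \<gamma>"
    by (simp add: mult.assoc)
  also have "T a b * cyc d = z ^ (length d - 1) * cyc (?m d) * T a b"
    using Cons.prems assms by (intro T_conj_cyc) auto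
  also have "\<dots> * lift \<gamma> = z ^ (length d - 1) * cyc (?m d) * (T a b * lift \<gamma>)"
    by (simp add: mult.assoc)
  also have "T a b * lift \<gamma> = z ^ ?s * lift (map ?m \<gamma>) * T a b"
    using Cons by auto
  also have "z ^ (length d - 1) * cyc (?m d) * (z ^ ?s * lift (map ?m \<gamma>) * T a b)
     = z ^ (length d - 1) * (cyc (?m d) * z ^ ?s) * lift (map ?m \<gamma>) * T a b"
    by (simp add: mult.assoc)
  also have "cyc (?m d) * z ^ ?s = z ^ ?s * cyc (?m d)"
  proof (rule cyc_z_power)
    show "set (?m d) \<subseteq> V"
      using Cons.prems assms by (auto simp: transpose_def)
    show "distinct (?m d)"
      using Cons.prems by (auto simp: distinct_map intro: inj_on_subset[OF inj_transpose])
  qed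
  finally show ?case
    by (simp add: mult.assoc z_power_mult_assoc algebra_simps)
qed simp

end


subsection \<open>Signed transpositions in the spin group\<close>

locale spin_generators =
  fixes n :: nat and t :: "nat \<Rightarrow> 'g :: monoid_mult" and z :: 'g
  assumes zz: "z * z = 1"
    and zt: "i \<in> {1..<n} \<Longrightarrow> t i * z = z * t i"
    and tt: "i \<in> {1..<n} \<Longrightarrow> t i * t i = z"
    and braid: "i \<in> {1..<n} \<Longrightarrow> Suc i \<in> {1..<n} \<Longrightarrow> (t i * t (Suc i)) ^ 3 = z"
    and far: "i \<in> {1..<n} \<Longrightarrow> j \<in> {1..<n} \<Longrightarrow> i + 2 \<le> j \<or> j + 2 \<le> i \<Longrightarrow> t i * t j = z * t j * t i"
begin

lemma zz_assoc: "z * (z * x) = x"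
  by (simp add: zz flip: mult.assoc)

lemma zt_assoc: "i \<in> {1..<n} \<Longrightarrow> t i * (z * x) = z * (t i * x)"
  by (simp add: zt flip: mult.assoc)

lemma tt_assoc: "i \<in> {1..<n} \<Longrightarrow> t i * (t i * x) = z * x"
  by (simp add: tt flip: mult.assoc)

lemma far_assoc:
  assumes "i \<in> {1..<n}" "j \<in> {1..<n}" "i + 2 \<le> j \<or> j + 2 \<le> i"
  shows "t i * t j = z * (t j * t i)"
  using far[OF assms] by (simp add: mult.assoc)

lemma braid_relation:
  assumes "i \<in> {1..<n}" "Suc i \<in> {1..<n}"
  shows "t i * (t (Suc i) * t i) = t (Suc i) * (t i * t (Suc i))"
proof -
  let ?x = "t i" and ?y = "t (Suc i)"
  have "?x * (?y * (?x * (?y * (?x * ?y)))) = z"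
    using braid[OF assms] by (simp add: power3_eq_cube mult.assoc)
  from arg_cong[OF this, of "\<lambda>w. w * (?y * (?x * ?y))"]
  have "z * (?x * (?y * ?x)) = z * (?y * (?x * ?y))"
    using assms by (simp add: mult.assoc tt_assoc zt_assoc zz_assoc zt zz tt)
  from arg_cong[OF this, of "\<lambda>w. z * w"] show ?thesis
    by (simp only: zz_assoc)
qed

lemma braid_relation_assoc:
  assumes "i \<in> {1..<n}" "Suc i \<in> {1..<n}"
  shows "t i * (t (Suc i) * (t i * x)) = t (Suc i) * (t i * (t (Suc i) * x))"
  using arg_cong[OF braid_relation[OF assms], of "\<lambda>w. w * x"] by (simp only: mult.assoc)

text \<open>A lift of the transposition of a and a + m + 1. Since t_k t_k = z, multiplying by t_k on
  both sides is conjugation by t_k up to a factor z; this is the factor that appears in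
  \<open>T_conj\<close>.\<close>

primrec up :: "nat \<Rightarrow> nat \<Rightarrow> 'g" where
  "up a 0 = t a"
| "up a (Suc m) = t (a + Suc m) * (up a m * t (a + Suc m))"

definition T :: "nat \<Rightarrow> nat \<Rightarrow> 'g" where
  "T a b = (if a < b then up a (b - Suc a) else z * up b (a - Suc b))"

lemma up_z: "a \<ge> 1 \<Longrightarrow> a + m < n \<Longrightarrow> up a m * z = z * up a m"
proof (induction m)
  case (Suc m)
  then have "up a m * z = z * up a m" and u: "a + Suc m \<in> {1..<n}"
    by auto
  from arg_cong[OF this(1), of "\<lambda>w. w * t (a + Suc m)"]
  have "up a m * (z * t (a + Suc m)) = z * (up a m * t (a + Suc m))"
    by (simp only: mult.assoc)
  then show ?case
    using u by (simp add: mult.assoc zt zt_assoc)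
qed (simp add: zt)

lemma up_up: "a \<ge> 1 \<Longrightarrow> a + m < n \<Longrightarrow> up a m * up a m = z"
proof (induction m)
  case (Suc m)
  let ?u = "t (a + Suc m)"
  have u: "a + Suc m \<in> {1..<n}"
    using Suc by auto
  have "up a (Suc m) * up a (Suc m) = ?u * (up a m * (z * (up a m * ?u)))"
    using u by (simp only: up.simps mult.assoc tt_assoc)
  also have "\<dots> = z * (?u * ((up a m * up a m) * ?u))"
  proof -
    have "up a m * (z * x) = z * (up a m * x)" for x
      using up_z[of a m] Suc.prems by (simp flip: mult.assoc)
    then show ?thesis
      using u by (simp add: mult.assoc zt_assoc)
  qed
  finally show ?case
    using Suc u by (simp add: zt_assoc zz_assoc tt)
qed (simp add: tt)

text \<open>An odd number of generators, 2 m + 1, make up \<open>up a m\<close>, and t_k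
  anticommutes with each of them.\<close>

lemma t_up_far:
  assumes "a \<ge> 1" "a + m < n" "k \<in> {1..<n}" "k + 1 < a \<or> k > a + m + 1"
  shows "t k * up a m = z * (up a m * t k)"
  using assms(2-)
proof (induction m)
  case 0
  then show ?case
    using assms(1) by (auto intro!: far_assoc)
next
  case (Suc m)
  let ?u = "t (a + Suc m)"
  have u: "a + Suc m \<in> {1..<n}"
    using Suc assms(1) by auto
  have ku: "t k * ?u = z * (?u * t k)" "?u * t k = z * (t k * ?u)"
    using Suc assms(1) by (auto intro!: far_assoc simp del: add_Suc_right)
  have IH: "t k * up a m = z * (up a m * t k)"
    using Suc by auto
  have "t k * up a (Suc m) = (t k * ?u) * (up a m * ?u)"
    by (simp add: mult.assoc)
  also have "\<dots> = z * (?u * ((t k * up a m) * ?u))"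
    by (simp only: ku(1) mult.assoc)
  also have "\<dots> = z * (?u * (z * (up a m * (t k * ?u))))"
    by (simp only: IH mult.assoc)
  also have "\<dots> = z * (z * (?u * (up a m * (z * (?u * t k)))))"
    using u by (simp only: zt_assoc ku(1))
  also have "\<dots> = z * (z * (?u * ((up a m * z) * (?u * t k))))"
    by (simp add: mult.assoc)
  also have "\<dots> = z * (up a (Suc m) * t k)"
    using u Suc assms(1) by (simp add: up_z mult.assoc zt_assoc zz_assoc)
  finally show ?case .
qed

lemma t_up_t_far:
  assumes "a \<ge> 1" "a + m < n" "k \<in> {1..<n}" "k + 1 < a \<or> k > a + m + 1"
  shows "t k * (up a m * t k) = up a m"
proof -
  have "t k * (up a m * t k) = (t k * up a m) * t k"
    by (simp add: mult.assoc)
  also have "\<dots> = z * (up a m * z)"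
    using t_up_far[OF assms] assms(3) by (simp add: mult.assoc tt)
  finally show ?thesis
    using assms by (simp add: up_z zz_assoc)
qed

lemma t_up_t_inside:
  assumes "a \<ge> 1" "a + m < n" "a < k" "k < a + m"
  shows "t k * (up a m * t k) = up a m"
  using assms(2-)
proof (induction m)
  case (Suc m)
  let ?u = "t (a + Suc m)"
  have u: "a + Suc m \<in> {1..<n}" and k: "k \<in> {1..<n}"
    using Suc assms(1) by auto
  show ?case
  proof (cases "k = a + m")
    case False
    then have "k < a + m"
      using Suc.prems by simp
    then have ku: "t k * ?u = z * (?u * t k)" "?u * t k = z * (t k * ?u)"
      using u k by (auto intro!: far_assoc simp del: add_Suc_right)
    have "t k * (up a (Suc m) * t k) = (t k * ?u) * (up a m * (?u * t k))"
      by (simp add: mult.assoc)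
    also have "\<dots> = z * (?u * (t k * ((up a m * z) * (t k * ?u))))"
      by (subst ku(2), subst ku(1), simp only: mult.assoc)
    also have "up a m * z = z * up a m"
      using Suc assms(1) by (intro up_z) auto
    also have "z * (?u * (t k * ((z * up a m) * (t k * ?u)))) = ?u * ((t k * (up a m * t k)) * ?u)"
      using u k by (simp add: mult.assoc zt_assoc zz_assoc)
    also have "t k * (up a m * t k) = up a m"
      using Suc False by auto
    finally show ?thesis
      by simp
  next
    \<comment> \<open>Here t_k is also the outermost factor of \<open>up a m\<close>. Two braid
      relations leave t_(k+1) on both sides of \<open>up a m'\<close>, where it disappears.\<close>
    case True
    with Suc.prems obtain m' where m: "m = Suc m'"
      by (cases m) auto
    have ukb: "t k * (?u * (t k * x)) = ?u * (t k * (?u * x))" for x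
      using braid_relation_assoc[of k x] k u True by simp
    have ukb1: "t k * (?u * t k) = ?u * (t k * ?u)"
      using ukb[of 1] by simp
    have uY: "?u * (up a m' * (?u * x)) = up a m' * x" for x
      using t_up_t_far[of a m' "a + Suc m"] u Suc.prems assms(1) m by (simp flip: mult.assoc)
    have "t k * (up a (Suc m) * t k) = t k * (?u * (t k * (up a m' * (t k * (?u * t k)))))"
      by (simp add: m True mult.assoc)
    also have "\<dots> = ?u * (t k * (?u * (up a m' * (?u * (t k * ?u)))))"
      by (simp only: ukb ukb1)
    also have "\<dots> = up a (Suc m)"
      by (simp only: uY) (simp add: m True mult.assoc)
    finally show ?thesis .
  qed
qed simp

text \<open>The base case is the braid relation applied to t_a t_(a+1) t_a t_(a+1) t_a. The later
  conjugating generators are far from t_a.\<close>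

lemma t_up_t_first:
  assumes "a \<ge> 1" "a + Suc m < n"
  shows "t a * (up a (Suc m) * t a) = up (Suc a) m"
  using assms(2)
proof (induction m)
  case 0
  then have a: "a \<in> {1..<n}" "Suc a \<in> {1..<n}"
    using assms(1) by auto
  have "t a * (up a (Suc 0) * t a) = t a * (t (Suc a) * (t a * (t (Suc a) * t a)))"
    by (simp add: mult.assoc)
  also have "\<dots> = t a * (t a * (t (Suc a) * (t a * t a)))"
    by (simp only: braid_relation_assoc[OF a, symmetric])
  also have "\<dots> = t (Suc a)"
    by (simp only: tt_assoc[OF a(1)] tt[OF a(1)] zt[OF a(2)] zz_assoc)
  finally show ?case
    by simp
next
  case (Suc m)
  let ?u = "t (a + Suc (Suc m))"
  have u: "a + Suc (Suc m) \<in> {1..<n}" and a: "a \<in> {1..<n}"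
    using Suc assms(1) by auto
  have au: "t a * ?u = z * (?u * t a)" "?u * t a = z * (t a * ?u)"
    using u a by (auto intro!: far_assoc simp del: add_Suc_right)
  have "t a * (up a (Suc (Suc m)) * t a) = (t a * ?u) * (up a (Suc m) * (?u * t a))"
    by (simp only: up.simps(2)[of a "Suc m"] mult.assoc)
  also have "\<dots> = z * (?u * (t a * ((up a (Suc m) * z) * (t a * ?u))))"
    by (subst au(2), subst au(1), simp only: mult.assoc)
  also have "up a (Suc m) * z = z * up a (Suc m)"
    using Suc assms(1) by (intro up_z) auto
  also have "z * (?u * (t a * ((z * up a (Suc m)) * (t a * ?u)))) = ?u * ((t a * (up a (Suc m) * t a)) * ?u)"
    using u a by (simp only: mult.assoc zt_assoc zz_assoc)
  also have "t a * (up a (Suc m) * t a) = up (Suc a) m"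
    using Suc by auto
  finally show ?case
    by simp
qed

lemma t_T_t_less:
  assumes "k \<in> {1..<n}" "1 \<le> a" "a < b" "b \<le> n"
  shows "t k * (T a b * t k) = T (transpose k (Suc k) a) (transpose k (Suc k) b)"
proof -
  obtain m where m: "b = a + Suc m"
    using assms(3) by (metis less_imp_Suc_add add_Suc_right)
  have T: "T a b = up a m"
    by (simp add: T_def m)
  have am: "a + m < n" "a \<ge> 1"
    using assms m by auto
  \<comment> \<open>The cases tell which of a and b are among k and k + 1. If none is, k lies
    outside the interval from a to b in the first case and strictly inside in the last.\<close>
  consider "k + 1 < a \<or> k > b" | "k = b" | "k = a" "m = 0" | "k + 1 = b" "m > 0" | "k = a" "m > 0"
    | "k + 1 = a" | "a < k" "k < a + m"
    using m by linarith
  then show ?thesis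
  proof cases
    case 1
    then have "transpose k (Suc k) a = a" "transpose k (Suc k) b = b"
      using assms(3) by (auto simp: transpose_def)
    moreover have "t k * (up a m * t k) = up a m"
      using 1 am m by (intro t_up_t_far assms(1)) auto
    ultimately show ?thesis
      by (simp only: T)
  next
    case 2
    have "T a (Suc b) = up a (Suc m)"
      by (simp add: T_def m)
    then have Tb: "T a (Suc b) = up a (Suc m)"
      by (simp add: m)
    have "transpose k (Suc k) a = a" "transpose k (Suc k) b = Suc b"
      using 2 assms(3) by (auto simp: transpose_def)
    then show ?thesis
      unfolding T by (simp only: Tb 2) (simp add: m)
  next
    case 3
    then show ?thesis
      using assms m by (auto simp: T_def tt_assoc tt zt)
  next
    case 4
    then obtain m' where m': "m = Suc m'"
      by (cases m) auto
    have k: "k = a + m"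
      using 4 m by simp
    have "t k * (up a m * t k) = t k * (t k * (up a m' * (t k * t k)))"
      using m' by (simp add: k mult.assoc)
    also have "\<dots> = z * (up a m' * z)"
      using assms(1) by (simp only: tt_assoc tt)
    also have "up a m' * z = z * up a m'"
      using am m' by (intro up_z) auto
    finally show ?thesis
      using 4 m m' by (auto simp: T zz_assoc T_def transpose_def)
  next
    case 5
    then obtain m' where m': "m = Suc m'"
      by (cases m) auto
    have "T (Suc a) b = up (Suc a) m'"
      by (simp add: T_def m m')
    moreover have "transpose k (Suc k) a = Suc a" "transpose k (Suc k) b = b"
      using 5 m m' by (auto simp: transpose_def)
    moreover have "t a * (up a m * t a) = up (Suc a) m'"
      unfolding m' by (rule t_up_t_first) (use am m' in auto)
    ultimately show ?thesis
      unfolding T by (simp only: 5)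
  next
    case 6
    \<comment> \<open>The lower end moves from k + 1 down to k, the converse of
      \<open>t_up_t_first\<close>.\<close>
    have "up (Suc k) m = t k * (up k (Suc m) * t k)"
      using am 6 assms by (intro t_up_t_first[symmetric]) auto
    then have "t k * (up a m * t k) = t k * (t k * (up k (Suc m) * (t k * t k)))"
      using 6 by (simp add: mult.assoc)
    also have "\<dots> = z * (up k (Suc m) * z)"
      using assms(1) by (simp only: tt_assoc tt)
    also have "up k (Suc m) * z = z * up k (Suc m)"
      using am 6 assms by (intro up_z) auto
    finally have "t k * (up a m * t k) = up k (Suc m)"
      by (simp only: zz_assoc)
    moreover have "T k b = up k (Suc m)"
      using 6 by (simp add: T_def m flip: 6)
    moreover have "transpose k (Suc k) a = k" "transpose k (Suc k) b = b"
      using 6 m by (auto simp: transpose_def)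
    ultimately show ?thesis
      unfolding T by simp
  next
    case 7
    then show ?thesis
      unfolding T using t_up_t_inside[of a m k] am m by (auto simp: T_def transpose_def)
  qed
qed

lemma T_flip: "a \<noteq> b \<Longrightarrow> T b a = z * T a b"
  by (auto simp: T_def zz_assoc)

lemma T_z:
  assumes "a \<in> {1..n}" "b \<in> {1..n}" "a \<noteq> b"
  shows "T a b * z = z * T a b"
  using assms by (auto simp: T_def up_z mult.assoc)

lemma t_T_t:
  assumes "k \<in> {1..<n}" "a \<in> {1..n}" "b \<in> {1..n}" "a \<noteq> b"
  shows "t k * (T a b * t k) = T (transpose k (Suc k) a) (transpose k (Suc k) b)"
proof (cases "a < b")
  case True
  then show ?thesis
    using assms by (intro t_T_t_less) auto
next
  case False
  then have "t k * (T b a * t k) = T (transpose k (Suc k) b) (transpose k (Suc k) a)"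
    using assms by (intro t_T_t_less) auto
  moreover have "T (transpose k (Suc k) a) (transpose k (Suc k) b) = z * T (transpose k (Suc k) b) (transpose k (Suc k) a)"
    using assms by (intro T_flip) (simp add: transpose_neq_iff)
  ultimately show ?thesis
    using assms T_flip[of b a] by (simp add: mult.assoc zt_assoc)
qed

text \<open>Induction along the recursion of \<open>up\<close>: if s exchanges k and k + 1 and r
  exchanges a and k, then s r s exchanges a and k + 1.\<close>

lemma up_T_up:
  assumes "a \<ge> 1" "a + m < n" "c \<in> {1..n}" "d \<in> {1..n}" "c \<noteq> d"
  shows "up a m * (T c d * up a m) = T (transpose a (a + Suc m) c) (transpose a (a + Suc m) d)"
  using assms(2-)
proof (induction m arbitrary: c d)
  case 0
  then show ?case
    using assms(1) by (simp add: t_T_t)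
next
  case (Suc m)
  let ?k = "a + Suc m"
  let ?s = "transpose ?k (Suc ?k)"
  let ?r = "transpose a ?k"
  have k: "?k \<in> {1..<n}"
    using Suc by auto
  have s: "?s x \<in> {1..n}" if "x \<in> {1..n}" for x
    using that k by (auto simp: transpose_def)
  have r: "?r x \<in> {1..n}" if "x \<in> {1..n}" for x
    using that k assms(1) by (auto simp: transpose_def)
  have neq: "?s c \<noteq> ?s d" "?r (?s c) \<noteq> ?r (?s d)"
    using Suc.prems by (simp_all add: transpose_neq_iff)
  have "up a (Suc m) * (T c d * up a (Suc m)) =
      t ?k * ((up a m * ((t ?k * (T c d * t ?k)) * up a m)) * t ?k)"
    by (simp add: mult.assoc)
  also have "t ?k * (T c d * t ?k) = T (?s c) (?s d)"
    using Suc.prems k by (intro t_T_t) auto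
  also have "up a m * (T (?s c) (?s d) * up a m) = T (?r (?s c)) (?r (?s d))"
    using Suc.prems s neq by (intro Suc.IH) auto
  also have "t ?k * (T (?r (?s c)) (?r (?s d)) * t ?k) = T (?s (?r (?s c))) (?s (?r (?s d)))"
    using Suc.prems s r k neq by (intro t_T_t) auto
  finally have *: "up a (Suc m) * (T c d * up a (Suc m)) = T (?s (?r (?s c))) (?s (?r (?s d)))" .
  have "?s (?r (?s x)) = transpose a (a + Suc (Suc m)) x" for x
    by (auto simp: transpose_def)
  then show ?case
    by (simp only: *)
qed

lemma T_T_T:
  assumes "a \<in> {1..n}" "b \<in> {1..n}" "a \<noteq> b" "c \<in> {1..n}" "d \<in> {1..n}" "c \<noteq> d"
  shows "T a b * (T c d * T a b) = T (transpose a b c) (transpose a b d)"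
proof -
  have less: "T a b * (T c d * T a b) = T (transpose a b c) (transpose a b d)"
    if "a < b" "a \<in> {1..n}" "b \<in> {1..n}" for a b
    using up_T_up[of a "b - Suc a" c d] that assms(4-) by (simp add: T_def[of a b])
  show ?thesis
  proof (cases "a < b")
    case False
    then have "T b a * (T c d * T b a) = T (transpose a b c) (transpose a b d)"
      using assms less[of b a] by (simp add: transpose_commute)
    moreover have "T a b * (T c d * T a b) = z * (T b a * ((T c d * z) * T b a))"
      using assms T_flip[of b a] by (simp add: mult.assoc)
    moreover have "T c d * z = z * T c d"
      using assms by (intro T_z) auto
    moreover have "T b a * (z * x) = z * (T b a * x)" for x
      using arg_cong[OF T_z[of b a], of "\<lambda>w. w * x"] assms by (simp add: mult.assoc)
    ultimately show ?thesis
      by (simp add: mult.assoc zz_assoc)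
  qed (use assms less in auto)
qed

lemma T_T:
  assumes "a \<in> {1..n}" "b \<in> {1..n}" "a \<noteq> b"
  shows "T a b * T a b = z"
proof -
  have less: "T a b * T a b = z" if "a < b" "a \<in> {1..n}" "b \<in> {1..n}" for a b
    using up_up[of a "b - Suc a"] that by (simp add: T_def)
  show ?thesis
  proof (cases "a < b")
    case False
    then have "T a b * T a b = z * ((T b a * z) * T b a)"
      using assms T_flip[of b a] by (simp add: mult.assoc)
    also have "T b a * z = z * T b a"
      using assms by (intro T_z) auto
    finally show ?thesis
      using less[of b a] assms False by (simp add: mult.assoc zz_assoc)
  qed (use assms less in auto)
qed

lemma spin_system: "spin_system {1..n} T z"
proof
  fix a b c d :: nat
  assume ab: "a \<in> {1..n}" "b \<in> {1..n}" "a \<noteq> b" and cd: "c \<in> {1..n}" "d \<in> {1..n}" "c \<noteq> d"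
  \<comment> \<open>\<open>T_T_T\<close> is multiplied on the right by \<open>T a b\<close>, whose
    square z commutes with all lifts.\<close>
  have "T (transpose a b c) (transpose a b d) * T a b = T a b * (T c d * (T a b * T a b))"
    unfolding T_T_T[OF ab cd, symmetric] by (simp only: mult.assoc)
  also have "\<dots> = T a b * (z * T c d)"
    using T_T[OF ab] T_z[OF cd] by simp
  also have "\<dots> = z * (T a b * T c d)"
    using arg_cong[OF T_z[OF ab], of "\<lambda>w. w * T c d"] by (simp only: mult.assoc)
  finally show "T a b * T c d = z * T (transpose a b c) (transpose a b d) * T a b"
    by (simp add: mult.assoc zz_assoc)
qed (auto simp: zz T_z T_T intro: T_flip)

lemma T_Suc: "T i (Suc i) = t i"
  by (simp add: T_def)

end

subsection \<open>The degree filtration on the monoid algebra\<close>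

text \<open>The levels are integers, so that bounds can be lowered without side conditions; negative
  levels contain only 0.\<close>

definition filt :: "int \<Rightarrow> mpoly set" where
  "filt j = {x. \<forall>\<pi> \<in> Poly_Mapping.keys x. odd_partition \<pi> \<and> int (sum_mset \<pi> + size \<pi>) \<le> j}"

lemma filt_0 [simp]: "0 \<in> filt j"
  by (simp add: filt_def)

lemma filt_add: "x \<in> filt j \<Longrightarrow> y \<in> filt j \<Longrightarrow> x + y \<in> filt j"
  using keys_add[of x y] by (auto simp: filt_def)

lemma filt_scale: "x \<in> filt j \<Longrightarrow> pscale c x \<in> filt j"
  by (auto simp: filt_def in_keys_iff)

lemma filt_minus: "x \<in> filt j \<Longrightarrow> - x \<in> filt j"
  by (auto simp: filt_def in_keys_iff)

lemma filt_diff: "x \<in> filt j \<Longrightarrow> y \<in> filt j \<Longrightarrow> x - y \<in> filt j"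
  using filt_add[of x j "- y"] filt_minus[of y j] by simp

lemma filt_sum: "(\<And>i. i \<in> I \<Longrightarrow> f i \<in> filt j) \<Longrightarrow> sum f I \<in> filt j"
  by (induction I rule: infinite_finite_induct) (auto intro: filt_add)

lemma filt_mono: "x \<in> filt i \<Longrightarrow> i \<le> j \<Longrightarrow> x \<in> filt j"
  by (fastforce simp: filt_def)

lemma filt_sign: "x \<in> filt j \<Longrightarrow> (- 1) ^ n * x \<in> filt j"
  by (simp add: minus_one_power_scale filt_scale)

lemma filt_of_nat: "x \<in> filt j \<Longrightarrow> of_nat n * x \<in> filt j"
  by (simp add: filt_scale flip: pscale_of_nat)

lemma filt_mult: "x \<in> filt i \<Longrightarrow> y \<in> filt j \<Longrightarrow> x * y \<in> filt (i + j)"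
  using keys_mult[of x y] by (fastforce simp: filt_def odd_partition_def)

lemma filt_1: "1 \<in> filt 0"
  by (simp add: filt_def odd_partition_def)

lemma filt_neg: "x \<in> filt j \<Longrightarrow> j < 0 \<Longrightarrow> x = 0"
proof (rule ccontr)
  assume "x \<in> filt j" "j < 0" "x \<noteq> 0"
  then obtain \<pi> where "\<pi> \<in> Poly_Mapping.keys x"
    by (metis keys_eq_empty ex_in_conv)
  then have "int (sum_mset \<pi> + size \<pi>) \<le> j"
    using \<open>x \<in> filt j\<close> by (auto simp: filt_def)
  then show False
    using \<open>j < 0\<close> by linarith
qed

lemma filt_odd_poly: "x \<in> filt j \<Longrightarrow> odd_poly x"
  by (simp add: filt_def odd_poly_def)

text \<open>The power of 2 in \<open>Ch\<close> is divided out, so that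
  \<open>Ch_combination\<close> of a product of these is a falling factorial times a normalised
  trace (\<open>chi_lift\<close>). The value 0 for even l reflects the vanishing of the characters
  on products with an even cycle.\<close>

definition yy :: "nat \<Rightarrow> mpoly" where
  "yy l = (if odd l then Poly_Mapping.single {#l#} (1 / 2 ^ ((l - 1) div 2)) else 0)"

lemma yy_filt: "yy l \<in> filt (int l + 1)"
  by (auto simp: yy_def filt_def odd_partition_def)

lemma yy_even [simp]: "even l \<Longrightarrow> yy l = 0"
  by (simp add: yy_def)

lemma prod_list_filt: "(\<And>a. a \<in> set A \<Longrightarrow> f a \<in> filt (g a)) \<Longrightarrow> (\<Prod>a \<leftarrow> A. f a) \<in> filt (\<Sum>a \<leftarrow> A. g a)"
  by (induction A) (auto intro: filt_mult filt_1)


subsection \<open>Multiplying a cycle into a permutation step by step\<close>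

text \<open>
  A cycle \<open>(x\<^sub>k \<dots> x\<^sub>1)\<close> is multiplied from the left onto a product of disjoint cycles, one transposition
  \<open>(x\<^bsub>j+1\<^esub> x\<^sub>j)\<close> at a time. The list \<open>c\<close> describes the cycle through the current point \<open>x\<^sub>j\<close>, starting
  there; \<open>A\<close> describes the other cycles that have been changed so far, and \<open>I\<close> indexes the cycles
  not yet touched, of lengths \<open>s i\<close>. An entry is \<^const>\<open>True\<close> if the point at this position is still
  allowed as \<open>x\<^bsub>j+1\<^esub>\<close>. The next point is fresh, or cuts \<open>c\<close>, or joins \<open>c\<close> with a cycle of \<open>A\<close> or with an
  untouched cycle.
\<close>

definition join_sign :: "bool list \<Rightarrow> bool list list \<Rightarrow> nat \<Rightarrow> nat \<Rightarrow> nat" where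
  "join_sign c A j q = (length (A ! j) - 1) *
     ((\<Sum>a \<leftarrow> take j A. length a - 1) + (length (A ! j) - q) + length c)"

primrec walk :: "(nat set \<Rightarrow> mpoly) \<Rightarrow> (nat \<Rightarrow> nat) \<Rightarrow> nat \<Rightarrow> bool list \<Rightarrow> bool list list \<Rightarrow> nat set \<Rightarrow> mpoly" where
  "walk h s 0 = (\<lambda>c A I. yy (length c) * (\<Prod>a \<leftarrow> A. yy (length a)) * h I)"
| "walk h s (Suc m) = (\<lambda>c A I.
     walk h s m (False # c) A I
     + (\<Sum>q \<in> {q \<in> {1..<length c}. c ! q}. (- 1) ^ ((q - 1) * (length c - q)) *
         walk h s m (False # drop (Suc q) c) (take q c # A) I)
     + (\<Sum>j < length A. \<Sum>q \<in> {q. q < length (A ! j) \<and> A ! j ! q}. (- 1) ^ join_sign c A j q *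
         walk h s m (False # drop (Suc q) (A ! j) @ take q (A ! j) @ c) (take j A @ drop (Suc j) A) I)
     + (\<Sum>i \<in> I. of_nat (s i) * walk h s m (False # replicate (s i - 1) True @ c) A (I - {i})))"

text \<open>The two final weights \<open>h\<close> in use: here the untouched cycles remain as
  factors, in \<open>all_touched\<close> none may be left.\<close>

definition remain :: "(nat \<Rightarrow> nat) \<Rightarrow> nat set \<Rightarrow> mpoly" where
  "remain s I = (\<Prod>i \<in> I. yy (s i))"

definition all_touched :: "nat set \<Rightarrow> mpoly" where
  "all_touched I = (if I = {} then 1 else 0)"

lemma sum_list_take_drop:
  "j < length A \<Longrightarrow> (\<Sum>a \<leftarrow> take j A @ drop (Suc j) A. f a) = (\<Sum>a \<leftarrow> A. f a) - (f (A ! j) :: 'a :: ab_group_add)"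
  by (subst (3) id_take_nth_drop[of j A]) (auto simp: algebra_simps)

text \<open>A fresh point or a cut raises the degree of the configuration by 1, a join with an entry
  of A lowers it by 1. Touching a cycle of length s raises it by s, which is the 1 of the step plus
  s - 1.\<close>

lemma walk_filt:
  assumes "finite I"
  shows "walk all_touched s m c A I \<in>
    filt (int (length c) + 1 + (\<Sum>a \<leftarrow> A. int (length a) + 1) + int m + (\<Sum>i \<in> I. int (s i) - 1))"
  using assms
proof (induction m arbitrary: c A I)
  case 0
  have "yy (length c) * (\<Prod>a \<leftarrow> A. yy (length a)) * 1 \<in>
      filt (int (length c) + 1 + (\<Sum>a \<leftarrow> A. int (length a) + 1) + 0)"
    by (intro filt_mult yy_filt prod_list_filt filt_1)
  then show ?case
    by (simp add: all_touched_def)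
next
  case (Suc m)
  have fresh: "walk all_touched s m (False # c) A I \<in>
      filt (int (length c) + 1 + (\<Sum>a \<leftarrow> A. int (length a) + 1) + int (Suc m) + (\<Sum>i \<in> I. int (s i) - 1))"
    by (rule filt_mono[OF Suc.IH]) (use Suc.prems in auto)
  have cut: "walk all_touched s m (False # drop (Suc q) c) (take q c # A) I \<in>
      filt (int (length c) + 1 + (\<Sum>a \<leftarrow> A. int (length a) + 1) + int (Suc m) + (\<Sum>i \<in> I. int (s i) - 1))"
    if "q < length c" for q
    by (rule filt_mono[OF Suc.IH]) (use Suc.prems that in auto)
  have join: "walk all_touched s m (False # drop (Suc q) (A ! j) @ take q (A ! j) @ c) (take j A @ drop (Suc j) A) I \<in>
      filt (int (length c) + 1 + (\<Sum>a \<leftarrow> A. int (length a) + 1) + int (Suc m) + (\<Sum>i \<in> I. int (s i) - 1))"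
    if "j < length A" "q < length (A ! j)" for j q
    by (rule filt_mono[OF Suc.IH], use Suc.prems in simp, subst sum_list_take_drop) (use that in auto)
  have touch: "walk all_touched s m (False # replicate (s i - 1) True @ c) A (I - {i}) \<in>
      filt (int (length c) + 1 + (\<Sum>a \<leftarrow> A. int (length a) + 1) + int (Suc m) + (\<Sum>i \<in> I. int (s i) - 1))"
    if "i \<in> I" "s i > 0" for i
    by (rule filt_mono[OF Suc.IH]) (use Suc.prems that in \<open>auto simp: sum.remove[of I i]\<close>)
  have touch': "of_nat (s i) * walk all_touched s m (False # replicate (s i - 1) True @ c) A (I - {i}) \<in>
      filt (int (length c) + 1 + (\<Sum>a \<leftarrow> A. int (length a) + 1) + int (Suc m) + (\<Sum>i \<in> I. int (s i) - 1))"
    if "i \<in> I" for i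
    using touch[OF that] by (cases "s i = 0") (simp_all add: filt_of_nat del: of_nat_Suc)
  show ?case
    unfolding walk.simps
    by (intro filt_add filt_sum filt_sign fresh cut join touch') auto
qed

text \<open>A join lowers the degree by 1 where the general bound allows 1 more, hence the gain of
  2.\<close>

lemma walk_join_filt:
  assumes "finite I" "j < length A" "q < length (A ! j)"
  shows "walk all_touched s m (False # drop (Suc q) (A ! j) @ take q (A ! j) @ c) (take j A @ drop (Suc j) A) I \<in>
      filt (int (length c) + 1 + (\<Sum>a \<leftarrow> A. int (length a) + 1) + int (Suc m) + (\<Sum>i \<in> I. int (s i) - 1) - 2)"
  by (rule filt_mono[OF walk_filt[OF assms(1)]], subst sum_list_take_drop) (use assms in auto)

text \<open>No step loses points. This makes the walk vanish at strict partitions of n when the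
  cycles have no room in n points or no fresh point is left.\<close>

lemma walk_remain_size:
  assumes "finite I" "\<pi> \<in> Poly_Mapping.keys (walk (remain s) s m c A I)"
  shows "length c + (\<Sum>a \<leftarrow> A. length a) + (\<Sum>i \<in> I. s i) \<le> sum_mset \<pi>"
proof -
  define G where "G N = {x :: mpoly. \<forall>\<pi> \<in> Poly_Mapping.keys x. N \<le> sum_mset \<pi>}" for N
  have add: "x + y \<in> G N" if "x \<in> G N" "y \<in> G N" for x y N
    using that keys_add[of x y] by (auto simp: G_def)
  have sum: "sum f I \<in> G N" if "\<And>i. i \<in> I \<Longrightarrow> f i \<in> G N" for f :: "nat \<Rightarrow> mpoly" and I N
    using that
  proof (induction I rule: infinite_finite_induct)
    case (insert i I)
    then show ?case
      by (simp add: add)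
  qed (simp_all add: G_def)
  have scale: "pscale c x \<in> G N" if "x \<in> G N" for c x N
    using that by (auto simp: G_def in_keys_iff)
  have sign: "(- 1) ^ k * x \<in> G N" "of_nat k * x \<in> G N" if "x \<in> G N" for k x N
    using that by (simp_all add: minus_one_power_scale scale flip: pscale_of_nat)
  have mult: "x * y \<in> G (M + N)" if "x \<in> G M" "y \<in> G N" for x y M N
    using that keys_mult[of x y] unfolding G_def by (fastforce intro: add_mono)
  have yy: "yy l \<in> G l" for l
    by (simp add: G_def yy_def)
  have mono: "x \<in> G N" if "x \<in> G M" "N \<le> M" for x M N
    using that by (fastforce simp: G_def)
  have list: "(\<Prod>a \<leftarrow> A. yy (length a)) \<in> G (\<Sum>a \<leftarrow> A. length a)" for A :: "bool list list"
    by (induction A) (auto intro: mult yy simp: G_def[of 0])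
  have set: "remain s I \<in> G (\<Sum>i \<in> I. s i)" if "finite I" for I
    using that unfolding remain_def by (induction I) (auto intro: mult yy simp: G_def[of 0])
  have "walk (remain s) s m c A I \<in> G (length c + (\<Sum>a \<leftarrow> A. length a) + (\<Sum>i \<in> I. s i))"
    using assms(1)
  proof (induction m arbitrary: c A I)
    case 0
    then show ?case
      by (auto intro!: mult yy list set)
  next
    case (Suc m)
    have fresh: "walk (remain s) s m (False # c) A I \<in> G (length c + (\<Sum>a \<leftarrow> A. length a) + (\<Sum>i \<in> I. s i))"
      by (rule mono[OF Suc.IH]) (use Suc.prems in auto)
    have cut: "walk (remain s) s m (False # drop (Suc q) c) (take q c # A) I
        \<in> G (length c + (\<Sum>a \<leftarrow> A. length a) + (\<Sum>i \<in> I. s i))"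
      if "q < length c" for q
      by (rule mono[OF Suc.IH]) (use Suc.prems that in auto)
    have join: "walk (remain s) s m (False # drop (Suc q) (A ! j) @ take q (A ! j) @ c) (take j A @ drop (Suc j) A) I
        \<in> G (length c + (\<Sum>a \<leftarrow> A. length a) + (\<Sum>i \<in> I. s i))"
      if "j < length A" "q < length (A ! j)" for j q
    proof (rule mono[OF Suc.IH])
      have "(\<Sum>a \<leftarrow> A. length a) = (\<Sum>a \<leftarrow> take j A @ A ! j # drop (Suc j) A. length a)"
        using that(1) by (simp flip: id_take_nth_drop)
      then show "length c + (\<Sum>a \<leftarrow> A. length a) + (\<Sum>i \<in> I. s i)
          \<le> length (False # drop (Suc q) (A ! j) @ take q (A ! j) @ c) +
            (\<Sum>a \<leftarrow> take j A @ drop (Suc j) A. length a) + (\<Sum>i \<in> I. s i)"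
        using that(2) by simp
    qed (use Suc.prems in auto)
    have touch: "walk (remain s) s m (False # replicate (s i - 1) True @ c) A (I - {i})
        \<in> G (length c + (\<Sum>a \<leftarrow> A. length a) + (\<Sum>i \<in> I. s i))"
      if "i \<in> I" for i
      by (rule mono[OF Suc.IH]) (use Suc.prems that in \<open>auto simp: sum.remove[of I i]\<close>)
    show ?case
      unfolding walk.simps
      by (intro add sum sign fresh cut join touch) auto
  qed
  then show ?thesis
    using assms(2) by (auto simp: G_def)
qed

text \<open>Walks are sorted by the set S of cycles that they touch. Only the last summand of a step
  touches one; there the pairs of an index i and a later set without i are reindexed by adding i to
  the set.\<close>

lemma walk_decompose:
  assumes "finite I"
  shows "walk (remain s) s m c A I = (\<Sum>S \<in> Pow I. remain s (I - S) * walk all_touched s m c A S)"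
  using assms
proof (induction m arbitrary: c A I)
  case 0
  have "(\<Sum>S \<in> Pow I. remain s (I - S) * (X * all_touched S)) = X * remain s I" for X
    using 0 by (subst sum.remove[of _ "{}"]) (auto simp: all_touched_def intro!: sum.neutral)
  then show ?case
    by simp
next
  case (Suc m)
  let ?w = "\<lambda>S. remain s (I - S)"
  let ?N = "\<lambda>i. False # replicate (s i - 1) True @ c"
  have diff: "S - {i} = S" if "S \<subseteq> I - {i}" for S i
    using that by auto
  have "(\<Sum>i \<in> I. of_nat (s i) * walk (remain s) s m (?N i) A (I - {i}))
      = (\<Sum>i \<in> I. \<Sum>S \<in> Pow (I - {i}). remain s (I - {i} - S) * (of_nat (s i) * walk all_touched s m (?N i) A S))"
    using Suc by (simp add: sum_distrib_left mult.left_commute)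
  also have "\<dots> = (\<Sum>(i, S) \<in> Sigma I (\<lambda>i. Pow (I - {i})).
      remain s (I - {i} - S) * (of_nat (s i) * walk all_touched s m (?N i) A S))"
    using Suc.prems by (subst sum.Sigma) auto
  also have "\<dots> = (\<Sum>(S, i) \<in> Sigma (Pow I) (\<lambda>S. S).
      ?w S * (of_nat (s i) * walk all_touched s m (?N i) A (S - {i})))"
    by (rule sum.reindex_bij_witness[of _ "\<lambda>(S, i). (i, S - {i})" "\<lambda>(i, S). (insert i S, i)"])
      (auto simp: insert_absorb Diff_insert2[symmetric] diff intro!: arg_cong2[where f = "(*)"] arg_cong[where f = "remain s"])
  also have "\<dots> = (\<Sum>S \<in> Pow I. ?w S * (\<Sum>i \<in> S. of_nat (s i) * walk all_touched s m (?N i) A (S - {i})))"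
    using Suc.prems by (subst sum.Sigma[symmetric]) (auto simp: sum_distrib_left intro: finite_subset)
  finally have touch: "(\<Sum>i \<in> I. of_nat (s i) * walk (remain s) s m (?N i) A (I - {i})) =
      (\<Sum>S \<in> Pow I. ?w S * (\<Sum>i \<in> S. of_nat (s i) * walk all_touched s m (?N i) A (S - {i})))" .
  have swap: "(\<Sum>q \<in> Q. e q * (\<Sum>S \<in> Pow I. ?w S * f q S)) = (\<Sum>S \<in> Pow I. ?w S * (\<Sum>q \<in> Q. e q * f q S))"
    for Q :: "nat set" and e f
    unfolding sum_distrib_left by (subst sum.swap) (simp add: mult.left_commute)
  have swap': "(\<Sum>j < n. \<Sum>S \<in> Pow I. ?w S * f j S) = (\<Sum>S \<in> Pow I. ?w S * (\<Sum>j < n. f j S))"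
    for n :: nat and f
    unfolding sum_distrib_left by (rule sum.swap)
  show ?case
    unfolding walk.simps touch
    by (simp only: Suc.IH[OF Suc.prems] swap swap' distrib_left sum.distrib)
qed

lemma walk_no_points:
  "walk all_touched s m (replicate e False) [] {} = yy (e + m)"
proof (induction m arbitrary: e)
  case (Suc m)
  have none: "{q. Suc 0 \<le> q \<and> q < e \<and> replicate e False ! q} = {}"
    by auto
  then show ?case
    using Suc[of "Suc e"] by (simp add: none del: nth_replicate)
qed (simp add: all_touched_def)

subsection \<open>The top degree part\<close>

text \<open>The walk without joins. A cycle that has been cut off is never visited again and
  contributes its factor at once. The sign of a cut can be left out: for odd q its exponent is even,
  for even q the factor is 0.\<close>

primrec top_walk :: "nat \<Rightarrow> bool list \<Rightarrow> mpoly" where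
  "top_walk 0 = (\<lambda>c. yy (length c))"
| "top_walk (Suc m) = (\<lambda>c. top_walk m (False # c) +
     (\<Sum>q \<in> {q \<in> {1..<length c}. c ! q}. yy q * top_walk m (False # drop (Suc q) c)))"

text \<open>All joins fall below the bound by \<open>walk_join_filt\<close>, so that A contributes
  nothing but a factor.\<close>

lemma walk_top_walk:
  "walk all_touched s m c A {} - (\<Prod>a \<leftarrow> A. yy (length a)) * top_walk m c \<in>
    filt (int (length c) + 1 + (\<Sum>a \<leftarrow> A. int (length a) + 1) + int m - 2)"
proof (induction m arbitrary: c A)
  case 0
  then show ?case
    by (simp add: all_touched_def mult.commute)
next
  case (Suc m)
  let ?P = "\<Prod>a \<leftarrow> A. yy (length a)"
  let ?D = "int (length c) + 1 + (\<Sum>a \<leftarrow> A. int (length a) + 1) + int (Suc m) - 2"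
  let ?Q = "{q \<in> {1..<length c}. c ! q}"
  let ?f = "\<lambda>q. walk all_touched s m (False # drop (Suc q) c) (take q c # A) {}"
  let ?g = "\<lambda>j q. walk all_touched s m (False # drop (Suc q) (A ! j) @ take q (A ! j) @ c) (take j A @ drop (Suc j) A) {}"
  have fresh: "walk all_touched s m (False # c) A {} - ?P * top_walk m (False # c) \<in> filt ?D"
    by (rule filt_mono[OF Suc.IH]) auto
  have cut: "(- 1) ^ ((q - 1) * (length c - q)) * ?f q - ?P * (yy q * top_walk m (False # drop (Suc q) c)) \<in> filt ?D"
    if q: "q \<in> ?Q" for q
  proof -
    have "?f q - (\<Prod>a \<leftarrow> take q c # A. yy (length a)) * top_walk m (False # drop (Suc q) c) \<in> filt ?D"
      by (rule filt_mono[OF Suc.IH]) (use q in auto)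
    then have "(- 1) ^ ((q - 1) * (length c - q)) * (?f q - (\<Prod>a \<leftarrow> take q c # A. yy (length a)) *
        top_walk m (False # drop (Suc q) c)) \<in> filt ?D"
      by (rule filt_sign)
    moreover have "(- 1) ^ ((q - 1) * (length c - q)) * yy q = yy q"
      by (cases "even q") (auto simp: minus_one_power_iff)
    moreover have "(\<Prod>a \<leftarrow> take q c # A. yy (length a)) = yy q * ?P"
      using q by simp
    moreover have "e * (w - (yq * P) * t) = e * w - P * ((e * yq) * t)" for e w yq P t :: mpoly
      by (simp add: algebra_simps)
    ultimately show ?thesis
      by (simp only:)
  qed
  have join: "(- 1) ^ join_sign c A j q * ?g j q \<in> filt ?D" if "j < length A" "q < length (A ! j)" for j q
    using walk_join_filt[of "{}" j A q s m c] that by (intro filt_sign) simp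
  have "(walk all_touched s m (False # c) A {} - ?P * top_walk m (False # c)) +
     (\<Sum>q \<in> ?Q. (- 1) ^ ((q - 1) * (length c - q)) * ?f q - ?P * (yy q * top_walk m (False # drop (Suc q) c))) +
     (\<Sum>j < length A. \<Sum>q \<in> {q. q < length (A ! j) \<and> A ! j ! q}. (- 1) ^ join_sign c A j q * ?g j q) \<in> filt ?D"
    by (intro filt_add filt_sum fresh cut join) auto
  then show ?case
    by (simp add: sum_subtractf sum_distrib_left algebra_simps)
qed

text \<open>Here j counts the fresh points chosen before the cycle is touched. Until then all points
  of the current cycle are used, so nothing can be cut.\<close>

lemma walk_one_untouched:
  "walk all_touched s m (replicate e False) [] {i} =
     of_nat (s i) * (\<Sum>j < m. walk all_touched s (m - 1 - j) (False # replicate (s i - 1) True @ replicate (e + j) False) [] {})"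
proof (induction m arbitrary: e)
  case 0
  then show ?case
    by (simp add: all_touched_def)
next
  case (Suc m)
  have none: "{q. Suc 0 \<le> q \<and> q < e \<and> replicate e False ! q} = {}"
    by auto
  then have "walk all_touched s (Suc m) (replicate e False) [] {i} =
      walk all_touched s m (replicate (Suc e) False) [] {i} +
      of_nat (s i) * walk all_touched s m (False # replicate (s i - 1) True @ replicate e False) [] {}"
    by (simp add: none del: nth_replicate)
  also have "\<dots> = of_nat (s i) * (walk all_touched s m (False # replicate (s i - 1) True @ replicate e False) [] {} +
      (\<Sum>j < m. walk all_touched s (m - 1 - j) (False # replicate (s i - 1) True @ replicate (Suc e + j) False) [] {}))"
    unfolding Suc.IH by (simp add: distrib_left)
  finally show ?case
    by (subst sum.lessThan_Suc_shift) (simp del: replicate_Suc)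
qed

lemma walk_one_untouched_top:
  assumes "s i > 0"
  shows "walk all_touched s k [] [] {i} -
     of_nat (s i) * (\<Sum>e < k. top_walk (k - 1 - e) (False # replicate (s i - 1) True @ replicate e False))
     \<in> filt (int k + int (s i) - 2)"
proof -
  have "walk all_touched s (k - 1 - e) (False # replicate (s i - 1) True @ replicate e False) [] {} -
      top_walk (k - 1 - e) (False # replicate (s i - 1) True @ replicate e False) \<in> filt (int k + int (s i) - 2)"
    if "e < k" for e
  proof -
    have "walk all_touched s (k - 1 - e) (False # replicate (s i - 1) True @ replicate e False) [] {} -
        (\<Prod>a \<leftarrow> ([] :: bool list list). yy (length a)) * top_walk (k - 1 - e) (False # replicate (s i - 1) True @ replicate e False)
        \<in> filt (int k + int (s i) - 2)"
      by (rule filt_mono[OF walk_top_walk]) (use assms that in auto)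
    then show ?thesis
      by simp
  qed
  then have "of_nat (s i) * (\<Sum>e < k. walk all_touched s (k - 1 - e) (False # replicate (s i - 1) True @ replicate e False) [] {} -
      top_walk (k - 1 - e) (False # replicate (s i - 1) True @ replicate e False)) \<in> filt (int k + int (s i) - 2)"
    by (intro filt_of_nat filt_sum) auto
  then show ?thesis
    using walk_one_untouched[of s k 0 i] by (simp add: sum_subtractf right_diff_distrib)
qed

text \<open>The configurations after touching: the point of entry or of the last cut and g fresh
  points chosen since, then b points of the touched cycle that are still available, then e fresh
  points chosen before the touch.\<close>

definition block_walk :: "nat \<Rightarrow> nat \<Rightarrow> nat \<Rightarrow> nat \<Rightarrow> mpoly" where
  "block_walk e m g b = top_walk m (replicate (Suc g) False @ replicate b True @ replicate e False)"

text \<open>Cutting at an available point with i available ones before it splits off these i points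
  and the 1 + g used ones.\<close>

lemma block_walk_Suc:
  "block_walk e (Suc m) g b = block_walk e m (Suc g) b + (\<Sum>i < b. yy (Suc (g + i)) * block_walk e m 0 (b - 1 - i))"
proof -
  let ?c = "replicate (Suc g) False @ replicate b True @ replicate e False"
  have nth: "?c ! q \<longleftrightarrow> Suc g \<le> q \<and> q < Suc g + b" if "q < length ?c" for q
    using that by (auto simp: nth_append nth_Cons split: nat.splits)
  have set: "{q \<in> {1..<length ?c}. ?c ! q} = (\<lambda>i. Suc (g + i)) ` {..<b}"
  proof (intro equalityI subsetI)
    fix q assume "q \<in> {q \<in> {1..<length ?c}. ?c ! q}"
    then have "Suc g \<le> q" "q < Suc g + b"
      using nth[of q] by auto
    then show "q \<in> (\<lambda>i. Suc (g + i)) ` {..<b}"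
      by (intro image_eqI[of _ _ "q - Suc g"]) auto
  next
    fix q assume "q \<in> (\<lambda>i. Suc (g + i)) ` {..<b}"
    then obtain i where i: "i < b" "q = Suc (g + i)"
      by auto
    then have "q < length ?c"
      by simp
    then show "q \<in> {q \<in> {1..<length ?c}. ?c ! q}"
      using nth[of q] i by simp
  qed
  have drop: "drop (Suc (Suc (g + i))) ?c = replicate (b - 1 - i) True @ replicate e False" if "i < b" for i
    using that by simp
  have "block_walk e (Suc m) g b = top_walk m (False # ?c) +
      (\<Sum>q \<in> (\<lambda>i. Suc (g + i)) ` {..<b}. yy q * top_walk m (False # drop (Suc q) ?c))"
    unfolding block_walk_def top_walk.simps set ..
  also have "(\<Sum>q \<in> (\<lambda>i. Suc (g + i)) ` {..<b}. yy q * top_walk m (False # drop (Suc q) ?c))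
     = (\<Sum>i < b. yy (Suc (g + i)) * block_walk e m 0 (b - 1 - i))"
  proof (subst sum.reindex)
    show "(\<Sum>i < b. ((\<lambda>q. yy q * top_walk m (False # drop (Suc q) ?c)) \<circ> (\<lambda>i. Suc (g + i))) i)
        = (\<Sum>i < b. yy (Suc (g + i)) * block_walk e m 0 (b - 1 - i))"
    proof (rule sum.cong[OF HOL.refl])
      fix i assume "i \<in> {..<b}"
      then have "drop (Suc (Suc (g + i))) ?c = replicate (b - 1 - i) True @ replicate e False"
        using drop by blast
      then show "((\<lambda>q. yy q * top_walk m (False # drop (Suc q) ?c)) \<circ> (\<lambda>i. Suc (g + i))) i
          = yy (Suc (g + i)) * block_walk e m 0 (b - 1 - i)"
        unfolding o_def block_walk_def by (simp only:) simp
    qed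
  qed (simp add: inj_on_def)
  finally show ?thesis
    by (simp add: block_walk_def)
qed

lemma block_walk_unroll:
  "block_walk e m g b = yy (Suc (m + g + b + e)) +
     (\<Sum>a < m. \<Sum>i < b. yy (Suc (g + a + i)) * block_walk e (m - 1 - a) 0 (b - 1 - i))"
proof (induction m arbitrary: g)
  case 0
  then show ?case
    by (simp add: block_walk_def add.assoc)
next
  case (Suc m)
  show ?case
    unfolding block_walk_Suc Suc.IH by (subst sum.lessThan_Suc_shift) (simp add: algebra_simps)
qed

text \<open>One pair (a, b) for each cycle at the end: a points chosen by the walk and b points of
  the touched cycle, where the point of entry or cut is counted in both. Hence the length a + b - 1
  in \<open>block_weight\<close>.\<close>

definition block_pairs :: "nat \<Rightarrow> nat \<Rightarrow> (nat \<times> nat) list set" where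
  "block_pairs k s = {ps. ps \<noteq> [] \<and> (\<forall>p \<in> set ps. fst p \<ge> 1 \<and> snd p \<ge> 1) \<and>
     sum_list (map fst ps) = k \<and> sum_list (map snd ps) = s}"

definition block_weight :: "(nat \<times> nat) list \<Rightarrow> mpoly" where
  "block_weight ps = (\<Prod>p \<leftarrow> ps. yy (fst p + snd p - 1))"

lemma length_le_sum_list: "(\<And>x. x \<in> set xs \<Longrightarrow> x \<ge> 1) \<Longrightarrow> length xs \<le> sum_list xs" for xs :: "nat list"
proof (induction xs)
  case (Cons x xs)
  then have "x \<ge> 1" "length xs \<le> sum_list xs"
    by auto
  then show ?case
    by simp
qed simp

lemma finite_block_pairs: "finite (block_pairs k s)"
proof (rule finite_subset)
  show "finite {ps. set ps \<subseteq> {..k} \<times> {..s} \<and> length ps \<le> k}"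
    by (rule finite_lists_length_le) simp
  show "block_pairs k s \<subseteq> {ps. set ps \<subseteq> {..k} \<times> {..s} \<and> length ps \<le> k}"
  proof clarify
    fix ps assume ps: "ps \<in> block_pairs k s"
    have "length (map fst ps) \<le> sum_list (map fst ps)"
      using ps by (intro length_le_sum_list) (auto simp: block_pairs_def)
    moreover have "x \<in> {..k} \<times> {..s}" if "x \<in> set ps" for x
      using ps that member_le_sum_list[of "fst x" "map fst ps"] member_le_sum_list[of "snd x" "map snd ps"]
      by (auto simp: block_pairs_def mem_Times_iff)
    ultimately show "set ps \<subseteq> {..k} \<times> {..s} \<and> length ps \<le> k"
      using ps by (auto simp: block_pairs_def)
  qed
qed

text \<open>The first pair describes the first cycle that is cut off. The e points chosen before the
  touch stay in the cycle left at the end, together with its own point of entry or cut, so the first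
  component of the last pair exceeds e.\<close>

lemma block_walk_eq_sum:
  "block_walk e m 0 b = (\<Sum>ps \<in> {ps \<in> block_pairs (Suc (m + e)) (Suc b). e < fst (last ps)}. block_weight ps)"
proof (induction m arbitrary: b rule: less_induct)
  case (less m)
  let ?L = "\<lambda>m b. {ps \<in> block_pairs (Suc (m + e)) (Suc b). e < fst (last ps)}"
  let ?X = "Sigma ({..<m} \<times> {..<b}) (\<lambda>x. ?L (m - 1 - fst x) (b - 1 - snd x))"
  let ?f = "\<lambda>(x, ps). (Suc (fst x), Suc (snd x)) # ps"
  have fin: "finite (?L m b)" for m b
    using finite_block_pairs by simp
  have split: "?L m b = insert [(Suc (m + e), Suc b)] (?f ` ?X)"
  proof (intro equalityI subsetI)
    fix ps assume ps: "ps \<in> ?L m b"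
    show "ps \<in> insert [(Suc (m + e), Suc b)] (?f ` ?X)"
    proof (cases ps rule: list.exhaust[case_names Nil Cons])
      case (Cons p qs)
      show ?thesis
      proof (cases "qs = []")
        case True
        then show ?thesis
          using ps Cons by (cases p) (auto simp: block_pairs_def)
      next
        case False
        obtain a i where p: "p = (Suc a, Suc i)"
          using ps Cons by (cases p) (auto simp: block_pairs_def Suc_le_eq gr0_conv_Suc)
        have "last qs \<in> set qs"
          using False by simp
        then have l: "fst (last qs) \<le> sum_list (map fst qs)" "snd (last qs) \<le> sum_list (map snd qs)"
          by (auto intro!: member_le_sum_list)
        have "e < fst (last qs)" "1 \<le> snd (last qs)"
          using ps Cons False \<open>last qs \<in> set qs\<close> by (auto simp: block_pairs_def)
        with l have "a < m" "i < b"
          using ps Cons p by (auto simp: block_pairs_def)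
        moreover from this have "qs \<in> ?L (m - 1 - a) (b - 1 - i)"
          using ps Cons p False by (auto simp: block_pairs_def)
        ultimately have "((a, i), qs) \<in> ?X"
          by simp
        then have "?f ((a, i), qs) \<in> ?f ` ?X"
          by (rule imageI)
        then show ?thesis
          by (simp add: Cons p)
      qed
    qed (use ps in \<open>simp add: block_pairs_def\<close>)
  next
    fix ps assume "ps \<in> insert [(Suc (m + e), Suc b)] (?f ` ?X)"
    then show "ps \<in> ?L m b"
      by (auto simp: block_pairs_def)
  qed
  have inj: "inj_on ?f ?X"
    by (auto simp: inj_on_def)
  have finX: "finite ?X"
    by (intro finite_SigmaI) (use fin in auto)
  have "[(Suc (m + e), Suc b)] \<notin> ?f ` ?X"
    by (auto simp: block_pairs_def)
  then have "(\<Sum>ps \<in> ?L m b. block_weight ps) = yy (Suc (m + b + e)) + (\<Sum>x \<in> ?X. block_weight (?f x))"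
    unfolding split using finX inj
    by (subst sum.insert) (auto simp: sum.reindex block_weight_def add_ac)
  also have "(\<Sum>x \<in> ?X. block_weight (?f x)) =
      (\<Sum>x \<in> {..<m} \<times> {..<b}. \<Sum>ps \<in> ?L (m - 1 - fst x) (b - 1 - snd x). yy (Suc (fst x + snd x)) * block_weight ps)"
    by (subst sum.Sigma) (use fin in \<open>auto simp: block_weight_def intro!: sum.cong\<close>)
  also have "\<dots> = (\<Sum>a < m. \<Sum>i < b. yy (Suc (a + i)) * block_walk e (m - 1 - a) 0 (b - 1 - i))"
    unfolding sum.cartesian_product by (intro sum.cong HOL.refl) (auto simp: less.IH sum_distrib_left)
  finally show ?case
    unfolding block_walk_unroll[of e m 0 b] by simp
qed

lemma mset_rotate: "mset (rotate j xs) = mset xs"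
  by (metis append_take_drop_id mset_append rotate_drop_take union_commute)

lemma block_pairs_rotate: "rotate j ps \<in> block_pairs k s \<longleftrightarrow> ps \<in> block_pairs k s"
proof -
  have "sum_list (map f (rotate j ps)) = sum_list (map f ps)" for f :: "nat \<times> nat \<Rightarrow> nat"
    by (simp only: sum_mset_sum_list[symmetric] mset_map mset_rotate)
  then show ?thesis
    by (simp add: block_pairs_def)
qed

text \<open>The weight is invariant under rotation of the list. Averaging the first component over
  all r positions turns it into k / r; this is the source of 1/r.\<close>

lemma sum_last_block:
  "(\<Sum>ps \<in> block_pairs k s. of_nat (fst (last ps)) * block_weight ps) =
   (\<Sum>ps \<in> block_pairs k s. pscale (of_nat k / of_nat (length ps)) (block_weight ps))"
proof -
  let ?B = "\<lambda>r. {ps \<in> block_pairs k s. length ps = r}"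
  have weight: "block_weight (rotate j ps) = block_weight ps" for j ps
    by (simp only: block_weight_def prod_mset_prod_list[symmetric] mset_map mset_rotate)
  have fin: "finite (?B r)" for r
    using finite_block_pairs by simp
  have last: "(\<Sum>ps \<in> ?B r. of_nat (fst (last ps)) * block_weight ps) =
      (\<Sum>ps \<in> ?B r. of_nat (fst (ps ! j)) * block_weight ps)" if "j < r" for r j
  proof (rule sum.reindex_bij_witness[of _ "rotate (Suc j)" "rotate (r - Suc j)"])
    fix ps assume ps: "ps \<in> ?B r"
    then have ne: "ps \<noteq> []"
      by (simp add: block_pairs_def)
    have eq: "rotate a (rotate b ps) = ps" if "a + b = r" for a b
      using ps that by (auto simp: rotate_rotate)
    show "rotate (Suc j) (rotate (r - Suc j) ps) = ps" "rotate (r - Suc j) (rotate (Suc j) ps) = ps"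
      by (rule eq, use that in simp)+
    show "rotate (r - Suc j) ps \<in> ?B r" "rotate (Suc j) ps \<in> ?B r"
      using ps by (simp_all only: mem_Collect_eq block_pairs_rotate length_rotate)
    have "rotate (r - Suc j) ps ! j = ps ! ((j + (r - Suc j)) mod r)"
      using ps that by (simp add: nth_rotate add.commute)
    also have "\<dots> = last ps"
      using ps that ne by (auto simp: last_conv_nth)
    finally show "of_nat (fst (rotate (r - Suc j) ps ! j)) * block_weight (rotate (r - Suc j) ps)
        = of_nat (fst (last ps)) * block_weight ps"
      by (simp add: weight)
  qed
  have "(\<Sum>ps \<in> ?B r. of_nat (fst (last ps)) * block_weight ps) =
      (\<Sum>ps \<in> ?B r. pscale (of_nat k / of_nat r) (block_weight ps))" for r
  proof (cases "r = 0")
    case False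
    have "pscale (of_nat r) (\<Sum>ps \<in> ?B r. of_nat (fst (last ps)) * block_weight ps)
        = (\<Sum>j < r. \<Sum>ps \<in> ?B r. of_nat (fst (ps ! j)) * block_weight ps)"
      by (simp add: pscale_of_nat flip: last)
    also have "\<dots> = (\<Sum>ps \<in> ?B r. of_nat (\<Sum>j < r. fst (ps ! j)) * block_weight ps)"
      by (subst sum.swap) (simp add: sum_distrib_right)
    also have "\<dots> = (\<Sum>ps \<in> ?B r. pscale (of_nat k) (block_weight ps))"
    proof (rule sum.cong[OF HOL.refl])
      fix ps assume "ps \<in> ?B r"
      then have "(\<Sum>j < r. fst (ps ! j)) = k"
        by (auto simp: block_pairs_def sum_list_sum_nth atLeast0LessThan)
      then show "of_nat (\<Sum>j < r. fst (ps ! j)) * block_weight ps = pscale (of_nat k) (block_weight ps)"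
        by (simp add: pscale_of_nat)
    qed
    finally have "pscale (1 / of_nat r) (pscale (of_nat r) (\<Sum>ps \<in> ?B r. of_nat (fst (last ps)) * block_weight ps))
        = pscale (1 / of_nat r) (\<Sum>ps \<in> ?B r. pscale (of_nat k) (block_weight ps))"
      by (rule arg_cong)
    then show ?thesis
      using False by (simp add: pvs.scale_sum_right[symmetric])
  qed (auto simp: block_pairs_def intro!: sum.neutral)
  then have "(\<Sum>ps \<in> ?B r. of_nat (fst (last ps)) * block_weight ps) =
      (\<Sum>ps \<in> ?B r. pscale (of_nat k / of_nat (length ps)) (block_weight ps))" for r
    by simp
  moreover have "sum F (block_pairs k s) = (\<Sum>r \<in> length ` block_pairs k s. sum F (?B r))" for F :: "_ \<Rightarrow> mpoly"
    by (rule sum.image_gen[OF finite_block_pairs])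
  ultimately show ?thesis
    by simp
qed

text \<open>For given pairs, the condition \<open>e < fst (last ps)\<close> is met by
  \<open>fst (last ps)\<close> values of e, and \<open>sum_last_block\<close> averages this number.
  The factor \<open>s i\<close> counts the points at which the cycle can be entered.\<close>

lemma walk_one_untouched_leading:
  assumes "s i > 0" "k > 0"
  shows "walk all_touched s k [] [] {i} -
     (\<Sum>ps \<in> block_pairs k (s i). pscale (of_nat (k * s i) / of_nat (length ps)) (block_weight ps))
     \<in> filt (int k + int (s i) - 2)"
proof -
  have "(\<Sum>e < k. top_walk (k - 1 - e) (False # replicate (s i - 1) True @ replicate e False))
      = (\<Sum>e < k. block_walk e (k - 1 - e) 0 (s i - 1))"
    by (simp add: block_walk_def)
  also have "\<dots> = (\<Sum>e < k. \<Sum>ps \<in> block_pairs k (s i). if e < fst (last ps) then block_weight ps else 0)"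
    using assms by (intro sum.cong HOL.refl) (auto simp: block_walk_eq_sum sum.inter_filter[OF finite_block_pairs])
  also have "\<dots> = (\<Sum>ps \<in> block_pairs k (s i). \<Sum>e < k. if e < fst (last ps) then block_weight ps else 0)"
    by (rule sum.swap)
  also have "\<dots> = (\<Sum>ps \<in> block_pairs k (s i). of_nat (fst (last ps)) * block_weight ps)"
  proof (rule sum.cong[OF HOL.refl])
    fix ps assume ps: "ps \<in> block_pairs k (s i)"
    then have "fst (last ps) \<le> k"
      by (auto simp: block_pairs_def intro!: member_le_sum_list)
    then have "{e. e < k \<and> e < fst (last ps)} = {..<fst (last ps)}"
      by auto
    then show "(\<Sum>e < k. if e < fst (last ps) then block_weight ps else 0) = of_nat (fst (last ps)) * block_weight ps"
      using sum.inter_filter[of "{..<k}" "\<lambda>_. block_weight ps" "\<lambda>e. e < fst (last ps)"] by simp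
  qed
  also have "\<dots> = (\<Sum>ps \<in> block_pairs k (s i). pscale (of_nat k / of_nat (length ps)) (block_weight ps))"
    by (rule sum_last_block)
  finally show ?thesis
    using walk_one_untouched_top[of s i k] assms
    by (simp add: pvs.scale_sum_right mult.commute flip: pscale_of_nat)
qed

subsection \<open>One step of the walk\<close>

context spin_system
begin

text \<open>At the start there is no current point: for \<open>c = []\<close> the factor
  \<open>cyc [x]\<close> is 1, and a fresh first point forms a cycle by itself.\<close>

lemma step_fresh: "cyc (x # take 1 c) * lift (c # D) = lift ((x # c) # D)"
  by (cases c) (simp_all add: mult.assoc)

lemma step_cut:
  assumes "set (y # A @ x # B) \<subseteq> V" "distinct (y # A @ x # B)"
  shows "cyc [x, y] * lift ((y # A @ x # B) # D) = z ^ (length A * (1 + length B)) * lift ((x # B) # (y # A) # D)"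
  using T_cyc_cut[OF assms] by (simp add: mult.assoc flip: mult.assoc[of "T x y"])

text \<open>The cycle of x is moved to the front past D1, rotated so that x comes first, and joined
  to c. The three signs add up to the one in \<open>join_sign\<close>.\<close>

lemma step_join:
  fixes a B :: "'l list"
  assumes "set (concat (c # D1 @ (a @ x # B) # D2)) \<subseteq> V" "distinct (concat (c # D1 @ (a @ x # B) # D2))"
  shows "cyc (x # take 1 c) * lift (c # D1 @ (a @ x # B) # D2) =
    z ^ ((length (a @ x # B) - 1) * ((\<Sum>d \<leftarrow> D1. length d - 1) + (length B + 1) + length c)) *
    lift ((x # B @ a @ c) # D1 @ D2)"
proof -
  let ?l = "length (a @ x # B) - 1" and ?s = "\<Sum>d \<leftarrow> D1. length d - 1"
  have "lift (D1 @ (a @ x # B) # D2) = z ^ (?l * ?s) * lift ((a @ x # B) # D1 @ D2)"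
    using assms by (intro lift_move_front) auto
  also have "cyc (a @ x # B) = z ^ ((length B + 1) * ?l) * cyc (x # B @ a)"
    using assms by (subst cyc_rotate[of "x # B" a]) (auto simp: add.commute)
  then have "lift ((a @ x # B) # D1 @ D2) = z ^ ((length B + 1) * ?l) * (cyc (x # B @ a) * lift (D1 @ D2))"
    by (simp add: mult.assoc)
  finally have D: "lift (D1 @ (a @ x # B) # D2) =
      z ^ (?l * (?s + (length B + 1))) * (cyc (x # B @ a) * lift (D1 @ D2))"
    by (simp add: z_power_mult_assoc algebra_simps)
  show ?thesis
  proof (cases c)
    case Nil
    then show ?thesis
      using D by (simp add: mult.assoc)
  next
    case (Cons y A)
    have c: "set c \<subseteq> V" "distinct c" "x \<in> V" "y \<in> V" "x \<noteq> y"
      using assms Cons by auto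
    have "T x y * (cyc c * (z ^ k * X)) = z ^ k * (T x y * (cyc c * X))" for k X
    proof -
      have "T x y * (cyc c * (z ^ k * X)) = T x y * ((cyc c * z ^ k) * X)"
        by (simp add: mult.assoc)
      also have "cyc c * z ^ k = z ^ k * cyc c"
        using c by (intro cyc_z_power)
      finally show ?thesis
        using c by (simp add: mult.assoc T_z_power_assoc)
    qed
    then have "cyc (x # take 1 c) * lift (c # D1 @ (a @ x # B) # D2) =
        z ^ (?l * (?s + (length B + 1))) * ((T x y * (cyc c * cyc (x # B @ a))) * lift (D1 @ D2))"
      unfolding lift_simps(2)[of c] D by (simp add: Cons mult.assoc)
    also have "T x y * (cyc c * cyc (x # B @ a)) = z ^ (length c * ?l) * cyc (x # (B @ a) @ c)"
    proof -
      have "set (y # A @ x # B @ a) \<subseteq> V" "distinct (y # A @ x # B @ a)"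
        using assms Cons by auto
      from T_cyc_join[OF this] show ?thesis
        by (simp add: Cons add.commute)
    qed
    finally show ?thesis
      by (simp add: mult.assoc z_power_mult_assoc algebra_simps)
  qed
qed

text \<open>Disjoint odd cycles commute, so only the multiset of cycles matters.\<close>

lemma lift_odd_cong:
  assumes "set (concat \<gamma>) \<subseteq> V" "distinct (concat \<gamma>)" "\<And>c. c \<in> set \<gamma> \<Longrightarrow> odd (length c)" "mset \<gamma> = mset \<delta>"
  shows "lift \<gamma> = lift \<delta>"
  using assms
proof (induction \<gamma> arbitrary: \<delta>)
  case (Cons c \<gamma>)
  have "c \<in> set \<delta>"
    using Cons.prems(4) by (metis list.set_intros(1) set_mset_mset)
  then obtain a b where \<delta>: "\<delta> = a @ c # b"
    by (meson split_list)
  have m: "mset \<gamma> = mset (a @ b)"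
    using Cons.prems(4) by (simp add: \<delta>)
  have set: "set (concat \<delta>) = set (concat (c # \<gamma>))"
    using Cons.prems(4) by (metis set_concat set_mset_mset)
  have "distinct (concat \<delta>)"
  proof -
    have "mset (concat xss) = sum_mset (image_mset mset (mset xss))" for xss :: "'l list list"
      by (induction xss) auto
    then have "mset (concat (c # \<gamma>)) = mset (concat \<delta>)"
      by (simp only: Cons.prems(4))
    then show ?thesis
      using Cons.prems(2) mset_eq_imp_distinct_iff by blast
  qed
  then have "lift \<delta> = z ^ ((length c - 1) * (\<Sum>d \<leftarrow> a. length d - 1)) * lift (c # a @ b)"
    unfolding \<delta> using Cons.prems(1) set by (intro lift_move_front) (simp_all only: \<delta>)
  also have "z ^ ((length c - 1) * (\<Sum>d \<leftarrow> a. length d - 1)) = 1"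
    using Cons.prems(3)[of c] by (intro z_power_even) simp
  finally show ?case
    using Cons.IH[OF _ _ _ m] Cons.prems by simp
qed simp

end

text \<open>The cycles whose product \<open>block_word\<close> represents when all parts are
  positive.\<close>

fun blocks :: "nat \<Rightarrow> nat list \<Rightarrow> nat list list" where
  "blocks m [] = []"
| "blocks m (p # ps) = [m + 1..<m + p + 1] # blocks (m + p) ps"

lemma concat_blocks: "concat (blocks m ps) = [m + 1..<m + sum_list ps + 1]"
proof (induction ps arbitrary: m)
  case (Cons p ps)
  then show ?case
    using upt_add_eq_append[of "m + 1" "m + p + 1" "sum_list ps"] by (simp add: add.assoc)
qed simp

lemma map_length_blocks: "map length (blocks m ps) = ps"
  by (induction ps arbitrary: m) auto


subsection \<open>Normalized characters as traces\<close>

text \<open>Self-maps form a monoid under composition. The spin group acts on its classes of words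
  by left translation, which brings it under the calculations with signed transpositions
  above.\<close>

datatype 'a endo = Endo (app: "'a \<Rightarrow> 'a")

instantiation endo :: (type) monoid_mult
begin
definition "1 = Endo id"
definition "x * y = Endo (app x \<circ> app y)"
instance
  by standard (simp_all add: one_endo_def times_endo_def o_assoc)
end

lemma mat_trace_mult:
  assumes "A \<in> carrier_mat d d" "B \<in> carrier_mat d d"
  shows "mat_trace (A * B) = (\<Sum>i < d. \<Sum>j < d. A $$ (i, j) * B $$ (j, i))"
  using assms by (auto simp: mat_trace_def scalar_prod_def atLeast0LessThan intro!: sum.cong)

lemma mat_trace_commute:
  assumes "A \<in> carrier_mat d d" "B \<in> carrier_mat d d"
  shows "mat_trace (A * B) = mat_trace (B * A)"
  unfolding mat_trace_mult[OF assms] mat_trace_mult[OF assms(2,1)]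
  by (subst sum.swap) (simp add: mult.commute)

locale spin_rep =
  fixes n d :: nat and \<rho> :: "spin_gen list set \<Rightarrow> complex mat"
  assumes irreducible: "irreducible_spin_rep n d \<rho>"
begin

text \<open>Left translation by the class of u, extended by the identity to sets that are no
  classes, so that \<open>E []\<close> is the unit. Applied to the class of the empty word it
  recovers the class of u, which is how \<open>M\<close> reads off the matrix.\<close>

definition E :: "spin_gen list \<Rightarrow> spin_gen list set endo" where
  "E u = Endo (\<lambda>X. if X \<in> range (spin_elt n) then spin_elt n u \<otimes>\<^bsub>spin_group n\<^esub> X else X)"

lemma E_append: "E (u @ v) = E u * E v"
  by (auto simp: E_def times_endo_def spin_mult fun_eq_iff)

lemma E_Nil: "E [] = 1"
  by (auto simp: E_def one_endo_def spin_mult fun_eq_iff)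

lemma E_cong: "spin_rel n u v \<Longrightarrow> E u = E v"
  unfolding E_def by (simp only: spin_elt_eq_iff[THEN iffD2, of n u v])

definition words :: "spin_gen list set endo set" where
  "words = E ` spin_words n"

definition M :: "spin_gen list set endo \<Rightarrow> complex mat" where
  "M x = \<rho> (app x (spin_elt n []))"

lemma M_E: "M (E u) = \<rho> (spin_elt n u)"
  by (simp add: M_def E_def spin_mult)

lemma words_one: "1 \<in> words"
  unfolding words_def E_Nil[symmetric] by (rule imageI) (simp add: spin_words_def)

lemma words_mult: "x \<in> words \<Longrightarrow> y \<in> words \<Longrightarrow> x * y \<in> words"
  by (auto simp: words_def simp flip: E_append intro!: imageI spin_words_append)

lemma words_power: "x \<in> words \<Longrightarrow> x ^ k \<in> words"
  by (induction k) (auto intro: words_one words_mult)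

lemma d_pos: "d > 0" and rep: "matrix_rep (spin_group n) d \<rho>" and rho_Z: "\<rho> (spin_elt n [Z]) = - 1\<^sub>m d"
  using irreducible by (simp_all add: irreducible_spin_rep_def irreducible_rep_def)

lemma carrier_spin_group: "carrier (spin_group n) = spin_elt n ` spin_words n"
  by (simp add: spin_group_def)

lemma M_carrier: "x \<in> words \<Longrightarrow> M x \<in> carrier_mat d d"
  using rep by (auto simp: words_def M_E matrix_rep_def carrier_spin_group)

lemma M_mult: "x \<in> words \<Longrightarrow> y \<in> words \<Longrightarrow> M (x * y) = M x * M y"
  using rep by (auto simp: words_def M_E matrix_rep_def carrier_spin_group spin_mult simp flip: E_append)

lemma M_one: "M 1 = 1\<^sub>m d"
  using rep by (simp add: M_E matrix_rep_def spin_group_def flip: E_Nil)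

abbreviation "zz \<equiv> E [Z]"

lemma zz_words: "zz \<in> words"
  by (simp add: words_def spin_words_def)

lemma t_words: "i \<in> {1..<n} \<Longrightarrow> E [spin_gen.T i] \<in> words"
  by (auto simp: words_def spin_words_def)

sublocale sg: spin_generators n "\<lambda>i. E [spin_gen.T i]" zz
proof
  show "zz * zz = 1"
    using E_cong[OF spin_rel.z_z] by (simp add: E_Nil flip: E_append)
  fix i assume i: "i \<in> {1..<n}"
  show "E [spin_gen.T i] * zz = zz * E [spin_gen.T i]"
    using E_cong[OF spin_rel.z_t[OF i]] by (simp flip: E_append)
  show "E [spin_gen.T i] * E [spin_gen.T i] = zz"
    using E_cong[OF spin_rel.t_t[OF i]] by (simp flip: E_append)
  show "(E [spin_gen.T i] * E [spin_gen.T (Suc i)]) ^ 3 = zz" if "Suc i \<in> {1..<n}"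
    using E_cong[OF spin_rel.braid[OF i that]] by (simp add: power3_eq_cube numeral_3_eq_3 flip: E_append)
  fix j assume j: "j \<in> {1..<n}" "i + 2 \<le> j \<or> j + 2 \<le> i"
  show "E [spin_gen.T i] * E [spin_gen.T j] = zz * E [spin_gen.T j] * E [spin_gen.T i]"
    using E_cong[OF spin_rel.far[OF i j]] by (simp flip: E_append)
qed

sublocale spin_system "{1..n}" sg.T zz
  by (rule sg.spin_system)

lemma T_words: "a \<in> {1..n} \<Longrightarrow> b \<in> {1..n} \<Longrightarrow> a \<noteq> b \<Longrightarrow> sg.T a b \<in> words"
proof -
  have up: "sg.up a m \<in> words" if "a \<ge> 1" "a + m < n" for a m
    using that by (induction m) (auto intro!: words_mult t_words)
  assume "a \<in> {1..n}" "b \<in> {1..n}" "a \<noteq> b"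
  then show "sg.T a b \<in> words"
    by (auto simp: sg.T_def intro!: up words_mult zz_words)
qed

lemma cyc_words: "set c \<subseteq> {1..n} \<Longrightarrow> distinct c \<Longrightarrow> cyc c \<in> words"
  by (induction c rule: cyc.induct) (auto intro!: words_mult T_words words_one)

lemma lift_words: "set (concat \<gamma>) \<subseteq> {1..n} \<Longrightarrow> distinct (concat \<gamma>) \<Longrightarrow> lift \<gamma> \<in> words"
  by (induction \<gamma>) (auto intro!: words_mult cyc_words words_one)

definition chi :: "spin_gen list set endo \<Rightarrow> complex" where
  "chi x = mat_trace (M x) / of_nat d"

lemma chi_commute: "x \<in> words \<Longrightarrow> y \<in> words \<Longrightarrow> chi (x * y) = chi (y * x)"
  using mat_trace_commute[OF M_carrier M_carrier] by (simp add: chi_def M_mult)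

lemma chi_zz: "x \<in> words \<Longrightarrow> chi (zz * x) = - chi x"
proof -
  assume x: "x \<in> words"
  have "M (zz * x) = - 1\<^sub>m d * M x"
    using x by (simp add: M_mult zz_words) (simp add: M_E rho_Z)
  also have "\<dots> = - M x"
    using M_carrier[OF x] by simp
  finally show ?thesis
    using M_carrier[OF x] by (simp add: chi_def mat_trace_def sum_negf)
qed

lemma chi_zz_power: "x \<in> words \<Longrightarrow> chi (zz ^ k * x) = (- 1) ^ k * chi x"
  by (induction k) (simp_all add: mult.assoc chi_zz words_mult words_power zz_words)

text \<open>The whole product is an even permutation and c is an odd one, so the product of the
  other cycles is odd and anticommutes with c. The trace therefore equals its negative.\<close>

lemma chi_even_cycle:
  assumes "set (concat \<gamma>) \<subseteq> {1..n}" "distinct (concat \<gamma>)" "even (\<Sum>c \<leftarrow> \<gamma>. length c - 1)"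
    and c: "c \<in> set \<gamma>" "c \<noteq> []" "even (length c)"
  shows "chi (lift \<gamma>) = 0"
proof -
  obtain a b where \<gamma>: "\<gamma> = a @ c # b"
    using c(1) by (meson split_list)
  have ab: "set (concat (a @ b)) \<subseteq> {1..n}" "distinct (concat (a @ b))" "set c \<inter> set (concat (a @ b)) = {}"
    and c': "set c \<subseteq> {1..n}" "distinct c"
    using assms(1,2) by (auto simp: \<gamma>)
  have odd: "odd (length c - 1)"
    using c(2,3) by (cases c) auto
  let ?x = "lift (a @ b)"
  have w: "?x \<in> words" "cyc c \<in> words"
    by (rule lift_words[OF ab(1,2)], rule cyc_words[OF c'])
  have "chi (cyc c * ?x) = chi (?x * cyc c)"
    using w by (rule chi_commute[rotated])
  also have "?x * cyc c = zz ^ ((length c - 1) * (\<Sum>d \<leftarrow> a @ b. length d - 1)) * cyc c * ?x"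
    by (rule lift_cyc_commute) (use ab c' in auto)
  also have "chi \<dots> = (- 1) ^ ((length c - 1) * (\<Sum>d \<leftarrow> a @ b. length d - 1)) * chi (cyc c * ?x)"
    unfolding mult.assoc using w by (intro chi_zz_power words_mult)
  also have "odd ((length c - 1) * (\<Sum>d \<leftarrow> a @ b. length d - 1))"
    using assms(3) odd by (simp add: \<gamma>)
  then have "(- 1) ^ ((length c - 1) * (\<Sum>d \<leftarrow> a @ b. length d - 1)) = (- 1 :: complex)"
    by simp
  finally have "chi (cyc c * ?x) = 0"
    by simp
  moreover have "lift \<gamma> = zz ^ ((length c - 1) * (\<Sum>d \<leftarrow> a. length d - 1)) * lift (c # a @ b)"
    unfolding \<gamma> by (rule lift_move_front) (use assms in \<open>auto simp: \<gamma>\<close>)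
  moreover have "cyc c * ?x \<in> words"
    using w by (intro words_mult)
  ultimately show ?thesis
    by (simp add: chi_zz_power)
qed

text \<open>An even product passes \<open>sg.T a b\<close> without sign, only relabelled. The square
  z of \<open>sg.T a b\<close> then contributes the same sign to both traces.\<close>

lemma chi_lift_transpose:
  assumes "a \<in> {1..n}" "b \<in> {1..n}" "a \<noteq> b" "set (concat \<gamma>) \<subseteq> {1..n}" "distinct (concat \<gamma>)"
    "even (\<Sum>c \<leftarrow> \<gamma>. length c - 1)"
  shows "chi (lift (map (map (transpose a b)) \<gamma>)) = chi (lift \<gamma>)"
proof -
  let ?\<gamma> = "map (map (transpose a b)) \<gamma>" and ?T = "sg.T a b"
  have set: "set (concat ?\<gamma>) \<subseteq> {1..n}"
    using assms by (auto simp: transpose_def)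
  have "concat ?\<gamma> = map (transpose a b) (concat \<gamma>)"
    by (simp add: map_concat)
  then have dist: "distinct (concat ?\<gamma>)"
    using assms by (simp add: distinct_map inj_on_subset[OF inj_transpose])
  have w: "lift \<gamma> \<in> words" "lift ?\<gamma> \<in> words" "?T \<in> words"
    using lift_words[OF assms(4,5)] lift_words[OF set dist] T_words assms(1-3) by auto
  have conj: "?T * lift \<gamma> = lift ?\<gamma> * ?T"
    using T_lift_conj[OF assms(1-5)] z_power_even[OF assms(6)] by simp
  have TT: "?T * ?T = zz"
    using assms by (intro TT) auto
  have comm: "lift \<delta> * zz = zz * lift \<delta>" if "set (concat \<delta>) \<subseteq> {1..n}" "distinct (concat \<delta>)" for \<delta>
    using lift_z_power[OF that, of 1] by simp
  have "chi (?T * (lift \<gamma> * ?T)) = chi ((lift \<gamma> * ?T) * ?T)"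
    using w by (intro chi_commute words_mult)
  also have "\<dots> = - chi (lift \<gamma>)"
    using w by (simp add: mult.assoc TT comm[OF assms(4,5)] chi_zz)
  finally have "- chi (lift \<gamma>) = chi ((?T * lift \<gamma>) * ?T)"
    by (simp add: mult.assoc)
  also have "\<dots> = - chi (lift ?\<gamma>)"
    unfolding conj using w by (simp add: mult.assoc TT comm[OF set dist] chi_zz)
  finally show ?thesis
    by simp
qed

lemma chi_lift_permutes:
  assumes "p permutes {1..n}" "set (concat \<gamma>) \<subseteq> {1..n}" "distinct (concat \<gamma>)"
    "even (\<Sum>c \<leftarrow> \<gamma>. length c - 1)"
  shows "chi (lift (map (map p) \<gamma>)) = chi (lift \<gamma>)"
proof -
  have "set (concat (map (map p) \<gamma>)) \<subseteq> {1..n} \<and> distinct (concat (map (map p) \<gamma>)) \<and>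
      chi (lift (map (map p) \<gamma>)) = chi (lift \<gamma>)"
    using assms(1) finite_atLeastAtMost[of 1 n]
  proof (induction rule: permutes_induct)
    case id
    then show ?case
      using assms by simp
  next
    case (swap a b p)
    let ?\<delta> = "map (map p) \<gamma>"
    have eq: "map (map (transpose a b \<circ> p)) \<gamma> = map (map (transpose a b)) ?\<delta>"
      by simp
    have c: "concat (map (map (transpose a b)) ?\<delta>) = map (transpose a b) (concat ?\<delta>)"
      by (simp add: map_concat)
    have len: "(\<Sum>c \<leftarrow> ?\<delta>. length c - 1) = (\<Sum>c \<leftarrow> \<gamma>. length c - 1)"
      by (simp add: o_def)
    have "chi (lift (map (map (transpose a b)) ?\<delta>)) = chi (lift ?\<delta>)"
    proof (cases "a = b")
      case False
      then show ?thesis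
        using swap assms(4) len by (intro chi_lift_transpose) auto
    qed simp
    moreover have "set (map (transpose a b) (concat ?\<delta>)) \<subseteq> {1..n}"
      using swap by (auto simp: transpose_def)
    moreover have "distinct (map (transpose a b) (concat ?\<delta>))"
      using swap by (simp add: distinct_map inj_on_subset[OF inj_transpose])
    ultimately show ?case
      unfolding eq c using swap by simp
  qed
  then show ?thesis
    by blast
qed

end

lemma finite_paths: "finite {p. length p = m \<and> distinct p \<and> set p \<subseteq> {1..n :: nat} - W}"
  by (rule finite_subset[OF _ finite_lists_length_eq[of "{1..n}" m]]) auto

lemma mat_mult_entry:
  fixes A B :: "complex mat"
  assumes "A \<in> carrier_mat d d" "B \<in> carrier_mat d d" "i < d" "j < d"
  shows "(A * B) $$ (i, j) = (\<Sum>l < d. A $$ (i, l) * B $$ (l, j))"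
  using assms by (simp add: scalar_prod_def atLeast0LessThan)

lemma ex_permutes_map:
  assumes "distinct xs" "distinct ys" "set xs = set ys"
  shows "\<exists>p. p permutes set xs \<and> map p xs = ys"
proof -
  have len: "length xs = length ys"
    using assms by (metis distinct_card)
  define p where "p x = (if x \<in> set xs then the (map_of (zip xs ys) x) else x)" for x
  have map: "map p xs = ys"
  proof (rule nth_equalityI)
    fix i assume "i < length (map p xs)"
    then show "map p xs ! i = ys ! i"
      using len assms(1) by (simp add: p_def map_of_zip_nth)
  qed (simp add: len)
  have "p ` set xs = set xs"
    using map assms(3) by (metis list.set_map)
  then have "bij_betw p (set xs) (set xs)"
    by (simp add: bij_betw_def eq_card_imp_inj_on)
  then have "p permutes set xs"
    by (rule bij_imp_permutes) (simp add: p_def)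
  with map show ?thesis
    by blast
qed

lemma mset_map_eq_ex_rearrangement:
  assumes "mset (map f xs) = mset ys"
  shows "\<exists>zs. mset zs = mset xs \<and> map f zs = ys"
  using assms
proof (induction ys arbitrary: xs)
  case (Cons y ys)
  have "y \<in> set (map f xs)"
    using Cons.prems by (metis list.set_intros(1) set_mset_mset)
  then obtain x where x: "x \<in> set xs" "f x = y"
    by auto
  then obtain a b where xs: "xs = a @ x # b"
    by (meson split_list)
  have "mset (map f (a @ b)) = mset ys"
    using Cons.prems x(2) by (simp add: xs)
  then obtain zs where "mset zs = mset (a @ b)" "map f zs = ys"
    using Cons.IH by blast
  then show ?case
    using x(2) by (intro exI[of _ "x # zs"]) (simp add: xs)
qed simp

lemma prod_list_yy:
  assumes "\<And>c. c \<in> set \<gamma> \<Longrightarrow> odd (length c)"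
  shows "(\<Prod>c \<leftarrow> \<gamma>. yy (length c)) = Poly_Mapping.single (mset (map length \<gamma>))
     (1 / 2 ^ ((length (concat \<gamma>) - length \<gamma>) div 2))"
  using assms
proof (induction \<gamma>)
  case (Cons c \<gamma>)
  have le: "length \<gamma> \<le> length (concat \<gamma>)" and even: "even (length (concat \<gamma>) - length \<gamma>)"
    if "\<And>c. c \<in> set \<gamma> \<Longrightarrow> odd (length c)" for \<gamma> :: "'a list list"
  proof -
    have "length \<gamma> \<le> length (concat \<gamma>) \<and> even (length (concat \<gamma>) + length \<gamma>)"
      using that
    proof (induction \<gamma>)
      case (Cons c \<gamma>)
      then have "odd (length c)" "length \<gamma> \<le> length (concat \<gamma>)" "even (length (concat \<gamma>) + length \<gamma>)"
        by auto
      then show ?case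
        by (cases c) simp_all
    qed simp
    then show "length \<gamma> \<le> length (concat \<gamma>)" "even (length (concat \<gamma>) - length \<gamma>)"
      by simp_all
  qed
  have c: "odd (length c)" "length c > 0"
    using Cons.prems[of c] by (auto simp: odd_pos)
  have "length \<gamma> \<le> length (concat \<gamma>)" "even (length (concat \<gamma>) - length \<gamma>)"
    using le[of \<gamma>] even[of \<gamma>] Cons.prems by auto
  then have "(length (concat (c # \<gamma>)) - length (c # \<gamma>)) div 2 =
      (length c - 1) div 2 + (length (concat \<gamma>) - length \<gamma>) div 2"
    using c by (auto elim!: evenE oddE)
  then show ?case
    using Cons c(1) by (simp add: yy_def mult_single power_add)
qed (simp add: mult_single)

section \<open>Character values of signed permutations, and Schur's lemma\<close>

locale spin_character = spin_rep n d \<rho>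
  for n d \<rho> +
  fixes \<phi> :: "strict_partition \<Rightarrow> nat multiset \<Rightarrow> complex" and \<xi> :: strict_partition
  assumes size: "sp_size \<xi> = n"
    and trace: "odd_partition \<pi> \<Longrightarrow> sum_mset \<pi> = n \<Longrightarrow> g \<in> conj_class_plus \<pi> \<Longrightarrow> \<phi> \<xi> \<pi> = mat_trace (\<rho> g)"
begin

lemma E_block: "E (map spin_gen.T [a..<a + k]) = cyc [a..<a + k + 1]"
proof (induction k arbitrary: a)
  case (Suc k)
  have "E (map spin_gen.T [a..<a + Suc k]) = E [spin_gen.T a] * E (map spin_gen.T [Suc a..<Suc a + k])"
    by (simp add: upt_conv_Cons flip: E_append del: upt_Suc)
  also have "\<dots> = sg.T a (Suc a) * cyc [Suc a..<Suc a + k + 1]"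
    by (simp only: Suc.IH sg.T_Suc)
  also have "\<dots> = cyc (a # Suc a # [Suc (Suc a)..<Suc a + k + 1])"
    by (simp add: upt_conv_Cons del: upt_Suc)
  also have "a # Suc a # [Suc (Suc a)..<Suc a + k + 1] = [a..<a + Suc k + 1]"
    by (simp add: upt_conv_Cons del: upt_Suc)
  finally show ?case .
qed (simp add: E_Nil)

lemma E_block_word: "(\<And>p. p \<in> set ps \<Longrightarrow> p > 0) \<Longrightarrow> E (block_word m ps) = lift (blocks m ps)"
proof (induction ps arbitrary: m)
  case (Cons p ps)
  obtain q where p: "p = Suc q"
    using Cons.prems[of p] by (auto simp: gr0_conv_Suc)
  show ?case
    using E_block[of "m + 1" q] Cons by (simp add: E_append p del: upt_Suc)
qed (simp add: E_Nil)

text \<open>The cycles are completed by fixed points, sorted by decreasing length, and relabelled to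
  the consecutive blocks of \<open>cycle_elt\<close>. None of this changes the normalised trace: odd
  cycles commute, and relabelling is a conjugation.\<close>

lemma chi_lift_odd:
  assumes "set (concat \<gamma>) \<subseteq> {1..n}" "distinct (concat \<gamma>)" "\<And>c. c \<in> set \<gamma> \<Longrightarrow> odd (length c)"
  shows "chi (lift \<gamma>) = \<phi> \<xi> (mset (map length \<gamma>) + replicate_mset (n - length (concat \<gamma>)) 1) /
    \<phi> \<xi> (replicate_mset n 1)"
proof -
  define rest where "rest = sorted_list_of_set ({1..n} - set (concat \<gamma>))"
  define \<delta> where "\<delta> = \<gamma> @ map (\<lambda>x. [x]) rest"
  define \<pi> where "\<pi> = mset (map length \<gamma>) + replicate_mset (n - length (concat \<gamma>)) 1"
  define ls where "ls = rev (sorted_list_of_multiset \<pi>)"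
  have rest: "set rest = {1..n} - set (concat \<gamma>)" "distinct rest" "length rest = n - length (concat \<gamma>)"
    using assms(1) by (simp_all only: rest_def card_Diff_subset[OF finite_set assms(1)]
        distinct_card[OF assms(2)] length_sorted_list_of_set) simp_all
  have concat_sing: "concat (map (\<lambda>x. [x]) xs) = xs" for xs :: "nat list"
    by (induction xs) auto
  have len_le: "length (concat \<gamma>) \<le> n"
    using assms(1) card_mono[of "{1..n}" "set (concat \<gamma>)"] by (simp only: distinct_card[OF assms(2)] finite_atLeastAtMost) simp
  have \<delta>: "set (concat \<delta>) = {1..n}" "distinct (concat \<delta>)" "\<And>c. c \<in> set \<delta> \<Longrightarrow> odd (length c)"
    using assms rest by (auto simp: \<delta>_def concat_sing)
  have lift_\<delta>: "lift \<delta> = lift \<gamma>"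
  proof -
    have "lift (map (\<lambda>x. [x]) xs) = 1" for xs
      by (induction xs) auto
    then show ?thesis
      by (simp add: \<delta>_def)
  qed
  have mset_\<delta>: "mset (map length \<delta>) = \<pi>"
    by (simp add: \<delta>_def \<pi>_def o_def map_replicate_const rest(3) mset_replicate)
  have ls: "mset ls = \<pi>"
    by (simp add: ls_def)
  have odd_ls: "odd l" if "l \<in> set ls" for l
  proof -
    have "l \<in># mset (map length \<delta>)"
      using that ls mset_\<delta> by (metis set_mset_mset)
    then show ?thesis
      using \<delta>(3) by auto
  qed
  obtain \<epsilon> where \<epsilon>: "mset \<epsilon> = mset \<delta>" "map length \<epsilon> = ls"
    using mset_map_eq_ex_rearrangement[of length \<delta> ls] mset_\<delta> ls by auto
  have set_\<epsilon>: "set \<epsilon> = set \<delta>"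
    using \<epsilon>(1) by (metis set_mset_mset)
  have mset_concat: "mset (concat xss) = sum_mset (image_mset mset (mset xss))" for xss :: "nat list list"
    by (induction xss) auto
  have "mset (concat \<epsilon>) = mset (concat \<delta>)"
    by (simp only: mset_concat \<epsilon>(1))
  then have \<epsilon>': "set (concat \<epsilon>) = {1..n}" "distinct (concat \<epsilon>)"
    using \<delta>(1,2) mset_eq_setD mset_eq_imp_distinct_iff by blast+
  have lift_\<epsilon>: "lift \<epsilon> = lift \<delta>"
    by (rule lift_odd_cong) (use \<epsilon> \<epsilon>' set_\<epsilon> \<delta>(3) in auto)
  have sum_ls: "sum_list ls = n"
    using \<epsilon>(2) \<epsilon>' distinct_card[of "concat \<epsilon>"] by (simp add: length_concat)
  then have blocks: "concat (blocks 0 ls) = [1..<n + 1]"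
    by (simp add: concat_blocks)
  obtain p where p: "p permutes {1..n}" "map p (concat \<epsilon>) = concat (blocks 0 ls)"
  proof -
    have "set (concat \<epsilon>) = set [1..<n + 1]"
      unfolding \<epsilon>'(1) by auto
    from ex_permutes_map[OF \<epsilon>'(2) distinct_upt this] show ?thesis
      unfolding blocks \<epsilon>'(1) using that by (simp only: blocks) blast
  qed
  have "map (map p) \<epsilon> = blocks 0 ls"
  proof (rule concat_injective)
    show "concat (map (map p) \<epsilon>) = concat (blocks 0 ls)"
      using p(2) by (simp add: map_concat)
    have "map length (map (map p) \<epsilon>) = map length (blocks 0 ls)"
      using \<epsilon>(2) by (simp add: map_length_blocks o_def)
    then show "length (map (map p) \<epsilon>) = length (blocks 0 ls)"
      by (metis length_map)
    show "\<forall>(x, y) \<in> set (zip (map (map p) \<epsilon>) (blocks 0 ls)). length x = length y"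
      using \<open>map length (map (map p) \<epsilon>) = map length (blocks 0 ls)\<close>
      by (auto simp: set_zip list_eq_iff_nth_eq)
  qed
  moreover have "even (\<Sum>c \<leftarrow> \<epsilon>. length c - 1)"
    using odd_ls unfolding \<epsilon>(2)[symmetric] by (induction \<epsilon>) auto
  ultimately have "chi (lift (blocks 0 ls)) = chi (lift \<epsilon>)"
    using chi_lift_permutes[OF p(1), of \<epsilon>] \<epsilon>' by simp
  moreover have E: "lift (blocks 0 ls) = E (block_word 0 ls)"
    using odd_ls by (intro E_block_word[symmetric]) (auto simp: odd_pos)
  moreover have sum_\<pi>: "sum_mset \<pi> = n"
    using ls sum_ls by (metis sum_mset_sum_list)
  then have "spin_elt n (block_word 0 ls) = cycle_elt \<pi>"
    by (simp add: cycle_elt_def ls_def)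
  moreover have "mat_trace (\<rho> (cycle_elt \<pi>)) = \<phi> \<xi> \<pi>"
  proof (rule trace[symmetric])
    show "odd_partition \<pi>"
      using odd_ls by (simp add: odd_partition_def ls[symmetric])
    have "lift (blocks 0 ls) \<in> words"
      by (rule lift_words) (simp_all only: blocks, auto)
    then have "E (block_word 0 ls) \<in> words"
      by (simp only: E)
    \<comment> \<open>The letters of the block word need not be inspected: it has the same
      translation as some word in the generators, hence lies in the same class.\<close>
    then obtain u where u: "u \<in> spin_words n" "E (block_word 0 ls) = E u"
      by (auto simp: words_def)
    from arg_cong[OF u(2), of "\<lambda>x. app x (spin_elt n [])"]
    have "spin_elt n (block_word 0 ls) = spin_elt n u"
      by (simp add: E_def spin_mult)
    then have "cycle_elt \<pi> \<in> carrier (spin_group (sum_mset \<pi>))"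
      using u(1) sum_\<pi> by (simp add: cycle_elt_def ls_def[symmetric] carrier_spin_group)
    then show "cycle_elt \<pi> \<in> conj_class_plus \<pi>"
      by (rule cycle_elt_in_conj_class_plus)
  qed (rule sum_\<pi>)
  ultimately have 1: "chi (lift \<gamma>) = \<phi> \<xi> \<pi> / of_nat d"
    using lift_\<delta> lift_\<epsilon> by (auto simp: chi_def M_E)
  have "\<phi> \<xi> (replicate_mset n 1) = mat_trace (\<rho> (cycle_elt (replicate_mset n 1)))"
  proof (rule trace)
    interpret group "spin_group n"
      by (rule group_spin_group)
    show "cycle_elt (replicate_mset n 1) \<in> conj_class_plus (replicate_mset n 1)"
      by (rule cycle_elt_in_conj_class_plus) (simp add: cycle_elt_ones del: One_nat_def)
  qed (auto simp: odd_partition_def)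
  also have "\<dots> = of_nat d"
    using rep by (simp add: cycle_elt_ones matrix_rep_def mat_trace_def del: One_nat_def)
  finally show ?thesis
    using 1 by (simp add: \<pi>_def)
qed

definition falling :: "nat \<Rightarrow> complex" where
  "falling N = of_nat (\<Prod>i < N. n - i)"

lemma falling_Suc: "falling (Suc N) = falling N * of_nat (n - N)"
  by (simp add: falling_def)

lemma falling_nonzero: "N \<le> n \<Longrightarrow> falling N \<noteq> 0"
  by (auto simp: falling_def)

lemma Ch_combination_large:
  assumes "\<And>\<pi>. \<pi> \<in> Poly_Mapping.keys x \<Longrightarrow> sum_mset \<pi> > n"
  shows "Ch_combination \<phi> x \<xi> = 0"
  unfolding Ch_combination_apply
  by (rule sum.neutral) (use assms size in \<open>fastforce simp: Ch_def Let_def\<close>)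

text \<open>With an even cycle both sides are 0. Otherwise the power of 2 in \<open>Ch\<close>
  cancels against those in \<open>yy\<close>. The parity hypothesis says that the permutation is
  even.\<close>

lemma chi_lift:
  assumes "set (concat \<gamma>) \<subseteq> {1..n}" "distinct (concat \<gamma>)" "[] \<notin> set \<gamma>" "even (\<Sum>c \<leftarrow> \<gamma>. length c + 1)"
  shows "falling (length (concat \<gamma>)) * chi (lift \<gamma>) = Ch_combination \<phi> (\<Prod>c \<leftarrow> \<gamma>. yy (length c)) \<xi>"
proof (cases "\<exists>c \<in> set \<gamma>. even (length c)")
  case True
  then obtain c where c: "c \<in> set \<gamma>" "even (length c)"
    by blast
  have "even (\<Sum>c \<leftarrow> \<gamma>. length c - 1) = even (\<Sum>c \<leftarrow> \<gamma>. length c + 1)"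
    using assms(3) by (induction \<gamma>) auto
  then have "chi (lift \<gamma>) = 0"
    using assms c by (intro chi_even_cycle[of _ c]) auto
  moreover have "(\<Prod>c \<leftarrow> \<gamma>. yy (length c)) = 0"
    using c by (induction \<gamma>) auto
  ultimately show ?thesis
    by simp
next
  case False
  then have odd: "odd (length c)" if "c \<in> set \<gamma>" for c
    using that by blast
  let ?N = "length (concat \<gamma>)"
  have le: "?N \<le> n"
    using assms(1) card_mono[of "{1..n}" "set (concat \<gamma>)"] by (simp only: distinct_card[OF assms(2)] finite_atLeastAtMost) simp
  have sum: "sum_mset (mset (map length \<gamma>)) = ?N"
    by (simp only: sum_mset_sum_list length_concat)
  have "Ch_combination \<phi> (\<Prod>c \<leftarrow> \<gamma>. yy (length c)) \<xi> =
      1 / 2 ^ ((?N - length \<gamma>) div 2) * Ch \<phi> (mset (map length \<gamma>)) \<xi>"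
    using prod_list_yy[of \<gamma>] odd by (simp add: Ch_combination_single fscale_def)
  also have "Ch \<phi> (mset (map length \<gamma>)) \<xi> = falling ?N * 2 ^ ((?N - length \<gamma>) div 2) *
      \<phi> \<xi> (mset (map length \<gamma>) + replicate_mset (n - ?N) 1) / \<phi> \<xi> (replicate_mset n 1)"
    unfolding Ch_def Let_def sum size using le by (simp add: falling_def)
  finally show ?thesis
    using chi_lift_odd[OF assms(1,2) odd] by simp
qed

text \<open>An eigenspace of S is invariant under the generators, hence under the group, and
  irreducibility makes it the whole space.\<close>

lemma Schur_scalar:
  assumes S: "S \<in> carrier_mat d d"
    and comm: "\<And>i. i \<in> {1..<n} \<Longrightarrow> M (E [spin_gen.T i]) * S = S * M (E [spin_gen.T i])"
  shows "\<exists>c. S = c \<cdot>\<^sub>m 1\<^sub>m d"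
proof -
  obtain c where "eigenvalue S c"
    using spectrum_non_empty[OF S d_pos] by (auto simp: spectrum_def)
  then obtain v where v: "v \<in> carrier_vec d" "v \<noteq> 0\<^sub>v d" "S *\<^sub>v v = c \<cdot>\<^sub>v v"
    using S by (auto simp: eigenvalue_def eigenvector_def)
  have comm': "M (E u) * S = S * M (E u)" if "u \<in> spin_words n" for u
    using that
  proof (induction u)
    case Nil
    then show ?case
      using S by (simp add: E_Nil M_one)
  next
    case (Cons g u)
    then have u: "E u \<in> words" "M (E u) * S = S * M (E u)" and g: "g = Z \<or> (\<exists>i \<in> {1..<n}. g = spin_gen.T i)"
      by (auto simp: words_def spin_words_def)
    have gw: "E [g] \<in> words"
      using g zz_words t_words by auto
    have "M (E [g]) * S = S * M (E [g])"
      using g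
    proof
      assume "g = Z"
      then show ?thesis
        using S by (simp add: M_E rho_Z)
    qed (use comm in auto)
    moreover have "M (E (g # u)) = M (E [g]) * M (E u)"
      using gw u(1) by (simp flip: M_mult E_append)
    moreover have "G * U * S = S * (G * U)"
      if "U * S = S * U" "G * S = S * G" "G \<in> carrier_mat d d" "U \<in> carrier_mat d d" for G U
    proof -
      have "G * U * S = G * (U * S)"
        using that S by (intro assoc_mult_mat)
      also have "\<dots> = G * S * U"
        unfolding that(1) using that S by (intro assoc_mult_mat[symmetric])
      also have "\<dots> = S * (G * U)"
        unfolding that(2) using that S by (intro assoc_mult_mat)
      finally show ?thesis .
    qed
    ultimately show ?case
      using u M_carrier[OF gw] M_carrier[OF u(1)] by simp
  qed
  define W where "W = {v \<in> carrier_vec d. S *\<^sub>v v = c \<cdot>\<^sub>v v}"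
  have "W = {0\<^sub>v d} \<or> W = carrier_vec d"
  proof -
    have "W \<subseteq> carrier_vec d"
      by (auto simp: W_def)
    moreover have "0\<^sub>v d \<in> W"
      using S by (auto simp: W_def scalar_prod_def intro!: eq_vecI)
    moreover have "\<forall>v \<in> W. \<forall>w \<in> W. v + w \<in> W"
      using S by (auto simp: W_def mult_add_distrib_mat_vec smult_add_distrib_vec[of _ d])
    moreover have "\<forall>a. \<forall>v \<in> W. a \<cdot>\<^sub>v v \<in> W"
      using S by (auto simp: W_def mult_mat_vec[of S d d] smult_smult_assoc mult.commute)
    moreover have "\<forall>g \<in> carrier (spin_group n). \<forall>v \<in> W. \<rho> g *\<^sub>v v \<in> W"
    proof (intro ballI)
      fix g w assume "g \<in> carrier (spin_group n)" "w \<in> W"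
      then obtain u where u: "u \<in> spin_words n" "\<rho> g = M (E u)"
        by (auto simp: carrier_spin_group M_E)
      have w: "w \<in> carrier_vec d" "S *\<^sub>v w = c \<cdot>\<^sub>v w"
        using \<open>w \<in> W\<close> by (auto simp: W_def)
      have m: "M (E u) \<in> carrier_mat d d"
        using u by (intro M_carrier) (simp add: words_def)
      have "S *\<^sub>v (M (E u) *\<^sub>v w) = (S * M (E u)) *\<^sub>v w"
        using S m w by (simp add: assoc_mult_mat_vec[of S d d _ d])
      also have "\<dots> = M (E u) *\<^sub>v (S *\<^sub>v w)"
        using S m w by (simp add: comm'[OF u(1), symmetric] assoc_mult_mat_vec[of _ d d S d])
      also have "\<dots> = c \<cdot>\<^sub>v (M (E u) *\<^sub>v w)"
        using m w by (simp add: mult_mat_vec)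
      finally show "\<rho> g *\<^sub>v w \<in> W"
        using m w by (simp add: W_def u(2))
    qed
    ultimately show ?thesis
      using irreducible unfolding irreducible_spin_rep_def irreducible_rep_def by blast
  qed
  then have all: "S *\<^sub>v w = c \<cdot>\<^sub>v w" if "w \<in> carrier_vec d" for w
    using that v by (auto simp: W_def)
  have "S = c \<cdot>\<^sub>m 1\<^sub>m d"
  proof (rule eq_matI)
    fix i j assume ij: "i < dim_row (c \<cdot>\<^sub>m 1\<^sub>m d)" "j < dim_col (c \<cdot>\<^sub>m 1\<^sub>m d)"
    then have "S $$ (i, j) = (S *\<^sub>v unit_vec d j) $ i"
      using S by (simp add: scalar_prod_right_unit[of _ d])
    also have "\<dots> = (c \<cdot>\<^sub>v unit_vec d j) $ i"
      by (simp add: all)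
    finally show "S $$ (i, j) = (c \<cdot>\<^sub>m 1\<^sub>m d) $$ (i, j)"
      using ij by auto
  qed (use S in auto)
  then show ?thesis
    by blast
qed

text \<open>Conjugation by a generator permutes the words p and costs k - 1 factors z, which cancel
  for odd k. So the sum of all signed k-cycles is a scalar matrix, and its normalised trace is the
  scalar.\<close>

lemma sum_paths_central:
  assumes "odd k" "x \<in> words"
  shows "(\<Sum>p \<in> {p. length p = k \<and> distinct p \<and> set p \<subseteq> {1..n}}. chi (cyc p * x)) =
    (\<Sum>p \<in> {p. length p = k \<and> distinct p \<and> set p \<subseteq> {1..n}}. chi (cyc p)) * chi x"
proof -
  let ?P = "{p. length p = k \<and> distinct p \<and> set p \<subseteq> {1..n}}"
  define S where "S = mat d d (\<lambda>(i, j). \<Sum>p \<in> ?P. M (cyc p) $$ (i, j))"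
  have S: "S \<in> carrier_mat d d"
    by (simp add: S_def)
  have P: "cyc p \<in> words" if "p \<in> ?P" for p
    using that by (intro cyc_words) auto
  have mult_left: "(A * S) $$ (i, j) = (\<Sum>p \<in> ?P. (A * M (cyc p)) $$ (i, j))"
    if "A \<in> carrier_mat d d" "i < d" "j < d" for A i j
  proof -
    have "(A * S) $$ (i, j) = (\<Sum>l < d. \<Sum>p \<in> ?P. A $$ (i, l) * M (cyc p) $$ (l, j))"
      using that S by (simp add: scalar_prod_def S_def atLeast0LessThan sum_distrib_left)
    also have "\<dots> = (\<Sum>p \<in> ?P. \<Sum>l < d. A $$ (i, l) * M (cyc p) $$ (l, j))"
      by (rule sum.swap)
    also have "\<dots> = (\<Sum>p \<in> ?P. (A * M (cyc p)) $$ (i, j))"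
      using that M_carrier[OF P] by (intro sum.cong HOL.refl) (simp add: mat_mult_entry[of _ d])
    finally show ?thesis .
  qed
  have mult_right: "(S * A) $$ (i, j) = (\<Sum>p \<in> ?P. (M (cyc p) * A) $$ (i, j))"
    if "A \<in> carrier_mat d d" "i < d" "j < d" for A i j
  proof -
    have "(S * A) $$ (i, j) = (\<Sum>l < d. \<Sum>p \<in> ?P. M (cyc p) $$ (i, l) * A $$ (l, j))"
      using that S by (simp add: scalar_prod_def S_def atLeast0LessThan sum_distrib_right)
    also have "\<dots> = (\<Sum>p \<in> ?P. \<Sum>l < d. M (cyc p) $$ (i, l) * A $$ (l, j))"
      by (rule sum.swap)
    also have "\<dots> = (\<Sum>p \<in> ?P. (M (cyc p) * A) $$ (i, j))"
      using that M_carrier[OF P] by (intro sum.cong HOL.refl) (simp add: mat_mult_entry[of _ d])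
    finally show ?thesis .
  qed
  have "M (E [spin_gen.T i]) * S = S * M (E [spin_gen.T i])" if i: "i \<in> {1..<n}" for i
  proof (rule eq_matI)
    let ?t = "E [spin_gen.T i]" and ?s = "transpose i (Suc i)"
    have t: "M ?t \<in> carrier_mat d d"
      using i by (intro M_carrier t_words)
    fix a b assume "a < dim_row (S * M ?t)" "b < dim_col (S * M ?t)"
    then have ab: "a < d" "b < d"
      using S t by auto
    have conj: "?t * cyc p = cyc (map ?s p) * ?t" if "p \<in> ?P" for p
      using T_conj_cyc[of i "Suc i" p] that i assms(1) z_power_even[of "k - 1"] by (simp add: sg.T_Suc)
    have sP: "map ?s p \<in> ?P" if "p \<in> ?P" for p
      using that i by (auto simp: distinct_map inj_on_subset[OF inj_transpose] transpose_def)
    have ss: "map ?s (map ?s p) = p" for p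
      by (simp add: o_def)
    have "(M ?t * S) $$ (a, b) = (\<Sum>p \<in> ?P. M (?t * cyc p) $$ (a, b))"
      using mult_left[OF t ab] P i by (simp add: M_mult t_words)
    also have "\<dots> = (\<Sum>p \<in> ?P. M (cyc (map ?s p) * ?t) $$ (a, b))"
      by (simp add: conj)
    also have "\<dots> = (\<Sum>p \<in> ?P. M (cyc p * ?t) $$ (a, b))"
      by (rule sum.reindex_bij_witness[of _ "map ?s" "map ?s"]) (auto simp only: sP ss)
    also have "\<dots> = (S * M ?t) $$ (a, b)"
      using mult_right[OF t ab] P i by (simp add: M_mult t_words)
    finally show "(M ?t * S) $$ (a, b) = (S * M ?t) $$ (a, b)" .
  qed (use S M_carrier[OF t_words[OF that]] in auto)
  then obtain c where c: "S = c \<cdot>\<^sub>m 1\<^sub>m d"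
    using Schur_scalar[OF S] by blast
  have tr: "(\<Sum>p \<in> ?P. mat_trace (M (cyc p) * A)) = c * mat_trace A" if "A \<in> carrier_mat d d" for A
  proof -
    have "(\<Sum>p \<in> ?P. mat_trace (M (cyc p) * A)) = (\<Sum>p \<in> ?P. \<Sum>i < d. (M (cyc p) * A) $$ (i, i))"
      using M_carrier[OF P] that by (intro sum.cong HOL.refl) (auto simp: mat_trace_def)
    also have "\<dots> = (\<Sum>i < d. (S * A) $$ (i, i))"
      by (subst sum.swap) (simp add: mult_right that)
    also have "\<dots> = c * mat_trace A"
      using that by (simp add: c mat_trace_def sum_distrib_left)
    finally show ?thesis .
  qed
  have "(\<Sum>p \<in> ?P. chi (cyc p * x)) = c * chi x"
    using tr[OF M_carrier[OF assms(2)]] P assms(2)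
    by (simp add: chi_def M_mult sum_divide_distrib[symmetric])
  moreover have "(\<Sum>p \<in> ?P. chi (cyc p)) = c"
  proof -
    have "(\<Sum>p \<in> ?P. mat_trace (M (cyc p) * 1\<^sub>m d)) = (\<Sum>p \<in> ?P. mat_trace (M (cyc p)))"
      using M_carrier[OF P] by (intro sum.cong HOL.refl) (simp add: right_mult_one_mat[of _ d d])
    then show ?thesis
      using tr[of "1\<^sub>m d"] d_pos by (simp add: chi_def sum_divide_distrib[symmetric] mat_trace_def)
  qed
  ultimately show ?thesis
    by simp
qed

end

subsection \<open>The product of a character with the character of a cycle\<close>

text \<open>W is the set of points already visited. The flags are all that the walk remembers of a
  cycle.\<close>

definition flags :: "nat set \<Rightarrow> nat list \<Rightarrow> bool list" where
  "flags W c = map (\<lambda>x. x \<notin> W) c"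

lemma flags_simps [simp]:
  "length (flags W c) = length c" "flags W [] = []" "flags W (x # c) = (x \<notin> W) # flags W c"
  "flags W (a @ b) = flags W a @ flags W b"
  by (simp_all add: flags_def)

lemma flags_insert: "x \<notin> set c \<Longrightarrow> flags (insert x W) c = flags W c"
  by (auto simp: flags_def)

lemma map_flags_insert: "x \<notin> set (concat A) \<Longrightarrow> map (flags (insert x W)) A = map (flags W) A"
  by (induction A) (simp_all add: flags_insert)

lemma flags_all_available: "set c \<inter> W = {} \<Longrightarrow> flags W c = replicate (length c) True"
  by (induction c) auto

lemma sum_list_filter_flags:
  fixes g :: "nat \<Rightarrow> complex"
  shows "sum_list (map g (filter (\<lambda>x. x \<notin> W) c)) = (\<Sum>q \<in> {q. q < length c \<and> flags W c ! q}. g (c ! q))"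
proof -
  have "sum_list (map g (filter (\<lambda>x. x \<notin> W) c)) = (\<Sum>x \<leftarrow> c. if x \<notin> W then g x else 0)"
    by (induction c) auto
  also have "\<dots> = (\<Sum>q < length c. if c ! q \<notin> W then g (c ! q) else 0)"
    by (simp add: sum_list_sum_nth atLeast0LessThan)
  also have "\<dots> = (\<Sum>q \<in> {q. q < length c \<and> flags W c ! q}. g (c ! q))"
    by (rule sum.mono_neutral_cong_right) (auto simp: flags_def)
  finally show ?thesis .
qed

lemma Ch_combination_sign: "Ch_combination \<phi> ((- 1) ^ e * x) \<xi> = (- 1) ^ e * Ch_combination \<phi> x \<xi>"
  by (simp add: minus_one_power_scale Ch_combination_pscale fscale_def)

lemma Ch_combination_of_nat: "Ch_combination \<phi> (of_nat k * x) \<xi> = of_nat k * Ch_combination \<phi> x \<xi>"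
  by (simp add: Ch_combination_pscale fscale_def flip: pscale_of_nat)

lemma sum_fun_apply: "(\<Sum>i \<in> I. f i) x = (\<Sum>i \<in> I. f i x)"
  by (induction I rule: infinite_finite_induct) auto

context spin_character
begin

text \<open>The m points still to be chosen, outside the visited set W, with the next one last: with
  current cycle c, the factor still to be multiplied is \<open>cyc (p @ take 1 c)\<close>.\<close>

definition paths :: "nat \<Rightarrow> nat set \<Rightarrow> nat list set" where
  "paths m W = {p. length p = m \<and> distinct p \<and> set p \<subseteq> {1..n} - W}"

lemma sum_paths_Suc:
  "(\<Sum>p \<in> paths (Suc m) W. f p) = (\<Sum>x \<in> {1..n} - W. \<Sum>p \<in> paths m (insert x W). f (p @ [x]))"
proof -
  have fin: "finite (paths m W)" for m W
    unfolding paths_def by (rule finite_paths)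
  have "(\<Sum>x \<in> {1..n} - W. \<Sum>p \<in> paths m (insert x W). f (p @ [x]))
      = (\<Sum>(x, p) \<in> Sigma ({1..n} - W) (\<lambda>x. paths m (insert x W)). f (p @ [x]))"
    using fin by (subst sum.Sigma) auto
  also have "\<dots> = (\<Sum>p \<in> paths (Suc m) W. f p)"
  proof (rule sum.reindex_bij_witness[of _ "\<lambda>p. (last p, butlast p)" "\<lambda>(x, p). p @ [x]"])
    fix p assume p: "p \<in> paths (Suc m) W"
    then obtain q x where "p = q @ [x]"
      by (cases p rule: rev_cases) (auto simp: paths_def)
    with p show "(case (last p, butlast p) of (x, p) \<Rightarrow> p @ [x]) = p"
      "(last p, butlast p) \<in> Sigma ({1..n} - W) (\<lambda>x. paths m (insert x W))"
      by (auto simp: paths_def)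
  qed (auto simp: paths_def)
  finally show ?thesis ..
qed

text \<open>The rightmost transposition of the path is carried out; the factors z that arise pass to
  the front and become a sign.\<close>

lemma sum_paths_step:
  assumes x: "x \<in> {1..n}" "x \<in> W'"
    and step: "cyc (x # take 1 c) * lift \<gamma> = zz ^ e * lift ((x # c') # D)"
    and \<gamma>': "set (concat ((x # c') # D)) \<subseteq> {1..n}" "distinct (concat ((x # c') # D))"
  shows "(\<Sum>p \<in> paths m W'. chi (cyc (p @ x # take 1 c) * lift \<gamma>)) =
    (- 1) ^ e * (\<Sum>p \<in> paths m W'. chi (cyc (p @ take 1 (x # c')) * lift ((x # c') # D)))"
  unfolding sum_distrib_left
proof (rule sum.cong[OF HOL.refl])
  fix p assume "p \<in> paths m W'"
  then have p: "set (p @ [x]) \<subseteq> {1..n}" "distinct (p @ [x])"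
    using x by (auto simp: paths_def)
  have "cyc (p @ x # take 1 c) * lift \<gamma> = cyc (p @ [x]) * (cyc (x # take 1 c) * lift \<gamma>)"
    by (subst cyc_append) (simp add: mult.assoc)
  also have "\<dots> = (cyc (p @ [x]) * zz ^ e) * lift ((x # c') # D)"
    unfolding step by (simp only: mult.assoc)
  also have "cyc (p @ [x]) * zz ^ e = zz ^ e * cyc (p @ [x])"
    using p by (rule cyc_z_power)
  finally have "cyc (p @ x # take 1 c) * lift \<gamma> = zz ^ e * (cyc (p @ [x]) * lift ((x # c') # D))"
    by (simp only: mult.assoc)
  moreover have "cyc (p @ [x]) * lift ((x # c') # D) \<in> words"
    by (intro words_mult cyc_words lift_words p \<gamma>')
  ultimately show "chi (cyc (p @ x # take 1 c) * lift \<gamma>) =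
      (- 1) ^ e * chi (cyc (p @ take 1 (x # c')) * lift ((x # c') # D))"
    by (simp add: chi_zz_power del: lift_simps)
qed

lemma sum_points:
  fixes g :: "nat \<Rightarrow> complex"
  assumes "distinct (concat \<gamma>)" "set (concat \<gamma>) \<subseteq> {1..n}" "W \<subseteq> set (concat \<gamma>)"
  shows "(\<Sum>x \<in> {1..n} - W. g x) = (\<Sum>x \<in> {1..n} - set (concat \<gamma>). g x) +
    (\<Sum>c \<leftarrow> \<gamma>. \<Sum>q \<in> {q. q < length c \<and> flags W c ! q}. g (c ! q))"
proof -
  have "{1..n} - W = ({1..n} - set (concat \<gamma>)) \<union> set (filter (\<lambda>x. x \<notin> W) (concat \<gamma>))"
    using assms(2,3) by auto
  then have "(\<Sum>x \<in> {1..n} - W. g x) = (\<Sum>x \<in> {1..n} - set (concat \<gamma>). g x) +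
      (\<Sum>x \<in> set (filter (\<lambda>x. x \<notin> W) (concat \<gamma>)). g x)"
    by (simp only:, intro sum.union_disjoint) auto
  also have "(\<Sum>x \<in> set (filter (\<lambda>x. x \<notin> W) (concat \<gamma>)). g x) =
      sum_list (map g (filter (\<lambda>x. x \<notin> W) (concat \<gamma>)))"
    using assms(1) by (intro sum.distinct_set_conv_list distinct_filter)
  also have "\<dots> = (\<Sum>c \<leftarrow> \<gamma>. sum_list (map g (filter (\<lambda>x. x \<notin> W) c)))"
    by (induction \<gamma>) simp_all
  finally show ?thesis
    by (simp add: sum_list_filter_flags)
qed

text \<open>The link between group and polynomials, by induction on the number of points still to
  come. The head of c is the current point, A and \<open>map u is\<close> are the changed and the
  untouched cycles, and the parity hypothesis makes the final product an even permutation, as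
  \<open>chi_lift\<close> demands.\<close>

lemma walk_correct:
  assumes "distinct (concat (c # A @ map u is))" "set (concat (c # A @ map u is)) \<subseteq> {1..n}"
    and "[] \<notin> set A" "c = [] \<Longrightarrow> m > 0" "c \<noteq> [] \<Longrightarrow> hd c \<in> W" "distinct is"
    and "\<And>i. i \<in> set is \<Longrightarrow> length (u i) = s i \<and> odd (s i)"
    and "W \<subseteq> set c \<union> set (concat A)" "even (m + (\<Sum>a \<leftarrow> c # A. length a + 1))"
  shows "falling (length (concat (c # A @ map u is))) *
      (\<Sum>p \<in> paths m W. chi (cyc (p @ take 1 c) * lift (c # A @ map u is))) =
    Ch_combination \<phi> (walk (remain s) s m (flags W c) (map (flags W) A) (set is)) \<xi>"
  using assms
proof (induction m arbitrary: c A W "is")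
  case 0
  let ?\<gamma> = "c # A @ map u is"
  have "paths 0 W = {[]}"
    by (auto simp: paths_def)
  moreover have "cyc (take 1 c) = 1"
    by (cases c) simp_all
  moreover have "falling (length (concat ?\<gamma>)) * chi (lift ?\<gamma>) = Ch_combination \<phi> (\<Prod>c \<leftarrow> ?\<gamma>. yy (length c)) \<xi>"
  proof (rule chi_lift)
    have "[] \<noteq> u i" if "i \<in> set is" for i
      using 0(7)[OF that] by auto
    then show "[] \<notin> set ?\<gamma>"
      using 0(3,4) by auto
    have "even (\<Sum>c \<leftarrow> map u is. length c + 1)"
      using 0(7) by (induction "is") auto
    then show "even (\<Sum>c \<leftarrow> ?\<gamma>. length c + 1)"
      using 0(9) by simp
  qed (use 0 in auto)
  moreover have "(\<Prod>i \<leftarrow> is. yy (length (u i))) = remain s (set is)"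
  proof -
    have "(\<Prod>i \<leftarrow> is. yy (length (u i))) = (\<Prod>i \<leftarrow> is. yy (s i))"
      using 0(7) by (intro arg_cong[where f = prod_list] map_cong) auto
    then show ?thesis
      using 0(6) by (simp add: remain_def prod.distinct_set_conv_list)
  qed
  ultimately show ?case
    by (simp add: o_def mult.assoc del: lift_simps)
next
  case (Suc m)
  let ?\<gamma> = "c # A @ map u is"
  let ?N = "length (concat ?\<gamma>)"
  \<comment> \<open>\<open>G x\<close> is the part of the sum in which x is the next point.\<close>
  define G where "G x = (\<Sum>p \<in> paths m (insert x W). chi (cyc (p @ x # take 1 c) * lift ?\<gamma>))" for x
  note dist = Suc.prems(1) and sub = Suc.prems(2)
  have W: "W \<subseteq> set (concat ?\<gamma>)"
    using Suc.prems(8) by auto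
  have W_n: "W \<subseteq> {1..n}"
    using W sub by blast
  \<comment> \<open>Common to all kinds of steps: an equation between configurations with sign
    exponent e, followed by the induction hypothesis with x added to the visited points.\<close>
  have main: "falling (length (concat ((x # c') # A' @ map u is'))) * G x = (- 1) ^ e *
      Ch_combination \<phi> (walk (remain s) s m (False # flags W c') (map (flags W) A') (set is')) \<xi>"
    if step: "cyc (x # take 1 c) * lift ?\<gamma> = zz ^ e * lift ((x # c') # A' @ map u is')"
      and new: "distinct (concat ((x # c') # A' @ map u is'))" "set (concat ((x # c') # A' @ map u is')) \<subseteq> {1..n}"
        "[] \<notin> set A'" "distinct is'" "set is' \<subseteq> set is" "W \<subseteq> set (x # c') \<union> set (concat A')"
        "even (m + (\<Sum>a \<leftarrow> (x # c') # A'. length a + 1))"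
    for x c' A' is' e
  proof -
    have x: "x \<notin> set c'" "x \<notin> set (concat A')" "x \<in> {1..n}"
      using new(1,2) by auto
    have "falling (length (concat ((x # c') # A' @ map u is'))) *
        (\<Sum>p \<in> paths m (insert x W). chi (cyc (p @ take 1 (x # c')) * lift ((x # c') # A' @ map u is'))) =
        Ch_combination \<phi> (walk (remain s) s m (flags (insert x W) (x # c')) (map (flags (insert x W)) A') (set is')) \<xi>"
      by (rule Suc.IH) (use new Suc.prems(7) in auto)
    moreover have "G x = (- 1) ^ e *
        (\<Sum>p \<in> paths m (insert x W). chi (cyc (p @ take 1 (x # c')) * lift ((x # c') # A' @ map u is')))"
      unfolding G_def using x new by (intro sum_paths_step step) auto
    ultimately show ?thesis
      using x by (simp add: flags_insert map_flags_insert mult.left_commute del: lift_simps concat.simps)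
  qed
  have fresh: "falling ?N * (\<Sum>x \<in> {1..n} - set (concat ?\<gamma>). G x) =
      Ch_combination \<phi> (walk (remain s) s m (False # flags W c) (map (flags W) A) (set is)) \<xi>"
    (is "_ = ?R")
  proof -
    have G: "falling (Suc ?N) * G x = ?R" if x: "x \<in> {1..n} - set (concat ?\<gamma>)" for x
    proof -
      have "falling (length (concat ((x # c) # A @ map u is))) * G x = (- 1) ^ 0 * ?R"
        by (rule main) (use x Suc.prems step_fresh[of x c "A @ map u is"] in auto)
      then show ?thesis
        by simp
    qed
    have card: "card ({1..n} - set (concat ?\<gamma>)) = n - ?N"
      using card_Diff_subset[OF finite_set sub] distinct_card[OF dist] by simp
    have le: "?N \<le> n"
      using card_mono[OF _ sub] distinct_card[OF dist] by simp
    show ?thesis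
    proof (cases "?N = n")
      \<comment> \<open>No fresh point is left. The right-hand side vanishes too, as all its
        monomials have size greater than n.\<close>
      case True
      then have "{1..n} - set (concat ?\<gamma>) = {}"
        using card by (subst card_0_eq[symmetric]) simp_all
      moreover have "?R = 0"
      proof (rule Ch_combination_large)
        fix \<pi> assume "\<pi> \<in> Poly_Mapping.keys (walk (remain s) s m (False # flags W c) (map (flags W) A) (set is))"
        then have "length (False # flags W c) + (\<Sum>a \<leftarrow> map (flags W) A. length a) + (\<Sum>i \<in> set is. s i) \<le> sum_mset \<pi>"
          by (intro walk_remain_size) auto
        moreover have "(\<Sum>i \<in> set is. s i) = (\<Sum>i \<leftarrow> is. length (u i))"
        proof -
          have "(\<Sum>i \<leftarrow> is. length (u i)) = (\<Sum>i \<leftarrow> is. s i)"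
            using Suc.prems(7) by (intro arg_cong[where f = sum_list] map_cong) auto
          then show ?thesis
            using Suc.prems(6) by (simp add: sum.distinct_set_conv_list)
        qed
        ultimately show "sum_mset \<pi> > n"
          using True by (simp add: length_concat o_def)
      qed
      ultimately show ?thesis
        by (simp only: sum.empty mult_zero_right)
    next
      case False
      \<comment> \<open>There are n - N equal summands, and n - N is the factor that
        \<open>falling (Suc ?N)\<close> has in addition to \<open>falling ?N\<close>.\<close>
      then have "Suc ?N \<le> n"
        using le by linarith
      then have F: "falling (Suc ?N) \<noteq> 0"
        by (rule falling_nonzero)
      have "(\<Sum>x \<in> {1..n} - set (concat ?\<gamma>). G x) = (\<Sum>x \<in> {1..n} - set (concat ?\<gamma>). ?R / falling (Suc ?N))"
        using G F by (intro sum.cong HOL.refl) (simp add: field_simps)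
      also have "\<dots> = of_nat (n - ?N) * (?R / falling (Suc ?N))"
        by (simp only: sum_constant card)
      finally show ?thesis
        using F falling_Suc[of ?N] by (simp add: field_simps del: concat.simps concat_append)
    qed
  qed
  have cut: "falling ?N * G (c ! q) = Ch_combination \<phi> ((- 1) ^ ((q - 1) * (length (flags W c) - q)) *
      walk (remain s) s m (False # drop (Suc q) (flags W c)) (take q (flags W c) # map (flags W) A) (set is)) \<xi>"
    if q: "q \<in> {1..<length c}" for q
  proof -
    define x B where "x = c ! q" and "B = drop (Suc q) c"
    obtain y a where ya: "take q c = y # a"
      using q by (cases "take q c") auto
    have c: "c = y # a @ x # B"
      using id_take_nth_drop[of q c] q ya by (simp add: x_def B_def)
    have len: "length a = q - 1" "Suc (length B) = length c - q"
      using q ya c by (auto dest: arg_cong[of _ _ length])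
    have q': "q = Suc (length a)"
      using len q by simp
    have "falling (length (concat ((x # B) # ((y # a) # A) @ map u is))) * G x = (- 1) ^ (length a * (1 + length B)) *
        Ch_combination \<phi> (walk (remain s) s m (False # flags W B) (map (flags W) ((y # a) # A)) (set is)) \<xi>"
    proof (rule main)
      have "set (y # a @ x # B) \<subseteq> {1..n}" "distinct (y # a @ x # B)"
        using dist sub by (auto simp: c)
      from step_cut[OF this, of "A @ map u is"]
      show "cyc (x # take 1 c) * lift ?\<gamma> =
          zz ^ (length a * (1 + length B)) * lift ((x # B) # ((y # a) # A) @ map u is)"
        by (simp add: c)
      show "distinct (concat ((x # B) # ((y # a) # A) @ map u is))"
        "set (concat ((x # B) # ((y # a) # A) @ map u is)) \<subseteq> {1..n}"
        using dist sub unfolding c by auto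
      show "W \<subseteq> set (x # B) \<union> set (concat ((y # a) # A))"
        using Suc.prems(8) unfolding c by auto
      show "even (m + (\<Sum>a \<leftarrow> (x # B) # (y # a) # A. length a + 1))"
        using Suc.prems(9) unfolding c by auto
    qed (use Suc.prems in auto)
    moreover have "length (concat ((x # B) # ((y # a) # A) @ map u is)) = ?N"
      by (simp add: c)
    moreover have "length a * (1 + length B) = (q - 1) * (length (flags W c) - q)"
      using len by simp
    moreover have "drop (Suc q) (flags W c) = flags W B" "take q (flags W c) = flags W (y # a)"
      by (simp_all add: c q')
    ultimately show ?thesis
      by (simp add: x_def[symmetric] Ch_combination_sign del: concat.simps concat_append flags_simps(3,4))
  qed
  have join: "falling ?N * G (A ! j ! q) = Ch_combination \<phi> ((- 1) ^ join_sign (flags W c) (map (flags W) A) j q *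
      walk (remain s) s m (False # drop (Suc q) (map (flags W) A ! j) @ take q (map (flags W) A ! j) @ flags W c)
        (take j (map (flags W) A) @ drop (Suc j) (map (flags W) A)) (set is)) \<xi>"
    if jq: "j < length A" "q < length (A ! j)" for j q
  proof -
    define x a B D1 D2 where "x = A ! j ! q" and "a = take q (A ! j)" and "B = drop (Suc q) (A ! j)"
      and "D1 = take j A" and "D2 = drop (Suc j) A"
    have Aj: "A ! j = a @ x # B"
      using id_take_nth_drop[OF jq(2)] by (simp add: x_def a_def B_def)
    have A: "A = D1 @ (a @ x # B) # D2"
      using id_take_nth_drop[OF jq(1)] by (simp add: Aj D1_def D2_def)
    have len: "length D1 = j" "length a = q"
      using jq by (simp_all add: D1_def a_def)
    define e where "e = (length (a @ x # B) - 1) * ((\<Sum>d \<leftarrow> D1. length d - 1) + (length B + 1) + length c)"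
    have "falling (length (concat ((x # B @ a @ c) # (D1 @ D2) @ map u is))) * G x = (- 1) ^ e *
        Ch_combination \<phi> (walk (remain s) s m (False # flags W (B @ a @ c)) (map (flags W) (D1 @ D2)) (set is)) \<xi>"
    proof (rule main)
      show "cyc (x # take 1 c) * lift ?\<gamma> = zz ^ e * lift ((x # B @ a @ c) # (D1 @ D2) @ map u is)"
        using step_join[of c D1 a x B "D2 @ map u is"] dist sub unfolding A e_def by simp
      have m: "mset (concat ((x # B @ a @ c) # (D1 @ D2) @ map u is)) = mset (concat ?\<gamma>)"
        unfolding A by (simp add: ac_simps)
      show "distinct (concat ((x # B @ a @ c) # (D1 @ D2) @ map u is))"
        using dist mset_eq_imp_distinct_iff[OF m] by (simp only:)
      show "set (concat ((x # B @ a @ c) # (D1 @ D2) @ map u is)) \<subseteq> {1..n}"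
        using sub mset_eq_setD[OF m] by (simp only:)
      show "W \<subseteq> set (x # B @ a @ c) \<union> set (concat (D1 @ D2))"
        using Suc.prems(8) unfolding A by auto
      show "even (m + (\<Sum>a \<leftarrow> (x # B @ a @ c) # D1 @ D2. length a + 1))"
        using Suc.prems(9) unfolding A by auto
    qed (use Suc.prems in \<open>auto simp: A\<close>)
    moreover have "length (concat ((x # B @ a @ c) # (D1 @ D2) @ map u is)) = ?N"
      by (simp add: A)
    moreover have "join_sign (flags W c) (map (flags W) A) j q = e"
      using len by (simp add: join_sign_def e_def A o_def nth_append)
    moreover have "map (flags W) A ! j = flags W a @ (x \<notin> W) # flags W B"
      using jq by (simp add: Aj)
    moreover have "take j (map (flags W) A) = map (flags W) D1" "drop (Suc j) (map (flags W) A) = map (flags W) D2"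
      by (simp_all add: take_map drop_map D1_def D2_def)
    ultimately show ?thesis
      using len by (simp add: x_def[symmetric] Ch_combination_sign del: concat.simps concat_append)
  qed
  have touch: "falling ?N * G (u i ! q) = Ch_combination \<phi>
      (walk (remain s) s m (False # replicate (s i - 1) True @ flags W c) (map (flags W) A) (set is - {i})) \<xi>"
    if i: "i \<in> set is" and q: "q < length (u i)" for i q
  proof -
    define x a B where "x = u i ! q" and "a = take q (u i)" and "B = drop (Suc q) (u i)"
    have ui: "u i = a @ x # B"
      using id_take_nth_drop[OF q] by (simp add: x_def a_def B_def)
    obtain is1 is2 where "is": "is = is1 @ i # is2"
      using split_list[OF i] by blast
    have sets: "set is - {i} = set (is1 @ is2)"
      using Suc.prems(6) by (auto simp: "is")
    have odd: "odd (length (a @ x # B))" and s: "s i = length (a @ x # B)"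
      using Suc.prems(7)[OF i] by (auto simp: ui)
    let ?e = "(length (a @ x # B) - 1) * ((\<Sum>d \<leftarrow> A @ map u is1. length d - 1) + (length B + 1) + length c)"
    have "falling (length (concat ((x # B @ a @ c) # A @ map u (is1 @ is2)))) * G x = (- 1) ^ ?e *
        Ch_combination \<phi> (walk (remain s) s m (False # flags W (B @ a @ c)) (map (flags W) A) (set (is1 @ is2))) \<xi>"
    proof (rule main)
      show "cyc (x # take 1 c) * lift ?\<gamma> = zz ^ ?e * lift ((x # B @ a @ c) # A @ map u (is1 @ is2))"
        using step_join[of c "A @ map u is1" a x B "map u is2"] dist sub unfolding "is" by (simp add: ui)
      have m: "mset (concat ((x # B @ a @ c) # A @ map u (is1 @ is2))) = mset (concat ?\<gamma>)"
        unfolding "is" by (simp add: ui ac_simps)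
      show "distinct (concat ((x # B @ a @ c) # A @ map u (is1 @ is2)))"
        using dist mset_eq_imp_distinct_iff[OF m] by (simp only:)
      show "set (concat ((x # B @ a @ c) # A @ map u (is1 @ is2))) \<subseteq> {1..n}"
        using sub mset_eq_setD[OF m] by (simp only:)
      show "W \<subseteq> set (x # B @ a @ c) \<union> set (concat A)"
        using Suc.prems(8) by auto
      show "even (m + (\<Sum>a \<leftarrow> (x # B @ a @ c) # A. length a + 1))"
        using Suc.prems(9) odd by auto
    qed (use Suc.prems in \<open>auto simp: "is"\<close>)
    moreover have "length (concat ((x # B @ a @ c) # A @ map u (is1 @ is2))) = ?N"
      by (simp add: "is" ui)
    \<comment> \<open>Untouched cycles have odd length, so joining them to c costs no sign.\<close>
    moreover have "(- 1) ^ ?e = (1 :: complex)"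
      using odd by (intro neg_one_even_power) simp
    moreover have "flags W (B @ a @ c) = replicate (s i - 1) True @ flags W c"
    proof -
      have "set (u i) \<inter> (set c \<union> set (concat A)) = {}"
        using dist i by auto
      then have "set (B @ a) \<inter> W = {}"
        using Suc.prems(8) by (auto simp: ui)
      then have "flags W (B @ a) = replicate (s i - 1) True"
        by (subst flags_all_available) (auto simp: s)
      then show ?thesis
        by (metis append_assoc flags_simps(4))
    qed
    ultimately show ?thesis
      by (simp add: x_def[symmetric] sets del: concat.simps concat_append flags_simps(4))
  qed
  have "falling ?N * (\<Sum>p \<in> paths (Suc m) W. chi (cyc (p @ take 1 c) * lift ?\<gamma>)) =
      falling ?N * (\<Sum>x \<in> {1..n} - W. G x)"
    by (simp add: sum_paths_Suc G_def)
  also have "\<dots> = falling ?N * (\<Sum>x \<in> {1..n} - set (concat ?\<gamma>). G x) +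
      (\<Sum>a \<leftarrow> ?\<gamma>. \<Sum>q \<in> {q. q < length a \<and> flags W a ! q}. falling ?N * G (a ! q))"
    unfolding sum_points[OF dist sub W] by (simp only: distrib_left sum_list_const_mult[symmetric] sum_distrib_left)
  also have "(\<Sum>a \<leftarrow> ?\<gamma>. \<Sum>q \<in> {q. q < length a \<and> flags W a ! q}. falling ?N * G (a ! q)) =
      (\<Sum>q \<in> {q. q < length c \<and> flags W c ! q}. falling ?N * G (c ! q)) +
      (\<Sum>j < length A. \<Sum>q \<in> {q. q < length (A ! j) \<and> flags W (A ! j) ! q}. falling ?N * G (A ! j ! q)) +
      (\<Sum>i \<in> set is. \<Sum>q \<in> {q. q < length (u i) \<and> flags W (u i) ! q}. falling ?N * G (u i ! q))"
    using Suc.prems(6)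
    by (simp add: sum_list_sum_nth[of "map _ A"] atLeast0LessThan sum.distinct_set_conv_list o_def del: concat.simps concat_append)
  also have "{q. q < length c \<and> flags W c ! q} = {q \<in> {1..<length (flags W c)}. flags W c ! q}"
  proof (intro Set.set_eqI iffI)
    fix q assume "q \<in> {q. q < length c \<and> flags W c ! q}"
    \<comment> \<open>Position 0 holds the current point, which is already visited.\<close>
    moreover from this have "q \<noteq> 0"
      using Suc.prems(5) by (cases c) (auto simp: flags_def intro!: Nat.gr0I)
    ultimately show "q \<in> {q \<in> {1..<length (flags W c)}. flags W c ! q}"
      by simp
  qed simp
  also have "(\<Sum>q \<in> {q \<in> {1..<length (flags W c)}. flags W c ! q}. falling ?N * G (c ! q)) =
      Ch_combination \<phi> (\<Sum>q \<in> {q \<in> {1..<length (flags W c)}. flags W c ! q}. (- 1) ^ ((q - 1) * (length (flags W c) - q)) *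
      walk (remain s) s m (False # drop (Suc q) (flags W c)) (take q (flags W c) # map (flags W) A) (set is)) \<xi>"
    unfolding Ch_combination_sum sum_fun_apply by (intro sum.cong HOL.refl cut) auto
  also have "(\<Sum>j < length A. \<Sum>q \<in> {q. q < length (A ! j) \<and> flags W (A ! j) ! q}. falling ?N * G (A ! j ! q)) =
      Ch_combination \<phi> (\<Sum>j < length (map (flags W) A). \<Sum>q \<in> {q. q < length (map (flags W) A ! j) \<and> map (flags W) A ! j ! q}.
        (- 1) ^ join_sign (flags W c) (map (flags W) A) j q *
        walk (remain s) s m (False # drop (Suc q) (map (flags W) A ! j) @ take q (map (flags W) A ! j) @ flags W c)
        (take j (map (flags W) A) @ drop (Suc j) (map (flags W) A)) (set is)) \<xi>"
    unfolding Ch_combination_sum sum_fun_apply by (intro sum.cong join) auto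
  also have "(\<Sum>i \<in> set is. \<Sum>q \<in> {q. q < length (u i) \<and> flags W (u i) ! q}. falling ?N * G (u i ! q)) =
      Ch_combination \<phi> (\<Sum>i \<in> set is. of_nat (s i) *
        walk (remain s) s m (False # replicate (s i - 1) True @ flags W c) (map (flags W) A) (set is - {i})) \<xi>"
    unfolding Ch_combination_sum sum_fun_apply
  proof (rule sum.cong[OF HOL.refl])
    fix i assume i: "i \<in> set is"
    have "set (u i) \<inter> (set c \<union> set (concat A)) = {}"
      using dist i by auto
    then have "set (u i) \<inter> W = {}"
      using Suc.prems(8) by blast
    then have "{q. q < length (u i) \<and> flags W (u i) ! q} = {..<s i}"
      using Suc.prems(7)[OF i] by (auto simp: flags_all_available)
    moreover have "falling ?N * G (u i ! q) = Ch_combination \<phi>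
      (walk (remain s) s m (False # replicate (s i - 1) True @ flags W c) (map (flags W) A) (set is - {i})) \<xi>"
      if "q \<in> {..<s i}" for q
      using touch[OF i] that Suc.prems(7)[OF i] by simp
    ultimately show "(\<Sum>q \<in> {q. q < length (u i) \<and> flags W (u i) ! q}. falling ?N * G (u i ! q)) = Ch_combination \<phi>
      (of_nat (s i) * walk (remain s) s m (False # replicate (s i - 1) True @ flags W c) (map (flags W) A) (set is - {i})) \<xi>"
      by (simp add: Ch_combination_of_nat del: concat.simps concat_append)
  qed
  finally show ?case
    unfolding fresh walk.simps by (simp add: Ch_combination_add add.assoc del: concat.simps concat_append lift_simps)
qed

text \<open>If the cycles have no room in n points, both sides are 0. Otherwise they are placed on
  consecutive points. The sum over all k-cycles acts as a scalar, and the same count without any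
  further cycles identifies it as the value of \<open>yy k\<close>.\<close>

lemma cycle_product:
  assumes k: "odd k" and I: "finite I" and s: "\<And>i. i \<in> I \<Longrightarrow> odd (s i)"
  shows "Ch_combination \<phi> (yy k) \<xi> * Ch_combination \<phi> (remain s I) \<xi> =
    Ch_combination \<phi> (walk (remain s) s k [] [] I) \<xi>"
proof (cases "(\<Sum>i \<in> I. s i) \<le> n")
  case False
  have "Ch_combination \<phi> (walk (remain s) s k [] [] I) \<xi> = 0"
    by (rule Ch_combination_large) (use walk_remain_size[OF I, of _ s k "[]" "[]"] False in fastforce)
  moreover have "Ch_combination \<phi> (remain s I) \<xi> = 0"
  proof (rule Ch_combination_large)
    fix \<pi> assume "\<pi> \<in> Poly_Mapping.keys (remain s I)"
    moreover have "Poly_Mapping.keys (remain s I) \<subseteq> {\<pi>. sum_mset \<pi> = (\<Sum>i \<in> I. s i)}"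
      unfolding remain_def using I
    proof (induction I)
      case (insert i I)
      have "Poly_Mapping.keys (yy (s i)) \<subseteq> {{#s i#}}"
        by (simp add: yy_def)
      then show ?case
        using insert keys_mult[of "yy (s i)" "\<Prod>i \<in> I. yy (s i)"] by fastforce
    qed simp
    ultimately show "n < sum_mset \<pi>"
      using False by auto
  qed
  ultimately show ?thesis
    by simp
next
  case True
  define "is" where "is = sorted_list_of_set I"
  have "is": "set is = I" "distinct is"
    using I by (simp_all add: is_def)
  define u where "u i = the (map_of (zip is (blocks 0 (map s is))) i)" for i
  have len: "length (blocks 0 ls) = length ls" for ls
    by (metis length_map map_length_blocks)
  have u: "map u is = blocks 0 (map s is)"
  proof (rule nth_equalityI)
    fix j assume "j < length (map u is)"
    then show "map u is ! j = blocks 0 (map s is) ! j"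
      using "is"(2) by (simp add: u_def map_of_zip_nth len)
  qed (simp add: len)
  have "map length (map u is) = map s is"
    unfolding u by (rule map_length_blocks)
  then have u_len: "length (u i) = s i" if "i \<in> I" for i
    using that "is"(1) by (auto simp: map_eq_conv)
  have sum: "sum_list (map s is) = (\<Sum>i \<in> I. s i)"
    using "is" by (simp add: sum.distinct_set_conv_list[symmetric])
  have concat: "concat (map u is) = [1..<(\<Sum>i \<in> I. s i) + 1]"
    unfolding u concat_blocks sum by simp
  have dist: "distinct (concat (map u is))" and sub: "set (concat (map u is)) \<subseteq> {1..n}"
    unfolding concat using True by auto
  let ?N = "length (concat (map u is))"
  let ?P = "{p. length p = k \<and> distinct p \<and> set p \<subseteq> {1..n}}"
  have P: "paths k {} = ?P"
    by (auto simp: paths_def)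
  have lift_Nil: "lift ([] # \<gamma>) = lift \<gamma>" for \<gamma>
    by simp
  have "falling (length (concat ([] # [] @ map u is))) *
      (\<Sum>p \<in> paths k {}. chi (cyc (p @ take 1 []) * lift ([] # [] @ map u is))) =
      Ch_combination \<phi> (walk (remain s) s k (flags {} []) (map (flags {}) []) (set is)) \<xi>"
    by (rule walk_correct) (use dist sub "is" u_len s k in \<open>auto simp: odd_pos\<close>)
  then have 1: "falling ?N * (\<Sum>p \<in> ?P. chi (cyc p * lift (map u is))) =
      Ch_combination \<phi> (walk (remain s) s k [] [] I) \<xi>"
    unfolding P by (simp add: "is"(1) del: concat_map_singleton)
  \<comment> \<open>Without further cycles the walk can only take fresh points and yields
    \<open>yy k\<close>.\<close>
  have "falling (length (concat ([] # [] @ map u []))) *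
      (\<Sum>p \<in> paths k {}. chi (cyc (p @ take 1 []) * lift ([] # [] @ map u []))) =
      Ch_combination \<phi> (walk (remain s) s k (flags {} []) (map (flags {}) []) (set [])) \<xi>"
    by (rule walk_correct) (use k in \<open>auto simp: odd_pos\<close>)
  then have 2: "(\<Sum>p \<in> ?P. chi (cyc p)) = Ch_combination \<phi> (yy k) \<xi>"
    using walk_decompose[of "{}" s k "[]" "[]"] walk_no_points[of s k 0]
    unfolding P by (simp add: falling_def remain_def)
  have 3: "falling ?N * chi (lift (map u is)) = Ch_combination \<phi> (remain s I) \<xi>"
  proof -
    have "falling ?N * chi (lift (map u is)) = Ch_combination \<phi> (\<Prod>c \<leftarrow> map u is. yy (length c)) \<xi>"
    proof (rule chi_lift[OF sub dist])
      show "[] \<notin> set (map u is)"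
        using u_len s "is"(1) by fastforce
      have "even (\<Sum>i \<leftarrow> js. length (u i) + 1)" if "set js \<subseteq> I" for js
        using that u_len s by (induction js) auto
      from this[of "is"] show "even (\<Sum>c \<leftarrow> map u is. length c + 1)"
        using "is"(1) by (simp add: o_def)
    qed
    also have "(\<Prod>c \<leftarrow> map u is. yy (length c)) = (\<Prod>i \<leftarrow> is. yy (s i))"
      using u_len "is"(1) by (auto intro!: arg_cong[where f = prod_list] map_cong)
    also have "\<dots> = remain s I"
      using "is" by (simp add: remain_def prod.distinct_set_conv_list[symmetric])
    finally show ?thesis .
  qed
  have "lift (map u is) \<in> words"
    using sub dist by (rule lift_words)
  from sum_paths_central[OF k this]
  have "falling ?N * (\<Sum>p \<in> ?P. chi (cyc p * lift (map u is))) =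
      (\<Sum>p \<in> ?P. chi (cyc p)) * (falling ?N * chi (lift (map u is)))"
    by simp
  then show ?thesis
    unfolding 1 2 3 by simp
qed

end

lemma Ch_combination_cycle_product:
  assumes \<phi>: "schur_spin_characters \<phi>" and k: "odd k" and I: "finite I" and s: "\<And>i. i \<in> I \<Longrightarrow> odd (s i)"
  shows "Ch_combination \<phi> (yy k) * Ch_combination \<phi> (remain s I) =
    (\<Sum>S \<in> Pow I. Ch_combination \<phi> (remain s (I - S) * walk all_touched s k [] [] S))"
proof
  fix \<xi>
  obtain d \<rho> where "irreducible_spin_rep (sp_size \<xi>) d \<rho>"
    "\<And>\<pi> g. odd_partition \<pi> \<Longrightarrow> sum_mset \<pi> = sp_size \<xi> \<Longrightarrow> g \<in> conj_class_plus \<pi> \<Longrightarrow> \<phi> \<xi> \<pi> = mat_trace (\<rho> g)"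
    by (rule obtain_spin_representation[OF \<phi>, of \<xi>]) blast
  then interpret spin_character "sp_size \<xi>" d \<rho> \<phi> \<xi>
    by unfold_locales auto
  show "(Ch_combination \<phi> (yy k) * Ch_combination \<phi> (remain s I)) \<xi> =
      (\<Sum>S \<in> Pow I. Ch_combination \<phi> (remain s (I - S) * walk all_touched s k [] [] S)) \<xi>"
    using cycle_product[OF k I s] walk_decompose[OF I, of s k "[]" "[]"]
    by (simp add: Ch_combination_sum)
qed

subsection \<open>Convolution of set functions\<close>

text \<open>Associativity of the convolution of set functions: the splittings of I into J, L and a
  rest are grouped by U = J \<union> L.\<close>

lemma sum_Pow_assoc:
  fixes f :: "nat set \<Rightarrow> nat set \<Rightarrow> nat set \<Rightarrow> 'b :: comm_monoid_add"
  assumes "finite I"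
  shows "(\<Sum>J \<in> Pow I. \<Sum>L \<in> Pow (I - J). f J L (I - J - L)) = (\<Sum>U \<in> Pow I. \<Sum>J \<in> Pow U. f J (U - J) (I - U))"
proof -
  have "(\<Sum>J \<in> Pow I. \<Sum>L \<in> Pow (I - J). f J L (I - J - L)) =
      (\<Sum>(J, L) \<in> Sigma (Pow I) (\<lambda>J. Pow (I - J)). f J L (I - J - L))"
    using assms by (subst sum.Sigma) auto
  also have "\<dots> = (\<Sum>(U, J) \<in> Sigma (Pow I) Pow. f J (U - J) (I - U))"
  proof (rule sum.reindex_bij_witness[of _ "\<lambda>(U, J). (J, U - J)" "\<lambda>(J, L). (J \<union> L, J)"])
    fix x assume "x \<in> Sigma (Pow I) (\<lambda>J. Pow (I - J))"
    then obtain J L where x: "x = (J, L)" "J \<subseteq> I" "L \<subseteq> I - J"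
      by auto
    then have eq: "J \<union> L - J = L" "I - (J \<union> L) = I - J - L"
      by auto
    show "(case case x of (J, L) \<Rightarrow> (J \<union> L, J) of (U, J) \<Rightarrow> (J, U - J)) = x"
      "(case x of (J, L) \<Rightarrow> (J \<union> L, J)) \<in> Sigma (Pow I) Pow"
      using x eq by auto
    show "(case case x of (J, L) \<Rightarrow> (J \<union> L, J) of (U, J) \<Rightarrow> f J (U - J) (I - U)) =
        (case x of (J, L) \<Rightarrow> f J L (I - J - L))"
      using x by (simp add: eq)
  qed auto
  also have "\<dots> = (\<Sum>U \<in> Pow I. \<Sum>J \<in> Pow U. f J (U - J) (I - U))"
    using assms by (subst sum.Sigma) (auto intro: finite_subset)
  finally show ?thesis .
qed

text \<open>As \<open>e {}\<close> is 1, convolution with e is unitriangular with respect to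
  inclusion and can be cancelled.\<close>

lemma set_conv_cancel:
  fixes g h e :: "nat set \<Rightarrow> 'b :: comm_ring_1"
  assumes "e {} = 1" "finite I"
    and eq: "\<And>J. J \<subseteq> I \<Longrightarrow> (\<Sum>S \<in> Pow J. g S * e (J - S)) = (\<Sum>S \<in> Pow J. h S * e (J - S))"
  shows "g I = h I"
  using assms(2,3)
proof (induction I rule: finite_psubset_induct)
  case (psubset I)
  have less: "g S = h S" if "S \<in> Pow I - {I}" for S
    using that psubset by (intro psubset.IH) auto
  have "(\<Sum>S \<in> Pow I. k S * e (I - S)) = k I * 1 + (\<Sum>S \<in> Pow I - {I}. k S * e (I - S))" for k
    using psubset.hyps assms(1) by (subst sum.remove[of _ I]) auto
  then show ?case
    using psubset.prems[OF order.refl] less by simp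
qed

text \<open>The quotient for the convolution of set functions, that is, of generating functions
  restricted to squarefree monomials. Infinite sets get the default 0.\<close>

function set_div :: "(nat set \<Rightarrow> 'b :: comm_ring_1) \<Rightarrow> (nat set \<Rightarrow> 'b) \<Rightarrow> nat set \<Rightarrow> 'b" where
  "set_div f e I = (if finite I then f I - (\<Sum>S \<in> Pow I - {I}. if S \<subset> I then set_div f e S * e (I - S) else 0) else 0)"
  by auto
termination
  by (relation "measure (\<lambda>(f, e, I). card I)") (auto simp: psubset_card_mono)

declare set_div.simps [simp del]

lemma set_div_conv:
  assumes "finite I" "e {} = 1"
  shows "(\<Sum>S \<in> Pow I. set_div f e S * e (I - S)) = f I"
proof -
  have "(\<Sum>S \<in> Pow I. set_div f e S * e (I - S)) = set_div f e I * e {} + (\<Sum>S \<in> Pow I - {I}. set_div f e S * e (I - S))"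
    using assms(1) by (subst sum.remove[of _ I]) auto
  also have "(\<Sum>S \<in> Pow I - {I}. set_div f e S * e (I - S)) =
      (\<Sum>S \<in> Pow I - {I}. if S \<subset> I then set_div f e S * e (I - S) else 0)"
    by (intro sum.cong) auto
  finally show ?thesis
    using assms by (simp add: set_div.simps[of f e I])
qed


subsection \<open>The logarithm of a multivariate power series\<close>

datatype 'b mps = Mps (coef: "nat multiset \<Rightarrow> 'b")

lemma finite_submultisets: "finite {k. k \<subseteq># (m :: nat multiset)}"
proof (rule finite_subset)
  show "finite (mset ` {xs. set xs \<subseteq> set_mset m \<and> length xs \<le> size m})"
    by (intro finite_imageI finite_lists_length_le) simp
  show "{k. k \<subseteq># m} \<subseteq> mset ` {xs. set xs \<subseteq> set_mset m \<and> length xs \<le> size m}"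
  proof clarify
    fix k assume k: "k \<subseteq># m"
    obtain xs where "mset xs = k"
      using ex_mset by blast
    then show "k \<in> mset ` {xs. set xs \<subseteq> set_mset m \<and> length xs \<le> size m}"
      using k size_mset_mono[OF k] set_mset_mono[OF k] by (intro image_eqI[of _ _ xs]) auto
  qed
qed

lemma double_diff_mset: "k \<subseteq># m \<Longrightarrow> m - (m - k) = k"
  by (simp add: multiset_eq_iff subseteq_mset_def)

lemma submultiset_chain:
  assumes "j \<subseteq># k" "k \<subseteq># m"
  shows "j \<subseteq># m" "k - j \<subseteq># m - j" "j + (k - j) = k" "m - j - (k - j) = m - k"
proof -
  have "count j x \<le> count k x" "count k x \<le> count m x" for x
    using assms by (simp_all add: subseteq_mset_def)
  note * = this le_trans[OF this]
  show "j \<subseteq># m" "k - j \<subseteq># m - j"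
    using * by (simp_all add: subseteq_mset_def diff_le_mono)
  show "j + (k - j) = k" "m - j - (k - j) = m - k"
    using * by (simp_all add: multiset_eq_iff)
qed

lemma submultiset_split:
  assumes "j \<subseteq># m" "l \<subseteq># m - j"
  shows "j + l \<subseteq># m" "j \<subseteq># j + l" "j + l - j = l" "m - (j + l) = m - j - l"
  using assms by (simp_all add: subset_mset.le_diff_conv2 add.commute diff_diff_add_mset)

instantiation mps :: (comm_ring_1) comm_ring_1
begin

definition "0 = Mps (\<lambda>m. 0)"
definition "1 = Mps (\<lambda>m. if m = {#} then 1 else 0)"
definition "f + g = Mps (\<lambda>m. coef f m + coef g m)"
definition "f - g = Mps (\<lambda>m. coef f m - coef g m)"
definition "- f = Mps (\<lambda>m. - coef f m)"
definition "f * g = Mps (\<lambda>m. \<Sum>k \<in> {k. k \<subseteq># m}. coef f k * coef g (m - k))"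

lemma mps_eqI: "(\<And>m. coef f m = coef g m) \<Longrightarrow> f = g"
  by (cases f; cases g) auto

lemma coef_simps [simp]:
  "coef 0 m = (0 :: 'a)" "coef (f + g) m = coef f m + coef g m" "coef (f - g) m = coef f m - coef g m"
  "coef (- f) m = - coef f m"
  by (simp_all add: zero_mps_def plus_mps_def minus_mps_def uminus_mps_def)

lemma coef_one: "coef 1 m = (if m = {#} then 1 else 0 :: 'a)"
  by (simp add: one_mps_def)

lemma coef_mult: "coef (f * g) m = (\<Sum>k \<in> {k. k \<subseteq># m}. coef f k * coef g (m - k))"
  by (simp add: times_mps_def)

instance
proof
  fix f g h :: "'a mps"
  show "f * g * h = f * (g * h)"
  proof (rule mps_eqI)
    fix m
    let ?S = "\<lambda>m. {k. k \<subseteq># (m :: nat multiset)}"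
    have "coef (f * g * h) m = (\<Sum>k \<in> ?S m. \<Sum>j \<in> ?S k. coef f j * coef g (k - j) * coef h (m - k))"
      by (simp add: coef_mult sum_distrib_right)
    also have "\<dots> = (\<Sum>(k, j) \<in> Sigma (?S m) ?S. coef f j * coef g (k - j) * coef h (m - k))"
      by (rule sum.Sigma) (auto simp: finite_submultisets)
    also have "\<dots> = (\<Sum>(j, l) \<in> Sigma (?S m) (\<lambda>j. ?S (m - j)). coef f j * (coef g l * coef h (m - j - l)))"
      by (rule sum.reindex_bij_witness[of _ "\<lambda>(j, l). (j + l, j)" "\<lambda>(k, j). (j, k - j)"])
        (auto simp: mult.assoc submultiset_chain submultiset_split intro: subset_mset.order_trans)
    also have "\<dots> = (\<Sum>j \<in> ?S m. \<Sum>l \<in> ?S (m - j). coef f j * (coef g l * coef h (m - j - l)))"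
      by (rule sum.Sigma[symmetric]) (auto simp: finite_submultisets)
    finally show "coef (f * g * h) m = coef (f * (g * h)) m"
      by (simp add: coef_mult sum_distrib_left)
  qed
  show "f * g = g * f"
  proof (rule mps_eqI)
    fix m
    show "coef (f * g) m = coef (g * f) m"
      unfolding coef_mult
      by (rule sum.reindex_bij_witness[of _ "\<lambda>k. m - k" "\<lambda>k. m - k"]) (auto simp: double_diff_mset mult.commute)
  qed
  show "1 * f = f"
  proof (rule mps_eqI)
    fix m
    have "coef (1 * f) m = (\<Sum>k \<in> {k. k \<subseteq># m}. if k = {#} then coef f m else 0)"
      unfolding coef_mult coef_one by (intro sum.cong) auto
    then show "coef (1 * f) m = coef f m"
      by (simp add: finite_submultisets)
  qed
  show "(f + g) * h = f * h + g * h"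
    by (rule mps_eqI) (simp add: coef_mult distrib_right sum.distrib)
  show "(0 :: 'a mps) \<noteq> 1"
    by (auto simp: zero_mps_def one_mps_def fun_eq_iff)
qed (auto intro!: mps_eqI simp: algebra_simps)

end

definition pderiv_mps :: "nat \<Rightarrow> 'b :: comm_ring_1 mps \<Rightarrow> 'b mps" where
  "pderiv_mps i f = Mps (\<lambda>m. of_nat (Suc (count m i)) * coef f (add_mset i m))"

lemma coef_pderiv_mps: "coef (pderiv_mps i f) m = of_nat (Suc (count m i)) * coef f (add_mset i m)"
  by (simp add: pderiv_mps_def)

lemma pderiv_mps_add: "pderiv_mps i (f + g) = pderiv_mps i f + pderiv_mps i g"
  by (rule mps_eqI) (simp add: coef_pderiv_mps distrib_left)

lemma sum_count_submultisets:
  fixes F :: "nat multiset \<Rightarrow> 'b :: comm_ring_1"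
  shows "(\<Sum>k \<in> {k. k \<subseteq># add_mset i m}. of_nat (count k i) * F k) =
    (\<Sum>k \<in> {k. k \<subseteq># m}. of_nat (Suc (count k i)) * F (add_mset i k))"
proof -
  have "(\<Sum>k \<in> {k. k \<subseteq># m}. of_nat (Suc (count k i)) * F (add_mset i k)) =
      (\<Sum>k \<in> add_mset i ` {k. k \<subseteq># m}. of_nat (count k i) * F k)"
    by (subst sum.reindex) (auto simp: inj_on_def)
  also have "\<dots> = (\<Sum>k \<in> {k. k \<subseteq># add_mset i m}. of_nat (count k i) * F k)"
  proof (rule sum.mono_neutral_left)
    show "\<forall>k \<in> {k. k \<subseteq># add_mset i m} - add_mset i ` {k. k \<subseteq># m}. of_nat (count k i) * F k = 0"
    proof
      fix k assume k: "k \<in> {k. k \<subseteq># add_mset i m} - add_mset i ` {k. k \<subseteq># m}"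
      have "i \<notin># k"
      proof
        assume "i \<in># k"
        then obtain l where "k = add_mset i l"
          by (meson multi_member_split)
        with k show False
          by auto
      qed
      then show "of_nat (count k i) * F k = 0"
        by (simp add: not_in_iff)
    qed
  qed (auto simp: finite_submultisets)
  finally show ?thesis ..
qed

text \<open>The exponent of t_i in a monomial is the sum of its exponents in the two
  factors.\<close>

lemma pderiv_mps_mult: "pderiv_mps i (f * g) = pderiv_mps i f * g + f * pderiv_mps i g"
proof (rule mps_eqI)
  fix m
  let ?S = "{k. k \<subseteq># add_mset i m}"
  have c: "of_nat (Suc (count m i)) = (of_nat (count k i) + of_nat (count (add_mset i m - k) i) :: 'a)"
    if "k \<in> ?S" for k
    using that mset_subset_eq_count[of k "add_mset i m" i] by (simp flip: of_nat_add of_nat_Suc)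
  have "coef (pderiv_mps i (f * g)) m = (\<Sum>k \<in> ?S. of_nat (Suc (count m i)) * (coef f k * coef g (add_mset i m - k)))"
    by (simp only: coef_pderiv_mps coef_mult sum_distrib_left)
  also have "\<dots> = (\<Sum>k \<in> ?S. of_nat (count k i) * (coef f k * coef g (add_mset i m - k))) +
      (\<Sum>k \<in> ?S. of_nat (count (add_mset i m - k) i) * (coef f k * coef g (add_mset i m - k)))"
    unfolding sum.distrib[symmetric] by (intro sum.cong HOL.refl) (simp only: c distrib_right)
  also have "(\<Sum>k \<in> ?S. of_nat (count (add_mset i m - k) i) * (coef f k * coef g (add_mset i m - k))) =
      (\<Sum>k \<in> ?S. of_nat (count k i) * (coef f (add_mset i m - k) * coef g k))"
    by (rule sum.reindex_bij_witness[of _ "\<lambda>k. add_mset i m - k" "\<lambda>k. add_mset i m - k"]) (auto simp: double_diff_mset)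
  also have "\<dots> = (\<Sum>k \<in> {k. k \<subseteq># m}. of_nat (Suc (count k i)) * (coef f (m - k) * coef g (add_mset i k)))"
    by (simp add: sum_count_submultisets)
  also have "\<dots> = coef (pderiv_mps i g * f) m"
    unfolding coef_mult coef_pderiv_mps by (intro sum.cong) (simp_all only: ac_simps)
  also have "(\<Sum>k \<in> ?S. of_nat (count k i) * (coef f k * coef g (add_mset i m - k))) = coef (pderiv_mps i f * g) m"
    unfolding coef_mult coef_pderiv_mps sum_count_submultisets by (intro sum.cong) (simp_all add: mult.assoc)
  finally show "coef (pderiv_mps i (f * g)) m = coef (pderiv_mps i f * g + f * pderiv_mps i g) m"
    by (simp add: mult.commute)
qed

lemma pderiv_mps_power: "pderiv_mps i (f ^ Suc n) = of_nat (Suc n) * f ^ n * pderiv_mps i f"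
proof (induction n)
  case (Suc n)
  have "pderiv_mps i (f ^ Suc (Suc n)) = pderiv_mps i f * f ^ Suc n + f * pderiv_mps i (f ^ Suc n)"
    by (simp add: pderiv_mps_mult)
  then show ?case
    unfolding Suc by (simp add: algebra_simps)
qed simp

lemma coef_power_zero:
  assumes "coef u {#} = 0" "size m < n"
  shows "coef (u ^ n) m = 0"
  using assms(2)
proof (induction n arbitrary: m)
  case (Suc n)
  have "coef u k * coef (u ^ n) (m - k) = 0" if "k \<subseteq># m" for k
  proof (cases "k = {#}")
    case False
    then have "size (m - k) < n"
      using that Suc.prems size_mset_mono[OF that] by (simp add: size_Diff_submset nonempty_has_size)
    then show ?thesis
      by (simp add: Suc.IH)
  qed (simp add: assms)
  then show ?case
    by (simp add: coef_mult)
qed simp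

definition smul :: "complex \<Rightarrow> ('x \<Rightarrow> complex) mps \<Rightarrow> ('x \<Rightarrow> complex) mps" where
  "smul c f = Mps (\<lambda>m. fscale c (coef f m))"

lemma coef_smul: "coef (smul c f) m = fscale c (coef f m)"
  by (simp add: smul_def)

lemma fscale_mult: "fscale c f * g = fscale c (f * g)" "f * fscale c g = fscale c (f * g)"
  by (auto simp: fscale_def fun_eq_iff)

lemma pderiv_mps_smul: "pderiv_mps i (smul c f) = smul c (pderiv_mps i f)"
  by (rule mps_eqI) (simp add: coef_pderiv_mps coef_smul fscale_mult del: of_nat_Suc)

lemma smul_mult_of_nat: "smul c (of_nat n * f) = smul (c * of_nat n) f"
proof -
  have "coef (of_nat n * f) m = fscale (of_nat n) (coef f m)" for m
    by (induction n) (simp_all add: distrib_right fun_vs.scale_left_distrib)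
  then show ?thesis
    by (intro mps_eqI) (simp add: coef_smul)
qed

lemma smul_minus_one_power: "smul ((- 1) ^ n) f = (- 1) ^ n * f"
  by (cases "even n") (auto intro!: mps_eqI simp: coef_smul)

definition log_trunc :: "nat \<Rightarrow> ('x \<Rightarrow> complex) mps \<Rightarrow> ('x \<Rightarrow> complex) mps" where
  "log_trunc N u = (\<Sum>n = 1..N. smul ((- 1) ^ (n + 1) / of_nat n) (u ^ n))"

lemma coef_sum: "coef (\<Sum>i \<in> I. f i) m = (\<Sum>i \<in> I. coef (f i) m)"
  by (induction I rule: infinite_finite_induct) simp_all

lemma pderiv_mps_zero [simp]: "pderiv_mps i 0 = 0"
  by (rule mps_eqI) (simp add: coef_pderiv_mps)

text \<open>A geometric sum: differentiating u^n / n gives u^(n-1) times the derivative of u, and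
  multiplication by 1 + u telescopes. For u without constant term, the error term only has monomials
  of degree at least N.\<close>

lemma pderiv_log_trunc: "pderiv_mps i (log_trunc N u) * (1 + u) = pderiv_mps i u * (1 - (- u) ^ N)"
proof (induction N)
  case 0
  then show ?case
    by (simp add: log_trunc_def)
next
  case (Suc N)
  have "pderiv_mps i (smul ((- 1) ^ (Suc N + 1) / of_nat (Suc N)) (u ^ Suc N)) =
      smul ((- 1) ^ (Suc N + 1) / of_nat (Suc N) * of_nat (Suc N)) (u ^ N * pderiv_mps i u)"
    unfolding pderiv_mps_smul pderiv_mps_power mult.assoc smul_mult_of_nat ..
  also have "(- 1) ^ (Suc N + 1) / of_nat (Suc N) * of_nat (Suc N) = ((- 1) ^ N :: complex)"
    by (simp del: of_nat_Suc)
  also have "smul ((- 1) ^ N) (u ^ N * pderiv_mps i u) = (- u) ^ N * pderiv_mps i u"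
    by (simp add: smul_minus_one_power power_minus[of u] mult.assoc)
  finally have "pderiv_mps i (log_trunc (Suc N) u) = pderiv_mps i (log_trunc N u) + (- u) ^ N * pderiv_mps i u"
    by (simp add: log_trunc_def pderiv_mps_add)
  then have "pderiv_mps i (log_trunc (Suc N) u) * (1 + u) =
      pderiv_mps i u * (1 - (- u) ^ N) + (- u) ^ N * pderiv_mps i u * (1 + u)"
    by (simp add: distrib_right Suc del: power_Suc)
  then show ?case
    by (simp add: algebra_simps)
qed

lemma ps_power_Gamma: "ps_power (Gamma \<phi>) f n = coef (Mps f ^ n)"
proof (induction n)
  case 0
  then show ?case
    by (simp add: ps_power_def ps_one_def Gamma_def fun_eq_iff coef_one)
next
  case (Suc n)
  have "ps_power (Gamma \<phi>) f (Suc n) = ps_mult (Gamma \<phi>) f (ps_power (Gamma \<phi>) f n)"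
    by (simp add: ps_power_def)
  then show ?case
    unfolding Suc by (simp add: ps_mult_def Gamma_def coef_mult fun_eq_iff)
qed

lemma ps_log_Gamma:
  assumes "f {#} = 1" "size m \<le> N"
  shows "ps_log (Gamma \<phi>) f m = coef (log_trunc N (Mps f - 1)) m"
proof -
  let ?u = "Mps f - 1"
  have "Mps (\<lambda>u. f u - ps_one (Gamma \<phi>) u) = ?u"
    by (rule mps_eqI) (simp add: ps_one_def Gamma_def coef_one)
  then have "ps_log (Gamma \<phi>) f m = (\<Sum>n = 1..size m. fscale ((- 1) ^ (n + 1) / of_nat n) (coef (?u ^ n) m))"
    by (simp add: ps_log_def ps_power_Gamma) (simp add: Gamma_def)
  also have "\<dots> = (\<Sum>n = 1..N. fscale ((- 1) ^ (n + 1) / of_nat n) (coef (?u ^ n) m))"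
  proof (rule sum.mono_neutral_left)
    have "coef (?u ^ n) m = 0" if "size m < n" for n
      using that assms(1) by (intro coef_power_zero) (simp_all add: coef_one)
    then show "\<forall>n \<in> {1..N} - {1..size m}. fscale ((- 1) ^ (n + 1) / of_nat n) (coef (?u ^ n) m) = 0"
      by auto
  qed (use assms(2) in auto)
  finally show ?thesis
    by (simp add: log_trunc_def coef_sum coef_smul)
qed

text \<open>The coefficient at m of the identity (d_i log f) f = d_i f, which replaces the
  logarithmic series in all that follows.\<close>

lemma ps_log_Gamma_recursion:
  assumes "f {#} = 1"
  shows "(\<Sum>k \<in> {k. k \<subseteq># m}. of_nat (Suc (count k i)) * ps_log (Gamma \<phi>) f (add_mset i k) * f (m - k)) =
    of_nat (Suc (count m i)) * f (add_mset i m)"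
proof -
  \<comment> \<open>Large enough for all monomials \<open>add_mset i k\<close>, and for the error
    term of \<open>pderiv_log_trunc\<close> to vanish at m.\<close>
  let ?N = "Suc (size m)"
  let ?u = "Mps f - 1"
  have "(\<Sum>k \<in> {k. k \<subseteq># m}. of_nat (Suc (count k i)) * ps_log (Gamma \<phi>) f (add_mset i k) * f (m - k)) =
      coef (pderiv_mps i (log_trunc ?N ?u) * (1 + ?u)) m"
    unfolding coef_mult coef_pderiv_mps
  proof (rule sum.cong[OF HOL.refl])
    fix k assume "k \<in> {k. k \<subseteq># m}"
    then have "size (add_mset i k) \<le> ?N"
      by (simp add: size_mset_mono)
    then show "of_nat (Suc (count k i)) * ps_log (Gamma \<phi>) f (add_mset i k) * f (m - k) =
        of_nat (Suc (count k i)) * coef (log_trunc ?N ?u) (add_mset i k) * coef (1 + ?u) (m - k)"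
      by (simp add: ps_log_Gamma[of f "add_mset i k" ?N, OF assms] coef_one del: of_nat_Suc)
  qed
  also have "\<dots> = coef (pderiv_mps i ?u) m - coef ((- ?u) ^ ?N * pderiv_mps i ?u) m"
    unfolding pderiv_log_trunc by (simp add: algebra_simps del: power_Suc)
  also have "coef ((- ?u) ^ ?N * pderiv_mps i ?u) m = 0"
  proof -
    have "coef ((- ?u) ^ ?N) k = 0" if "k \<subseteq># m" for k
      using size_mset_mono[OF that] assms by (intro coef_power_zero) (simp_all add: coef_one)
    then show ?thesis
      unfolding coef_mult by (intro sum.neutral) simp
  qed
  also have "coef (pderiv_mps i ?u) m - 0 = of_nat (Suc (count m i)) * f (add_mset i m)"
    by (simp add: coef_pderiv_mps coef_one)
  finally show ?thesis .
qed


subsection \<open>Cumulants of the identity map\<close>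

lemma submultisets_mset_set:
  assumes "finite I"
  shows "{k. k \<subseteq># mset_set I} = mset_set ` Pow I"
proof (intro equalityI subsetI)
  fix k assume "k \<in> {k. k \<subseteq># mset_set I}"
  then have k: "k \<subseteq># mset_set I"
    by simp
  then have "set_mset k \<subseteq> I"
    using set_mset_mono[OF k] assms by simp
  moreover have "k = mset_set (set_mset k)"
  proof (rule multiset_eqI)
    fix x
    show "count k x = count (mset_set (set_mset k)) x"
    proof (cases "x \<in># k")
      case True
      moreover have "count k x \<le> 1"
        using mset_subset_eq_count[OF k, of x] assms by (auto simp: count_mset_set' split: if_splits)
      ultimately have "count k x = 1"
        by (metis One_nat_def Suc_leI count_greater_zero_iff le_antisym)
      then show ?thesis
        using True by (simp add: count_mset_set')
    qed (simp add: not_in_iff count_mset_set')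
  qed
  ultimately show "k \<in> mset_set ` Pow I"
    by blast
next
  fix k assume "k \<in> mset_set ` Pow I"
  then show "k \<in> {k. k \<subseteq># mset_set I}"
    using assms by (auto simp: subset_imp_msubset_mset_set)
qed

lemma sum_submultisets_mset_set:
  assumes "finite I"
  shows "(\<Sum>k \<in> {k. k \<subseteq># mset_set I}. F k (mset_set I - k)) = (\<Sum>S \<in> Pow I. F (mset_set S) (mset_set (I - S)))"
proof -
  have inj: "inj_on mset_set (Pow I)"
    using assms by (auto intro!: inj_onI dest: finite_subset) (metis finite_set_mset_mset_set finite_subset)+
  have "(\<Sum>k \<in> mset_set ` Pow I. F k (mset_set I - k)) = (\<Sum>S \<in> Pow I. F (mset_set S) (mset_set I - mset_set S))"
    by (subst sum.reindex[OF inj]) simp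
  also have "\<dots> = (\<Sum>S \<in> Pow I. F (mset_set S) (mset_set (I - S)))"
    using assms by (intro sum.cong) (auto simp: mset_set_Diff)
  finally show ?thesis
    unfolding submultisets_mset_set[OF assms] .
qed

section \<open>Moments and cumulants as set functions\<close>

definition moment :: "(strict_partition \<Rightarrow> nat multiset \<Rightarrow> complex) \<Rightarrow> (nat \<Rightarrow> mpoly) \<Rightarrow> mpoly \<Rightarrow> nat set \<Rightarrow>
    strict_partition \<Rightarrow> complex" where
  "moment \<phi> a x I = Ch_combination \<phi> (x * (\<Prod>i \<in> I. a i))"

text \<open>The cumulant of x and the a_i with i in I. Multiplication of polynomials is the disjoint
  product, so \<open>moment\<close> is the identity map applied to a disjoint product. Singling out
  x means differentiating the logarithm with respect to the variable of x, which yields the quotient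
  of the moment functions with and without x.\<close>

definition kappa :: "(strict_partition \<Rightarrow> nat multiset \<Rightarrow> complex) \<Rightarrow> (nat \<Rightarrow> mpoly) \<Rightarrow> mpoly \<Rightarrow> nat set \<Rightarrow>
    strict_partition \<Rightarrow> complex" where
  "kappa \<phi> a x = set_div (moment \<phi> a x) (moment \<phi> a 1)"

lemma Ch_combination_one: "schur_spin_characters \<phi> \<Longrightarrow> Ch_combination \<phi> 1 = 1"
  using spin_character_ones_nonzero[of \<phi>]
  by (auto simp: Ch_combination_single Ch_def fscale_def fun_eq_iff Let_def simp flip: single_one)

lemma moment_empty: "moment \<phi> a x {} = Ch_combination \<phi> x"
  by (simp add: moment_def)

lemma kappa_conv:
  assumes "schur_spin_characters \<phi>" "finite I"
  shows "(\<Sum>S \<in> Pow I. kappa \<phi> a x S * moment \<phi> a 1 (I - S)) = moment \<phi> a x I"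
  unfolding kappa_def using assms by (intro set_div_conv) (simp_all add: moment_empty Ch_combination_one)

lemma kappa_unique:
  assumes "schur_spin_characters \<phi>" "finite I"
    "\<And>J. J \<subseteq> I \<Longrightarrow> (\<Sum>S \<in> Pow J. g S * moment \<phi> a 1 (J - S)) = moment \<phi> a x J"
  shows "kappa \<phi> a x I = g I"
proof (rule set_conv_cancel[of "moment \<phi> a 1"])
  show "moment \<phi> a 1 {} = 1"
    using assms(1) by (simp add: moment_empty Ch_combination_one)
  show "(\<Sum>S \<in> Pow J. kappa \<phi> a x S * moment \<phi> a 1 (J - S)) = (\<Sum>S \<in> Pow J. g S * moment \<phi> a 1 (J - S))"
    if "J \<subseteq> I" for J
    using kappa_conv[OF assms(1) finite_subset[OF that assms(2)]] assms(3)[OF that] by simp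
qed (rule assms(2))

lemma kappa_add:
  assumes "schur_spin_characters \<phi>" "finite I"
  shows "kappa \<phi> a (x + y) I = kappa \<phi> a x I + kappa \<phi> a y I"
proof (rule kappa_unique[OF assms])
  fix J assume "J \<subseteq> I"
  then have "finite J"
    using assms(2) finite_subset by blast
  then show "(\<Sum>S \<in> Pow J. (kappa \<phi> a x S + kappa \<phi> a y S) * moment \<phi> a 1 (J - S)) = moment \<phi> a (x + y) J"
    by (simp add: distrib_right sum.distrib kappa_conv[OF assms(1)]) (simp add: moment_def distrib_right Ch_combination_add)
qed

lemma kappa_pscale:
  assumes "schur_spin_characters \<phi>" "finite I"
  shows "kappa \<phi> a (pscale c x) I = fscale c (kappa \<phi> a x I)"
proof (rule kappa_unique[OF assms])
  fix J assume "J \<subseteq> I"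
  then have "finite J"
    using assms(2) finite_subset by blast
  then show "(\<Sum>S \<in> Pow J. fscale c (kappa \<phi> a x S) * moment \<phi> a 1 (J - S)) = moment \<phi> a (pscale c x) J"
    by (simp add: fscale_mult fun_vs.scale_sum_right[symmetric] kappa_conv[OF assms(1)])
      (simp add: moment_def pscale_mult_left Ch_combination_pscale)
qed

lemma kappa_sum:
  assumes "schur_spin_characters \<phi>" "finite I"
  shows "kappa \<phi> a (\<Sum>j \<in> S. f j) I = (\<Sum>j \<in> S. kappa \<phi> a (f j) I)"
proof (induction S rule: infinite_finite_induct)
  have "kappa \<phi> a 0 I = 0"
    using kappa_pscale[OF assms, of a 0 0] by simp
  then show "kappa \<phi> a (\<Sum>j \<in> {}. f j) I = (\<Sum>j \<in> {}. kappa \<phi> a (f j) I)"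
    "infinite S \<Longrightarrow> kappa \<phi> a (\<Sum>j \<in> S. f j) I = (\<Sum>j \<in> S. kappa \<phi> a (f j) I)" for S
    by simp_all
qed (simp add: kappa_add[OF assms])

lemma kappa_cong:
  assumes "schur_spin_characters \<phi>" "finite I" "\<And>i. i \<in> I \<Longrightarrow> a i = b i"
  shows "kappa \<phi> a x I = kappa \<phi> b x I"
proof (rule kappa_unique[OF assms(1,2)])
  fix J assume J: "J \<subseteq> I"
  then have fin: "finite J"
    using assms(2) finite_subset by blast
  have "moment \<phi> a y S = moment \<phi> b y S" if "S \<subseteq> J" for y S
    using that J assms(3) unfolding moment_def by (intro arg_cong[where f = "Ch_combination \<phi>"] arg_cong2[where f = "(*)"] prod.cong) auto
  then have "(\<Sum>S \<in> Pow J. kappa \<phi> b x S * moment \<phi> a 1 (J - S)) = (\<Sum>S \<in> Pow J. kappa \<phi> b x S * moment \<phi> b 1 (J - S))"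
    "moment \<phi> a x J = moment \<phi> b x J"
    by (auto intro!: sum.cong)
  then show "(\<Sum>S \<in> Pow J. kappa \<phi> b x S * moment \<phi> a 1 (J - S)) = moment \<phi> a x J"
    using kappa_conv[OF assms(1) fin] by simp
qed

lemma kappa_one:
  assumes "schur_spin_characters \<phi>" "finite I"
  shows "kappa \<phi> a 1 I = (if I = {} then 1 else 0)"
proof (rule kappa_unique[OF assms])
  fix J assume "J \<subseteq> I"
  then have "finite J"
    using assms(2) finite_subset by blast
  then show "(\<Sum>S \<in> Pow J. (if S = {} then 1 else 0) * moment \<phi> a 1 (J - S)) = moment \<phi> a 1 J"
    by (subst sum.remove[of _ "{}"]) (auto intro!: sum.neutral)
qed

text \<open>The exponential generating functions satisfy \<open>\<kappa>\<^sub>x E = E\<^sub>x\<close>; differentiate this with respect to the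
  variable of the argument \<open>y\<close>.\<close>

lemma kappa_mult:
  assumes \<phi>: "schur_spin_characters \<phi>" and I: "finite I" "p \<notin> I"
  shows "kappa \<phi> a (x * y) I = kappa \<phi> (a(p := y)) x (insert p I) + (\<Sum>S \<in> Pow I. kappa \<phi> a x S * kappa \<phi> a y (I - S))"
proof (rule kappa_unique[OF \<phi> I(1)])
  fix J assume "J \<subseteq> I"
  then have J: "finite J" "p \<notin> J"
    using I finite_subset by auto
  let ?b = "a(p := y)" and ?e = "moment \<phi> a 1"
  have moment: "moment \<phi> ?b z S = moment \<phi> a z S" if "S \<subseteq> J" for z S
    using that J(2) unfolding moment_def by (intro arg_cong[where f = "Ch_combination \<phi>"] arg_cong2[where f = "(*)"] prod.cong) auto
  have moment': "moment \<phi> ?b z (insert p S) = moment \<phi> a (z * y) S" if "S \<subseteq> J" for z S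
  proof -
    have "(\<Prod>i \<in> insert p S. ?b i) = y * (\<Prod>i \<in> S. ?b i)"
      using that J finite_subset by (subst prod.insert) auto
    then show ?thesis
      using moment[OF that, of "z * y"] by (simp add: moment_def mult.assoc)
  qed
  have kappa: "kappa \<phi> ?b x S = kappa \<phi> a x S" if "S \<subseteq> J" for S
    using that J finite_subset by (intro kappa_cong[OF \<phi>]) auto
  \<comment> \<open>The moment of x y over J is the moment of x over the larger index set with y at
    the place p. Sets S without p give the products of cumulants, sets with p the joint
    cumulant.\<close>
  have "moment \<phi> a (x * y) J = (\<Sum>S \<in> Pow (insert p J). kappa \<phi> ?b x S * moment \<phi> ?b 1 (insert p J - S))"
    using moment'[of J x] kappa_conv[OF \<phi>, of "insert p J" ?b x] J by simp
  also have "\<dots> = (\<Sum>S \<in> Pow J. kappa \<phi> ?b x S * moment \<phi> ?b 1 (insert p J - S)) +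
      (\<Sum>S \<in> insert p ` Pow J. kappa \<phi> ?b x S * moment \<phi> ?b 1 (insert p J - S))"
    unfolding Pow_insert using J by (intro sum.union_disjoint) auto
  finally have total: "moment \<phi> a (x * y) J =
      (\<Sum>S \<in> Pow J. kappa \<phi> ?b x S * moment \<phi> ?b 1 (insert p J - S)) +
      (\<Sum>S \<in> insert p ` Pow J. kappa \<phi> ?b x S * moment \<phi> ?b 1 (insert p J - S))" .
  have "(\<Sum>S \<in> Pow J. kappa \<phi> ?b x S * moment \<phi> ?b 1 (insert p J - S)) =
      (\<Sum>S \<in> Pow J. \<Sum>L \<in> Pow (J - S). kappa \<phi> a x S * kappa \<phi> a y L * ?e (J - S - L))"
  proof (rule sum.cong[OF HOL.refl])
    fix S assume S: "S \<in> Pow J"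
    then have "insert p J - S = insert p (J - S)"
      using J(2) by auto
    then have "moment \<phi> ?b 1 (insert p J - S) = moment \<phi> a y (J - S)"
      using moment'[of "J - S" 1] by auto
    also have "\<dots> = (\<Sum>L \<in> Pow (J - S). kappa \<phi> a y L * ?e (J - S - L))"
      using J by (intro kappa_conv[OF \<phi>, symmetric]) auto
    finally have "moment \<phi> ?b 1 (insert p J - S) = (\<Sum>L \<in> Pow (J - S). kappa \<phi> a y L * ?e (J - S - L))" .
    moreover have "kappa \<phi> ?b x S = kappa \<phi> a x S"
      using S by (intro kappa) auto
    ultimately show "kappa \<phi> ?b x S * moment \<phi> ?b 1 (insert p J - S) =
        (\<Sum>L \<in> Pow (J - S). kappa \<phi> a x S * kappa \<phi> a y L * ?e (J - S - L))"
      by (simp only: sum_distrib_left mult.assoc)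
  qed
  also have "\<dots> = (\<Sum>U \<in> Pow J. \<Sum>S \<in> Pow U. kappa \<phi> a x S * kappa \<phi> a y (U - S) * ?e (J - U))"
    by (rule sum_Pow_assoc[OF J(1), of "\<lambda>S L R. kappa \<phi> a x S * kappa \<phi> a y L * ?e R"])
  also have "\<dots> = (\<Sum>U \<in> Pow J. (\<Sum>S \<in> Pow U. kappa \<phi> a x S * kappa \<phi> a y (U - S)) * ?e (J - U))"
    by (simp only: sum_distrib_right)
  finally have first: "(\<Sum>S \<in> Pow J. kappa \<phi> ?b x S * moment \<phi> ?b 1 (insert p J - S)) =
      (\<Sum>U \<in> Pow J. (\<Sum>S \<in> Pow U. kappa \<phi> a x S * kappa \<phi> a y (U - S)) * ?e (J - U))" .
  have second: "(\<Sum>S \<in> insert p ` Pow J. kappa \<phi> ?b x S * moment \<phi> ?b 1 (insert p J - S)) =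
      (\<Sum>S \<in> Pow J. kappa \<phi> ?b x (insert p S) * ?e (J - S))"
  proof (subst sum.reindex)
    show "inj_on (insert p) (Pow J)"
      using J(2) by (intro inj_onI) (auto simp: insert_ident)
    show "(\<Sum>S \<in> Pow J. ((\<lambda>S. kappa \<phi> ?b x S * moment \<phi> ?b 1 (insert p J - S)) \<circ> insert p) S) =
        (\<Sum>S \<in> Pow J. kappa \<phi> ?b x (insert p S) * ?e (J - S))"
    proof (rule sum.cong[OF HOL.refl])
      fix S assume "S \<in> Pow J"
      have "insert p J - insert p S = J - S"
        using J(2) by auto
      then show "((\<lambda>S. kappa \<phi> ?b x S * moment \<phi> ?b 1 (insert p J - S)) \<circ> insert p) S =
          kappa \<phi> ?b x (insert p S) * ?e (J - S)"
        using moment[of "J - S" 1] by (simp add: o_def)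
    qed
  qed
  show "(\<Sum>S \<in> Pow J. (kappa \<phi> ?b x (insert p S) + (\<Sum>L \<in> Pow S. kappa \<phi> a x L * kappa \<phi> a y (S - L))) * ?e (J - S)) =
      moment \<phi> a (x * y) J"
    unfolding total first second distrib_right sum.distrib by (rule add.commute)
qed

text \<open>In \<open>kappa_mult\<close> the product of x and y and the sum over S are symmetric in
  x and y, hence so is the remaining term. Any argument may therefore be singled out.\<close>

lemma kappa_swap:
  assumes "schur_spin_characters \<phi>" "finite I" "p \<notin> I"
  shows "kappa \<phi> (a(p := y)) x (insert p I) = kappa \<phi> (a(p := x)) y (insert p I)"
proof -
  have "(\<Sum>S \<in> Pow I. kappa \<phi> a x S * kappa \<phi> a y (I - S)) = (\<Sum>S \<in> Pow I. kappa \<phi> a y S * kappa \<phi> a x (I - S))"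
    by (rule sum.reindex_bij_witness[of _ "\<lambda>S. I - S" "\<lambda>S. I - S"]) (auto simp: double_diff mult.commute)
  then show ?thesis
    using kappa_mult[OF assms, of a x y] kappa_mult[OF assms, of a y x] by (simp add: mult.commute[of y x])
qed

section \<open>Comparison with the definition of cumulants by power series\<close>

lemma Ch_coeffs_zero: "schur_spin_characters \<phi> \<Longrightarrow> Ch_coeffs \<phi> 0 = 0"
  using Ch_coeffs_Ch_combination[of \<phi> 0] by (simp add: odd_poly_def)

lemma odd_poly_prod: "(\<And>i. i \<in> I \<Longrightarrow> odd_poly (a i)) \<Longrightarrow> odd_poly (\<Prod>i \<in> I. a i)"
  by (induction I rule: infinite_finite_induct) (auto intro: odd_poly_mult simp: odd_poly_def[of 1] odd_partition_def)

lemma odd_poly_pscale: "odd_poly x \<Longrightarrow> odd_poly (pscale c x)"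
  by (auto simp: odd_poly_def in_keys_iff)

text \<open>Each ordering of I contributes the same disjoint product, hence the factorial. Cumulants
  only involve squarefree monomials.\<close>

lemma ps_power_linear_series:
  assumes \<phi>: "schur_spin_characters \<phi>" and a: "\<And>i. i < l \<Longrightarrow> odd_poly (a i)" and I: "I \<subseteq> {..<l}"
  shows "ps_power (Gamma_disjoint \<phi>) (linear_series (map (\<lambda>i. Ch_combination \<phi> (a i)) [0..<l])) n (mset_set I) =
    Ch_combination \<phi> (if card I = n then pscale (fact n) (\<Prod>i \<in> I. a i) else 0)"
  using I
proof (induction n arbitrary: I)
  case 0
  then have "finite I"
    using finite_subset by blast
  then show ?case
    by (auto simp: ps_power_def ps_one_def Gamma_disjoint_def Ch_combination_single mset_set_empty_iff simp flip: single_one)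
next
  case (Suc n)
  let ?A = "Gamma_disjoint \<phi>" and ?f = "linear_series (map (\<lambda>i. Ch_combination \<phi> (a i)) [0..<l])"
  let ?P = "\<lambda>J. if card J = n then pscale (fact n) (\<Prod>i \<in> J. a i) else 0"
  have fin: "finite I"
    using Suc.prems finite_subset by blast
  have odd: "odd_poly (?P J)" if "J \<subseteq> I" for J
    using that Suc.prems a by (auto simp: odd_poly_def[of 0] intro!: odd_poly_pscale odd_poly_prod)
  have lin: "?f (mset_set S) = (\<Sum>i < l. if S = {i} then Ch_combination \<phi> (a i) else 0)" if "S \<subseteq> I" for S
  proof -
    have "mset_set S = {#i#} \<longleftrightarrow> S = {i}" for i
      using that fin finite_subset by (metis finite_set_mset_mset_set mset_set.insert_remove mset_set.empty
          empty_iff finite.emptyI insert_Diff_single mset_set.insert set_mset_single)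
    then show ?thesis
      by (auto simp: linear_series_def intro!: sum.cong)
  qed
  have summand: "disjoint_product \<phi> (?f (mset_set S)) (Ch_combination \<phi> (?P (I - S))) =
      (\<Sum>i \<in> I. if S = {i} then Ch_combination \<phi> (a i * ?P (I - {i})) else 0)" if S: "S \<in> Pow I" for S
  proof (cases "\<exists>i. S = {i}")
    case True
    then obtain i where i: "S = {i}"
      by blast
    then have "i \<in> I" "i < l"
      using S Suc.prems by auto
    moreover have "(\<Sum>j < l. if {i} = {j} then Ch_combination \<phi> (a j) else 0) = Ch_combination \<phi> (a i)"
      using \<open>i < l\<close> by simp
    ultimately have "?f (mset_set S) = Ch_combination \<phi> (a i)"
      using lin[of S] S i by (simp only: Pow_iff)
    moreover have "disjoint_product \<phi> (Ch_combination \<phi> (a i)) (Ch_combination \<phi> (?P (I - S))) =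
        Ch_combination \<phi> (a i * ?P (I - S))"
      using \<open>i < l\<close> by (intro disjoint_product_Ch_combination[OF \<phi>] a odd) auto
    moreover have "(\<Sum>j \<in> I. if S = {j} then Q j else 0) = Q i" for Q :: "nat \<Rightarrow> strict_partition \<Rightarrow> complex"
      using \<open>i \<in> I\<close> fin by (simp add: i)
    ultimately show ?thesis
      by (simp only: i)
  next
    case False
    then have "?f (mset_set S) = 0" "(\<Sum>i \<in> I. if S = {i} then Ch_combination \<phi> (a i * ?P (I - {i})) else 0) = 0"
      using lin[of S] S by (auto intro!: sum.neutral)
    then show ?thesis
      by (simp add: disjoint_product_def Ch_coeffs_zero[OF \<phi>])
  qed
  have "ps_power ?A ?f (Suc n) (mset_set I) = ps_mult ?A ?f (ps_power ?A ?f n) (mset_set I)"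
    by (simp add: ps_power_def)
  also have "\<dots> = (\<Sum>S \<in> Pow I. disjoint_product \<phi> (?f (mset_set S)) (ps_power ?A ?f n (mset_set (I - S))))"
    unfolding ps_mult_def Gamma_disjoint_def
    by (subst sum_submultisets_mset_set[OF fin]) simp
  also have "\<dots> = (\<Sum>S \<in> Pow I. disjoint_product \<phi> (?f (mset_set S)) (Ch_combination \<phi> (?P (I - S))))"
    using Suc.prems by (intro sum.cong HOL.refl) (subst Suc.IH, auto)
  also have "\<dots> = (\<Sum>S \<in> Pow I. \<Sum>i \<in> I. if S = {i} then Ch_combination \<phi> (a i * ?P (I - {i})) else 0)"
    by (intro sum.cong HOL.refl summand)
  also have "\<dots> = (\<Sum>i \<in> I. \<Sum>S \<in> Pow I. if S = {i} then Ch_combination \<phi> (a i * ?P (I - {i})) else 0)"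
    by (rule sum.swap)
  also have "\<dots> = (\<Sum>i \<in> I. Ch_combination \<phi> (a i * ?P (I - {i})))"
    using fin by (intro sum.cong) (simp_all add: sum.delta)
  also have "\<dots> = (\<Sum>i \<in> I. Ch_combination \<phi> (if card I = Suc n then pscale (fact n) (\<Prod>i \<in> I. a i) else 0))"
  proof (rule sum.cong[OF HOL.refl])
    fix i assume i: "i \<in> I"
    then have "card I > 0"
      using fin card_gt_0_iff by blast
    then have "card (I - {i}) = n \<longleftrightarrow> card I = Suc n"
      using i fin by auto
    moreover have "a i * (\<Prod>j \<in> I - {i}. a j) = (\<Prod>j \<in> I. a j)"
      using i fin by (simp add: prod.remove)
    ultimately show "Ch_combination \<phi> (a i * ?P (I - {i})) =
        Ch_combination \<phi> (if card I = Suc n then pscale (fact n) (\<Prod>i \<in> I. a i) else 0)"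
      by (simp add: pscale_mult_right)
  qed
  also have "\<dots> = Ch_combination \<phi> (if card I = Suc n then pscale (fact (Suc n)) (\<Prod>i \<in> I. a i) else 0)"
  proof -
    have "of_nat (card I) * Ch_combination \<phi> x = Ch_combination \<phi> (pscale (of_nat (card I)) x)" for x
      by (simp add: Ch_combination_pscale fun_eq_iff fscale_def)
    then show ?thesis
      by (cases "card I = Suc n") (simp_all only: sum_constant if_True if_False pvs.scale_scale fact_Suc
          Ch_combination_zero mult_zero_right simp_thms)
  qed
  finally show ?case .
qed

lemma ps_exp_linear_series:
  assumes \<phi>: "schur_spin_characters \<phi>" and a: "\<And>i. i < l \<Longrightarrow> odd_poly (a i)" and I: "I \<subseteq> {..<l}"
  shows "ps_exp (Gamma_disjoint \<phi>) (linear_series (map (\<lambda>i. Ch_combination \<phi> (a i)) [0..<l])) (mset_set I) =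
    moment \<phi> a 1 I"
proof -
  have fin: "finite I"
    using I finite_subset by blast
  have "ps_exp (Gamma_disjoint \<phi>) (linear_series (map (\<lambda>i. Ch_combination \<phi> (a i)) [0..<l])) (mset_set I) =
    (\<Sum>n \<le> card I. fscale (1 / fact n) (Ch_combination \<phi> (if card I = n then pscale (fact n) (\<Prod>i \<in> I. a i) else 0)))"
    using ps_power_linear_series[OF assms] fin by (simp add: ps_exp_def) (simp add: Gamma_disjoint_def)
  also have "\<dots> = (\<Sum>n \<le> card I. if n = card I then Ch_combination \<phi> (\<Prod>i \<in> I. a i) else 0)"
    by (intro sum.cong) (auto simp: Ch_combination_pscale)
  finally show ?thesis
    by (simp add: moment_def)
qed

text \<open>The logarithm is differentiated with respect to the variable t_0 of the first argument.
  At squarefree monomials all multiplicities are 1, and the recursion becomes the convolution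
  equation that characterises \<open>kappa\<close>.\<close>

lemma cumulant_eq_kappa:
  assumes \<phi>: "schur_spin_characters \<phi>" and a: "\<And>i. i < Suc l \<Longrightarrow> odd_poly (a i)"
  shows "cumulant (Gamma_disjoint \<phi>) (Gamma \<phi>) id (map (\<lambda>i. Ch_combination \<phi> (a i)) [0..<Suc l]) =
    kappa \<phi> a (a 0) {1..l}"
proof -
  define f where "f m = id (ps_exp (Gamma_disjoint \<phi>) (linear_series (map (\<lambda>i. Ch_combination \<phi> (a i)) [0..<Suc l])) m)" for m
  have f: "f (mset_set I) = moment \<phi> a 1 I" if "I \<subseteq> {..<Suc l}" for I
    unfolding f_def id_def using that by (intro ps_exp_linear_series[OF \<phi>] a)
  have f0: "f {#} = 1"
    using f[of "{}"] by (simp add: moment_empty Ch_combination_one[OF \<phi>])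
  define L where "L S = ps_log (Gamma \<phi>) f (mset_set (insert 0 S))" for S
  have "kappa \<phi> a (a 0) {1..l} = L {1..l}"
  proof (rule kappa_unique[OF \<phi>])
    fix J assume J: "J \<subseteq> {1..l}"
    then have fin: "finite J" and "0 \<notin> J"
      using finite_subset by auto
    have add: "add_mset 0 (mset_set S) = mset_set (insert 0 S)" "count (mset_set S) 0 = 0" if "S \<subseteq> J" for S
    proof -
      have "finite S" "0 \<notin> S"
        using that fin \<open>0 \<notin> J\<close> finite_subset by auto
      then show "add_mset 0 (mset_set S) = mset_set (insert 0 S)" "count (mset_set S) 0 = 0"
        by simp_all
    qed
    have "(\<Sum>S \<in> Pow J. of_nat (Suc (count (mset_set S) 0)) * ps_log (Gamma \<phi>) f (add_mset 0 (mset_set S)) * f (mset_set (J - S))) =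
        of_nat (Suc (count (mset_set J) 0)) * f (add_mset 0 (mset_set J))"
      using ps_log_Gamma_recursion[where f = f and m = "mset_set J" and i = 0, OF f0]
      by (subst (asm) sum_submultisets_mset_set[OF fin])
    also have "\<dots> = moment \<phi> a 1 (insert 0 J)"
      using add[of J] J by (simp, subst f) auto
    also have "\<dots> = moment \<phi> a (a 0) J"
      using fin \<open>0 \<notin> J\<close> by (simp add: moment_def)
    also have "(\<Sum>S \<in> Pow J. of_nat (Suc (count (mset_set S) 0)) * ps_log (Gamma \<phi>) f (add_mset 0 (mset_set S)) * f (mset_set (J - S))) =
        (\<Sum>S \<in> Pow J. L S * moment \<phi> a 1 (J - S))"
    proof (rule sum.cong[OF HOL.refl])
      fix S assume "S \<in> Pow J"
      moreover from this J have "f (mset_set (J - S)) = moment \<phi> a 1 (J - S)"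
        by (intro f) auto
      ultimately show "of_nat (Suc (count (mset_set S) 0)) * ps_log (Gamma \<phi>) f (add_mset 0 (mset_set S)) * f (mset_set (J - S)) =
          L S * moment \<phi> a 1 (J - S)"
        using add[of S] by (simp add: L_def)
    qed
    finally show "(\<Sum>S \<in> Pow J. L S * moment \<phi> a 1 (J - S)) = moment \<phi> a (a 0) J" .
  qed simp
  moreover have "cumulant (Gamma_disjoint \<phi>) (Gamma \<phi>) id (map (\<lambda>i. Ch_combination \<phi> (a i)) [0..<Suc l]) =
      ps_log (Gamma \<phi>) f (mset [0..<Suc l])"
    by (simp add: cumulant_def f_def[abs_def] del: upt_Suc)
  moreover have "insert 0 {1..l} = {0..<Suc l}"
    by auto
  then have "mset [0..<Suc l] = mset_set (insert 0 {1..l})"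
    by (simp only: mset_upt)
  ultimately show ?thesis
    by (simp only: L_def)
qed

subsection \<open>The degree filtration is multiplicative\<close>

definition Gp :: "(strict_partition \<Rightarrow> nat multiset \<Rightarrow> complex) \<Rightarrow> int \<Rightarrow> (strict_partition \<Rightarrow> complex) set" where
  "Gp \<phi> j = Ch_combination \<phi> ` filt j"

lemma Gp_intro: "x \<in> filt j \<Longrightarrow> Ch_combination \<phi> x \<in> Gp \<phi> j"
  by (auto simp: Gp_def)

lemma Gp_0: "0 \<in> Gp \<phi> j"
  unfolding Gp_def by (rule image_eqI[of _ _ 0]) simp_all

lemma Gp_add: "f \<in> Gp \<phi> j \<Longrightarrow> g \<in> Gp \<phi> j \<Longrightarrow> f + g \<in> Gp \<phi> j"
  by (auto simp: Gp_def simp flip: Ch_combination_add intro: filt_add)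

lemma Gp_diff: "f \<in> Gp \<phi> j \<Longrightarrow> g \<in> Gp \<phi> j \<Longrightarrow> f - g \<in> Gp \<phi> j"
  by (auto simp: Gp_def simp flip: Ch_combination_diff intro: filt_diff)

lemma Gp_scale: "f \<in> Gp \<phi> j \<Longrightarrow> fscale c f \<in> Gp \<phi> j"
  by (auto simp: Gp_def simp flip: Ch_combination_pscale intro: filt_scale)

lemma Gp_sum: "(\<And>i. i \<in> I \<Longrightarrow> f i \<in> Gp \<phi> j) \<Longrightarrow> (\<Sum>i \<in> I. f i) \<in> Gp \<phi> j"
  by (induction I rule: infinite_finite_induct) (auto intro: Gp_add Gp_0)

lemma Gp_mono: "f \<in> Gp \<phi> i \<Longrightarrow> i \<le> j \<Longrightarrow> f \<in> Gp \<phi> j"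
  by (auto simp: Gp_def intro: filt_mono)

lemma Gp_neg: "f \<in> Gp \<phi> j \<Longrightarrow> j < 0 \<Longrightarrow> f = 0"
  by (auto simp: Gp_def dest: filt_neg)

definition deg :: "nat multiset \<Rightarrow> int" where
  "deg \<pi> = int (sum_mset \<pi> + size \<pi>)"

lemma deg_simps [simp]: "deg {#} = 0" "deg (add_mset k \<pi>) = int k + 1 + deg \<pi>" "deg (\<pi> + \<sigma>) = deg \<pi> + deg \<sigma>"
  by (simp_all add: deg_def)

lemma deg_nonneg: "deg \<pi> \<ge> 0"
  unfolding deg_def by (rule of_nat_0_le_iff)

lemma deg_pos: "\<pi> \<noteq> {#} \<Longrightarrow> deg \<pi> > 0"
  using nonempty_has_size[of \<pi>] by (simp only: deg_def of_nat_0_less_iff)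

lemma odd_partition_simps [simp]:
  "odd_partition {#}" "odd_partition (add_mset k \<pi>) \<longleftrightarrow> odd k \<and> odd_partition \<pi>"
  "odd_partition (\<pi> + \<sigma>) \<longleftrightarrow> odd_partition \<pi> \<and> odd_partition \<sigma>"
  by (auto simp: odd_partition_def)

text \<open>For odd partitions this is the monomial up to a nonzero scalar; the product formula for
  cycles is stated in these terms.\<close>

definition Yo :: "nat multiset \<Rightarrow> mpoly" where
  "Yo \<pi> = prod_mset (image_mset yy \<pi>)"

lemma Yo_simps [simp]: "Yo {#} = 1" "Yo (add_mset k \<pi>) = yy k * Yo \<pi>" "Yo (\<pi> + \<sigma>) = Yo \<pi> * Yo \<sigma>"
  by (simp_all add: Yo_def)

lemma Yo_filt: "Yo \<pi> \<in> filt (deg \<pi>)"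
proof (induction \<pi>)
  case (add k \<pi>)
  then show ?case
    using filt_mult[OF yy_filt[of k] add.IH] by (simp only: Yo_simps deg_simps)
qed (simp add: filt_1)

lemma Yo_mono:
  assumes "odd_partition \<pi>"
  obtains c where "mono \<pi> = pscale c (Yo \<pi>)"
proof -
  have "\<exists>c. c \<noteq> 0 \<and> Yo \<pi> = Poly_Mapping.single \<pi> c"
    using assms
  proof (induction \<pi>)
    case empty
    then show ?case
      by (intro exI[of _ 1]) (simp flip: single_one)
  next
    case (add k \<pi>)
    then obtain c where "c \<noteq> 0" "Yo \<pi> = Poly_Mapping.single \<pi> c"
      by auto
    then show ?case
      using add.prems by (intro exI[of _ "1 / 2 ^ ((k - 1) div 2) * c"]) (simp add: yy_def mult_single)
  qed
  then obtain c where "c \<noteq> 0" "Yo \<pi> = Poly_Mapping.single \<pi> c"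
    by blast
  then show thesis
    by (intro that[of "1 / c"]) simp
qed

text \<open>Membership in a level is checked on the products \<open>Yo \<pi>\<close> only. The map h
  is arbitrary apart from linearity on their combinations, so the lemma serves for pointwise
  products and for each argument of a cumulant.\<close>

lemma filt_linear:
  assumes x: "x \<in> filt j"
    and lin: "\<And>c (K :: nat multiset set). h (\<Sum>\<pi> \<in> K. pscale (c \<pi>) (Yo \<pi>)) = (\<Sum>\<pi> \<in> K. fscale (c \<pi>) (h (Yo \<pi>)))"
    and Yo: "\<And>\<pi>. odd_partition \<pi> \<Longrightarrow> deg \<pi> \<le> j \<Longrightarrow> h (Yo \<pi>) \<in> Gp \<phi> t"
  shows "h x \<in> Gp \<phi> t"
proof -
  have keys: "odd_partition \<pi>" "deg \<pi> \<le> j" if "\<pi> \<in> Poly_Mapping.keys x" for \<pi>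
    using x that by (simp_all add: filt_def deg_def)
  then have "\<forall>\<pi> \<in> Poly_Mapping.keys x. \<exists>c. mono \<pi> = pscale c (Yo \<pi>)"
    by (metis Yo_mono)
  then obtain c where c: "\<And>\<pi>. \<pi> \<in> Poly_Mapping.keys x \<Longrightarrow> mono \<pi> = pscale (c \<pi>) (Yo \<pi>)"
    by (metis (no_types))
  have "x = (\<Sum>\<pi> \<in> Poly_Mapping.keys x. pscale (Poly_Mapping.lookup x \<pi>) (mono \<pi>))"
    by (rule mpoly_sum_monomials)
  also have "\<dots> = (\<Sum>\<pi> \<in> Poly_Mapping.keys x. pscale (Poly_Mapping.lookup x \<pi> * c \<pi>) (Yo \<pi>))"
    by (intro sum.cong HOL.refl) (simp add: c)
  finally have "h x = h (\<Sum>\<pi> \<in> Poly_Mapping.keys x. pscale (Poly_Mapping.lookup x \<pi> * c \<pi>) (Yo \<pi>))"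
    by (rule arg_cong)
  also have "\<dots> = (\<Sum>\<pi> \<in> Poly_Mapping.keys x. fscale (Poly_Mapping.lookup x \<pi> * c \<pi>) (h (Yo \<pi>)))"
    by (rule lin)
  also have "\<dots> \<in> Gp \<phi> t"
    by (intro Gp_sum Gp_scale Yo keys)
  finally show ?thesis .
qed

lemma Ch_combination_linear:
  "Ch_combination \<phi> (\<Sum>\<pi> \<in> K. pscale (c \<pi>) (f \<pi>)) = (\<Sum>\<pi> \<in> K. fscale (c \<pi>) (Ch_combination \<phi> (f \<pi>)))"
  by (simp only: Ch_combination_sum Ch_combination_pscale)

lemma Yo_eq_remain:
  "\<exists>s (I :: nat set). finite I \<and> Yo \<pi> = remain s I \<and> (\<Sum>i \<in> I. int (s i) + 1) = deg \<pi> \<and> (\<forall>i \<in> I. s i \<in># \<pi>)"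
proof -
  obtain xs where xs: "mset xs = \<pi>"
    using ex_mset by blast
  have "Yo \<pi> = (\<Prod>x \<leftarrow> xs. yy x)"
    unfolding xs[symmetric] by (induction xs) simp_all
  also have "\<dots> = (\<Prod>i \<leftarrow> [0..<length xs]. yy (xs ! i))"
    by (subst (1) map_nth[of xs, symmetric]) (simp only: map_map o_def)
  also have "\<dots> = remain ((!) xs) {0..<length xs}"
    by (simp add: remain_def prod.distinct_set_conv_list[symmetric])
  finally have "Yo \<pi> = remain ((!) xs) {0..<length xs}" .
  moreover have "deg \<pi> = (\<Sum>x \<leftarrow> xs. int x + 1)"
    unfolding xs[symmetric] by (induction xs) simp_all
  then have "(\<Sum>i \<in> {0..<length xs}. int (xs ! i) + 1) = deg \<pi>"
    by (simp add: sum_list_sum_nth)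
  moreover have "\<forall>i \<in> {0..<length xs}. xs ! i \<in># \<pi>"
    using xs by auto
  ultimately show ?thesis
    by blast
qed

lemma remain_filt: "finite I \<Longrightarrow> remain s I \<in> filt (\<Sum>i \<in> I. int (s i) + 1)"
  unfolding remain_def
proof (induction I rule: finite_induct)
  case (insert i I)
  then show ?case
    using filt_mult[OF yy_filt[of "s i"] insert.IH] by (simp only: prod.insert[OF insert.hyps] sum.insert[OF insert.hyps])
qed (simp add: filt_1)

lemma walk_start_filt:
  "finite S \<Longrightarrow> walk all_touched s k [] [] S \<in> filt (int k + 1 + (\<Sum>i \<in> S. int (s i) + 1) - 2 * int (card S))"
  by (rule filt_mono[OF walk_filt]) (auto simp: sum_subtractf sum.distrib)

text \<open>The summand of the empty set is the disjoint product; any other S loses 2 |S|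
  degrees.\<close>

lemma cycle_product_leading:
  assumes \<phi>: "schur_spin_characters \<phi>" and k: "odd k" and \<pi>: "odd_partition \<pi>"
  shows "\<exists>r \<in> filt (int k + 1 + deg \<pi> - 2).
    Ch_combination \<phi> (yy k) * Ch_combination \<phi> (Yo \<pi>) = Ch_combination \<phi> (yy k * Yo \<pi>) + Ch_combination \<phi> r"
proof -
  obtain s and I :: "nat set" where I: "finite I" "Yo \<pi> = remain s I" "(\<Sum>i \<in> I. int (s i) + 1) = deg \<pi>"
    "\<And>i. i \<in> I \<Longrightarrow> s i \<in># \<pi>"
    using Yo_eq_remain[of \<pi>] by blast
  have odd: "odd (s i)" if "i \<in> I" for i
    using I(4)[OF that] \<pi> by (simp add: odd_partition_def)
  let ?f = "\<lambda>S. remain s (I - S) * walk all_touched s k [] [] S"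
  define r where "r = (\<Sum>S \<in> Pow I - {{}}. ?f S)"
  have "?f S \<in> filt (int k + 1 + deg \<pi> - 2)" if "S \<in> Pow I - {{}}" for S
  proof -
    have S: "finite S" "S \<subseteq> I" "card S > 0"
      using that I(1) finite_subset by (auto simp: card_gt_0_iff)
    have "?f S \<in> filt ((\<Sum>i \<in> I - S. int (s i) + 1) + (int k + 1 + (\<Sum>i \<in> S. int (s i) + 1) - 2 * int (card S)))"
      using I(1) S by (intro filt_mult remain_filt walk_start_filt) auto
    moreover have "(\<Sum>i \<in> I - S. int (s i) + 1) + (\<Sum>i \<in> S. int (s i) + 1) = deg \<pi>"
      using sum.subset_diff[OF S(2) I(1), of "\<lambda>i. int (s i) + 1"] I(3) by simp
    ultimately show ?thesis
      using S(3) by (elim filt_mono) linarith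
  qed
  then have r: "r \<in> filt (int k + 1 + deg \<pi> - 2)"
    unfolding r_def by (rule filt_sum)
  have "Ch_combination \<phi> (yy k) * Ch_combination \<phi> (Yo \<pi>) = Ch_combination \<phi> (\<Sum>S \<in> Pow I. ?f S)"
    unfolding I(2) Ch_combination_sum by (rule Ch_combination_cycle_product[OF \<phi> k I(1) odd])
  also have "(\<Sum>S \<in> Pow I. ?f S) = ?f {} + r"
    unfolding r_def using I(1) by (intro sum.remove) auto
  also have "?f {} = yy k * Yo \<pi>"
    using walk_no_points[of s k 0] by (simp add: I(2) mult.commute)
  finally show ?thesis
    using r by (simp only: Ch_combination_add) blast
qed

lemma cycle_mult_Gp:
  assumes \<phi>: "schur_spin_characters \<phi>" and k: "odd k" and g: "g \<in> Gp \<phi> j"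
  shows "Ch_combination \<phi> (yy k) * g \<in> Gp \<phi> (int k + 1 + j)"
proof -
  obtain x where x: "x \<in> filt j" "g = Ch_combination \<phi> x"
    using g by (auto simp: Gp_def)
  show ?thesis
    unfolding x(2)
  proof (rule filt_linear[OF x(1), where h = "\<lambda>x. Ch_combination \<phi> (yy k) * Ch_combination \<phi> x"])
    fix \<pi> assume \<pi>: "odd_partition \<pi>" "deg \<pi> \<le> j"
    obtain r where r: "r \<in> filt (int k + 1 + deg \<pi> - 2)"
      "Ch_combination \<phi> (yy k) * Ch_combination \<phi> (Yo \<pi>) = Ch_combination \<phi> (yy k * Yo \<pi>) + Ch_combination \<phi> r"
      using cycle_product_leading[OF \<phi> k \<pi>(1)] by blast
    have "yy k * Yo \<pi> \<in> filt (int k + 1 + j)"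
      by (rule filt_mono[OF filt_mult[OF yy_filt Yo_filt]]) (use \<pi> in simp)
    moreover have "r \<in> filt (int k + 1 + j)"
      by (rule filt_mono[OF r(1)]) (use \<pi> in simp)
    ultimately show "Ch_combination \<phi> (yy k) * Ch_combination \<phi> (Yo \<pi>) \<in> Gp \<phi> (int k + 1 + j)"
      unfolding r(2) by (intro Gp_add Gp_intro)
  qed (simp only: Ch_combination_linear sum_distrib_left fscale_mult)
qed

text \<open>Induction on the degree of \<pi>. When a part k is split off, the disjoint product of
  \<open>yy k\<close> with the rest is the pointwise product minus a term of lower degree. The
  former is handled by \<open>cycle_mult_Gp\<close>, the latter by induction.\<close>

lemma Gp_mult:
  assumes \<phi>: "schur_spin_characters \<phi>" and f: "f \<in> Gp \<phi> i" and g: "g \<in> Gp \<phi> j"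
  shows "f * g \<in> Gp \<phi> (i + j)"
proof -
  have Yo: "Ch_combination \<phi> (Yo \<pi>) * g \<in> Gp \<phi> (deg \<pi> + j)" if "odd_partition \<pi>" for \<pi>
    using that
  proof (induction "nat (deg \<pi>)" arbitrary: \<pi> rule: less_induct)
    case less
    show ?case
    proof (cases \<pi>)
      case empty
      then show ?thesis
        using g Ch_combination_one[OF \<phi>] by simp
    next
      case (add k \<sigma>)
      then have k: "odd k" and \<sigma>: "odd_partition \<sigma>"
        using less.prems by auto
      obtain r where r: "r \<in> filt (int k + 1 + deg \<sigma> - 2)"
        "Ch_combination \<phi> (yy k) * Ch_combination \<phi> (Yo \<sigma>) = Ch_combination \<phi> (yy k * Yo \<sigma>) + Ch_combination \<phi> r"
        using cycle_product_leading[OF \<phi> k \<sigma>] by blast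
      have rg: "Ch_combination \<phi> r * g \<in> Gp \<phi> (deg \<pi> + j)"
      proof (rule filt_linear[OF r(1), where h = "\<lambda>x. Ch_combination \<phi> x * g"])
        fix \<tau> assume \<tau>: "odd_partition \<tau>" "deg \<tau> \<le> int k + 1 + deg \<sigma> - 2"
        then have "deg \<tau> < deg \<pi>" "deg \<tau> \<ge> 0"
          using add deg_nonneg by auto
        then have "Ch_combination \<phi> (Yo \<tau>) * g \<in> Gp \<phi> (deg \<tau> + j)"
          using \<tau> by (intro less.hyps) auto
        then show "Ch_combination \<phi> (Yo \<tau>) * g \<in> Gp \<phi> (deg \<pi> + j)"
          by (rule Gp_mono) (use \<open>deg \<tau> < deg \<pi>\<close> in simp)
      qed (simp only: Ch_combination_linear sum_distrib_right fscale_mult)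
      have "Ch_combination \<phi> (Yo \<sigma>) * g \<in> Gp \<phi> (deg \<sigma> + j)"
        using \<sigma> add deg_nonneg[of \<sigma>] by (intro less.hyps) auto
      then have "Ch_combination \<phi> (yy k) * (Ch_combination \<phi> (Yo \<sigma>) * g) \<in> Gp \<phi> (deg \<pi> + j)"
        using cycle_mult_Gp[OF \<phi> k] unfolding add deg_simps add.assoc by blast
      then have diff: "Ch_combination \<phi> (yy k) * (Ch_combination \<phi> (Yo \<sigma>) * g) - Ch_combination \<phi> r * g \<in> Gp \<phi> (deg \<pi> + j)"
        using rg by (rule Gp_diff)
      have "Ch_combination \<phi> (yy k) * (Ch_combination \<phi> (Yo \<sigma>) * g) - Ch_combination \<phi> r * g =
          Ch_combination \<phi> (Yo \<pi>) * g"
        unfolding mult.assoc[symmetric] r(2) add by (simp only: Yo_simps distrib_right add_diff_cancel_right')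
      with diff show ?thesis
        by (simp only:)
    qed
  qed
  obtain x where x: "x \<in> filt i" "f = Ch_combination \<phi> x"
    using f by (auto simp: Gp_def)
  show ?thesis
    unfolding x(2)
  proof (rule filt_linear[OF x(1), where h = "\<lambda>x. Ch_combination \<phi> x * g"])
    fix \<pi> assume "odd_partition \<pi>" "deg \<pi> \<le> i"
    then show "Ch_combination \<phi> (Yo \<pi>) * g \<in> Gp \<phi> (i + j)"
      by (intro Gp_mono[OF Yo]) auto
  qed (simp only: Ch_combination_linear sum_distrib_right fscale_mult)
qed


subsection \<open>The degree of cumulants\<close>

text \<open>Convolution with the moments turns the right side into the product of
  \<open>yy k\<close> with the cycles and the left side into its expansion by
  \<open>Ch_combination_cycle_product\<close>; the moments are then cancelled. The summand S = {} is
  the cumulant of \<open>yy k\<close> with the cycles in I.\<close>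

lemma kappa_cycles:
  assumes \<phi>: "schur_spin_characters \<phi>" and k: "odd k" and I: "finite I" and s: "\<And>i. i \<in> I \<Longrightarrow> odd (s i)"
  shows "(\<Sum>S \<in> Pow I. kappa \<phi> (\<lambda>i. yy (s i)) (walk all_touched s k [] [] S) (I - S)) =
    (if I = {} then Ch_combination \<phi> (yy k) else 0)"
proof -
  let ?a = "\<lambda>i. yy (s i)" and ?C = "walk all_touched s k [] []"
  let ?e = "moment \<phi> ?a 1"
  show ?thesis
  proof (rule set_conv_cancel[where e = ?e and g = "\<lambda>I. \<Sum>S \<in> Pow I. kappa \<phi> ?a (?C S) (I - S)"
        and h = "\<lambda>I. if I = {} then Ch_combination \<phi> (yy k) else 0"])
    show "?e {} = 1"
      by (simp add: moment_empty Ch_combination_one[OF \<phi>])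
    fix J assume "J \<subseteq> I"
    then have J: "finite J" "\<And>i. i \<in> J \<Longrightarrow> odd (s i)"
      using I s finite_subset by auto
    have "(\<Sum>U \<in> Pow J. (\<Sum>S \<in> Pow U. kappa \<phi> ?a (?C S) (U - S)) * ?e (J - U)) =
        (\<Sum>U \<in> Pow J. \<Sum>S \<in> Pow U. kappa \<phi> ?a (?C S) (U - S) * ?e (J - U))"
      by (simp only: sum_distrib_right)
    also have "\<dots> = (\<Sum>S \<in> Pow J. \<Sum>L \<in> Pow (J - S). kappa \<phi> ?a (?C S) L * ?e (J - S - L))"
      by (rule sum_Pow_assoc[OF J(1), of "\<lambda>S L R. kappa \<phi> ?a (?C S) L * ?e R", symmetric])
    also have "\<dots> = (\<Sum>S \<in> Pow J. moment \<phi> ?a (?C S) (J - S))"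
      using J(1) by (intro sum.cong HOL.refl kappa_conv[OF \<phi>]) simp
    also have "\<dots> = (\<Sum>S \<in> Pow J. Ch_combination \<phi> (remain s (J - S) * ?C S))"
      by (simp only: moment_def remain_def mult.commute)
    also have "\<dots> = Ch_combination \<phi> (yy k) * Ch_combination \<phi> (remain s J)"
      by (rule Ch_combination_cycle_product[OF \<phi> k J, symmetric])
    also have "\<dots> = Ch_combination \<phi> (yy k) * ?e J"
      by (simp add: moment_def remain_def)
    also have "\<dots> = (\<Sum>U \<in> Pow J. (if U = {} then Ch_combination \<phi> (yy k) else 0) * ?e (J - U))"
      using J(1) by (subst sum.remove[of _ "{}"]) (auto intro!: sum.neutral)
    finally show "(\<Sum>U \<in> Pow J. (\<Sum>S \<in> Pow U. kappa \<phi> ?a (?C S) (U - S)) * ?e (J - U)) =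
        (\<Sum>U \<in> Pow J. (if U = {} then Ch_combination \<phi> (yy k) else 0) * ?e (J - U))" .
  qed (rule I)
qed

text \<open>Two nested inductions: on the total degree D, and for fixed D on the excess M of the
  number of parts over the size of I. If an argument has two parts, \<open>kappa_mult\<close> makes
  one of them a new argument, which lowers M, at the cost of products of cumulants with smaller D.
  If all are single cycles, \<open>kappa_cycles\<close> leads to cumulants with smaller D.\<close>

lemma kappa_Yo_filt:
  assumes \<phi>: "schur_spin_characters \<phi>" and "finite I" "odd_partition q" "\<And>i. i \<in> I \<Longrightarrow> odd_partition (p i)"
  shows "kappa \<phi> (\<lambda>i. Yo (p i)) (Yo q) I \<in> Gp \<phi> (deg q + (\<Sum>i \<in> I. deg (p i)) - 2 * int (card I))"
proof -
  have "\<forall>q p I. finite I \<longrightarrow> odd_partition q \<longrightarrow> (\<forall>i \<in> I. odd_partition (p i)) \<longrightarrow>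
      nat (deg q + (\<Sum>i \<in> I. deg (p i))) = D \<longrightarrow> size q + (\<Sum>i \<in> I. size (p i)) - card I = M \<longrightarrow>
      kappa \<phi> (\<lambda>i. Yo (p i)) (Yo q) I \<in> Gp \<phi> (deg q + (\<Sum>i \<in> I. deg (p i)) - 2 * int (card I))" for D M
  proof (induction D arbitrary: M rule: less_induct)
    case D: (less D)
    show ?case
    proof (induction M rule: less_induct)
      case M: (less M)
      have nonneg: "(\<Sum>i \<in> I. deg (p i)) \<ge> 0" for p :: "nat \<Rightarrow> nat multiset" and I
        by (simp add: sum_nonneg deg_nonneg)
      have IH_D: "kappa \<phi> (\<lambda>i. Yo (p i)) (Yo q) I \<in> Gp \<phi> (deg q + (\<Sum>i \<in> I. deg (p i)) - 2 * int (card I))"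
        if "finite I" "odd_partition q" "\<And>i. i \<in> I \<Longrightarrow> odd_partition (p i)"
          "deg q + (\<Sum>i \<in> I. deg (p i)) < int D" for q p I
      proof -
        have "nat (deg q + (\<Sum>i \<in> I. deg (p i))) < D"
          using that(4) deg_nonneg[of q] nonneg[of p I] by linarith
        then show ?thesis
          using D that(1-3) by blast
      qed
      have split: "kappa \<phi> (\<lambda>i. Yo (p i)) (Yo q) I \<in> Gp \<phi> (deg q + (\<Sum>i \<in> I. deg (p i)) - 2 * int (card I))"
        if I: "finite I" and q: "odd_partition q" "size q \<ge> 2"
          and p: "\<And>i. i \<in> I \<Longrightarrow> odd_partition (p i)" "\<And>i. i \<in> I \<Longrightarrow> p i \<noteq> {#}"
          and eq: "nat (deg q + (\<Sum>i \<in> I. deg (p i))) = D" "size q + (\<Sum>i \<in> I. size (p i)) - card I = M"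
        for q p I
      proof -
        obtain k q' where "q = add_mset k q'"
          using q(2) by (cases q) auto
        with q(2) have q': "q = add_mset k q'" "q' \<noteq> {#}"
          by auto
        obtain l where l: "l \<notin> I"
          using ex_new_if_finite[OF infinite_UNIV_nat I] by blast
        let ?a = "\<lambda>i. Yo (p i)" and ?p = "p(l := {#k#})"
        have total: "deg q' + (int k + 1) + (\<Sum>i \<in> I. deg (p i)) = int D"
          using eq(1) deg_nonneg[of q] nonneg[of p I] by (simp add: q')
        have "(\<Sum>i \<in> I. size (?p i)) = (\<Sum>i \<in> I. size (p i))" "(\<Sum>i \<in> I. deg (?p i)) = (\<Sum>i \<in> I. deg (p i))"
          using l by (auto intro!: sum.cong)
        then have sum_p: "(\<Sum>i \<in> insert l I. size (?p i)) = 1 + (\<Sum>i \<in> I. size (p i))"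
          "(\<Sum>i \<in> insert l I. deg (?p i)) = int k + 1 + (\<Sum>i \<in> I. deg (p i))"
          by (simp_all only: sum.insert[OF I l] fun_upd_same) simp_all
        \<comment> \<open>Since no \<open>p i\<close> is empty, the truncated difference that
          defines M is exact.\<close>
        have "card I \<le> (\<Sum>i \<in> I. size (p i))"
          using sum_mono[of I "\<lambda>_. 1" "\<lambda>i. size (p i)"] p(2) by (simp add: Suc_le_eq nonempty_has_size)
        then have less: "size q' + (\<Sum>i \<in> insert l I. size (?p i)) - card (insert l I) < M"
          using eq(2) I l by (simp add: q' sum_p(1) del: sum.insert fun_upd_apply)
        have deg_eq: "deg q' + (\<Sum>i \<in> insert l I. deg (?p i)) = int D"
          using total by (simp add: sum_p(2) del: sum.insert fun_upd_apply)
        have "kappa \<phi> (\<lambda>i. Yo (?p i)) (Yo q') (insert l I) \<in>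
            Gp \<phi> (deg q' + (\<Sum>i \<in> insert l I. deg (?p i)) - 2 * int (card (insert l I)))"
        proof -
          have "\<forall>i \<in> insert l I. odd_partition (?p i)" "odd_partition q'"
            using p(1) q(1) by (auto simp: q')
          moreover have "nat (deg q' + (\<Sum>i \<in> insert l I. deg (?p i))) = D"
            by (simp only: deg_eq nat_int)
          ultimately show ?thesis
            using M less I by blast
        qed
        also have "(\<lambda>i. Yo (?p i)) = ?a(l := yy k)"
          by auto
        finally have first: "kappa \<phi> (?a(l := yy k)) (Yo q') (insert l I) \<in>
            Gp \<phi> (deg q + (\<Sum>i \<in> I. deg (p i)) - 2 * int (card I))"
          unfolding deg_eq by (elim Gp_mono) (use total I l in \<open>simp add: q'\<close>)
        \<comment> \<open>Both q' and {k} are nonempty, so each factor has total degree below D. The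
          losses 2 |S| and 2 |I - S| add up.\<close>
        have second: "kappa \<phi> ?a (Yo q') S * kappa \<phi> ?a (Yo {#k#}) (I - S) \<in>
            Gp \<phi> (deg q + (\<Sum>i \<in> I. deg (p i)) - 2 * int (card I))" if S: "S \<in> Pow I" for S
        proof -
          have fin: "finite S" "finite (I - S)"
            using S I finite_subset by auto
          have sum: "(\<Sum>i \<in> I - S. deg (p i)) + (\<Sum>i \<in> S. deg (p i)) = (\<Sum>i \<in> I. deg (p i))"
            using S I by (intro sum.subset_diff[symmetric]) auto
          have card: "card (I - S) + card S = card I"
            using S I fin by (simp add: card_Diff_subset card_mono)
          have "kappa \<phi> ?a (Yo q') S \<in> Gp \<phi> (deg q' + (\<Sum>i \<in> S. deg (p i)) - 2 * int (card S))"
            using S fin p(1) q(1) total sum nonneg[of p "I - S"] by (intro IH_D) (auto simp: q')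
          moreover have "kappa \<phi> ?a (Yo {#k#}) (I - S) \<in>
              Gp \<phi> (deg {#k#} + (\<Sum>i \<in> I - S. deg (p i)) - 2 * int (card (I - S)))"
            using S fin p(1) q(1) total sum nonneg[of p S] deg_pos[OF q'(2)] by (intro IH_D) (auto simp: q')
          ultimately have "kappa \<phi> ?a (Yo q') S * kappa \<phi> ?a (Yo {#k#}) (I - S) \<in>
              Gp \<phi> ((deg q' + (\<Sum>i \<in> S. deg (p i)) - 2 * int (card S)) +
                (deg {#k#} + (\<Sum>i \<in> I - S. deg (p i)) - 2 * int (card (I - S))))"
            by (rule Gp_mult[OF \<phi>])
          then show ?thesis
            by (rule Gp_mono) (use sum card in \<open>simp add: q'\<close>)
        qed
        have "Yo q = Yo q' * yy k"
          by (simp add: q' mult.commute)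
        then have "kappa \<phi> ?a (Yo q) I = kappa \<phi> (?a(l := yy k)) (Yo q') (insert l I) +
            (\<Sum>S \<in> Pow I. kappa \<phi> ?a (Yo q') S * kappa \<phi> ?a (Yo {#k#}) (I - S))"
          using kappa_mult[OF \<phi> I l, of ?a "Yo q'" "yy k"] by simp
        then show ?thesis
          using first second by (simp only:) (intro Gp_add Gp_sum)
      qed
      show ?case
      proof (intro allI impI)
        fix q p and I :: "nat set"
        assume I: "finite I" and q: "odd_partition q" and p: "\<forall>i \<in> I. odd_partition (p i)"
          and eq: "nat (deg q + (\<Sum>i \<in> I. deg (p i))) = D" "size q + (\<Sum>i \<in> I. size (p i)) - card I = M"
        let ?a = "\<lambda>i. Yo (p i)"
        let ?b = "deg q + (\<Sum>i \<in> I. deg (p i)) - 2 * int (card I)"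
        have total: "deg q + (\<Sum>i \<in> I. deg (p i)) = int D"
          using eq(1) deg_nonneg[of q] nonneg[of p I] by simp
        \<comment> \<open>Unit arguments, then an argument with two parts at the distinguished place
          or elsewhere, and finally single cycles throughout.\<close>
        consider "q = {#}" | i where "i \<in> I" "p i = {#}" | "\<forall>i \<in> I. p i \<noteq> {#}" "size q \<ge> 2"
          | i where "q \<noteq> {#}" "\<forall>i \<in> I. p i \<noteq> {#}" "i \<in> I" "size (p i) \<ge> 2"
          | "size q = 1" "\<forall>i \<in> I. size (p i) = 1"
          by (metis One_nat_def Suc_1 Suc_leI le_neq_implies_less nonempty_has_size)
        then show "kappa \<phi> ?a (Yo q) I \<in> Gp \<phi> ?b"
        proof cases
          case 1
          have "1 \<in> Gp \<phi> 0"
            using Gp_intro[OF filt_1] Ch_combination_one[OF \<phi>] by metis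
          then show ?thesis
            using 1 kappa_one[OF \<phi> I] by (auto intro: Gp_0)
        next
          case 2
          define J where "J = I - {i}"
          have J: "finite J" "i \<notin> J" "I = insert i J"
            using I 2 by (auto simp: J_def)
          \<comment> \<open>\<open>kappa_mult\<close> is applied with second factor 1: cumulants of
            1 leave only S = J, which already accounts for the left side, so the cumulant with the
            unit argument is 0.\<close>
          have "(\<Sum>S \<in> Pow J. kappa \<phi> ?a (Yo q) S * kappa \<phi> ?a 1 (J - S)) =
              (\<Sum>S \<in> Pow J. if S = J then kappa \<phi> ?a (Yo q) J else 0)"
            using J(1) by (intro sum.cong) (auto simp: kappa_one[OF \<phi>] Diff_eq_empty_iff)
          then have "kappa \<phi> (?a(i := 1)) (Yo q) I = 0"
            using kappa_mult[OF \<phi> J(1,2), of ?a "Yo q" 1] J(1) by (simp add: J(3))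
          moreover have "?a(i := 1) = ?a"
            using 2 by auto
          ultimately show ?thesis
            by (simp add: Gp_0)
        next
          case 3
          then show ?thesis
            using I q p eq by (intro split) auto
        next
          case 4
          define J where "J = I - {i}"
          have J: "finite J" "i \<notin> J" "I = insert i J"
            using I 4 by (auto simp: J_def)
          \<comment> \<open>The argument with two parts is exchanged with the distinguished one,
            which preserves D and M.\<close>
          let ?p = "p(i := q)"
          have "(\<Sum>j \<in> J. size (?p j)) = (\<Sum>j \<in> J. size (p j))" "(\<Sum>j \<in> J. deg (?p j)) = (\<Sum>j \<in> J. deg (p j))"
            using J(2) by (auto intro!: sum.cong)
          then have sum_p: "size (p i) + (\<Sum>j \<in> I. size (?p j)) = size q + (\<Sum>j \<in> I. size (p j))"
            "deg (p i) + (\<Sum>j \<in> I. deg (?p j)) = deg q + (\<Sum>j \<in> I. deg (p j))"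
            using J(1,2) by (simp_all only: J(3) sum.insert[OF J(1,2)] fun_upd_same)
          have "kappa \<phi> (\<lambda>j. Yo (?p j)) (Yo (p i)) I \<in>
              Gp \<phi> (deg (p i) + (\<Sum>j \<in> I. deg (?p j)) - 2 * int (card I))"
            using I q p 4 eq sum_p by (intro split) auto
          moreover have "(\<lambda>j. Yo (?p j)) = ?a(i := Yo q)"
            by auto
          moreover have "kappa \<phi> (?a(i := Yo q)) (Yo (p i)) I = kappa \<phi> (?a(i := Yo (p i))) (Yo q) I"
            unfolding J(3) by (rule kappa_swap[OF \<phi> J(1,2)])
          ultimately show ?thesis
            using sum_p(2) by (simp add: fun_upd_idem)
        next
          case 5
          then obtain k where k: "q = {#k#}"
            using size_1_singleton_mset by blast
          have "\<exists>s. \<forall>i \<in> I. p i = {#s i#}"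
            using 5(2) size_1_singleton_mset by (intro bchoice) blast
          then obtain s where s: "\<And>i. i \<in> I \<Longrightarrow> p i = {#s i#}"
            by blast
          have odd: "odd k" "\<And>i. i \<in> I \<Longrightarrow> odd (s i)"
            using q p s by (auto simp: k)
          let ?C = "walk all_touched s k [] []"
          have a: "kappa \<phi> (\<lambda>i. yy (s i)) x J = kappa \<phi> ?a x J" if "J \<subseteq> I" for x J
            using that I s finite_subset by (intro kappa_cong[OF \<phi>]) auto
          have "(\<Sum>S \<in> Pow I. kappa \<phi> (\<lambda>i. yy (s i)) (?C S) (I - S)) = (if I = {} then Ch_combination \<phi> (yy k) else 0)"
            by (rule kappa_cycles[OF \<phi> odd(1) I]) (rule odd(2))
          then have "(if I = {} then Ch_combination \<phi> (yy k) else 0) =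
              (\<Sum>S \<in> Pow I. kappa \<phi> ?a (?C S) (I - S))"
            by (simp only: a Diff_subset)
          also have "\<dots> = kappa \<phi> ?a (?C {}) I + (\<Sum>S \<in> Pow I - {{}}. kappa \<phi> ?a (?C S) (I - S))"
            using I by (subst sum.remove[of _ "{}"]) auto
          also have "?C {} = Yo q"
            using walk_no_points[of s k 0] by (simp add: k)
          finally have "kappa \<phi> ?a (Yo q) I = (if I = {} then Ch_combination \<phi> (yy k) else 0) -
              (\<Sum>S \<in> Pow I - {{}}. kappa \<phi> ?a (?C S) (I - S))"
            by (simp only: add_diff_cancel_right')
          moreover have "(if I = {} then Ch_combination \<phi> (yy k) else 0) \<in> Gp \<phi> ?b"
            using Gp_intro[OF yy_filt[of k]] by (auto simp: k intro: Gp_0)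
          moreover have "kappa \<phi> ?a (?C S) (I - S) \<in> Gp \<phi> ?b" if S: "S \<in> Pow I - {{}}" for S
          proof -
            have fin: "finite S" "S \<subseteq> I" "finite (I - S)" "card S > 0"
              using S I finite_subset by (auto simp: card_gt_0_iff)
            have deg_S: "(\<Sum>i \<in> S. int (s i) + 1) = (\<Sum>i \<in> S. deg (p i))"
              using fin(2) s by (intro sum.cong) auto
            have sum: "(\<Sum>i \<in> I - S. deg (p i)) + (\<Sum>i \<in> S. deg (p i)) = (\<Sum>i \<in> I. deg (p i))"
              using fin(2) I by (intro sum.subset_diff[symmetric]) auto
            have card: "card (I - S) + card S = card I"
              using fin I by (simp add: card_Diff_subset card_mono)
            have "?C S \<in> filt (deg q + (\<Sum>i \<in> S. deg (p i)) - 2 * int (card S))"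
              using walk_start_filt[OF fin(1), of s k] by (simp add: k deg_S)
            then show ?thesis
            proof (rule filt_linear[where h = "\<lambda>x. kappa \<phi> ?a x (I - S)"])
              fix \<pi> assume \<pi>: "odd_partition \<pi>" "deg \<pi> \<le> deg q + (\<Sum>i \<in> S. deg (p i)) - 2 * int (card S)"
              show "kappa \<phi> ?a (Yo \<pi>) (I - S) \<in> Gp \<phi> ?b"
              proof (rule Gp_mono[OF IH_D])
                show "deg \<pi> + (\<Sum>i \<in> I - S. deg (p i)) < int D"
                  "deg \<pi> + (\<Sum>i \<in> I - S. deg (p i)) - 2 * int (card (I - S)) \<le> ?b"
                  using \<pi>(2) total sum card fin(4) by linarith+
              qed (use \<pi> p fin in auto)
            qed (simp only: kappa_sum[OF \<phi> fin(3)] kappa_pscale[OF \<phi> fin(3)])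
          qed
          ultimately show ?thesis
            by (simp only:) (intro Gp_diff Gp_sum)
        qed
      qed
    qed
  qed
  then show ?thesis
    using assms by blast
qed

text \<open>Multilinearity: arguments with index in J are still arbitrary, the others are already
  products \<open>Yo\<close>. Each in turn is brought to the distinguished place by
  \<open>kappa_swap\<close>, expanded there, and put back.\<close>

lemma kappa_filt:
  assumes \<phi>: "schur_spin_characters \<phi>" and I: "finite I" and x: "x \<in> filt k0"
    and a: "\<And>i. i \<in> I \<Longrightarrow> a i \<in> filt (k i)"
  shows "kappa \<phi> a x I \<in> Gp \<phi> (k0 + (\<Sum>i \<in> I. k i) - 2 * int (card I))" (is "_ \<in> Gp \<phi> ?b")
proof -
  have "kappa \<phi> a x I \<in> Gp \<phi> ?b"
    if "finite J" "J \<subseteq> I" "\<And>i. i \<in> J \<Longrightarrow> a i \<in> filt (k i)"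
      "\<And>i. i \<in> I - J \<Longrightarrow> \<exists>\<pi>. odd_partition \<pi> \<and> deg \<pi> \<le> k i \<and> a i = Yo \<pi>" for J a
    using that
  proof (induction J arbitrary: a rule: finite_induct)
    case empty
    then have "\<exists>p. \<forall>i \<in> I. odd_partition (p i) \<and> deg (p i) \<le> k i \<and> a i = Yo (p i)"
      by (intro bchoice) auto
    then obtain p where p: "\<And>i. i \<in> I \<Longrightarrow> odd_partition (p i) \<and> deg (p i) \<le> k i \<and> a i = Yo (p i)"
      by blast
    show ?case
    proof (rule filt_linear[OF x, where h = "\<lambda>x. kappa \<phi> a x I"])
      fix \<pi> assume \<pi>: "odd_partition \<pi>" "deg \<pi> \<le> k0"
      have eq: "kappa \<phi> a (Yo \<pi>) I = kappa \<phi> (\<lambda>i. Yo (p i)) (Yo \<pi>) I"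
        using p by (intro kappa_cong[OF \<phi> I]) simp
      have "kappa \<phi> (\<lambda>i. Yo (p i)) (Yo \<pi>) I \<in> Gp \<phi> (deg \<pi> + (\<Sum>i \<in> I. deg (p i)) - 2 * int (card I))"
        using \<pi> p by (intro kappa_Yo_filt[OF \<phi> I]) auto
      then show "kappa \<phi> a (Yo \<pi>) I \<in> Gp \<phi> ?b"
        unfolding eq by (rule Gp_mono) (use \<pi> p sum_mono[of I "\<lambda>i. deg (p i)" k] in auto)
    qed (simp only: kappa_sum[OF \<phi> I] kappa_pscale[OF \<phi> I])
  next
    case (insert j J)
    have j: "j \<in> I" "finite (I - {j})" "j \<notin> I - {j}" "I = insert j (I - {j})"
      using insert.prems(1) I by auto
    have swap: "kappa \<phi> (a(j := y)) x I = kappa \<phi> (a(j := x)) y I" for y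
      using kappa_swap[OF \<phi> j(2,3), of a y x] j(4) by simp
    have "a j \<in> filt (k j)"
      using insert.prems by simp
    then have "kappa \<phi> (a(j := x)) (a j) I \<in> Gp \<phi> ?b"
    proof (rule filt_linear[where h = "\<lambda>y. kappa \<phi> (a(j := x)) y I"])
      fix \<pi> assume \<pi>: "odd_partition \<pi>" "deg \<pi> \<le> k j"
      have "kappa \<phi> (a(j := Yo \<pi>)) x I \<in> Gp \<phi> ?b"
        by (rule insert.IH) (use insert.prems insert.hyps \<pi> in auto)
      then show "kappa \<phi> (a(j := x)) (Yo \<pi>) I \<in> Gp \<phi> ?b"
        by (simp only: swap)
    qed (simp only: kappa_sum[OF \<phi> I] kappa_pscale[OF \<phi> I])
    then have "kappa \<phi> (a(j := a j)) x I \<in> Gp \<phi> ?b"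
      by (simp only: swap)
    then show ?case
      by simp
  qed
  from this[OF I order.refl, of a] show ?thesis
    using a by auto
qed

section \<open>Degrees in the algebra and the integer-indexed filtration\<close>

lemma span_Ch_eq:
  "fun_vs.span {Ch \<phi> \<pi> | \<pi>. P \<pi>} = Ch_combination \<phi> ` {x. \<forall>\<pi> \<in> Poly_Mapping.keys x. P \<pi>}"
proof (intro equalityI subsetI)
  fix f assume "f \<in> fun_vs.span {Ch \<phi> \<pi> | \<pi>. P \<pi>}"
  then show "f \<in> Ch_combination \<phi> ` {x. \<forall>\<pi> \<in> Poly_Mapping.keys x. P \<pi>}"
  proof (induction rule: fun_vs.span_induct_alt)
    case base
    then show ?case
      by (intro image_eqI[of _ _ 0]) simp_all
  next
    case (step c f g)
    then obtain \<pi> x where \<pi>: "f = Ch \<phi> \<pi>" "P \<pi>" and x: "g = Ch_combination \<phi> x" "\<forall>\<sigma> \<in> Poly_Mapping.keys x. P \<sigma>"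
      by auto
    have "Poly_Mapping.keys (Poly_Mapping.single \<pi> c + x) \<subseteq> insert \<pi> (Poly_Mapping.keys x)"
      using keys_add[of "Poly_Mapping.single \<pi> c" x] by (auto split: if_splits)
    then show ?case
      using \<pi> x by (intro image_eqI[of _ _ "Poly_Mapping.single \<pi> c + x"]) (auto simp: Ch_combination_add Ch_combination_single)
  qed
next
  fix f assume "f \<in> Ch_combination \<phi> ` {x. \<forall>\<pi> \<in> Poly_Mapping.keys x. P \<pi>}"
  then obtain x where x: "f = Ch_combination \<phi> x" "\<forall>\<pi> \<in> Poly_Mapping.keys x. P \<pi>"
    by auto
  show "f \<in> fun_vs.span {Ch \<phi> \<pi> | \<pi>. P \<pi>}"
    unfolding x(1) Ch_combination_def
    by (intro fun_vs.span_sum fun_vs.span_scale fun_vs.span_base) (use x(2) in auto)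
qed

lemma Gamma_space_eq: "Gamma_space \<phi> = Ch_combination \<phi> ` {x. odd_poly x}"
  unfolding Gamma_space_def odd_poly_def by (rule span_Ch_eq)

lemma Gamma_filtration_eq: "Gamma_filtration \<phi> k = Gp \<phi> (int k)"
proof -
  have "{x. \<forall>\<pi> \<in> Poly_Mapping.keys x. odd_partition \<pi> \<and> sum_mset \<pi> + size \<pi> \<le> k} = filt (int k)"
    unfolding filt_def by (simp only: of_nat_le_iff)
  then show ?thesis
    unfolding Gamma_filtration_def Gp_def by (simp only: span_Ch_eq)
qed

lemma alg_degree_le:
  assumes "alg_filtration A = Gamma_filtration \<phi>" "x \<in> Gp \<phi> j"
  shows "alg_degree A x \<le> ereal (real_of_int j)"
proof (cases "x = 0")
  case False
  then have "j \<ge> 0"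
    using Gp_neg[OF assms(2)] by force
  then have "(INF k \<in> {k. x \<in> Gp \<phi> (int k)}. ereal (real k)) \<le> ereal (real (nat j))"
    using assms(2) by (intro INF_lower) simp
  then have "alg_degree A x \<le> ereal (real (nat j))"
    using assms(1) False by (simp only: alg_degree_def Gamma_filtration_eq if_False)
  then show ?thesis
    using \<open>j \<ge> 0\<close> by simp
qed (simp add: alg_degree_def)

text \<open>The levels are natural numbers, so the infimum over a nonempty set of them is attained.
  The sum of the degrees of all monomials provides one level.\<close>

lemma alg_degree_attained:
  assumes "alg_filtration A = Gamma_filtration \<phi>" "x \<in> Gamma_space \<phi>" "x \<noteq> 0"
  obtains k where "alg_degree A x = ereal (real k)" "x \<in> Gp \<phi> (int k)"
proof -
  let ?K = "{k. x \<in> Gp \<phi> (int k)}"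
  obtain y where y: "x = Ch_combination \<phi> y" "odd_poly y"
    using assms(2) by (auto simp: Gamma_space_eq)
  define m where "m = (\<Sum>\<pi> \<in> Poly_Mapping.keys y. sum_mset \<pi> + size \<pi>)"
  have "y \<in> filt (int m)"
    unfolding filt_def
  proof (intro CollectI ballI conjI)
    fix \<pi> assume \<pi>: "\<pi> \<in> Poly_Mapping.keys y"
    then show "odd_partition \<pi>"
      using y(2) by (simp add: odd_poly_def)
    have "sum_mset \<pi> + size \<pi> \<le> m"
      unfolding m_def using \<pi> by (intro member_le_sum) auto
    then show "int (sum_mset \<pi> + size \<pi>) \<le> int m"
      by (simp only: of_nat_le_iff)
  qed
  then have "m \<in> ?K"
    by (simp add: y(1) Gp_intro)
  then have least: "(LEAST k. k \<in> ?K) \<in> ?K"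
    by (rule LeastI)
  have "(INF k \<in> ?K. ereal (real k)) = ereal (real (LEAST k. k \<in> ?K))"
  proof (rule antisym)
    show "(INF k \<in> ?K. ereal (real k)) \<le> ereal (real (LEAST k. k \<in> ?K))"
      by (rule INF_lower[OF least])
    show "ereal (real (LEAST k. k \<in> ?K)) \<le> (INF k \<in> ?K. ereal (real k))"
      by (rule INF_greatest) (auto intro: Least_le)
  qed
  then have "alg_degree A x = ereal (real (LEAST k. k \<in> ?K))"
    using assms(1,3) by (simp add: alg_degree_def Gamma_filtration_eq)
  then show thesis
    using least that by blast
qed

lemma cumulant_filt:
  assumes \<phi>: "schur_spin_characters \<phi>" and "as \<noteq> []"
    and k: "\<And>i. i < length as \<Longrightarrow> as ! i \<in> Gp \<phi> (k i)"
  shows "cumulant (Gamma_disjoint \<phi>) (Gamma \<phi>) id as \<in>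
    Gp \<phi> ((\<Sum>i < length as. k i) - 2 * (int (length as) - 1))"
proof -
  obtain l where l: "length as = Suc l"
    using assms(2) by (cases as) auto
  have "\<forall>i \<in> {..<Suc l}. \<exists>x \<in> filt (k i). as ! i = Ch_combination \<phi> x"
    using k l by (auto simp: Gp_def)
  then obtain a where a: "\<And>i. i < Suc l \<Longrightarrow> a i \<in> filt (k i) \<and> as ! i = Ch_combination \<phi> (a i)"
    by (metis lessThan_iff)
  have "as = map (\<lambda>i. Ch_combination \<phi> (a i)) [0..<Suc l]"
    using a l by (intro nth_equalityI) (simp_all del: upt_Suc)
  moreover have "cumulant (Gamma_disjoint \<phi>) (Gamma \<phi>) id (map (\<lambda>i. Ch_combination \<phi> (a i)) [0..<Suc l]) =
      kappa \<phi> a (a 0) {1..l}"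
    by (rule cumulant_eq_kappa[OF \<phi>]) (use a filt_odd_poly in blast)
  ultimately have "cumulant (Gamma_disjoint \<phi>) (Gamma \<phi>) id as = kappa \<phi> a (a 0) {1..l}"
    by (simp only:)
  moreover have "kappa \<phi> a (a 0) {1..l} \<in> Gp \<phi> (k 0 + (\<Sum>i \<in> {1..l}. k i) - 2 * int (card {1..l}))"
    by (rule kappa_filt[OF \<phi>]) (use a in auto)
  moreover have "{..<Suc l} = insert 0 {1..l}"
    by auto
  then have "(\<Sum>i < Suc l. k i) = k 0 + (\<Sum>i \<in> {1..l}. k i)"
    by simp
  ultimately show ?thesis
    by (simp add: l)
qed

lemma approximate_factorization_id:
  assumes \<phi>: "schur_spin_characters \<phi>"
  shows "approximate_factorization (Gamma_disjoint \<phi>) (Gamma \<phi>) id"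
  unfolding approximate_factorization_def
proof (intro allI impI)
  fix as assume as: "as \<noteq> [] \<and> set as \<subseteq> alg_space (Gamma_disjoint \<phi>)"
  let ?A = "Gamma_disjoint \<phi>"
  have A: "alg_filtration ?A = Gamma_filtration \<phi>" "alg_space ?A = Gamma_space \<phi>"
    and B: "alg_filtration (Gamma \<phi>) = Gamma_filtration \<phi>"
    by (simp_all add: Gamma_disjoint_def Gamma_def)
  have "\<exists>d. \<forall>i < length as. as ! i \<noteq> 0 \<longrightarrow> alg_degree ?A (as ! i) = ereal (real (d i)) \<and> as ! i \<in> Gp \<phi> (int (d i))"
  proof -
    have "\<forall>i \<in> {..<length as}. \<exists>d. as ! i \<noteq> 0 \<longrightarrow> alg_degree ?A (as ! i) = ereal (real d) \<and> as ! i \<in> Gp \<phi> (int d)"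
    proof
      fix i assume "i \<in> {..<length as}"
      then have "as ! i \<in> Gamma_space \<phi>"
        using as A(2) by auto
      then show "\<exists>d. as ! i \<noteq> 0 \<longrightarrow> alg_degree ?A (as ! i) = ereal (real d) \<and> as ! i \<in> Gp \<phi> (int d)"
        using alg_degree_attained[OF A(1)] by metis
    qed
    then show ?thesis
      by (metis lessThan_iff)
  qed
  then obtain d where d: "\<And>i. i < length as \<Longrightarrow> as ! i \<noteq> 0 \<Longrightarrow>
      alg_degree ?A (as ! i) = ereal (real (d i)) \<and> as ! i \<in> Gp \<phi> (int (d i))"
    by blast
  let ?l = "length as"
  show "alg_degree (Gamma \<phi>) (cumulant ?A (Gamma \<phi>) id as) \<le>
      (\<Sum>a \<leftarrow> as. alg_degree ?A a) - ereal (2 * (real ?l - 1))"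
  proof (cases "\<exists>i < ?l. as ! i = 0")
    case True
    then obtain j where j: "j < ?l" "as ! j = 0"
      by blast
    \<comment> \<open>A zero argument has degree -\<infinity>, and the cumulant has to be 0. As 0
      lies in every level, its place j can be given a level so low that the bound becomes
      negative.\<close>
    define k where "k i = (if i = j then - (\<Sum>i \<in> {..<?l} - {j}. int (d i)) - 1
      else if as ! i = 0 then 0 else int (d i))" for i
    have mem: "cumulant ?A (Gamma \<phi>) id as \<in> Gp \<phi> ((\<Sum>i < ?l. k i) - 2 * (int ?l - 1))"
      using as d j by (intro cumulant_filt[OF \<phi>]) (auto simp: k_def Gp_0)
    have "(\<Sum>i < ?l. k i) = k j + (\<Sum>i \<in> {..<?l} - {j}. k i)"
      using j(1) by (intro sum.remove) auto
    moreover have "(\<Sum>i \<in> {..<?l} - {j}. k i) \<le> (\<Sum>i \<in> {..<?l} - {j}. int (d i))"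
      by (intro sum_mono) (auto simp: k_def)
    moreover have "k j = - (\<Sum>i \<in> {..<?l} - {j}. int (d i)) - 1"
      by (simp add: k_def)
    moreover have "int ?l \<ge> 1"
      using j(1) by simp
    moreover have "s - 2 * (n - 1) < 0" if "s = y + x" "x \<le> D" "y = - D - 1" "1 \<le> n" for s x y D n :: int
      using that by presburger
    ultimately have "(\<Sum>i < ?l. k i) - 2 * (int ?l - 1) < 0"
      by blast
    with mem have "cumulant ?A (Gamma \<phi>) id as = 0"
      by (rule Gp_neg)
    then show ?thesis
      by (simp add: alg_degree_def)
  next
    case False
    have "cumulant ?A (Gamma \<phi>) id as \<in> Gp \<phi> ((\<Sum>i < ?l. int (d i)) - 2 * (int ?l - 1))"
      using as d False by (intro cumulant_filt[OF \<phi>]) auto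
    then have "alg_degree (Gamma \<phi>) (cumulant ?A (Gamma \<phi>) id as) \<le>
        ereal (real_of_int ((\<Sum>i < ?l. int (d i)) - 2 * (int ?l - 1)))"
      by (rule alg_degree_le[OF B])
    also have "(\<Sum>a \<leftarrow> as. alg_degree ?A a) = (\<Sum>i < ?l. ereal (real (d i)))"
      using d False by (simp add: sum_list_sum_nth atLeast0LessThan)
    then have "ereal (real_of_int ((\<Sum>i < ?l. int (d i)) - 2 * (int ?l - 1))) =
        (\<Sum>a \<leftarrow> as. alg_degree ?A a) - ereal (2 * (real ?l - 1))"
      by (simp add: sum_ereal)
    finally show ?thesis .
  qed
qed


subsection \<open>The leading term of the second cumulant\<close>

lemma composition_pairs_eq:
  "bij_betw (\<lambda>(as, bs). zip as bs) (composition_pairs r k1 k2)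
     {ps \<in> block_pairs k1 k2. length ps = r \<and> (\<forall>p \<in> set ps. even (fst p + snd p))}" if "r > 0"
proof (rule bij_betw_byWitness[where f' = "\<lambda>ps. (map fst ps, map snd ps)"])
  show "\<forall>x \<in> composition_pairs r k1 k2. (map fst (case x of (as, bs) \<Rightarrow> zip as bs), map snd (case x of (as, bs) \<Rightarrow> zip as bs)) = x"
    by (auto simp: composition_pairs_def)
  show "\<forall>ps \<in> {ps \<in> block_pairs k1 k2. length ps = r \<and> (\<forall>p \<in> set ps. even (fst p + snd p))}.
      (case (map fst ps, map snd ps) of (as, bs) \<Rightarrow> zip as bs) = ps"
    by (simp add: zip_map_fst_snd)
  show "(\<lambda>(as, bs). zip as bs) ` composition_pairs r k1 k2 \<subseteq>
      {ps \<in> block_pairs k1 k2. length ps = r \<and> (\<forall>p \<in> set ps. even (fst p + snd p))}"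
    using that by (auto simp: composition_pairs_def block_pairs_def set_zip)
  show "(\<lambda>ps. (map fst ps, map snd ps)) `
      {ps \<in> block_pairs k1 k2. length ps = r \<and> (\<forall>p \<in> set ps. even (fst p + snd p))} \<subseteq> composition_pairs r k1 k2"
    by (auto simp: composition_pairs_def block_pairs_def)
qed

text \<open>The source of 2^(r-1): the exponents (a_i + b_i - 2) / 2 of the blocks add up to (k1 +
  k2) / 2 - r, those of the two original cycles to (k1 + k2) / 2 - 1.\<close>

lemma block_weight_even:
  assumes "\<And>p. p \<in> set ps \<Longrightarrow> even (fst p + snd p) \<and> fst p \<ge> 1 \<and> snd p \<ge> 1"
    "sum_list (map fst ps) = k1" "sum_list (map snd ps) = k2" "odd k1" "odd k2" "ps \<noteq> []"
  shows "pscale (2 ^ ((k1 - 1) div 2 + (k2 - 1) div 2)) (block_weight ps) =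
    Poly_Mapping.single (mset (map (\<lambda>p. fst p + snd p - 1) ps)) (2 ^ (length ps - 1))"
proof -
  define e where "e = (\<Sum>p \<leftarrow> ps. (fst p + snd p - 2) div 2)"
  have "block_weight ps = Poly_Mapping.single (mset (map (\<lambda>p. fst p + snd p - 1) ps)) (1 / 2 ^ e)"
    using assms(1) unfolding e_def
  proof (induction ps)
    case (Cons p ps)
    have "even (fst p + snd p)" "fst p \<ge> 1" "snd p \<ge> 1"
      using Cons.prems by auto
    then have "yy (fst p + snd p - 1) = Poly_Mapping.single {#fst p + snd p - 1#} (1 / 2 ^ ((fst p + snd p - 2) div 2))"
    proof -
      have "fst p + snd p = Suc (fst p + snd p - 1)" "fst p + snd p - 1 - 1 = fst p + snd p - 2"
        using \<open>fst p \<ge> 1\<close> by simp_all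
      moreover from this have "odd (fst p + snd p - 1)"
        using \<open>even (fst p + snd p)\<close> by (metis even_Suc)
      ultimately show ?thesis
        by (simp only: yy_def if_True simp_thms)
    qed
    then show ?case
      using Cons by (simp add: block_weight_def mult_single power_add)
  qed (simp add: block_weight_def)
  moreover have "2 * (e + length ps) = k1 + k2"
    using assms(1) unfolding assms(2,3)[symmetric] e_def
  proof (induction ps)
    case (Cons p ps)
    have "even (fst p + snd p)" "fst p \<ge> 1" "snd p \<ge> 1"
      using Cons.prems by auto
    then have "2 * ((fst p + snd p - 2) div 2) + 2 = fst p + snd p"
      by simp
    then show ?case
      using Cons by simp
  qed simp
  moreover have "length ps \<ge> 1"
    using assms(6) by (cases ps) auto
  ultimately have "(k1 - 1) div 2 + (k2 - 1) div 2 = e + (length ps - 1)"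
    using assms(4,5) by (auto elim!: oddE)
  then show ?thesis
    using \<open>block_weight ps = _\<close> by (simp add: power_add)
qed

text \<open>A pair with odd sum belongs to a cycle of even length a + b - 1, for which
  \<open>yy\<close> is 0. This is the source of the parity condition on a_i + b_i.\<close>

lemma block_weight_odd: "\<exists>p \<in> set ps. odd (fst p + snd p) \<Longrightarrow> \<forall>p \<in> set ps. fst p \<ge> 1 \<Longrightarrow> block_weight ps = 0"
proof (induction ps)
  case (Cons p ps)
  show ?case
  proof (cases "odd (fst p + snd p)")
    case True
    then have "even (fst p + snd p - 1)"
      by simp
    then show ?thesis
      by (simp add: block_weight_def del: One_nat_def)
  next
    case False
    then have "block_weight ps = 0"
      using Cons by auto
    then show ?thesis
      by (simp add: block_weight_def)
  qed
qed simp

text \<open>With one further cycle, the sets {} and {0} in the product formula give the disjoint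
  product and the walk W, whose leading part is T. The sum stops at min k1 k2 because a composition
  of k has at most k parts.\<close>

lemma second_cumulant_leading:
  fixes \<phi> k1 k2
  assumes \<phi>: "schur_spin_characters \<phi>" and k: "odd k1" "odd k2"
  obtains R where "R \<in> Gp \<phi> (int (k1 + k2) - 2)"
    "Ch \<phi> {#k1, k2#} - Ch \<phi> {#k1#} * Ch \<phi> {#k2#} =
       - (\<Sum>r = 1..min k1 k2. fscale (2 ^ (r - 1) / of_nat r * of_nat k1 * of_nat k2)
           (\<Sum>(as, bs) \<in> composition_pairs r k1 k2. Ch \<phi> (mset (map2 (\<lambda>a b. a + b - 1) as bs)))) + R"
proof -
  \<comment> \<open>The power of 2 between the product of the two \<open>Ch\<close> and the product
    of the two \<open>yy\<close>.\<close>
  define P :: complex where "P = 2 ^ ((k1 - 1) div 2 + (k2 - 1) div 2)"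
  define W where "W = walk all_touched (\<lambda>_. k2) k1 [] [] {0}"
  define T where "T = (\<Sum>ps \<in> block_pairs k1 k2. pscale (of_nat (k1 * k2) / of_nat (length ps)) (block_weight ps))"
  define R where "R = fscale (- P) (Ch_combination \<phi> (W - T))"
  have kpos: "k1 > 0" "k2 > 0"
    using k by (auto simp: odd_pos)
  have "W - T \<in> filt (int (k1 + k2) - 2)"
    using walk_one_untouched_leading[of "\<lambda>_. k2" 0 k1] kpos by (simp add: W_def T_def)
  then have R: "R \<in> Gp \<phi> (int (k1 + k2) - 2)"
    unfolding R_def by (intro Gp_scale Gp_intro)
  have yy: "mono {#l#} = pscale (2 ^ ((l - 1) div 2)) (yy l)" if "odd l" for l
    using that by (simp add: yy_def)
  have "Pow {0 :: nat} = {{}, {0}}"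
    by auto
  then have star: "Ch_combination \<phi> (yy k1) * Ch_combination \<phi> (yy k2) =
      Ch_combination \<phi> (yy k1 * yy k2) + Ch_combination \<phi> W"
    using Ch_combination_cycle_product[OF \<phi> k(1), of "{0}" "\<lambda>_. k2"] k(2) walk_no_points[of "\<lambda>_. k2" k1 0]
    by (simp add: remain_def W_def mult.commute)
  have Ch1: "Ch \<phi> {#l#} = fscale (2 ^ ((l - 1) div 2)) (Ch_combination \<phi> (yy l))" if "odd l" for l
    using Ch_combination_single[of \<phi> "{#l#}" 1] unfolding yy[OF that] Ch_combination_pscale by simp
  have Ch2: "Ch \<phi> {#k1, k2#} = fscale P (Ch_combination \<phi> (yy k1 * yy k2))"
  proof -
    have "mono {#k1, k2#} = mono {#k1#} * mono {#k2#}"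
      by (simp add: mult_single add_mset_commute)
    also have "\<dots> = pscale P (yy k1 * yy k2)"
      by (simp only: yy[OF k(1)] yy[OF k(2)] pscale_mult_left pscale_mult_right pvs.scale_scale P_def power_add mult.commute)
    finally have "Ch_combination \<phi> (mono {#k1, k2#}) = fscale P (Ch_combination \<phi> (yy k1 * yy k2))"
      by (simp only: Ch_combination_pscale)
    then show ?thesis
      by (simp add: Ch_combination_single)
  qed
  have "Ch \<phi> {#k1#} * Ch \<phi> {#k2#} = fscale P (Ch_combination \<phi> (yy k1) * Ch_combination \<phi> (yy k2))"
    by (simp only: Ch1[OF k(1)] Ch1[OF k(2)] fscale_mult fun_vs.scale_scale P_def power_add mult.commute)
  then have "Ch \<phi> {#k1, k2#} - Ch \<phi> {#k1#} * Ch \<phi> {#k2#} = - fscale P (Ch_combination \<phi> W)"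
    unfolding star Ch2 by (simp only: fun_vs.scale_right_distrib) simp
  also have "\<dots> = - fscale P (Ch_combination \<phi> T) + R"
    unfolding R_def Ch_combination_diff by (simp only: fun_vs.scale_right_diff_distrib fun_vs.scale_minus_left) simp
  also have "fscale P (Ch_combination \<phi> T) =
      (\<Sum>r = 1..min k1 k2. fscale (2 ^ (r - 1) / of_nat r * of_nat k1 * of_nat k2)
        (\<Sum>(as, bs) \<in> composition_pairs r k1 k2. Ch \<phi> (mset (map2 (\<lambda>a b. a + b - 1) as bs))))"
  proof -
    let ?good = "\<lambda>ps. \<forall>p \<in> set ps. even (fst p + snd p)"
    let ?F = "\<lambda>ps. fscale (2 ^ (length ps - 1) / of_nat (length ps) * of_nat k1 * of_nat k2)
      (Ch \<phi> (mset (map (\<lambda>p. fst p + snd p - 1) ps)))"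
    have F: "fscale P (Ch_combination \<phi> (pscale (of_nat (k1 * k2) / of_nat (length ps)) (block_weight ps))) =
        (if ?good ps then ?F ps else 0)" if ps: "ps \<in> block_pairs k1 k2" for ps
    proof (cases "?good ps")
      case True
      have "pscale P (block_weight ps) = Poly_Mapping.single (mset (map (\<lambda>p. fst p + snd p - 1) ps)) (2 ^ (length ps - 1))"
        unfolding P_def using ps True k by (intro block_weight_even) (auto simp: block_pairs_def)
      then have "pscale (of_nat (k1 * k2) / of_nat (length ps)) (pscale P (block_weight ps)) =
          Poly_Mapping.single (mset (map (\<lambda>p. fst p + snd p - 1) ps)) (2 ^ (length ps - 1) / of_nat (length ps) * of_nat k1 * of_nat k2)"
        by (simp add: mult_ac)
      then have "Ch_combination \<phi> (pscale (of_nat (k1 * k2) / of_nat (length ps)) (pscale P (block_weight ps))) = ?F ps"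
        by (simp only: Ch_combination_single)
      then have "fscale P (Ch_combination \<phi> (pscale (of_nat (k1 * k2) / of_nat (length ps)) (block_weight ps))) = ?F ps"
        by (simp only: Ch_combination_pscale fun_vs.scale_left_commute)
      then show ?thesis
        unfolding if_P[OF True] .
    next
      case False
      then have "block_weight ps = 0"
        using ps by (intro block_weight_odd) (auto simp: block_pairs_def)
      then show ?thesis
        unfolding if_not_P[OF False] by simp
    qed
    have len: "length ps \<in> {1..min k1 k2}" if "ps \<in> block_pairs k1 k2" for ps
    proof -
      have "length (map fst ps) \<le> sum_list (map fst ps)" "length (map snd ps) \<le> sum_list (map snd ps)"
        using that by (intro length_le_sum_list; auto simp: block_pairs_def)+
      moreover have "length ps \<ge> 1"
        using that by (cases ps) (auto simp: block_pairs_def)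
      ultimately show ?thesis
        using that by (simp add: block_pairs_def)
    qed
    have "fscale P (Ch_combination \<phi> T) = (\<Sum>ps \<in> block_pairs k1 k2. if ?good ps then ?F ps else 0)"
      unfolding T_def Ch_combination_sum fun_vs.scale_sum_right by (intro sum.cong HOL.refl F)
    also have "\<dots> = (\<Sum>ps \<in> {ps \<in> block_pairs k1 k2. ?good ps}. ?F ps)"
      by (rule sum.inter_filter[OF finite_block_pairs, symmetric])
    also have "\<dots> = (\<Sum>r = 1..min k1 k2. \<Sum>ps \<in> {ps \<in> {ps \<in> block_pairs k1 k2. ?good ps}. length ps = r}. ?F ps)"
      by (rule sum.group[symmetric]) (use finite_block_pairs len in auto)
    also have "\<dots> = (\<Sum>r = 1..min k1 k2. fscale (2 ^ (r - 1) / of_nat r * of_nat k1 * of_nat k2)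
        (\<Sum>(as, bs) \<in> composition_pairs r k1 k2. Ch \<phi> (mset (map2 (\<lambda>a b. a + b - 1) as bs))))"
    proof (rule sum.cong[OF HOL.refl])
      fix r assume r: "r \<in> {1..min k1 k2}"
      then have "r > 0"
        by simp
      have set: "{ps \<in> {ps \<in> block_pairs k1 k2. ?good ps}. length ps = r} = {ps \<in> block_pairs k1 k2. length ps = r \<and> ?good ps}"
        by auto
      have "(\<Sum>ps \<in> {ps \<in> {ps \<in> block_pairs k1 k2. ?good ps}. length ps = r}. ?F ps) =
          (\<Sum>x \<in> composition_pairs r k1 k2. ?F (case x of (as, bs) \<Rightarrow> zip as bs))"
        unfolding set by (rule sum.reindex_bij_betw[OF composition_pairs_eq[OF \<open>r > 0\<close>], symmetric])
      also have "\<dots> = (\<Sum>x \<in> composition_pairs r k1 k2. fscale (2 ^ (r - 1) / of_nat r * of_nat k1 * of_nat k2)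
          (case x of (as, bs) \<Rightarrow> Ch \<phi> (mset (map2 (\<lambda>a b. a + b - 1) as bs))))"
      proof (rule sum.cong[OF HOL.refl])
        fix x assume "x \<in> composition_pairs r k1 k2"
        then obtain as bs where x: "x = (as, bs)" "length (zip as bs) = r"
          by (auto simp: composition_pairs_def)
        show "?F (case x of (as, bs) \<Rightarrow> zip as bs) = fscale (2 ^ (r - 1) / of_nat r * of_nat k1 * of_nat k2)
            (case x of (as, bs) \<Rightarrow> Ch \<phi> (mset (map2 (\<lambda>a b. a + b - 1) as bs)))"
          unfolding x(1) prod.case x(2) by (simp only: split_def)
      qed
      finally show "(\<Sum>ps \<in> {ps \<in> {ps \<in> block_pairs k1 k2. ?good ps}. length ps = r}. ?F ps) =
          fscale (2 ^ (r - 1) / of_nat r * of_nat k1 * of_nat k2)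
          (\<Sum>(as, bs) \<in> composition_pairs r k1 k2. Ch \<phi> (mset (map2 (\<lambda>a b. a + b - 1) as bs)))"
        by (simp only: fun_vs.scale_sum_right)
    qed
    finally show ?thesis .
  qed
  finally show thesis
    using that[OF R] by blast
qed

text \<open>For one further argument the convolution equation has only the summands S = {} and S =
  {1}.\<close>

lemma second_cumulant:
  assumes \<phi>: "schur_spin_characters \<phi>" and k: "odd k1" "odd k2"
  shows "cumulant (Gamma_disjoint \<phi>) (Gamma \<phi>) id [Ch \<phi> {#k1#}, Ch \<phi> {#k2#}]
    = Ch \<phi> {#k1, k2#} - Ch \<phi> {#k1#} * Ch \<phi> {#k2#}"
proof -
  define a where "a i = mono {#if i = 0 then k1 else k2#}" for i :: nat
  have Ch: "Ch_combination \<phi> (mono \<pi>) = Ch \<phi> \<pi>" for \<pi>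
    by (simp add: Ch_combination_single)
  have "[Ch \<phi> {#k1#}, Ch \<phi> {#k2#}] = map (\<lambda>i. Ch_combination \<phi> (a i)) [0..<Suc 1]"
    by (simp add: a_def Ch)
  moreover have "odd_poly (a i)" for i
    using k by (simp add: a_def odd_poly_def)
  ultimately have "cumulant (Gamma_disjoint \<phi>) (Gamma \<phi>) id [Ch \<phi> {#k1#}, Ch \<phi> {#k2#}] = kappa \<phi> a (a 0) {1..1}"
    using cumulant_eq_kappa[OF \<phi>, of 1 a] by simp
  moreover have "kappa \<phi> a (a 0) {} = Ch_combination \<phi> (a 0)"
    using kappa_conv[OF \<phi>, of "{}" a "a 0"] by (simp add: moment_empty Ch_combination_one[OF \<phi>])
  moreover have "Pow {1 :: nat} = {{}, {1}}"
    by auto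
  then have "kappa \<phi> a (a 0) {} * moment \<phi> a 1 {1} + kappa \<phi> a (a 0) {1} * moment \<phi> a 1 {} = moment \<phi> a (a 0) {1}"
    using kappa_conv[OF \<phi>, of "{1}" a "a 0"] by simp
  moreover have "moment \<phi> a 1 {1} = Ch \<phi> {#k2#}" "moment \<phi> a 1 {} = 1" "moment \<phi> a (a 0) {1} = Ch \<phi> {#k1, k2#}"
    by (simp_all add: moment_def a_def Ch Ch_combination_one[OF \<phi>] mult_single add_mset_commute)
  moreover have "Ch_combination \<phi> (a 0) = Ch \<phi> {#k1#}"
    by (simp add: a_def Ch)
  ultimately show ?thesis
    by (simp add: eq_diff_eq add.commute)
qed

theorem theorem4p2:
  fixes \<phi> :: "strict_partition \<Rightarrow> nat multiset \<Rightarrow> complex"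
  assumes "schur_spin_characters \<phi>"
  shows "approximate_factorization (Gamma_disjoint \<phi>) (Gamma \<phi>) id \<and>
    (\<forall>k1 k2. odd k1 \<and> odd k2 \<longrightarrow>
       cumulant (Gamma_disjoint \<phi>) (Gamma \<phi>) id [Ch \<phi> {#k1#}, Ch \<phi> {#k2#}]
         = Ch \<phi> {#k1, k2#} - Ch \<phi> {#k1#} * Ch \<phi> {#k2#} \<and>
       (\<exists>R. alg_degree (Gamma \<phi>) R \<le> ereal (real (k1 + k2 - 2)) \<and>
         Ch \<phi> {#k1, k2#} - Ch \<phi> {#k1#} * Ch \<phi> {#k2#} =
           - (\<Sum>r = 1..min k1 k2. fscale (2 ^ (r - 1) / of_nat r * of_nat k1 * of_nat k2)
               (\<Sum>(as, bs) \<in> composition_pairs r k1 k2.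
                  Ch \<phi> (mset (map2 (\<lambda>a b. a + b - 1) as bs)))) + R))"
proof (intro conjI allI impI)
  show "approximate_factorization (Gamma_disjoint \<phi>) (Gamma \<phi>) id"
    by (rule approximate_factorization_id[OF assms])
  fix k1 k2 :: nat assume k: "odd k1 \<and> odd k2"
  then show "cumulant (Gamma_disjoint \<phi>) (Gamma \<phi>) id [Ch \<phi> {#k1#}, Ch \<phi> {#k2#}]
      = Ch \<phi> {#k1, k2#} - Ch \<phi> {#k1#} * Ch \<phi> {#k2#}"
    using second_cumulant[OF assms] by blast
  obtain R where R: "R \<in> Gp \<phi> (int (k1 + k2) - 2)"
    "Ch \<phi> {#k1, k2#} - Ch \<phi> {#k1#} * Ch \<phi> {#k2#} =
       - (\<Sum>r = 1..min k1 k2. fscale (2 ^ (r - 1) / of_nat r * of_nat k1 * of_nat k2)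
           (\<Sum>(as, bs) \<in> composition_pairs r k1 k2. Ch \<phi> (mset (map2 (\<lambda>a b. a + b - 1) as bs)))) + R"
    using second_cumulant_leading[OF assms] k by blast
  \<comment> \<open>Odd numbers are positive, so the truncated \<open>k1 + k2 - 2\<close> agrees
    with the integer difference.\<close>
  have "k1 > 0" "k2 > 0"
    using k by (auto simp: odd_pos)
  then have "real_of_int (int (k1 + k2) - 2) = real (k1 + k2 - 2)"
    by (simp add: of_nat_diff)
  moreover have "alg_degree (Gamma \<phi>) R \<le> ereal (real_of_int (int (k1 + k2) - 2))"
    by (rule alg_degree_le[OF _ R(1)]) (simp add: Gamma_def)
  ultimately have "alg_degree (Gamma \<phi>) R \<le> ereal (real (k1 + k2 - 2))"
    by (simp only:)
  then show "\<exists>R. alg_degree (Gamma \<phi>) R \<le> ereal (real (k1 + k2 - 2)) \<and>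
      Ch \<phi> {#k1, k2#} - Ch \<phi> {#k1#} * Ch \<phi> {#k2#} =
        - (\<Sum>r = 1..min k1 k2. fscale (2 ^ (r - 1) / of_nat r * of_nat k1 * of_nat k2)
            (\<Sum>(as, bs) \<in> composition_pairs r k1 k2. Ch \<phi> (mset (map2 (\<lambda>a b. a + b - 1) as bs)))) + R"
    using R(2) by (intro exI[of _ R] conjI)
qed

end
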